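(* Let $R$ be a commutative ring and let $C$ be a categorification of $R$ with valuation $|\ |:\mathrm{Ob}(C)\to R$. Let $L$ be the category of finite linearly ordered sets and order preserving bijections, and let $C^L$ be the category of functors from $L$ to $C$, with sum and product $$(F+G)(x)=F(x)\oplus G(x),\qquad (FG)(x)=\bigoplus_{x_1\sqcup x_2=x}F(x_1)\otimes G(x_2).$$ Let $P:C^L\to C^L$ be given by $P(F)(x)=F(x\setminus m(x))$ for $x\neq\emptyset$, where $m(x)$ is the maximal element of $x$, and $P(F)(\emptyset)=0$. Then $(C^L,P)$ is a Rota-Baxter category of weight $0$. The valuation map $|\ |:C^L\to R[[x]]$ given by $$|F|=\sum_{n\in\mathbb{N}}|F([n])|\frac{x^n}{n!}$$ satisfies $|P(F)|=\int_0^x|F|\,dt$ for every $F$ in $C^L$.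
   Context: A distributive category is a category $C$ with functors $\oplus,\otimes:C\times C\to C$ and objects $0,1$ such that $(C,\oplus,0)$ is symmetric monoidal with unit $0$, $(C,\otimes,1)$ is monoidal with unit $1$, and there are natural isomorphisms $x\otimes(y\oplus z)\simeq(x\otimes y)\oplus(x\otimes z)$ and $(x\oplus y)\otimes z\simeq(x\otimes z)\oplus(y\otimes z)$. It has negative objects if it comes with a functor $-:C\to C$ and natural isomorphisms $-(x\oplus y)\simeq -x\oplus -y$, $-0\simeq 0$, $-(-x)\simeq x$; on $C^L$ negatives are taken objectwise. A functor $P:C\to C$ is additive if there are natural isomorphisms $P(x\oplus y)\simeq P(x)\oplus P(y)$ (and $P(-x)\simeq -P(x)$ if $C$ has a negative functor). A Rota-Baxter category of weight $0$ is a distributive category $C$ with an additive functor $P:C\to C$ and natural isomorphisms $P(x)\otimes P(y)\simeq P(P(x)\otimes y)\oplus P(x\otimes P(y))$. A categorification of a ring $R$ is a distributive category $C$ with negative functor together with a valuation map $|\ |:\mathrm{Ob}(C)\to R$ such that $|x|=|y|$ if $x\simeq y$, $|x\oplus y|=|x|+|y|$, $|x\otimes y|=|x||y|$, $|1|=1$, $|0|=0$, $|-x|=-|x|$. A valuation map on $C^L$ is a map on objects with these same properties. The sum over $x_1\sqcup x_2=x$ runs over ordered pairs of disjoint, possibly empty, subsets with union $x$, each with the induced order. $[n]=\{1,\dots,n\}$ with its usual order, $[0]=\emptyset$. $R[[x]]$ is the ring of formal divided power series $\sum_n a_n\frac{x^n}{n!}$, $a_n\in R$, where $\frac{x^n}{n!}$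 are formal symbols with $\frac{x^k}{k!}\frac{x^s}{s!}=\binom{k+s}{s}\frac{x^{k+s}}{(k+s)!}$, and $\int_0^x$ sends $\sum_n a_n\frac{x^n}{n!}$ to $\sum_{n\ge1}a_{n-1}\frac{x^n}{n!}$.
   Formalization: "Distributive category" is taken in Laplaza's sense, for C and for C^L: there are also natural isomorphisms 0⊗x≃0, x⊗0≃0, and the coherence diagrams commute. Without this the claim fails: for N with max as sum and + as product (times R), C^L has no unit. *)

theory Defs
  imports "HOL-Algebra.Ring" "HOL-Library.FuncSet"
begin

section \<open>Categories, functors, natural isomorphisms\<close>

record ('o, 'a) cat =
  Obj :: "'o set"
  Arr :: "'a set"
  Dom :: "'a \<Rightarrow> 'o"
  Cod :: "'a \<Rightarrow> 'o"
  Idn :: "'o \<Rightarrow> 'a"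
  Cmp :: "'a \<Rightarrow> 'a \<Rightarrow> 'a"  (infixr "\<bullet>\<index>" 55)

definition Hom :: "('o, 'a) cat \<Rightarrow> 'o \<Rightarrow> 'o \<Rightarrow> 'a set" where
  "Hom C x y = {f \<in> Arr C. Dom C f = x \<and> Cod C f = y}"

locale category =
  fixes C :: "('o, 'a) cat" (structure)
  assumes Dom_Obj: "f \<in> Arr C \<Longrightarrow> Dom C f \<in> Obj C"
    and Cod_Obj: "f \<in> Arr C \<Longrightarrow> Cod C f \<in> Obj C"
    and Idn_Hom: "x \<in> Obj C \<Longrightarrow> Idn C x \<in> Hom C x x"
    and Cmp_Hom: "f \<in> Hom C x y \<Longrightarrow> g \<in> Hom C y z \<Longrightarrow> g \<bullet> f \<in> Hom C x z"
    and Cmp_Idn_right: "f \<in> Hom C x y \<Longrightarrow> f \<bullet> Idn C x = f"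
    and Cmp_Idn_left: "f \<in> Hom C x y \<Longrightarrow> Idn C y \<bullet> f = f"
    and Cmp_assoc: "f \<in> Hom C w x \<Longrightarrow> g \<in> Hom C x y \<Longrightarrow> h \<in> Hom C y z
      \<Longrightarrow> (h \<bullet> g) \<bullet> f = h \<bullet> (g \<bullet> f)"

definition inverse_arrows :: "('o, 'a) cat \<Rightarrow> 'a \<Rightarrow> 'a \<Rightarrow> bool" where
  "inverse_arrows C f g \<longleftrightarrow> f \<in> Arr C \<and> g \<in> Hom C (Cod C f) (Dom C f)
     \<and> g \<bullet>\<^bsub>C\<^esub> f = Idn C (Dom C f) \<and> f \<bullet>\<^bsub>C\<^esub> g = Idn C (Cod C f)"

definition inverse_arrow :: "('o, 'a) cat \<Rightarrow> 'a \<Rightarrow> 'a" where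
  "inverse_arrow C f = (THE g. inverse_arrows C f g)"

definition is_isomorphism :: "('o, 'a) cat \<Rightarrow> 'a \<Rightarrow> bool" where
  "is_isomorphism C f \<longleftrightarrow> (\<exists>g. inverse_arrows C f g)"

definition isomorphic :: "('o, 'a) cat \<Rightarrow> 'o \<Rightarrow> 'o \<Rightarrow> bool" where
  "isomorphic C x y \<longleftrightarrow> (\<exists>f \<in> Hom C x y. is_isomorphism C f)"

record ('o, 'a, 'p, 'b) fun_data =
  FOb :: "'o \<Rightarrow> 'p"
  FAr :: "'a \<Rightarrow> 'b"

locale is_functor = A: category A + B: category B
  for A :: "('o, 'a) cat" and B :: "('p, 'b) cat" +
  fixes F :: "('o, 'a, 'p, 'b) fun_data"
  assumes FOb_Obj: "x \<in> Obj A \<Longrightarrow> FOb F x \<in> Obj B"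
    and FAr_Hom: "f \<in> Hom A x y \<Longrightarrow> FAr F f \<in> Hom B (FOb F x) (FOb F y)"
    and FAr_Idn: "x \<in> Obj A \<Longrightarrow> FAr F (Idn A x) = Idn B (FOb F x)"
    and FAr_Cmp: "f \<in> Hom A x y \<Longrightarrow> g \<in> Hom A y z
      \<Longrightarrow> FAr F (g \<bullet>\<^bsub>A\<^esub> f) = FAr F g \<bullet>\<^bsub>B\<^esub> FAr F f"

definition id_functor :: "('o, 'a, 'o, 'a) fun_data" where
  "id_functor = \<lparr>FOb = \<lambda>x. x, FAr = \<lambda>f. f\<rparr>"

definition is_natural ::
  "('o, 'a) cat \<Rightarrow> ('p, 'b) cat \<Rightarrow> ('o, 'a, 'p, 'b) fun_data \<Rightarrow> ('o, 'a, 'p, 'b) fun_data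
    \<Rightarrow> ('o \<Rightarrow> 'b) \<Rightarrow> bool" where
  "is_natural A B F G t \<longleftrightarrow>
     (\<forall>x \<in> Obj A. t x \<in> Hom B (FOb F x) (FOb G x)) \<and>
     (\<forall>f \<in> Arr A. t (Cod A f) \<bullet>\<^bsub>B\<^esub> FAr F f = FAr G f \<bullet>\<^bsub>B\<^esub> t (Dom A f))"

definition natural_iso ::
  "('o, 'a) cat \<Rightarrow> ('p, 'b) cat \<Rightarrow> ('o, 'a, 'p, 'b) fun_data \<Rightarrow> ('o, 'a, 'p, 'b) fun_data
    \<Rightarrow> ('o \<Rightarrow> 'b) \<Rightarrow> bool" where
  "natural_iso A B F G t \<longleftrightarrow>
     is_functor A B F \<and> is_functor A B G \<and> is_natural A B F G t \<and>
     (\<forall>x \<in> Obj A. is_isomorphism B (t x))"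

definition naturally_isomorphic ::
  "('o, 'a) cat \<Rightarrow> ('p, 'b) cat \<Rightarrow> ('o, 'a, 'p, 'b) fun_data \<Rightarrow> ('o, 'a, 'p, 'b) fun_data \<Rightarrow> bool"
  where "naturally_isomorphic A B F G \<longleftrightarrow> (\<exists>t. natural_iso A B F G t)"

definition prod_cat :: "('o, 'a) cat \<Rightarrow> ('p, 'b) cat \<Rightarrow> ('o \<times> 'p, 'a \<times> 'b) cat"
  (infixr "\<times>\<^sub>C" 80) where
  "A \<times>\<^sub>C B = \<lparr>
     Obj = Obj A \<times> Obj B,
     Arr = Arr A \<times> Arr B,
     Dom = (\<lambda>(f, g). (Dom A f, Dom B g)),
     Cod = (\<lambda>(f, g). (Cod A f, Cod B g)),
     Idn = (\<lambda>(x, y). (Idn A x, Idn B y)),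
     Cmp = (\<lambda>(g, g') (f, f'). (g \<bullet>\<^bsub>A\<^esub> f, g' \<bullet>\<^bsub>B\<^esub> f'))\<rparr>"

type_synonym ('o, 'a) endofunctor = "('o, 'a, 'o, 'a) fun_data"
type_synonym ('o, 'a) bifunctor = "('o \<times> 'o, 'a \<times> 'a, 'o, 'a) fun_data"

text \<open>In the functor category, functors and families of components are required to be
  extensional, that is undefined outside the source category, so that equality of objects and of
  arrows is equality of functors and of natural transformations.\<close>

definition functor_cat :: "('o, 'a) cat \<Rightarrow> ('p, 'b) cat \<Rightarrow>
    (('o, 'a, 'p, 'b) fun_data,
     ('o, 'a, 'p, 'b) fun_data \<times> ('o, 'a, 'p, 'b) fun_data \<times> ('o \<Rightarrow> 'b)) cat" where
  "functor_cat A B =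
    (let Ob = {F. is_functor A B F \<and> FOb F \<in> extensional (Obj A) \<and> FAr F \<in> extensional (Arr A)}
     in \<lparr>
     Obj = Ob,
     Arr = {(F, G, t). F \<in> Ob \<and> G \<in> Ob \<and> t \<in> extensional (Obj A) \<and> is_natural A B F G t},
     Dom = (\<lambda>(F, G, t). F),
     Cod = (\<lambda>(F, G, t). G),
     Idn = (\<lambda>F. (F, F, \<lambda>x \<in> Obj A. Idn B (FOb F x))),
     Cmp = (\<lambda>(G', H, u) (F, G, t). (F, H, \<lambda>x \<in> Obj A. u x \<bullet>\<^bsub>B\<^esub> t x))\<rparr>)"


section \<open>Monoidal and distributive categories\<close>

locale monoidal_category = category C
  for C :: "('o, 'a) cat" (structure) +
  fixes T :: "('o, 'a) bifunctor" and I :: 'o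
    and assoc :: "'o \<times> 'o \<times> 'o \<Rightarrow> 'a" and lunit runit :: "'o \<Rightarrow> 'a"
  fixes tob (infixr "\<otimes>\<^sub>o" 75) and tar (infixr "\<otimes>\<^sub>a" 75)
  defines "x \<otimes>\<^sub>o y \<equiv> FOb T (x, y)" and "f \<otimes>\<^sub>a g \<equiv> FAr T (f, g)"
  assumes T_functor: "is_functor (C \<times>\<^sub>C C) C T"
    and I_Obj: "I \<in> Obj C"
    and assoc_iso: "natural_iso (C \<times>\<^sub>C C \<times>\<^sub>C C) C
      \<lparr>FOb = \<lambda>(x, y, z). (x \<otimes>\<^sub>o y) \<otimes>\<^sub>o z, FAr = \<lambda>(f, g, h). (f \<otimes>\<^sub>a g) \<otimes>\<^sub>a h\<rparr>
      \<lparr>FOb = \<lambda>(x, y, z). x \<otimes>\<^sub>o (y \<otimes>\<^sub>o z), FAr = \<lambda>(f, g, h). f \<otimes>\<^sub>a (g \<otimes>\<^sub>a h)\<rparr> assoc"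
    and lunit_iso: "natural_iso C C
      \<lparr>FOb = \<lambda>x. I \<otimes>\<^sub>o x, FAr = \<lambda>f. Idn C I \<otimes>\<^sub>a f\<rparr> id_functor lunit"
    and runit_iso: "natural_iso C C
      \<lparr>FOb = \<lambda>x. x \<otimes>\<^sub>o I, FAr = \<lambda>f. f \<otimes>\<^sub>a Idn C I\<rparr> id_functor runit"
    and pentagon: "w \<in> Obj C \<Longrightarrow> x \<in> Obj C \<Longrightarrow> y \<in> Obj C \<Longrightarrow> z \<in> Obj C \<Longrightarrow>
      assoc (w, x, y \<otimes>\<^sub>o z) \<bullet> assoc (w \<otimes>\<^sub>o x, y, z) =
      (Idn C w \<otimes>\<^sub>a assoc (x, y, z)) \<bullet> assoc (w, x \<otimes>\<^sub>o y, z) \<bullet> (assoc (w, x, y) \<otimes>\<^sub>a Idn C z)"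
    and triangle: "x \<in> Obj C \<Longrightarrow> y \<in> Obj C \<Longrightarrow>
      (Idn C x \<otimes>\<^sub>a lunit y) \<bullet> assoc (x, I, y) = runit x \<otimes>\<^sub>a Idn C y"

locale symmetric_monoidal_category = monoidal_category C T I assoc lunit runit tob tar
  for C :: "('o, 'a) cat" (structure)
    and T I assoc lunit runit and tob (infixr "\<otimes>\<^sub>o" 75) and tar (infixr "\<otimes>\<^sub>a" 75) +
  fixes sym :: "'o \<times> 'o \<Rightarrow> 'a"
  assumes sym_iso: "natural_iso (C \<times>\<^sub>C C) C
      T \<lparr>FOb = \<lambda>(x, y). y \<otimes>\<^sub>o x, FAr = \<lambda>(f, g). g \<otimes>\<^sub>a f\<rparr> sym"
    and sym_sym: "x \<in> Obj C \<Longrightarrow> y \<in> Obj C \<Longrightarrow> sym (y, x) \<bullet> sym (x, y) = Idn C (x \<otimes>\<^sub>o y)"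
    and hexagon: "x \<in> Obj C \<Longrightarrow> y \<in> Obj C \<Longrightarrow> z \<in> Obj C \<Longrightarrow>
      assoc (y, z, x) \<bullet> sym (x, y \<otimes>\<^sub>o z) \<bullet> assoc (x, y, z) =
      (Idn C y \<otimes>\<^sub>a sym (x, z)) \<bullet> assoc (y, x, z) \<bullet> (sym (x, y) \<otimes>\<^sub>a Idn C z)"

text \<open>A distributive category is taken in the sense of Laplaza (\<open>Coherence for distributivity\<close>),
  also called a bimonoidal category, without symmetry of the product: besides the two monoidal
  structures and the two distributivity isomorphisms there are the annihilation isomorphisms
  \<open>0 \<otimes> x \<simeq> 0\<close> and \<open>x \<otimes> 0 \<simeq> 0\<close>, and the coherence diagrams below commute.

  The annihilation isomorphisms do not follow from the rest, and without them a functor category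
  under the convolution product need not have a unit: take the discrete category on the natural
  numbers with \<open>max\<close> as sum and \<open>+\<close> as product, where \<open>0\<close> is both units.  The coherence diagrams
  are what makes the convolution product satisfy the pentagon, since its associativity
  isomorphism is built from the distributivity isomorphisms.

  Names: \<open>aP\<close>, \<open>lP\<close>, \<open>rP\<close>, \<open>sP\<close> are the associativity, left unit, right unit and symmetry
  isomorphisms of the sum, \<open>aT\<close>, \<open>lT\<close>, \<open>rT\<close> the first three for the product, \<open>dl\<close>, \<open>dr\<close> are
  the distributivity isomorphisms and \<open>nl\<close>, \<open>nr\<close> the annihilation isomorphisms.\<close>

locale coherent_distributive_category =
  sum: symmetric_monoidal_category C plusC zeroC aP lP rP plus_o plus_a sP +
  prod: monoidal_category C timesC oneC aT lT rT times_o times_a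
  for C :: "('o, 'a) cat" (structure)
    and plusC zeroC aP lP rP
    and plus_o (infixr "\<oplus>\<^sub>o" 70) and plus_a (infixr "\<oplus>\<^sub>a" 70) and sP
    and timesC oneC aT lT rT
    and times_o (infixr "\<otimes>\<^sub>o" 75) and times_a (infixr "\<otimes>\<^sub>a" 75) +
  fixes dl dr :: "'o \<times> 'o \<times> 'o \<Rightarrow> 'a" and nl nr :: "'o \<Rightarrow> 'a"
  fixes \<i>
  defines "\<i> \<equiv> Idn C"
  assumes dl_iso: "natural_iso (C \<times>\<^sub>C C \<times>\<^sub>C C) C
      \<lparr>FOb = \<lambda>(x, y, z). x \<otimes>\<^sub>o (y \<oplus>\<^sub>o z), FAr = \<lambda>(f, g, h). f \<otimes>\<^sub>a (g \<oplus>\<^sub>a h)\<rparr>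
      \<lparr>FOb = \<lambda>(x, y, z). (x \<otimes>\<^sub>o y) \<oplus>\<^sub>o (x \<otimes>\<^sub>o z),
       FAr = \<lambda>(f, g, h). (f \<otimes>\<^sub>a g) \<oplus>\<^sub>a (f \<otimes>\<^sub>a h)\<rparr> dl"
    and dr_iso: "natural_iso (C \<times>\<^sub>C C \<times>\<^sub>C C) C
      \<lparr>FOb = \<lambda>(x, y, z). (x \<oplus>\<^sub>o y) \<otimes>\<^sub>o z, FAr = \<lambda>(f, g, h). (f \<oplus>\<^sub>a g) \<otimes>\<^sub>a h\<rparr>
      \<lparr>FOb = \<lambda>(x, y, z). (x \<otimes>\<^sub>o z) \<oplus>\<^sub>o (y \<otimes>\<^sub>o z),
       FAr = \<lambda>(f, g, h). (f \<otimes>\<^sub>a h) \<oplus>\<^sub>a (g \<otimes>\<^sub>a h)\<rparr> dr"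
    and nl_iso: "natural_iso C C
      \<lparr>FOb = \<lambda>x. zeroC \<otimes>\<^sub>o x, FAr = \<lambda>f. \<i> zeroC \<otimes>\<^sub>a f\<rparr>
      \<lparr>FOb = \<lambda>x. zeroC, FAr = \<lambda>f. \<i> zeroC\<rparr> nl"
    and nr_iso: "natural_iso C C
      \<lparr>FOb = \<lambda>x. x \<otimes>\<^sub>o zeroC, FAr = \<lambda>f. f \<otimes>\<^sub>a \<i> zeroC\<rparr>
      \<lparr>FOb = \<lambda>x. zeroC, FAr = \<lambda>f. \<i> zeroC\<rparr> nr"
    \<comment> \<open>distributivity and symmetry of the sum\<close>
    and dl_sP: "\<lbrakk>x \<in> Obj C; y \<in> Obj C; z \<in> Obj C\<rbrakk> \<Longrightarrow>
      sP (x \<otimes>\<^sub>o y, x \<otimes>\<^sub>o z) \<bullet> dl (x, y, z) = dl (x, z, y) \<bullet> (\<i> x \<otimes>\<^sub>a sP (y, z))"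
    and dr_sP: "\<lbrakk>x \<in> Obj C; y \<in> Obj C; z \<in> Obj C\<rbrakk> \<Longrightarrow>
      sP (x \<otimes>\<^sub>o z, y \<otimes>\<^sub>o z) \<bullet> dr (x, y, z) = dr (y, x, z) \<bullet> (sP (x, y) \<otimes>\<^sub>a \<i> z)"
    \<comment> \<open>distributivity and associativity of the sum\<close>
    and dr_aP: "\<lbrakk>w \<in> Obj C; x \<in> Obj C; y \<in> Obj C; z \<in> Obj C\<rbrakk> \<Longrightarrow>
      aP (w \<otimes>\<^sub>o z, x \<otimes>\<^sub>o z, y \<otimes>\<^sub>o z) \<bullet> (dr (w, x, z) \<oplus>\<^sub>a \<i> (y \<otimes>\<^sub>o z)) \<bullet> dr (w \<oplus>\<^sub>o x, y, z) =
      (\<i> (w \<otimes>\<^sub>o z) \<oplus>\<^sub>a dr (x, y, z)) \<bullet> dr (w, x \<oplus>\<^sub>o y, z) \<bullet> (aP (w, x, y) \<otimes>\<^sub>a \<i> z)"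
    and dl_aP: "\<lbrakk>w \<in> Obj C; x \<in> Obj C; y \<in> Obj C; z \<in> Obj C\<rbrakk> \<Longrightarrow>
      aP (w \<otimes>\<^sub>o x, w \<otimes>\<^sub>o y, w \<otimes>\<^sub>o z) \<bullet> (dl (w, x, y) \<oplus>\<^sub>a \<i> (w \<otimes>\<^sub>o z)) \<bullet> dl (w, x \<oplus>\<^sub>o y, z) =
      (\<i> (w \<otimes>\<^sub>o x) \<oplus>\<^sub>a dl (w, y, z)) \<bullet> dl (w, x, y \<oplus>\<^sub>o z) \<bullet> (\<i> w \<otimes>\<^sub>a aP (x, y, z))"
    \<comment> \<open>distributivity and associativity of the product\<close>
    and dl_aT: "\<lbrakk>w \<in> Obj C; x \<in> Obj C; y \<in> Obj C; z \<in> Obj C\<rbrakk> \<Longrightarrow>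
      dl (w, x \<otimes>\<^sub>o y, x \<otimes>\<^sub>o z) \<bullet> (\<i> w \<otimes>\<^sub>a dl (x, y, z)) \<bullet> aT (w, x, y \<oplus>\<^sub>o z) =
      (aT (w, x, y) \<oplus>\<^sub>a aT (w, x, z)) \<bullet> dl (w \<otimes>\<^sub>o x, y, z)"
    and dr_aT: "\<lbrakk>w \<in> Obj C; x \<in> Obj C; y \<in> Obj C; z \<in> Obj C\<rbrakk> \<Longrightarrow>
      (aT (w, y, z) \<oplus>\<^sub>a aT (x, y, z)) \<bullet> dr (w \<otimes>\<^sub>o y, x \<otimes>\<^sub>o y, z) \<bullet> (dr (w, x, y) \<otimes>\<^sub>a \<i> z) =
      dr (w, x, y \<otimes>\<^sub>o z) \<bullet> aT (w \<oplus>\<^sub>o x, y, z)"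
    and dl_dr_aT: "\<lbrakk>w \<in> Obj C; x \<in> Obj C; y \<in> Obj C; z \<in> Obj C\<rbrakk> \<Longrightarrow>
      dl (w, x \<otimes>\<^sub>o z, y \<otimes>\<^sub>o z) \<bullet> (\<i> w \<otimes>\<^sub>a dr (x, y, z)) \<bullet> aT (w, x \<oplus>\<^sub>o y, z) =
      (aT (w, x, z) \<oplus>\<^sub>a aT (w, y, z)) \<bullet> dr (w \<otimes>\<^sub>o x, w \<otimes>\<^sub>o y, z) \<bullet> (dl (w, x, y) \<otimes>\<^sub>a \<i> z)"
    \<comment> \<open>the two expansions of \<open>(w \<oplus> x) \<otimes> (y \<oplus> z)\<close>; the first three factors of the left-hand
      side exchange the middle two of four summands\<close>
    and dl_dr: "\<lbrakk>w \<in> Obj C; x \<in> Obj C; y \<in> Obj C; z \<in> Obj C\<rbrakk> \<Longrightarrow>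
      (let p = w \<otimes>\<^sub>o y; q = x \<otimes>\<^sub>o y; r = w \<otimes>\<^sub>o z; s = x \<otimes>\<^sub>o z in
       inverse_arrow C (aP (p, r, q \<oplus>\<^sub>o s))
         \<bullet> (\<i> p \<oplus>\<^sub>a (aP (r, q, s) \<bullet> (sP (q, r) \<oplus>\<^sub>a \<i> s) \<bullet> inverse_arrow C (aP (q, r, s))))
         \<bullet> aP (p, q, r \<oplus>\<^sub>o s)
         \<bullet> (dr (w, x, y) \<oplus>\<^sub>a dr (w, x, z)) \<bullet> dl (w \<oplus>\<^sub>o x, y, z)) =
      (dl (w, y, z) \<oplus>\<^sub>a dl (x, y, z)) \<bullet> dr (w, x, y \<oplus>\<^sub>o z)"
    \<comment> \<open>annihilation\<close>
    and nl_nr_zero: "nl zeroC = nr zeroC"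
    and nr_plus: "\<lbrakk>x \<in> Obj C; y \<in> Obj C\<rbrakk> \<Longrightarrow>
      nr (x \<oplus>\<^sub>o y) = lP zeroC \<bullet> (nr x \<oplus>\<^sub>a nr y) \<bullet> dr (x, y, zeroC)"
    and nl_plus: "\<lbrakk>x \<in> Obj C; y \<in> Obj C\<rbrakk> \<Longrightarrow>
      nl (x \<oplus>\<^sub>o y) = lP zeroC \<bullet> (nl x \<oplus>\<^sub>a nl y) \<bullet> dl (zeroC, x, y)"
    and nr_one: "nr oneC = lT zeroC"
    and nl_one: "nl oneC = rT zeroC"
    and nr_times: "\<lbrakk>x \<in> Obj C; y \<in> Obj C\<rbrakk> \<Longrightarrow>
      nr (x \<otimes>\<^sub>o y) = nr x \<bullet> (\<i> x \<otimes>\<^sub>a nr y) \<bullet> aT (x, y, zeroC)"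
    and nr_nl: "\<lbrakk>x \<in> Obj C; y \<in> Obj C\<rbrakk> \<Longrightarrow>
      nr x \<bullet> (\<i> x \<otimes>\<^sub>a nl y) \<bullet> aT (x, zeroC, y) = nl y \<bullet> (nr x \<otimes>\<^sub>a \<i> y)"
    and nl_times: "\<lbrakk>x \<in> Obj C; y \<in> Obj C\<rbrakk> \<Longrightarrow>
      nl (x \<otimes>\<^sub>o y) \<bullet> aT (zeroC, x, y) = nl y \<bullet> (nl x \<otimes>\<^sub>a \<i> y)"
    \<comment> \<open>distributivity and the units\<close>
    and dl_lP: "\<lbrakk>x \<in> Obj C; y \<in> Obj C\<rbrakk> \<Longrightarrow>
      lP (x \<otimes>\<^sub>o y) \<bullet> (nr x \<oplus>\<^sub>a \<i> (x \<otimes>\<^sub>o y)) \<bullet> dl (x, zeroC, y) = \<i> x \<otimes>\<^sub>a lP y"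
    and dr_lP: "\<lbrakk>x \<in> Obj C; y \<in> Obj C\<rbrakk> \<Longrightarrow>
      lP (x \<otimes>\<^sub>o y) \<bullet> (nl y \<oplus>\<^sub>a \<i> (x \<otimes>\<^sub>o y)) \<bullet> dr (zeroC, x, y) = lP x \<otimes>\<^sub>a \<i> y"
    and dl_rP: "\<lbrakk>x \<in> Obj C; y \<in> Obj C\<rbrakk> \<Longrightarrow>
      rP (x \<otimes>\<^sub>o y) \<bullet> (\<i> (x \<otimes>\<^sub>o y) \<oplus>\<^sub>a nr x) \<bullet> dl (x, y, zeroC) = \<i> x \<otimes>\<^sub>a rP y"
    and dr_rP: "\<lbrakk>x \<in> Obj C; y \<in> Obj C\<rbrakk> \<Longrightarrow>
      rP (x \<otimes>\<^sub>o y) \<bullet> (\<i> (x \<otimes>\<^sub>o y) \<oplus>\<^sub>a nl y) \<bullet> dr (x, zeroC, y) = rP x \<otimes>\<^sub>a \<i> y"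
    and dl_lT: "\<lbrakk>x \<in> Obj C; y \<in> Obj C\<rbrakk> \<Longrightarrow> (lT x \<oplus>\<^sub>a lT y) \<bullet> dl (oneC, x, y) = lT (x \<oplus>\<^sub>o y)"
    and dr_rT: "\<lbrakk>x \<in> Obj C; y \<in> Obj C\<rbrakk> \<Longrightarrow> (rT x \<oplus>\<^sub>a rT y) \<bullet> dr (x, y, oneC) = rT (x \<oplus>\<^sub>o y)"

definition distributive_category ::
  "('o, 'a) cat \<Rightarrow> ('o, 'a) bifunctor \<Rightarrow> 'o \<Rightarrow> ('o, 'a) bifunctor \<Rightarrow> 'o \<Rightarrow> bool" where
  "distributive_category C plusC zeroC timesC oneC \<longleftrightarrow>
     (\<exists>aP lP rP sP aT lT rT dl dr nl nr.
       coherent_distributive_category C plusC zeroC aP lP rP sP timesC oneC aT lT rT dl dr nl nr)"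

definition negative_functor ::
  "('o, 'a) cat \<Rightarrow> ('o, 'a) bifunctor \<Rightarrow> 'o \<Rightarrow> ('o, 'a) endofunctor \<Rightarrow> bool" where
  "negative_functor C plusC zeroC neg \<longleftrightarrow>
     is_functor C C neg \<and>
     naturally_isomorphic (C \<times>\<^sub>C C) C
       \<lparr>FOb = \<lambda>(x, y). FOb neg (FOb plusC (x, y)), FAr = \<lambda>(f, g). FAr neg (FAr plusC (f, g))\<rparr>
       \<lparr>FOb = \<lambda>(x, y). FOb plusC (FOb neg x, FOb neg y),
        FAr = \<lambda>(f, g). FAr plusC (FAr neg f, FAr neg g)\<rparr> \<and>
     isomorphic C (FOb neg zeroC) zeroC \<and>
     naturally_isomorphic C C
       \<lparr>FOb = \<lambda>x. FOb neg (FOb neg x), FAr = \<lambda>f. FAr neg (FAr neg f)\<rparr> id_functor"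


section \<open>Rota-Baxter categories\<close>

text \<open>The argument \<open>ng\<close> is \<open>Some neg\<close> if the category comes with a negative functor \<open>neg\<close>
  and \<open>None\<close> otherwise.\<close>

definition additive_functor ::
  "('o, 'a) cat \<Rightarrow> ('o, 'a) bifunctor \<Rightarrow> ('o, 'a) endofunctor option \<Rightarrow> ('o, 'a) endofunctor \<Rightarrow> bool"
  where
  "additive_functor C plusC ng P \<longleftrightarrow>
     is_functor C C P \<and>
     naturally_isomorphic (C \<times>\<^sub>C C) C
       \<lparr>FOb = \<lambda>(x, y). FOb P (FOb plusC (x, y)), FAr = \<lambda>(f, g). FAr P (FAr plusC (f, g))\<rparr>
       \<lparr>FOb = \<lambda>(x, y). FOb plusC (FOb P x, FOb P y),
        FAr = \<lambda>(f, g). FAr plusC (FAr P f, FAr P g)\<rparr> \<and>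
     (\<forall>neg. ng = Some neg \<longrightarrow>
       naturally_isomorphic C C
         \<lparr>FOb = \<lambda>x. FOb P (FOb neg x), FAr = \<lambda>f. FAr P (FAr neg f)\<rparr>
         \<lparr>FOb = \<lambda>x. FOb neg (FOb P x), FAr = \<lambda>f. FAr neg (FAr P f)\<rparr>)"

definition rota_baxter_category_0 ::
  "('o, 'a) cat \<Rightarrow> ('o, 'a) bifunctor \<Rightarrow> 'o \<Rightarrow> ('o, 'a) bifunctor \<Rightarrow> 'o
    \<Rightarrow> ('o, 'a) endofunctor option \<Rightarrow> ('o, 'a) endofunctor \<Rightarrow> bool" where
  "rota_baxter_category_0 C plusC zeroC timesC oneC ng P \<longleftrightarrow>
     distributive_category C plusC zeroC timesC oneC \<and>
     (\<forall>neg. ng = Some neg \<longrightarrow> negative_functor C plusC zeroC neg) \<and>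
     additive_functor C plusC ng P \<and>
     naturally_isomorphic (C \<times>\<^sub>C C) C
       \<lparr>FOb = \<lambda>(x, y). FOb timesC (FOb P x, FOb P y),
        FAr = \<lambda>(f, g). FAr timesC (FAr P f, FAr P g)\<rparr>
       \<lparr>FOb = \<lambda>(x, y). FOb plusC (FOb P (FOb timesC (FOb P x, y)), FOb P (FOb timesC (x, FOb P y))),
        FAr = \<lambda>(f, g). FAr plusC (FAr P (FAr timesC (FAr P f, g)), FAr P (FAr timesC (f, FAr P g)))\<rparr>"


section \<open>Valuations and categorifications\<close>

definition valuation_map ::
  "('r, 'm) ring_scheme \<Rightarrow> ('o, 'a) cat \<Rightarrow> ('o, 'a) bifunctor \<Rightarrow> 'o \<Rightarrow> ('o, 'a) bifunctor \<Rightarrow> 'o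
    \<Rightarrow> ('o, 'a) endofunctor \<Rightarrow> ('o \<Rightarrow> 'r) \<Rightarrow> bool" where
  "valuation_map R C plusC zeroC timesC oneC neg v \<longleftrightarrow>
     v \<in> Obj C \<rightarrow> carrier R \<and>
     (\<forall>x \<in> Obj C. \<forall>y \<in> Obj C. isomorphic C x y \<longrightarrow> v x = v y) \<and>
     (\<forall>x \<in> Obj C. \<forall>y \<in> Obj C. v (FOb plusC (x, y)) = v x \<oplus>\<^bsub>R\<^esub> v y) \<and>
     (\<forall>x \<in> Obj C. \<forall>y \<in> Obj C. v (FOb timesC (x, y)) = v x \<otimes>\<^bsub>R\<^esub> v y) \<and>
     v oneC = \<one>\<^bsub>R\<^esub> \<and>
     v zeroC = \<zero>\<^bsub>R\<^esub> \<and>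
     (\<forall>x \<in> Obj C. v (FOb neg x) = \<ominus>\<^bsub>R\<^esub> v x)"

definition categorification ::
  "('r, 'm) ring_scheme \<Rightarrow> ('o, 'a) cat \<Rightarrow> ('o, 'a) bifunctor \<Rightarrow> 'o \<Rightarrow> ('o, 'a) bifunctor \<Rightarrow> 'o
    \<Rightarrow> ('o, 'a) endofunctor \<Rightarrow> ('o \<Rightarrow> 'r) \<Rightarrow> bool" where
  "categorification R C plusC zeroC timesC oneC neg v \<longleftrightarrow>
     distributive_category C plusC zeroC timesC oneC \<and>
     negative_functor C plusC zeroC neg \<and>
     valuation_map R C plusC zeroC timesC oneC neg v"


section \<open>Finite linearly ordered sets\<close>

text \<open>A finite linearly ordered set is a finite subset of a type \<open>'e\<close> together with its
  (reflexive) order relation.\<close>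

type_synonym 'e lin = "'e set \<times> 'e rel"
type_synonym 'e lin_arr = "'e lin \<times> 'e lin \<times> ('e \<Rightarrow> 'e)"

definition lin_cat :: "('e lin, 'e lin_arr) cat" where
  "lin_cat =
    (let Ob = {(A, r). finite A \<and> linear_order_on A r} in \<lparr>
     Obj = Ob,
     Arr = {((A, r), (B, s), f). (A, r) \<in> Ob \<and> (B, s) \<in> Ob \<and> f \<in> extensional A \<and> bij_betw f A B \<and>
              (\<forall>a \<in> A. \<forall>b \<in> A. (a, b) \<in> r \<longrightarrow> (f a, f b) \<in> s)},
     Dom = (\<lambda>(x, y, f). x),
     Cod = (\<lambda>(x, y, f). y),
     Idn = (\<lambda>x. (x, x, \<lambda>a \<in> fst x. a)),
     Cmp = (\<lambda>(y', z, g) (x, y, f). (x, z, compose (fst x) g f))\<rparr>)"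

definition lin_restrict :: "'e lin \<Rightarrow> 'e set \<Rightarrow> 'e lin"  (infixl "\<restriction>" 90) where
  "x \<restriction> B = (B, snd x \<inter> B \<times> B)"

definition arr_restrict :: "'e lin_arr \<Rightarrow> 'e set \<Rightarrow> 'e lin_arr"  (infixl "\<restriction>\<^sub>a" 90) where
  "\<phi> \<restriction>\<^sub>a B = (case \<phi> of (x, y, f) \<Rightarrow> (x \<restriction> B, y \<restriction> (f ` B), restrict f B))"

definition max_elt :: "'e lin \<Rightarrow> 'e" where
  "max_elt x = (THE m. m \<in> fst x \<and> (\<forall>a \<in> fst x. (a, m) \<in> snd x))"

definition without_max :: "'e lin \<Rightarrow> 'e set" where
  "without_max x = fst x - {max_elt x}"

text \<open>A direct sum over the decompositions of \<open>x\<close> has to be taken in some order.  The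
  decompositions are listed in the order in which \<^const>\<open>subseqs\<close> produces the sublists of the
  decreasing list of elements of \<open>x\<close>; isomorphisms of linear orders respect this listing.
  Iterated sums are bracketed to the right and end with the zero object, the empty sum.\<close>

definition elts_desc :: "'e lin \<Rightarrow> 'e list" where
  "elts_desc x = (THE as. set as = fst x \<and> sorted_wrt (\<lambda>a b. a \<noteq> b \<and> (b, a) \<in> snd x) as)"

definition decomps :: "'e lin \<Rightarrow> ('e set \<times> 'e set) list" where
  "decomps x = map (\<lambda>as. (set as, fst x - set as)) (subseqs (elts_desc x))"

lemma elts_desc:
  assumes "(A, r) \<in> Obj lin_cat"
  shows "set (elts_desc (A, r)) = A"
    and "sorted_wrt (\<lambda>a b. a \<noteq> b \<and> (b, a) \<in> r) (elts_desc (A, r))"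
    and "distinct (elts_desc (A, r))"
proof -
  let ?R = "\<lambda>a b. a \<noteq> b \<and> (b, a) \<in> r"
  from assms have fin: "finite A" and lin: "linear_order_on A r"
    by (auto simp: lin_cat_def)
  have max: "\<exists>m \<in> B. \<forall>b \<in> B. (b, m) \<in> r" if "finite B" "B \<noteq> {}" "B \<subseteq> A" for B
    using that
  proof (induction B rule: finite_ne_induct)
    case (singleton c)
    then show ?case using lin by (auto simp: order_on_defs refl_on_def)
  next
    case (insert c B)
    then obtain m where m: "m \<in> B" "\<forall>b \<in> B. (b, m) \<in> r" by auto
    have "c \<in> A" "m \<in> A" "c \<noteq> m" using insert m by auto
    then consider "(c, m) \<in> r" | "(m, c) \<in> r"
      using lin unfolding order_on_defs total_on_def by blast
    then show ?case
    proof cases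
      case 1
      then show ?thesis using m by auto
    next
      case 2
      then have "\<forall>b \<in> B. (b, c) \<in> r"
        using m lin by (meson linear_order_on_def partial_order_onD(2) transD)
      moreover have "(c, c) \<in> r"
        using lin \<open>c \<in> A\<close> by (auto simp: order_on_defs refl_on_def)
      ultimately show ?thesis by auto
    qed
  qed
  have ex: "\<exists>as. set as = B \<and> sorted_wrt ?R as" if "finite B" "B \<subseteq> A" for B
    using that
  proof (induction "card B" arbitrary: B)
    case 0
    then show ?case by (intro exI[of _ "[]"]) auto
  next
    case (Suc n)
    then have "B \<noteq> {}" by auto
    then obtain m where m: "m \<in> B" "\<forall>b \<in> B. (b, m) \<in> r" using max Suc.prems by blast
    have "n = card (B - {m})" using Suc.hyps(2) m by simp
    from Suc.hyps(1)[OF this] Suc.prems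
    obtain as where as: "set as = B - {m}" "sorted_wrt ?R as" by auto
    then show ?case using m by (intro exI[of _ "m # as"]) auto
  qed
  have dist: "distinct as" if "sorted_wrt ?R as" for as
    using that by (induction as) auto
  have uniq: "as = bs" if "set as = set bs" "sorted_wrt ?R as" "sorted_wrt ?R bs" for as bs
    using that
  proof (induction as arbitrary: bs)
    case Nil
    then show ?case by simp
  next
    case (Cons a as)
    then obtain b bs' where bs: "bs = b # bs'" by (cases bs) auto
    have "a = b"
    proof (rule ccontr)
      assume "a \<noteq> b"
      then have "b \<in> set as" "a \<in> set bs'" using Cons.prems(1) bs by auto
      then have "(b, a) \<in> r" "(a, b) \<in> r" using Cons.prems bs by auto
      then show False using lin \<open>a \<noteq> b\<close> by (auto simp: order_on_defs antisym_def)
    qed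
    moreover have "set as = set bs'"
      using dist[OF Cons.prems(2)] dist[OF Cons.prems(3)] Cons.prems(1) bs \<open>a = b\<close> by auto
    ultimately show ?case using Cons bs by auto
  qed
  obtain as where as: "set as = A" "sorted_wrt ?R as" using ex[OF fin] by auto
  have "set (elts_desc (A, r)) = fst (A, r) \<and>
      sorted_wrt (\<lambda>a b. a \<noteq> b \<and> (b, a) \<in> snd (A, r)) (elts_desc (A, r))"
    unfolding elts_desc_def by (rule theI[of _ as]) (use as uniq in auto)
  then show "set (elts_desc (A, r)) = A" "sorted_wrt ?R (elts_desc (A, r))" by auto
  then show "distinct (elts_desc (A, r))" using dist by blast
qed

lemma set_decomps:
  assumes "x \<in> Obj lin_cat"
  shows "set (decomps x) = {(B, B'). B \<inter> B' = {} \<and> B \<union> B' = fst x}"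
proof -
  obtain A r where x: "x = (A, r)" by force
  have "set (decomps x) = (\<lambda>B. (B, A - B)) ` (set ` set (subseqs (elts_desc x)))"
    by (auto simp: decomps_def x)
  also have "\<dots> = (\<lambda>B. (B, A - B)) ` Pow A"
    using elts_desc(1)[of A r] assms x by (simp add: subseqs_powset)
  also have "\<dots> = {(B, B'). B \<inter> B' = {} \<and> B \<union> B' = fst x}"
    by (auto simp: x)
  finally show ?thesis .
qed

lemma distinct_decomps:
  assumes "x \<in> Obj lin_cat"
  shows "distinct (decomps x)"
proof -
  obtain A r where x: "x = (A, r)" by force
  have "distinct (map set (subseqs (elts_desc x)))"
    using elts_desc(3)[of A r] assms x distinct_set_subseqs by metis
  moreover have "map set (subseqs (elts_desc x)) = map fst (decomps x)"
    by (simp add: decomps_def)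
  ultimately show ?thesis by (metis distinct_map)
qed


section \<open>Functors on finite linearly ordered sets\<close>

definition lin_fun_cat where
  "lin_fun_cat C = functor_cat lin_cat C"

definition const_fun :: "('o, 'a) cat \<Rightarrow> 'o \<Rightarrow> ('e lin, 'e lin_arr, 'o, 'a) fun_data" where
  "const_fun C c = \<lparr>FOb = \<lambda>x \<in> Obj lin_cat. c, FAr = \<lambda>\<phi> \<in> Arr lin_cat. Idn C c\<rparr>"

definition pointwise_neg where
  "pointwise_neg neg =
    (let N = (\<lambda>F. \<lparr>FOb = \<lambda>x \<in> Obj lin_cat. FOb neg (FOb F x),
                   FAr = \<lambda>\<phi> \<in> Arr lin_cat. FAr neg (FAr F \<phi>)\<rparr>)
     in \<lparr>FOb = N, FAr = \<lambda>(F, F', t). (N F, N F', \<lambda>x \<in> Obj lin_cat. FAr neg (t x))\<rparr>)"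

definition pointwise_plus where
  "pointwise_plus plusC =
    (let S = (\<lambda>(F, G). \<lparr>FOb = \<lambda>x \<in> Obj lin_cat. FOb plusC (FOb F x, FOb G x),
                        FAr = \<lambda>\<phi> \<in> Arr lin_cat. FAr plusC (FAr F \<phi>, FAr G \<phi>)\<rparr>)
     in \<lparr>FOb = S, FAr = \<lambda>((F, F', t), (G, G', u)).
            (S (F, G), S (F', G'), \<lambda>x \<in> Obj lin_cat. FAr plusC (t x, u x))\<rparr>)"

definition big_plus_ob :: "('o, 'a) bifunctor \<Rightarrow> 'o \<Rightarrow> 'o list \<Rightarrow> 'o" where
  "big_plus_ob plusC zeroC xs = foldr (\<lambda>x y. FOb plusC (x, y)) xs zeroC"

definition big_plus_ar :: "('o, 'a) cat \<Rightarrow> ('o, 'a) bifunctor \<Rightarrow> 'o \<Rightarrow> 'a list \<Rightarrow> 'a" where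
  "big_plus_ar C plusC zeroC fs = foldr (\<lambda>f g. FAr plusC (f, g)) fs (Idn C zeroC)"

definition convolution where
  "convolution C plusC zeroC timesC =
    (let M = (\<lambda>(F, G).
       \<lparr>FOb = \<lambda>x \<in> Obj lin_cat. big_plus_ob plusC zeroC
           (map (\<lambda>(B, B'). FOb timesC (FOb F (x \<restriction> B), FOb G (x \<restriction> B'))) (decomps x)),
        FAr = \<lambda>\<phi> \<in> Arr lin_cat. big_plus_ar C plusC zeroC
           (map (\<lambda>(B, B'). FAr timesC (FAr F (\<phi> \<restriction>\<^sub>a B), FAr G (\<phi> \<restriction>\<^sub>a B'))) (decomps (Dom lin_cat \<phi>)))\<rparr>)
     in \<lparr>FOb = M, FAr = \<lambda>((F, F', t), (G, G', u)).
          (M (F, G), M (F', G'), \<lambda>x \<in> Obj lin_cat. big_plus_ar C plusC zeroC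
             (map (\<lambda>(B, B'). FAr timesC (t (x \<restriction> B), u (x \<restriction> B'))) (decomps x)))\<rparr>)"

definition unit_fun ::
  "('o, 'a) cat \<Rightarrow> 'o \<Rightarrow> 'o \<Rightarrow> ('e lin, 'e lin_arr, 'o, 'a) fun_data" where
  "unit_fun C zeroC oneC =
    (let e = (\<lambda>x. if fst x = {} then oneC else zeroC)
     in \<lparr>FOb = \<lambda>x \<in> Obj lin_cat. e x, FAr = \<lambda>\<phi> \<in> Arr lin_cat. Idn C (e (Dom lin_cat \<phi>))\<rparr>)"

definition shift_functor where
  "shift_functor C zeroC =
    (let S = (\<lambda>F.
       \<lparr>FOb = \<lambda>x \<in> Obj lin_cat. if fst x = {} then zeroC else FOb F (x \<restriction> without_max x),
        FAr = \<lambda>\<phi> \<in> Arr lin_cat. let x = Dom lin_cat \<phi> in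
          if fst x = {} then Idn C zeroC else FAr F (\<phi> \<restriction>\<^sub>a without_max x)\<rparr>)
     in \<lparr>FOb = S, FAr = \<lambda>(F, G, t). (S F, S G, \<lambda>x \<in> Obj lin_cat.
          if fst x = {} then Idn C zeroC else t (x \<restriction> without_max x))\<rparr>)"


section \<open>Formal divided power series\<close>

text \<open>The series \<open>\<Sum>\<^sub>n a\<^sub>n x\<^sup>n/n!\<close> is represented by the sequence \<open>a\<close>.\<close>

definition divided_power_series :: "('r, 'm) ring_scheme \<Rightarrow> (nat \<Rightarrow> 'r) ring" where
  "divided_power_series R = \<lparr>
     carrier = UNIV \<rightarrow> carrier R,
     mult = (\<lambda>a b n. \<Oplus>\<^bsub>R\<^esub>k \<in> {..n}. [(n choose k)] \<cdot>\<^bsub>R\<^esub> (a k \<otimes>\<^bsub>R\<^esub> b (n - k))),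
     one = (\<lambda>n. if n = 0 then \<one>\<^bsub>R\<^esub> else \<zero>\<^bsub>R\<^esub>),
     zero = (\<lambda>n. \<zero>\<^bsub>R\<^esub>),
     add = (\<lambda>a b n. a n \<oplus>\<^bsub>R\<^esub> b n)\<rparr>"

definition integral_series :: "('r, 'm) ring_scheme \<Rightarrow> (nat \<Rightarrow> 'r) \<Rightarrow> (nat \<Rightarrow> 'r)" where
  "integral_series R a = (\<lambda>n. if n = 0 then \<zero>\<^bsub>R\<^esub> else a (n - 1))"

text \<open>The ordered set \<open>[n]\<close>, its elements being named by an injection \<open>\<iota>\<close> of the natural
  numbers into the type \<open>'e\<close>.\<close>

definition std_lin :: "(nat \<Rightarrow> 'e) \<Rightarrow> nat \<Rightarrow> 'e lin" where
  "std_lin \<iota> n = (\<iota> ` {1..n}, {(\<iota> i, \<iota> j) | i j. 1 \<le> i \<and> i \<le> j \<and> j \<le> n})"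

definition series_valuation ::
  "(nat \<Rightarrow> 'e) \<Rightarrow> ('o \<Rightarrow> 'r) \<Rightarrow> ('e lin, 'e lin_arr, 'o, 'a) fun_data \<Rightarrow> nat \<Rightarrow> 'r" where
  "series_valuation \<iota> v F = (\<lambda>n. v (FOb F (std_lin \<iota> n)))"

end

theory Submission
  imports Defs
begin

text \<open>The main point is coherence for the convolution product.  A term in the operations of a
  distributive category expands to a set of monomials, which are words in its variables.  Multiplying
  the value of \<open>t\<close> by the sum of a set \<open>B\<close> of words and expanding gives an isomorphism onto the sum
  of the words obtained by prefixing the monomials of \<open>t\<close> to \<open>B\<close>.  If no word arises twice, then
  Laplaza's diagrams show that every structure isomorphism \<open>t \<rightarrow> u\<close> is compatible with the actions
  of \<open>t\<close> and \<open>u\<close>, and for \<open>B = {[]}\<close> this determines it.  So there is at most one isomorphism built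
  from the structure isomorphisms between two such terms, and there is one if the terms have the same
  monomials, since both can be rewritten to the sum of these.

  A product of functors at \<open>x\<close> is the value of a term whose variables are pairs of a functor and a
  subset of \<open>x\<close>.  If a term in functors repeats no variable in a monomial, then its expansion at \<open>x\<close>
  repeats no word.  Hence the structure isomorphisms of \<open>C\<^sup>L\<close>, their naturality and the diagrams for
  them follow by comparing sets of words.  The same applies to the Rota-Baxter isomorphism: on both
  sides the words correspond to the decompositions of \<open>x\<close> into two nonempty sets, on the right-hand
  side sorted according to which of them contains the maximum.

  The valuation of \<open>F(x)\<close> depends on the cardinality of \<open>x\<close> only, so the \<open>2\<^sup>n\<close> summands of
  \<open>(FG)([n])\<close> are grouped by the cardinality of the first set, which gives the binomial
  coefficients.\<close>

section \<open>Monoidal categories\<close>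

text \<open>Coherence cannot hold for all terms: on \<open>Add a a\<close> both the identity and the
  symmetry are canonical. Restricting to terms without repeated monomials is what makes uniqueness
  possible, but rewriting must then stay inside this class, and most constructions are shaped by
  that.

  Letting terms act is a Cayley-type device: a product acts by composing two actions, so products
  need no normal form of their own. The price is that in a product \<open>Mul t u\<close> the left
  factor acts on \<open>mons u B\<close> and not on \<open>B\<close>; invariants therefore quantify
  over the set \<open>B\<close> of words. Monomials are words and not multisets because the product
  of \<open>C\<close> is not assumed symmetric, while the sum is, so that a set of words may be
  listed in any order and a total order of words can serve as a convention.

  In \<open>C^L\<close> the variables of a term are indices and not functors. Hence a diagram may be
  instantiated with equal functors although its terms are free of repetitions, and a component of a
  structure isomorphism may be picked arbitrarily among the canonical isomorphisms.\<close>

context category begin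

lemma Hom_iff: "f \<in> Hom C x y \<longleftrightarrow> f \<in> Arr C \<and> Dom C f = x \<and> Cod C f = y"
  by (auto simp: Hom_def)

lemma Idn_simps [simp]:
  assumes "x \<in> Obj C"
  shows "Idn C x \<in> Arr C" "Dom C (Idn C x) = x" "Cod C (Idn C x) = x"
  using Idn_Hom[OF assms] by (auto simp: Hom_iff)

lemma Dom_Cod_Obj [simp]: "f \<in> Arr C \<Longrightarrow> Dom C f \<in> Obj C" "f \<in> Arr C \<Longrightarrow> Cod C f \<in> Obj C"
  by (auto simp: Dom_Obj Cod_Obj)

lemma Cmp_simps [simp]:
  assumes "f \<in> Arr C" "g \<in> Arr C" "Dom C g = Cod C f"
  shows "g \<bullet> f \<in> Arr C" "Dom C (g \<bullet> f) = Dom C f" "Cod C (g \<bullet> f) = Cod C g"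
  using Cmp_Hom[of f "Dom C f" "Cod C f" g "Cod C g"] assms by (auto simp: Hom_iff)

lemma cmp_assoc:
  assumes "f \<in> Arr C" "g \<in> Arr C" "h \<in> Arr C" "Dom C g = Cod C f" "Dom C h = Cod C g"
  shows "(h \<bullet> g) \<bullet> f = h \<bullet> (g \<bullet> f)"
  using Cmp_assoc[of f "Dom C f" "Cod C f" g "Cod C g" h "Cod C h"] assms by (auto simp: Hom_iff)

lemma Cmp_Idn [simp]:
  assumes "f \<in> Arr C"
  shows "Dom C f = x \<Longrightarrow> f \<bullet> Idn C x = f" "Cod C f = x \<Longrightarrow> Idn C x \<bullet> f = f"
  using Cmp_Idn_right[of f "Dom C f" "Cod C f"] Cmp_Idn_left[of f "Dom C f" "Cod C f"] assms
  by (auto simp: Hom_iff)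

text \<open>Composites are kept nested to the right, where a redex \<open>g \<bullet> f\<close> is
  followed by a tail \<open>h\<close>. In this form an equation for \<open>g \<bullet> f\<close> can
  rewrite inside such a chain.\<close>

lemma cmp_reduce:
  assumes "g \<bullet> f = k" "f \<in> Arr C" "g \<in> Arr C" "h \<in> Arr C" "Dom C g = Cod C f" "Dom C f = Cod C h"
  shows "g \<bullet> (f \<bullet> h) = k \<bullet> h"
  using cmp_assoc[of h f g] assms by simp

abbreviation ident ("\<ii>") where "\<ii> \<equiv> Idn C"
abbreviation iso where "iso f \<equiv> is_isomorphism C f"
abbreviation inv_arr where "inv_arr f \<equiv> inverse_arrow C f"

lemma inverse_arrows_unique:
  assumes "inverse_arrows C f g" "inverse_arrows C f h"
  shows "g = h"
proof -
  have "g = g \<bullet> (f \<bullet> h)" using assms by (auto simp: inverse_arrows_def Hom_iff)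
  also have "\<dots> = (g \<bullet> f) \<bullet> h" using assms by (subst cmp_assoc) (auto simp: inverse_arrows_def Hom_iff)
  also have "\<dots> = h" using assms by (auto simp: inverse_arrows_def Hom_iff)
  finally show ?thesis .
qed

lemma inverse_arrows_inv: "iso f \<Longrightarrow> inverse_arrows C f (inv_arr f)"
  unfolding inverse_arrow_def is_isomorphism_def
  by (rule theI') (use inverse_arrows_unique in blast)

lemma iso_Arr [simp]: "iso f \<Longrightarrow> f \<in> Arr C"
  by (auto simp: is_isomorphism_def inverse_arrows_def)

lemma inv_simps [simp]:
  assumes "iso f"
  shows "inv_arr f \<in> Arr C" "Dom C (inv_arr f) = Cod C f" "Cod C (inv_arr f) = Dom C f"
    "inv_arr f \<bullet> f = Idn C (Dom C f)" "f \<bullet> inv_arr f = Idn C (Cod C f)"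
  using inverse_arrows_inv[OF assms] by (auto simp: inverse_arrows_def Hom_iff)

text \<open>Cancellation in the same shape as \<open>cmp_reduce\<close>, with a tail
  \<open>h\<close> in a composite nested to the right.\<close>

lemma inv_reduce:
  assumes "iso f" "h \<in> Arr C"
  shows "Cod C h = Dom C f \<Longrightarrow> inv_arr f \<bullet> (f \<bullet> h) = h" "Cod C h = Cod C f \<Longrightarrow> f \<bullet> (inv_arr f \<bullet> h) = h"
  using assms by (simp_all add: cmp_assoc[symmetric])

lemma isoI:
  assumes "f \<in> Arr C" "g \<in> Arr C" "Dom C g = Cod C f" "Cod C g = Dom C f"
    "g \<bullet> f = Idn C (Dom C f)" "f \<bullet> g = Idn C (Cod C f)"
  shows "iso f"
  unfolding is_isomorphism_def inverse_arrows_def using assms by (intro exI[of _ g]) (auto simp: Hom_iff)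

lemma inv_unique:
  assumes "f \<in> Arr C" "g \<in> Arr C" "Dom C g = Cod C f" "Cod C g = Dom C f"
    "g \<bullet> f = Idn C (Dom C f)" "f \<bullet> g = Idn C (Cod C f)"
  shows "inv_arr f = g"
  using inverse_arrows_unique[of f g "inv_arr f"] inverse_arrows_inv[OF isoI[OF assms]] assms
  by (auto simp: inverse_arrows_def Hom_iff)

lemma iso_inv [simp]: "iso f \<Longrightarrow> iso (inv_arr f)"
  by (rule isoI[of _ f]) auto

lemma iso_Idn [simp]: "x \<in> Obj C \<Longrightarrow> iso (Idn C x)"
  by (rule isoI[of _ "Idn C x"]) auto

lemma iso_Cmp [simp]:
  assumes "iso f" "iso g" "Dom C g = Cod C f"
  shows "iso (g \<bullet> f)"
  by (rule isoI[of _ "inv_arr f \<bullet> inv_arr g"]) (use assms in \<open>auto simp: cmp_assoc inv_reduce\<close>)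

lemma iso_cancel_left:
  assumes "f \<bullet> g = f \<bullet> h" "iso f" "g \<in> Arr C" "h \<in> Arr C" "Cod C g = Dom C f" "Cod C h = Dom C f"
  shows "g = h"
proof -
  have "inv_arr f \<bullet> (f \<bullet> g) = inv_arr f \<bullet> (f \<bullet> h)" using assms by simp
  then show ?thesis using assms(2-) by (simp add: inv_reduce)
qed

lemma iso_cancel_right:
  assumes "g \<bullet> f = h \<bullet> f" "iso f" "g \<in> Arr C" "h \<in> Arr C" "Dom C g = Cod C f" "Dom C h = Cod C f"
  shows "g = h"
proof -
  have "(g \<bullet> f) \<bullet> inv_arr f = (h \<bullet> f) \<bullet> inv_arr f" using assms by simp
  then show ?thesis using assms(2-) by (simp add: cmp_assoc)
qed

lemma isomorphicI: "iso f \<Longrightarrow> isomorphic C (Dom C f) (Cod C f)"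
  unfolding isomorphic_def by (intro bexI[of _ f]) (auto simp: Hom_iff)

lemma isomorphicE:
  assumes "isomorphic C x y"
  obtains f where "iso f" "Dom C f = x" "Cod C f = y"
  using assms unfolding isomorphic_def by (auto simp: Hom_iff)

end

section \<open>Product categories, functors and natural isomorphisms\<close>

lemma prod_cat_simps [simp]:
  "Obj (A \<times>\<^sub>C B) = Obj A \<times> Obj B" "Arr (A \<times>\<^sub>C B) = Arr A \<times> Arr B"
  "Dom (A \<times>\<^sub>C B) (f, g) = (Dom A f, Dom B g)" "Cod (A \<times>\<^sub>C B) (f, g) = (Cod A f, Cod B g)"
  "Idn (A \<times>\<^sub>C B) (x, y) = (Idn A x, Idn B y)"
  "Cmp (A \<times>\<^sub>C B) (f', g') (f, g) = (f' \<bullet>\<^bsub>A\<^esub> f, g' \<bullet>\<^bsub>B\<^esub> g)"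
  by (auto simp: prod_cat_def)

lemma category_prod_cat:
  assumes "category A" "category B"
  shows "category (A \<times>\<^sub>C B)"
proof -
  interpret A: category A by fact
  interpret B: category B by fact
  show ?thesis
    by unfold_locales (auto simp: Hom_def A.cmp_assoc B.cmp_assoc)
qed

lemma is_functorI:
  assumes "category A" "category B"
    and "\<And>x. x \<in> Obj A \<Longrightarrow> FOb F x \<in> Obj B"
    and "\<And>f. f \<in> Arr A \<Longrightarrow> FAr F f \<in> Arr B \<and> Dom B (FAr F f) = FOb F (Dom A f) \<and>
      Cod B (FAr F f) = FOb F (Cod A f)"
    and "\<And>x. x \<in> Obj A \<Longrightarrow> FAr F (Idn A x) = Idn B (FOb F x)"
    and "\<And>f g. f \<in> Arr A \<Longrightarrow> g \<in> Arr A \<Longrightarrow> Dom A g = Cod A f \<Longrightarrow>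
      FAr F (g \<bullet>\<^bsub>A\<^esub> f) = FAr F g \<bullet>\<^bsub>B\<^esub> FAr F f"
  shows "is_functor A B F"
  using assms by (auto simp: is_functor_def is_functor_axioms_def Hom_def)

context is_functor begin

lemma functor_simps [simp]:
  "f \<in> Arr A \<Longrightarrow> FAr F f \<in> Arr B"
  "f \<in> Arr A \<Longrightarrow> Dom B (FAr F f) = FOb F (Dom A f)"
  "f \<in> Arr A \<Longrightarrow> Cod B (FAr F f) = FOb F (Cod A f)"
  using FAr_Hom[of f "Dom A f" "Cod A f"] by (auto simp: Hom_def)

lemma functor_Cmp:
  "f \<in> Arr A \<Longrightarrow> g \<in> Arr A \<Longrightarrow> Dom A g = Cod A f \<Longrightarrow> FAr F (g \<bullet>\<^bsub>A\<^esub> f) = FAr F g \<bullet>\<^bsub>B\<^esub> FAr F f"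
  using FAr_Cmp[of f "Dom A f" "Cod A f" g "Cod A g"] by (auto simp: Hom_def)

lemma functor_iso:
  assumes "is_isomorphism A f"
  shows "is_isomorphism B (FAr F f)"
proof (rule B.isoI[of _ "FAr F (inverse_arrow A f)"])
  have "FAr F (inverse_arrow A f) \<bullet>\<^bsub>B\<^esub> FAr F f = FAr F (inverse_arrow A f \<bullet>\<^bsub>A\<^esub> f)"
    using assms by (subst functor_Cmp) auto
  then show "FAr F (inverse_arrow A f) \<bullet>\<^bsub>B\<^esub> FAr F f = Idn B (Dom B (FAr F f))"
    using assms by (simp add: FAr_Idn)
  have "FAr F f \<bullet>\<^bsub>B\<^esub> FAr F (inverse_arrow A f) = FAr F (f \<bullet>\<^bsub>A\<^esub> inverse_arrow A f)"
    using assms by (subst functor_Cmp) auto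
  then show "FAr F f \<bullet>\<^bsub>B\<^esub> FAr F (inverse_arrow A f) = Idn B (Cod B (FAr F f))"
    using assms by (simp add: FAr_Idn)
qed (use assms in auto)

end

lemma natural_isoI:
  assumes "is_functor A B F" "is_functor A B G"
    and "\<And>x. x \<in> Obj A \<Longrightarrow> is_isomorphism B (t x) \<and> Dom B (t x) = FOb F x \<and> Cod B (t x) = FOb G x"
    and "\<And>f. f \<in> Arr A \<Longrightarrow> t (Cod A f) \<bullet>\<^bsub>B\<^esub> FAr F f = FAr G f \<bullet>\<^bsub>B\<^esub> t (Dom A f)"
  shows "natural_iso A B F G t"
proof -
  interpret is_functor A B F by fact
  show ?thesis using assms by (auto simp: natural_iso_def is_natural_def Hom_def)
qed

lemma natural_isoD:
  assumes "natural_iso A B F G t"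
  shows "is_functor A B F" "is_functor A B G"
    "\<And>x. x \<in> Obj A \<Longrightarrow> is_isomorphism B (t x)"
    "\<And>x. x \<in> Obj A \<Longrightarrow> t x \<in> Arr B"
    "\<And>x. x \<in> Obj A \<Longrightarrow> Dom B (t x) = FOb F x" "\<And>x. x \<in> Obj A \<Longrightarrow> Cod B (t x) = FOb G x"
    "\<And>f. f \<in> Arr A \<Longrightarrow> t (Cod A f) \<bullet>\<^bsub>B\<^esub> FAr F f = FAr G f \<bullet>\<^bsub>B\<^esub> t (Dom A f)"
  using assms by (auto simp: natural_iso_def is_natural_def Hom_def)

lemma bifunctor_simps:
  assumes "is_functor (C \<times>\<^sub>C C) C T"
  shows "x \<in> Obj C \<Longrightarrow> y \<in> Obj C \<Longrightarrow> FOb T (x, y) \<in> Obj C"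
    "f \<in> Arr C \<Longrightarrow> g \<in> Arr C \<Longrightarrow> FAr T (f, g) \<in> Arr C"
    "f \<in> Arr C \<Longrightarrow> g \<in> Arr C \<Longrightarrow> Dom C (FAr T (f, g)) = FOb T (Dom C f, Dom C g)"
    "f \<in> Arr C \<Longrightarrow> g \<in> Arr C \<Longrightarrow> Cod C (FAr T (f, g)) = FOb T (Cod C f, Cod C g)"
    "x \<in> Obj C \<Longrightarrow> y \<in> Obj C \<Longrightarrow> FAr T (Idn C x, Idn C y) = Idn C (FOb T (x, y))"
    "f \<in> Arr C \<Longrightarrow> f' \<in> Arr C \<Longrightarrow> g \<in> Arr C \<Longrightarrow> g' \<in> Arr C \<Longrightarrow> Dom C f' = Cod C f \<Longrightarrow> Dom C g' = Cod C g \<Longrightarrow>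
      FAr T (f' \<bullet>\<^bsub>C\<^esub> f, g' \<bullet>\<^bsub>C\<^esub> g) = FAr T (f', g') \<bullet>\<^bsub>C\<^esub> FAr T (f, g)"
    "is_isomorphism C f \<Longrightarrow> is_isomorphism C g \<Longrightarrow> is_isomorphism C (FAr T (f, g))"
proof -
  interpret is_functor "C \<times>\<^sub>C C" C T by fact
  show "x \<in> Obj C \<Longrightarrow> y \<in> Obj C \<Longrightarrow> FOb T (x, y) \<in> Obj C"
    using FOb_Obj[of "(x, y)"] by simp
  show "f \<in> Arr C \<Longrightarrow> g \<in> Arr C \<Longrightarrow> FAr T (f, g) \<in> Arr C"
    "f \<in> Arr C \<Longrightarrow> g \<in> Arr C \<Longrightarrow> Dom C (FAr T (f, g)) = FOb T (Dom C f, Dom C g)"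
    "f \<in> Arr C \<Longrightarrow> g \<in> Arr C \<Longrightarrow> Cod C (FAr T (f, g)) = FOb T (Cod C f, Cod C g)"
    by simp_all
  show "x \<in> Obj C \<Longrightarrow> y \<in> Obj C \<Longrightarrow> FAr T (Idn C x, Idn C y) = Idn C (FOb T (x, y))"
    using FAr_Idn[of "(x, y)"] by simp
  show "f \<in> Arr C \<Longrightarrow> f' \<in> Arr C \<Longrightarrow> g \<in> Arr C \<Longrightarrow> g' \<in> Arr C \<Longrightarrow> Dom C f' = Cod C f \<Longrightarrow> Dom C g' = Cod C g \<Longrightarrow>
      FAr T (f' \<bullet>\<^bsub>C\<^esub> f, g' \<bullet>\<^bsub>C\<^esub> g) = FAr T (f', g') \<bullet>\<^bsub>C\<^esub> FAr T (f, g)"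
    using functor_Cmp[of "(f, g)" "(f', g')"] by simp
  assume iso: "is_isomorphism C f" "is_isomorphism C g"
  have "is_isomorphism (C \<times>\<^sub>C C) (f, g)"
    by (rule A.isoI[of _ "(inverse_arrow C f, inverse_arrow C g)"]) (use iso in auto)
  then show "is_isomorphism C (FAr T (f, g))" by (rule functor_iso)
qed

section \<open>Unit coherence in a monoidal category\<close>

context monoidal_category begin

lemma tensor_simps [simp]:
  "x \<in> Obj C \<Longrightarrow> y \<in> Obj C \<Longrightarrow> x \<otimes>\<^sub>o y \<in> Obj C"
  "f \<in> Arr C \<Longrightarrow> g \<in> Arr C \<Longrightarrow> f \<otimes>\<^sub>a g \<in> Arr C"
  "f \<in> Arr C \<Longrightarrow> g \<in> Arr C \<Longrightarrow> Dom C (f \<otimes>\<^sub>a g) = Dom C f \<otimes>\<^sub>o Dom C g"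
  "f \<in> Arr C \<Longrightarrow> g \<in> Arr C \<Longrightarrow> Cod C (f \<otimes>\<^sub>a g) = Cod C f \<otimes>\<^sub>o Cod C g"
  "x \<in> Obj C \<Longrightarrow> y \<in> Obj C \<Longrightarrow> Idn C x \<otimes>\<^sub>a Idn C y = Idn C (x \<otimes>\<^sub>o y)"
  "iso f \<Longrightarrow> iso g \<Longrightarrow> iso (f \<otimes>\<^sub>a g)"
  using bifunctor_simps[OF T_functor] by (simp_all add: tob_def tar_def)

lemma interchange:
  "f \<in> Arr C \<Longrightarrow> f' \<in> Arr C \<Longrightarrow> g \<in> Arr C \<Longrightarrow> g' \<in> Arr C \<Longrightarrow> Dom C f' = Cod C f \<Longrightarrow> Dom C g' = Cod C g \<Longrightarrow>
    (f' \<otimes>\<^sub>a g') \<bullet> (f \<otimes>\<^sub>a g) = (f' \<bullet> f) \<otimes>\<^sub>a (g' \<bullet> g)"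
  using bifunctor_simps(6)[OF T_functor] by (simp add: tob_def tar_def)

lemma I_Obj' [simp]: "I \<in> Obj C" by (rule I_Obj)

lemma assoc_simps [simp]:
  assumes "x \<in> Obj C" "y \<in> Obj C" "z \<in> Obj C"
  shows "assoc (x, y, z) \<in> Arr C" "iso (assoc (x, y, z))"
    "Dom C (assoc (x, y, z)) = (x \<otimes>\<^sub>o y) \<otimes>\<^sub>o z" "Cod C (assoc (x, y, z)) = x \<otimes>\<^sub>o y \<otimes>\<^sub>o z"
  using natural_isoD(3-6)[OF assoc_iso, of "(x, y, z)"] assms by simp_all

lemma assoc_natural:
  assumes "f \<in> Arr C" "g \<in> Arr C" "h \<in> Arr C"
  shows "assoc (Cod C f, Cod C g, Cod C h) \<bullet> ((f \<otimes>\<^sub>a g) \<otimes>\<^sub>a h) =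
    (f \<otimes>\<^sub>a g \<otimes>\<^sub>a h) \<bullet> assoc (Dom C f, Dom C g, Dom C h)"
  using natural_isoD(7)[OF assoc_iso, of "(f, g, h)"] assms by simp

lemma unit_simps [simp]:
  assumes "x \<in> Obj C"
  shows "lunit x \<in> Arr C" "iso (lunit x)" "Dom C (lunit x) = I \<otimes>\<^sub>o x" "Cod C (lunit x) = x"
    "runit x \<in> Arr C" "iso (runit x)" "Dom C (runit x) = x \<otimes>\<^sub>o I" "Cod C (runit x) = x"
  using natural_isoD(3-6)[OF lunit_iso, of x] natural_isoD(3-6)[OF runit_iso, of x] assms
  by (simp_all add: id_functor_def)

lemma unit_natural:
  assumes "f \<in> Arr C"
  shows "lunit (Cod C f) \<bullet> (Idn C I \<otimes>\<^sub>a f) = f \<bullet> lunit (Dom C f)"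
    "runit (Cod C f) \<bullet> (f \<otimes>\<^sub>a Idn C I) = f \<bullet> runit (Dom C f)"
  using natural_isoD(7)[OF lunit_iso, of f] natural_isoD(7)[OF runit_iso, of f] assms
  by (simp_all add: id_functor_def)

text \<open>By naturality of the unit isomorphisms, tensoring with the unit is conjugate to the
  identity functor, hence faithful. Equations are below often proved after tensoring with
  \<open>I\<close>, where pentagon and hexagon apply.\<close>

lemma tensor_unit_faithful:
  assumes "f \<in> Arr C" "g \<in> Arr C" "Dom C f = Dom C g" "Cod C f = Cod C g"
  shows "Idn C I \<otimes>\<^sub>a f = Idn C I \<otimes>\<^sub>a g \<Longrightarrow> f = g" "f \<otimes>\<^sub>a Idn C I = g \<otimes>\<^sub>a Idn C I \<Longrightarrow> f = g"
  using unit_natural[of f] unit_natural[of g] assms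
    iso_cancel_right[of f "lunit (Dom C g)" g] iso_cancel_right[of f "runit (Dom C g)" g] by simp_all

text \<open>Oriented against \<open>interchange\<close>: a composite in one argument is split, so
  that its factors can be regrouped with their neighbours.\<close>

lemma interchange_left:
  "f \<in> Arr C \<Longrightarrow> f' \<in> Arr C \<Longrightarrow> x \<in> Obj C \<Longrightarrow> Dom C f' = Cod C f \<Longrightarrow>
    (f' \<bullet> f) \<otimes>\<^sub>a \<ii> x = (f' \<otimes>\<^sub>a \<ii> x) \<bullet> (f \<otimes>\<^sub>a \<ii> x)"
  by (subst interchange) auto

lemma interchange_right:
  "f \<in> Arr C \<Longrightarrow> f' \<in> Arr C \<Longrightarrow> x \<in> Obj C \<Longrightarrow> Dom C f' = Cod C f \<Longrightarrow>
    \<ii> x \<otimes>\<^sub>a (f' \<bullet> f) = (\<ii> x \<otimes>\<^sub>a f') \<bullet> (\<ii> x \<otimes>\<^sub>a f)"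
  by (subst interchange) auto

text \<open>Kelly's argument. After tensoring with \<open>I\<close> on the left, the pentagon for
  \<open>I, I, x, y\<close> and two uses of the triangle identify both sides; the common tail
  \<open>?e\<close> of the pentagon is cancelled, and then the factor \<open>I\<close>.\<close>

lemma lunit_tensor:
  assumes [simp]: "x \<in> Obj C" "y \<in> Obj C"
  shows "lunit (x \<otimes>\<^sub>o y) \<bullet> assoc (I, x, y) = lunit x \<otimes>\<^sub>a \<ii> y"
proof -
  let ?e = "assoc (I, I \<otimes>\<^sub>o x, y) \<bullet> (assoc (I, I, x) \<otimes>\<^sub>a \<ii> y)"
  have "(\<ii> I \<otimes>\<^sub>a (lunit (x \<otimes>\<^sub>o y) \<bullet> assoc (I, x, y))) \<bullet> ?e =
      (\<ii> I \<otimes>\<^sub>a lunit (x \<otimes>\<^sub>o y)) \<bullet> (\<ii> I \<otimes>\<^sub>a assoc (I, x, y)) \<bullet> ?e"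
    by (simp add: interchange_right cmp_assoc)
  also have "\<dots> = (\<ii> I \<otimes>\<^sub>a lunit (x \<otimes>\<^sub>o y)) \<bullet> assoc (I, I, x \<otimes>\<^sub>o y) \<bullet> assoc (I \<otimes>\<^sub>o I, x, y)"
    by (simp add: pentagon)
  also have "\<dots> = (runit I \<otimes>\<^sub>a \<ii> (x \<otimes>\<^sub>o y)) \<bullet> assoc (I \<otimes>\<^sub>o I, x, y)"
    by (simp add: cmp_reduce[OF triangle])
  also have "\<dots> = assoc (I, x, y) \<bullet> ((runit I \<otimes>\<^sub>a \<ii> x) \<otimes>\<^sub>a \<ii> y)"
    using assoc_natural[of "runit I" "\<ii> x" "\<ii> y"] by simp
  also have "\<dots> = assoc (I, x, y) \<bullet> ((\<ii> I \<otimes>\<^sub>a lunit x) \<otimes>\<^sub>a \<ii> y) \<bullet> (assoc (I, I, x) \<otimes>\<^sub>a \<ii> y)"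
    by (simp add: triangle[symmetric] interchange_left)
  also have "\<dots> = (\<ii> I \<otimes>\<^sub>a (lunit x \<otimes>\<^sub>a \<ii> y)) \<bullet> ?e"
    using cmp_reduce[OF assoc_natural[of "\<ii> I" "lunit x" "\<ii> y"]] by (simp add: cmp_assoc)
  finally have "\<ii> I \<otimes>\<^sub>a (lunit (x \<otimes>\<^sub>o y) \<bullet> assoc (I, x, y)) = \<ii> I \<otimes>\<^sub>a (lunit x \<otimes>\<^sub>a \<ii> y)"
    by (rule iso_cancel_right) auto
  then show ?thesis by (rule tensor_unit_faithful(1)[rotated 4]) auto
qed

text \<open>Naturality of \<open>lunit\<close> at the arrow \<open>lunit I\<close> gives
  \<open>\<ii> I \<otimes>\<^sub>a lunit I = lunit (I \<otimes>\<^sub>o I)\<close>, so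
  \<open>lunit_tensor\<close> and the triangle at \<open>I, I\<close> have the same left-hand
  side.\<close>

lemma lunit_eq_runit: "lunit I = runit I"
proof -
  have "lunit I \<bullet> (\<ii> I \<otimes>\<^sub>a lunit I) = lunit I \<bullet> lunit (I \<otimes>\<^sub>o I)"
    using unit_natural(1)[of "lunit I"] by simp
  then have "\<ii> I \<otimes>\<^sub>a lunit I = lunit (I \<otimes>\<^sub>o I)" by (rule iso_cancel_left) auto
  then have "lunit I \<otimes>\<^sub>a \<ii> I = runit I \<otimes>\<^sub>a \<ii> I"
    using triangle[of I I] lunit_tensor[of I I] by simp
  then show ?thesis by (rule tensor_unit_faithful(2)[rotated 4]) auto
qed

end

section \<open>Symmetry and the exchange of two neighbouring summands\<close>

context symmetric_monoidal_category begin

lemma sym_simps [simp]: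
  assumes "x \<in> Obj C" "y \<in> Obj C"
  shows "sym (x, y) \<in> Arr C" "iso (sym (x, y))"
    "Dom C (sym (x, y)) = x \<otimes>\<^sub>o y" "Cod C (sym (x, y)) = y \<otimes>\<^sub>o x"
  using natural_isoD(3-6)[OF sym_iso, of "(x, y)"] assms by (simp_all add: tob_def)

lemma sym_natural:
  assumes "f \<in> Arr C" "g \<in> Arr C"
  shows "sym (Cod C f, Cod C g) \<bullet> (f \<otimes>\<^sub>a g) = (g \<otimes>\<^sub>a f) \<bullet> sym (Dom C f, Dom C g)"
  using natural_isoD(7)[OF sym_iso, of "(f, g)"] assms by (simp add: tar_def)

text \<open>Tensor with \<open>I\<close> on the right: the hexagon at \<open>x, I, I\<close>
  together with \<open>lunit_tensor\<close> and the naturality of the unit and the symmetry yields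
  the equation up to the isomorphism \<open>sym (x, I)\<close>.\<close>

lemma lunit_sym:
  assumes [simp]: "x \<in> Obj C"
  shows "lunit x \<bullet> sym (x, I) = runit x"
proof -
  have "sym (x, I) \<bullet> (runit x \<otimes>\<^sub>a \<ii> I) = (sym (x, I) \<bullet> (\<ii> x \<otimes>\<^sub>a lunit I)) \<bullet> assoc (x, I, I)"
    by (simp add: cmp_assoc triangle)
  also have "\<dots> = (lunit I \<otimes>\<^sub>a \<ii> x) \<bullet> sym (x, I \<otimes>\<^sub>o I) \<bullet> assoc (x, I, I)"
    using sym_natural[of "\<ii> x" "lunit I"] by (simp add: cmp_assoc)
  also have "\<dots> = lunit (I \<otimes>\<^sub>o x) \<bullet> assoc (I, I, x) \<bullet> sym (x, I \<otimes>\<^sub>o I) \<bullet> assoc (x, I, I)"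
    by (simp add: lunit_tensor[symmetric] cmp_assoc)
  also have "\<dots> = (lunit (I \<otimes>\<^sub>o x) \<bullet> (\<ii> I \<otimes>\<^sub>a sym (x, I))) \<bullet> assoc (I, x, I) \<bullet> (sym (x, I) \<otimes>\<^sub>a \<ii> I)"
    by (simp add: hexagon cmp_assoc)
  also have "\<dots> = sym (x, I) \<bullet> (lunit (x \<otimes>\<^sub>o I) \<bullet> assoc (I, x, I)) \<bullet> (sym (x, I) \<otimes>\<^sub>a \<ii> I)"
    using unit_natural(1)[of "sym (x, I)"] by (simp add: cmp_assoc)
  also have "\<dots> = sym (x, I) \<bullet> ((lunit x \<bullet> sym (x, I)) \<otimes>\<^sub>a \<ii> I)"
    by (simp add: lunit_tensor interchange_left)
  finally have "runit x \<otimes>\<^sub>a \<ii> I = (lunit x \<bullet> sym (x, I)) \<otimes>\<^sub>a \<ii> I"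
    by (rule iso_cancel_left) auto
  then show ?thesis by (rule tensor_unit_faithful(2)[rotated 4, symmetric]) auto
qed


text \<open>The elementary move for sums bracketed to the right: it takes
  \<open>p \<otimes>\<^sub>o a \<otimes>\<^sub>o q\<close> to
  \<open>a \<otimes>\<^sub>o p \<otimes>\<^sub>o q\<close>, pulling the head \<open>a\<close> of the
  second sum in front of the first sum \<open>p\<close>. The lemmas about it restate pentagon and
  hexagon for this move.\<close>

definition exch :: "'o \<Rightarrow> 'o \<Rightarrow> 'o \<Rightarrow> 'a" where
  "exch p a q = assoc (a, p, q) \<bullet> (sym (p, a) \<otimes>\<^sub>a \<ii> q) \<bullet> inv_arr (assoc (p, a, q))"

lemma exch_simps [simp]:
  assumes "p \<in> Obj C" "a \<in> Obj C" "q \<in> Obj C"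
  shows "exch p a q \<in> Arr C" "iso (exch p a q)"
    "Dom C (exch p a q) = p \<otimes>\<^sub>o a \<otimes>\<^sub>o q" "Cod C (exch p a q) = a \<otimes>\<^sub>o p \<otimes>\<^sub>o q"
  using assms by (simp_all add: exch_def)

lemma exch_assoc:
  assumes [simp]: "p \<in> Obj C" "a \<in> Obj C" "q \<in> Obj C"
  shows "exch p a q \<bullet> assoc (p, a, q) = assoc (a, p, q) \<bullet> (sym (p, a) \<otimes>\<^sub>a \<ii> q)"
  by (simp add: exch_def cmp_assoc)

lemma exch_natural:
  assumes [simp]: "f \<in> Arr C" "g \<in> Arr C" "h \<in> Arr C"
  shows "exch (Cod C f) (Cod C g) (Cod C h) \<bullet> (f \<otimes>\<^sub>a g \<otimes>\<^sub>a h) =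
    (g \<otimes>\<^sub>a f \<otimes>\<^sub>a h) \<bullet> exch (Dom C f) (Dom C g) (Dom C h)" (is "?l = ?r")
proof -
  let ?x = "Dom C f" and ?y = "Dom C g" and ?z = "Dom C h"
  have "?l \<bullet> assoc (?x, ?y, ?z) =
      (exch (Cod C f) (Cod C g) (Cod C h) \<bullet> assoc (Cod C f, Cod C g, Cod C h)) \<bullet> ((f \<otimes>\<^sub>a g) \<otimes>\<^sub>a h)"
    by (simp add: assoc_natural cmp_assoc)
  also have "\<dots> = assoc (Cod C g, Cod C f, Cod C h) \<bullet> ((sym (Cod C f, Cod C g) \<bullet> (f \<otimes>\<^sub>a g)) \<otimes>\<^sub>a h)"
    by (simp add: exch_assoc cmp_assoc interchange)
  also have "\<dots> = (assoc (Cod C g, Cod C f, Cod C h) \<bullet> ((g \<otimes>\<^sub>a f) \<otimes>\<^sub>a h)) \<bullet> (sym (?x, ?y) \<otimes>\<^sub>a \<ii> ?z)"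
    by (simp add: sym_natural cmp_assoc interchange)
  also have "\<dots> = ?r \<bullet> assoc (?x, ?y, ?z)"
    by (simp add: exch_assoc cmp_assoc assoc_natural)
  finally show ?thesis by (rule iso_cancel_right) auto
qed

text \<open>The hexagon, with the associativity on the right absorbed into \<open>exch\<close>. This
  and its mirror \<open>exch_sym_right\<close> are the two inductive steps for commutativity of
  shuffles.\<close>

lemma exch_sym_left:
  assumes [simp]: "a \<in> Obj C" "p \<in> Obj C" "q \<in> Obj C"
  shows "assoc (a, q, p) \<bullet> sym (p, a \<otimes>\<^sub>o q) = (\<ii> a \<otimes>\<^sub>a sym (p, q)) \<bullet> exch p a q"
proof -
  have "(assoc (a, q, p) \<bullet> sym (p, a \<otimes>\<^sub>o q)) \<bullet> assoc (p, a, q) =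
      ((\<ii> a \<otimes>\<^sub>a sym (p, q)) \<bullet> exch p a q) \<bullet> assoc (p, a, q)"
    by (simp add: cmp_assoc hexagon exch_assoc)
  then show ?thesis by (rule iso_cancel_right) auto
qed

text \<open>The inverse of \<open>exch_sym_left\<close>: inserting \<open>sym\<close> followed by
  its inverse turns one into the other.\<close>

lemma exch_sym_right:
  assumes [simp]: "a \<in> Obj C" "p \<in> Obj C" "q \<in> Obj C"
  shows "exch q a p \<bullet> sym (a \<otimes>\<^sub>o p, q) = (\<ii> a \<otimes>\<^sub>a sym (p, q)) \<bullet> assoc (a, p, q)"
proof -
  have "(\<ii> a \<otimes>\<^sub>a sym (p, q)) \<bullet> assoc (a, p, q) =
      (\<ii> a \<otimes>\<^sub>a sym (p, q)) \<bullet> assoc (a, p, q) \<bullet> sym (q, a \<otimes>\<^sub>o p) \<bullet> sym (a \<otimes>\<^sub>o p, q)"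
    by (simp add: sym_sym)
  also have "\<dots> = (\<ii> a \<otimes>\<^sub>a sym (p, q)) \<bullet> (\<ii> a \<otimes>\<^sub>a sym (q, p)) \<bullet> exch q a p \<bullet> sym (a \<otimes>\<^sub>o p, q)"
    by (simp add: cmp_reduce[OF exch_sym_left] cmp_assoc)
  also have "\<dots> = ((\<ii> a \<otimes>\<^sub>a sym (p, q)) \<bullet> (\<ii> a \<otimes>\<^sub>a sym (q, p))) \<bullet> exch q a p \<bullet> sym (a \<otimes>\<^sub>o p, q)"
    by (simp add: cmp_assoc)
  also have "\<dots> = exch q a p \<bullet> sym (a \<otimes>\<^sub>o p, q)"
    by (simp add: interchange sym_sym)
  finally show ?thesis by simp
qed

text \<open>Two pentagons joined by the naturality of associativity at \<open>sym (p, a)\<close>. It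
  is the step of shuffle associativity in which the head belongs to the second of three
  sums.\<close>

lemma exch_assoc_middle:
  assumes [simp]: "a \<in> Obj C" "p \<in> Obj C" "q \<in> Obj C" "r \<in> Obj C"
  shows "(\<ii> a \<otimes>\<^sub>a assoc (p, q, r)) \<bullet> assoc (a, p \<otimes>\<^sub>o q, r) \<bullet> (exch p a q \<otimes>\<^sub>a \<ii> r) =
    exch p a (q \<otimes>\<^sub>o r) \<bullet> (\<ii> p \<otimes>\<^sub>a assoc (a, q, r)) \<bullet> assoc (p, a \<otimes>\<^sub>o q, r)" (is "?l = ?r")
proof -
  have "?l \<bullet> (assoc (p, a, q) \<otimes>\<^sub>a \<ii> r) =
      (\<ii> a \<otimes>\<^sub>a assoc (p, q, r)) \<bullet> assoc (a, p \<otimes>\<^sub>o q, r) \<bullet> ((exch p a q \<bullet> assoc (p, a, q)) \<otimes>\<^sub>a \<ii> r)"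
    by (simp add: cmp_assoc interchange_left)
  also have "\<dots> = ((\<ii> a \<otimes>\<^sub>a assoc (p, q, r)) \<bullet> assoc (a, p \<otimes>\<^sub>o q, r) \<bullet> (assoc (a, p, q) \<otimes>\<^sub>a \<ii> r))
      \<bullet> ((sym (p, a) \<otimes>\<^sub>a \<ii> q) \<otimes>\<^sub>a \<ii> r)"
    by (simp add: exch_assoc interchange_left cmp_assoc)
  also have "\<dots> = assoc (a, p, q \<otimes>\<^sub>o r) \<bullet> (assoc (a \<otimes>\<^sub>o p, q, r) \<bullet> ((sym (p, a) \<otimes>\<^sub>a \<ii> q) \<otimes>\<^sub>a \<ii> r))"
    by (simp add: pentagon[symmetric] cmp_assoc)
  also have "\<dots> = (assoc (a, p, q \<otimes>\<^sub>o r) \<bullet> (sym (p, a) \<otimes>\<^sub>a \<ii> (q \<otimes>\<^sub>o r))) \<bullet> assoc (p \<otimes>\<^sub>o a, q, r)"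
    using assoc_natural[of "sym (p, a)" "\<ii> q" "\<ii> r"] by (simp add: cmp_assoc)
  also have "\<dots> = exch p a (q \<otimes>\<^sub>o r) \<bullet> assoc (p, a, q \<otimes>\<^sub>o r) \<bullet> assoc (p \<otimes>\<^sub>o a, q, r)"
    by (simp add: exch_assoc[symmetric] cmp_assoc)
  also have "\<dots> = ?r \<bullet> (assoc (p, a, q) \<otimes>\<^sub>a \<ii> r)"
    by (simp add: pentagon cmp_assoc)
  finally show ?thesis by (rule iso_cancel_right) auto
qed

text \<open>The second hexagon, for a composite first argument; it follows from the first because
  the symmetries are mutually inverse.\<close>

lemma sym_tensor_left:
  assumes [simp]: "a \<in> Obj C" "p \<in> Obj C" "q \<in> Obj C"
  shows "exch p a q \<bullet> (\<ii> p \<otimes>\<^sub>a sym (q, a)) \<bullet> assoc (p, q, a) = sym (p \<otimes>\<^sub>o q, a)" (is "?l = ?r")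
proof -
  have "(?l \<bullet> sym (a, p \<otimes>\<^sub>o q)) \<bullet> assoc (a, p, q) =
      exch p a q \<bullet> (\<ii> p \<otimes>\<^sub>a sym (q, a)) \<bullet> assoc (p, q, a) \<bullet> sym (a, p \<otimes>\<^sub>o q) \<bullet> assoc (a, p, q)"
    by (simp add: cmp_assoc)
  also have "\<dots> = exch p a q \<bullet> ((\<ii> p \<otimes>\<^sub>a sym (q, a)) \<bullet> (\<ii> p \<otimes>\<^sub>a sym (a, q))) \<bullet> assoc (p, a, q) \<bullet> (sym (a, p) \<otimes>\<^sub>a \<ii> q)"
    by (simp add: hexagon cmp_assoc)
  also have "\<dots> = (exch p a q \<bullet> assoc (p, a, q)) \<bullet> (sym (a, p) \<otimes>\<^sub>a \<ii> q)"
    by (simp add: interchange sym_sym cmp_assoc)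
  also have "\<dots> = assoc (a, p, q) \<bullet> ((sym (p, a) \<otimes>\<^sub>a \<ii> q) \<bullet> (sym (a, p) \<otimes>\<^sub>a \<ii> q))"
    by (simp add: exch_assoc cmp_assoc)
  also have "\<dots> = \<ii> (a \<otimes>\<^sub>o p \<otimes>\<^sub>o q) \<bullet> assoc (a, p, q)"
    by (simp add: interchange sym_sym)
  finally have "?l \<bullet> sym (a, p \<otimes>\<^sub>o q) = \<ii> (a \<otimes>\<^sub>o p \<otimes>\<^sub>o q)" by (rule iso_cancel_right) auto
  then have "?l \<bullet> sym (a, p \<otimes>\<^sub>o q) = ?r \<bullet> sym (a, p \<otimes>\<^sub>o q)" by (simp add: sym_sym)
  then show ?thesis by (rule iso_cancel_right) auto
qed

text \<open>Passing \<open>p \<otimes>\<^sub>o q\<close> at once agrees with passing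
  \<open>q\<close> and then \<open>p\<close>, by the second hexagon and
  \<open>exch_assoc_middle\<close>. It is the step of shuffle associativity in which the head
  belongs to the third sum.\<close>

lemma exch_assoc_right:
  assumes [simp]: "a \<in> Obj C" "p \<in> Obj C" "q \<in> Obj C" "r \<in> Obj C"
  shows "(\<ii> a \<otimes>\<^sub>a assoc (p, q, r)) \<bullet> exch (p \<otimes>\<^sub>o q) a r =
    exch p a (q \<otimes>\<^sub>o r) \<bullet> (\<ii> p \<otimes>\<^sub>a exch q a r) \<bullet> assoc (p, q, a \<otimes>\<^sub>o r)" (is "?l = ?r")
proof -
  have "?r \<bullet> assoc (p \<otimes>\<^sub>o q, a, r) =
      exch p a (q \<otimes>\<^sub>o r) \<bullet> (\<ii> p \<otimes>\<^sub>a exch q a r) \<bullet> (assoc (p, q, a \<otimes>\<^sub>o r) \<bullet> assoc (p \<otimes>\<^sub>o q, a, r))"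
    by (simp add: cmp_assoc)
  also have "\<dots> = exch p a (q \<otimes>\<^sub>o r) \<bullet> (\<ii> p \<otimes>\<^sub>a (exch q a r \<bullet> assoc (q, a, r))) \<bullet>
      assoc (p, q \<otimes>\<^sub>o a, r) \<bullet> (assoc (p, q, a) \<otimes>\<^sub>a \<ii> r)"
    by (simp add: pentagon interchange_right cmp_assoc)
  also have "\<dots> = exch p a (q \<otimes>\<^sub>o r) \<bullet> (\<ii> p \<otimes>\<^sub>a assoc (a, q, r)) \<bullet>
      ((\<ii> p \<otimes>\<^sub>a (sym (q, a) \<otimes>\<^sub>a \<ii> r)) \<bullet> assoc (p, q \<otimes>\<^sub>o a, r)) \<bullet> (assoc (p, q, a) \<otimes>\<^sub>a \<ii> r)"
    by (simp add: exch_assoc interchange_right cmp_assoc)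
  also have "\<dots> = (exch p a (q \<otimes>\<^sub>o r) \<bullet> (\<ii> p \<otimes>\<^sub>a assoc (a, q, r)) \<bullet> assoc (p, a \<otimes>\<^sub>o q, r)) \<bullet>
      ((\<ii> p \<otimes>\<^sub>a sym (q, a)) \<otimes>\<^sub>a \<ii> r) \<bullet> (assoc (p, q, a) \<otimes>\<^sub>a \<ii> r)"
    using assoc_natural[of "\<ii> p" "sym (q, a)" "\<ii> r", symmetric] by (simp add: cmp_assoc)
  also have "\<dots> = (\<ii> a \<otimes>\<^sub>a assoc (p, q, r)) \<bullet> assoc (a, p \<otimes>\<^sub>o q, r) \<bullet>
      ((exch p a q \<bullet> (\<ii> p \<otimes>\<^sub>a sym (q, a)) \<bullet> assoc (p, q, a)) \<otimes>\<^sub>a \<ii> r)"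
    by (simp add: exch_assoc_middle[symmetric] interchange_left cmp_assoc)
  also have "\<dots> = ?l \<bullet> assoc (p \<otimes>\<^sub>o q, a, r)"
    by (simp add: sym_tensor_left exch_assoc cmp_assoc)
  finally show ?thesis by (rule iso_cancel_right[symmetric]) auto
qed

lemma exch_lunit:
  assumes [simp]: "a \<in> Obj C" "p \<in> Obj C"
  shows "(\<ii> a \<otimes>\<^sub>a lunit p) \<bullet> exch I a p = lunit (a \<otimes>\<^sub>o p)" (is "?l = ?r")
proof -
  have "?l \<bullet> assoc (I, a, p) = ((\<ii> a \<otimes>\<^sub>a lunit p) \<bullet> assoc (a, I, p)) \<bullet> (sym (I, a) \<otimes>\<^sub>a \<ii> p)"
    by (simp add: exch_assoc cmp_assoc)
  also have "\<dots> = (lunit a \<bullet> (sym (a, I) \<bullet> sym (I, a))) \<otimes>\<^sub>a \<ii> p"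
    by (simp add: triangle interchange lunit_sym[symmetric] cmp_assoc)
  also have "\<dots> = ?r \<bullet> assoc (I, a, p)"
    by (simp add: sym_sym lunit_tensor)
  finally show ?thesis by (rule iso_cancel_right) auto
qed

end

section \<open>Sums indexed by sets of words\<close>

lemma sorted_wrt_set_unique:
  assumes "set xs = set ys" "sorted_wrt R xs" "sorted_wrt R ys" and asym: "\<And>a b. R a b \<Longrightarrow> \<not> R b a"
  shows "xs = ys"
  using assms(1-3)
proof (induction xs arbitrary: ys)
  case (Cons a xs)
  then obtain b ys' where ys: "ys = b # ys'" by (cases ys) auto
  have "a = b"
  proof (rule ccontr)
    assume "a \<noteq> b"
    then have "b \<in> set xs" "a \<in> set ys'" using Cons.prems(1) ys by auto
    then show False using Cons.prems asym ys by auto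
  qed
  moreover have "a \<notin> set xs" "b \<notin> set ys'" using Cons.prems(2,3) asym ys by auto
  then have "set xs = set ys'" using Cons.prems(1) ys \<open>a = b\<close> by auto
  ultimately show ?case using Cons ys by auto
qed simp

text \<open>The type of letters is arbitrary, so some strict total order is chosen, obtained from a
  well-order by removing the diagonal. It only fixes a convention for listing sets of words.\<close>

definition atom_less :: "'v rel" where
  "atom_less = (SOME r. trans r \<and> irrefl r \<and> total r)"

lemma atom_less:
  "trans (atom_less :: 'v rel)" "irrefl (atom_less :: 'v rel)" "total (atom_less :: 'v rel)"
proof -
  obtain r :: "'v rel" where "well_order_on UNIV r"
    using well_order_on by blast
  then have "linear_order_on UNIV r" by (simp add: well_order_on_def)
  then have "trans (r - Id) \<and> irrefl (r - Id) \<and> total (r - Id)"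
    by (auto simp: order_on_defs irrefl_def total_on_def trans_diff_Id)
  then have "trans (atom_less :: 'v rel) \<and> irrefl (atom_less :: 'v rel) \<and> total (atom_less :: 'v rel)"
    unfolding atom_less_def by (rule someI)
  then show "trans (atom_less :: 'v rel)" "irrefl (atom_less :: 'v rel)" "total (atom_less :: 'v rel)"
    by auto
qed

text \<open>Monomials are words.  The lexicographic order makes the enumeration of a set of words
  commute with prefixing a letter, so that distributing a letter over a sum needs no reordering.\<close>

definition word_less :: "'v list \<Rightarrow> 'v list \<Rightarrow> bool" where
  "word_less x y \<longleftrightarrow> (x, y) \<in> lexord atom_less"

lemma word_less:
  fixes x y z :: "'v list"
  shows "\<not> word_less x x" "word_less x y \<Longrightarrow> \<not> word_less y x"
  "word_less x y \<Longrightarrow> word_less y z \<Longrightarrow> word_less x z"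
  "x \<noteq> y \<Longrightarrow> word_less x y \<or> word_less y x"
  "word_less (a # x) (a # y) \<longleftrightarrow> word_less x y"
proof -
  have irr: "\<not> word_less x x" for x :: "'v list"
    using atom_less(2) lexord_irreflexive[of atom_less x] by (auto simp: word_less_def irrefl_def)
  have tr: "word_less x y \<Longrightarrow> word_less y z \<Longrightarrow> word_less x z" for x y z :: "'v list"
    unfolding word_less_def by (rule lexord_trans[OF _ _ atom_less(1)])
  show "\<not> word_less x x" "word_less x y \<Longrightarrow> word_less y z \<Longrightarrow> word_less x z"
    "word_less x y \<Longrightarrow> \<not> word_less y x"
    using irr tr by blast+
  show "x \<noteq> y \<Longrightarrow> word_less x y \<or> word_less y x"
  proof -
    have "\<forall>a b :: 'v. (a, b) \<in> atom_less \<or> a = b \<or> (b, a) \<in> atom_less"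
      using atom_less(3) by (auto simp: total_on_def)
    from lexord_linear[OF this, of x y] show "x \<noteq> y \<Longrightarrow> word_less x y \<or> word_less y x"
      unfolding word_less_def by argo
  qed
  show "word_less (a # x) (a # y) \<longleftrightarrow> word_less x y"
    using atom_less(2) by (auto simp: word_less_def irrefl_def)
qed

definition enum :: "'v list set \<Rightarrow> 'v list list" where
  "enum A = (THE xs. set xs = A \<and> sorted_wrt word_less xs)"

lemma enum_set:
  assumes "sorted_wrt word_less xs"
  shows "enum (set xs) = xs"
  unfolding enum_def
  by (rule the_equality) (use assms in \<open>auto intro: sorted_wrt_set_unique simp: word_less(2)\<close>)

lemma enum:
  assumes "finite A"
  shows "set (enum A) = A" "sorted_wrt word_less (enum A)"
proof -
  \<comment> \<open>The reversed order: its decreasing list of elements is the increasing one for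
    \<open>word_less\<close>, so existence comes from \<open>elts_desc\<close>.\<close>
  let ?r = "{(y, x). x \<in> A \<and> y \<in> A \<and> (x = y \<or> word_less x y)}"
  have "linear_order_on A ?r"
    by (auto simp: order_on_defs refl_on_def trans_def antisym_def total_on_def word_less(2)
        dest: word_less(3) word_less(4))
  then have A: "(A, ?r) \<in> Obj lin_cat" using assms by (auto simp: lin_cat_def)
  have "sorted_wrt word_less (elts_desc (A, ?r))"
    by (rule sorted_wrt_mono_rel[OF _ elts_desc(2)[OF A]]) auto
  from enum_set[OF this] this show "set (enum A) = A" "sorted_wrt word_less (enum A)"
    using elts_desc(1)[OF A] by auto
qed

lemma filter_enum:
  assumes "finite A" "B \<subseteq> A"
  shows "filter (\<lambda>m. m \<in> B) (enum A) = enum B"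
proof -
  have "set (filter (\<lambda>m. m \<in> B) (enum A)) = B" using enum(1)[OF assms(1)] assms(2) by auto
  then show ?thesis
    using enum_set[OF sorted_wrt_filter[OF enum(2)[OF assms(1)], of "\<lambda>m. m \<in> B"]] by simp
qed

lemma enum_empty [simp]: "enum {} = []"
  using enum_set[of "[]"] by simp

lemma enum_single [simp]: "enum {m} = [m]"
  using enum_set[of "[m]"] by simp

lemma enum_Cons: "finite A \<Longrightarrow> enum (Cons a ` A) = map (Cons a) (enum A)"
  using enum_set[of "map (Cons a) (enum A)"] enum[of A] by (simp add: sorted_wrt_map word_less(5))

section \<open>Shuffles of sums over disjoint sets\<close>

context symmetric_monoidal_category begin

primrec lsum :: "('m \<Rightarrow> 'o) \<Rightarrow> 'm list \<Rightarrow> 'o" where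
  "lsum X [] = I"
| "lsum X (m # ms) = X m \<otimes>\<^sub>o lsum X ms"

text \<open>All sets involved are read off one common list \<Omega>, so that identities between
  shuffles of several sets can be proved by a single induction on \<Omega>.\<close>

abbreviation fsum :: "('m \<Rightarrow> 'o) \<Rightarrow> 'm list \<Rightarrow> 'm set \<Rightarrow> 'o" where
  "fsum X \<Omega> A \<equiv> lsum X (filter (\<lambda>m. m \<in> A) \<Omega>)"

text \<open>The shuffle of the sums over two disjoint sets into the sum over their union.\<close>

primrec merge :: "('m \<Rightarrow> 'o) \<Rightarrow> 'm list \<Rightarrow> 'm set \<Rightarrow> 'm set \<Rightarrow> 'a" where
  "merge X [] A B = lunit I"
| "merge X (m # \<Omega>) A B =
    (if m \<in> A then (\<ii> (X m) \<otimes>\<^sub>a merge X \<Omega> A B) \<bullet> assoc (X m, fsum X \<Omega> A, fsum X \<Omega> B)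
     else if m \<in> B then (\<ii> (X m) \<otimes>\<^sub>a merge X \<Omega> A B) \<bullet> exch (fsum X \<Omega> A) (X m) (fsum X \<Omega> B)
     else merge X \<Omega> A B)"

lemma lsum_Obj [simp]: "(\<And>m. X m \<in> Obj C) \<Longrightarrow> lsum X ms \<in> Obj C"
  by (induction ms) auto

lemma merge_simps [simp]:
  assumes "\<And>m. X m \<in> Obj C" "A \<inter> B = {}"
  shows "merge X \<Omega> A B \<in> Arr C" "iso (merge X \<Omega> A B)"
    "Dom C (merge X \<Omega> A B) = fsum X \<Omega> A \<otimes>\<^sub>o fsum X \<Omega> B"
    "Cod C (merge X \<Omega> A B) = fsum X \<Omega> (A \<union> B)"
proof -
  have "iso (merge X \<Omega> A B) \<and> Dom C (merge X \<Omega> A B) = fsum X \<Omega> A \<otimes>\<^sub>o fsum X \<Omega> B \<and>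
      Cod C (merge X \<Omega> A B) = fsum X \<Omega> (A \<union> B)"
    using assms by (induction \<Omega>) auto
  then show "merge X \<Omega> A B \<in> Arr C" "iso (merge X \<Omega> A B)"
    "Dom C (merge X \<Omega> A B) = fsum X \<Omega> A \<otimes>\<^sub>o fsum X \<Omega> B"
    "Cod C (merge X \<Omega> A B) = fsum X \<Omega> (A \<union> B)" by auto
qed

text \<open>Elements of \<Omega> outside \<open>A \<union> B\<close> are skipped by the recursion.
  This makes shuffles computed inside different ambient lists comparable.\<close>

lemma merge_filter:
  "A \<union> B \<subseteq> D \<Longrightarrow> merge X (filter (\<lambda>m. m \<in> D) \<Omega>) A B = merge X \<Omega> A B"
proof (induction \<Omega>)
  case (Cons m \<Omega>)
  have "filter (\<lambda>m. m \<in> A) (filter (\<lambda>m. m \<in> D) \<Omega>) = filter (\<lambda>m. m \<in> A) \<Omega>"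
    "filter (\<lambda>m. m \<in> B) (filter (\<lambda>m. m \<in> D) \<Omega>) = filter (\<lambda>m. m \<in> B) \<Omega>"
    using Cons.prems by (auto intro!: filter_cong)
  then show ?case using Cons by auto
qed simp

text \<open>Induction on \<Omega>; a head from \<open>A\<close> needs \<open>exch_sym_right\<close>
  and a head from \<open>B\<close> needs \<open>exch_sym_left\<close>. The empty list is the
  equality of the two unit isomorphisms at \<open>I\<close>.\<close>

lemma merge_comm:
  assumes X [simp]: "\<And>m. X m \<in> Obj C" and "A \<inter> B = {}"
  shows "merge X \<Omega> B A \<bullet> sym (fsum X \<Omega> A, fsum X \<Omega> B) = merge X \<Omega> A B"
proof (induction \<Omega>)
  case Nil
  then show ?case by (simp add: lunit_sym) (simp add: lunit_eq_runit)
next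
  case (Cons m \<Omega>)
  let ?x = "X m" and ?p = "fsum X \<Omega> A" and ?q = "fsum X \<Omega> B"
  have [simp]: "A \<inter> B = {}" "B \<inter> A = {}" using assms by auto
  consider "m \<in> A" "m \<notin> B" | "m \<notin> A" "m \<in> B" | "m \<notin> A" "m \<notin> B" using assms by blast
  then show ?case
  proof cases
    case 1
    then have "merge X (m # \<Omega>) B A \<bullet> sym (fsum X (m # \<Omega>) A, fsum X (m # \<Omega>) B) =
        (\<ii> ?x \<otimes>\<^sub>a merge X \<Omega> B A) \<bullet> (exch ?q ?x ?p \<bullet> sym (?x \<otimes>\<^sub>o ?p, ?q))"
      by (simp add: cmp_assoc)
    also have "\<dots> = (\<ii> ?x \<otimes>\<^sub>a (merge X \<Omega> B A \<bullet> sym (?p, ?q))) \<bullet> assoc (?x, ?p, ?q)"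
      by (simp add: exch_sym_right interchange_right cmp_assoc)
    finally show ?thesis using 1 Cons by simp
  next
    case 2
    then have "merge X (m # \<Omega>) B A \<bullet> sym (fsum X (m # \<Omega>) A, fsum X (m # \<Omega>) B) =
        (\<ii> ?x \<otimes>\<^sub>a merge X \<Omega> B A) \<bullet> (assoc (?x, ?q, ?p) \<bullet> sym (?p, ?x \<otimes>\<^sub>o ?q))"
      by (simp add: cmp_assoc)
    also have "\<dots> = (\<ii> ?x \<otimes>\<^sub>a (merge X \<Omega> B A \<bullet> sym (?p, ?q))) \<bullet> exch ?p ?x ?q"
      by (simp add: exch_sym_left interchange_right cmp_assoc)
    finally show ?thesis using 2 Cons by simp
  next
    case 3
    then show ?thesis using Cons by simp
  qed
qed

text \<open>Induction on \<Omega>; according to whether the head lies in \<open>A\<close>,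
  \<open>B\<close> or \<open>D\<close>, the step is the pentagon, \<open>exch_assoc_middle\<close>
  or \<open>exch_assoc_right\<close>.\<close>

lemma merge_assoc:
  assumes X [simp]: "\<And>m. X m \<in> Obj C" and dj [simp]: "A \<inter> B = {}" "A \<inter> D = {}" "B \<inter> D = {}"
  shows "merge X \<Omega> (A \<union> B) D \<bullet> (merge X \<Omega> A B \<otimes>\<^sub>a \<ii> (fsum X \<Omega> D)) =
    merge X \<Omega> A (B \<union> D) \<bullet> (\<ii> (fsum X \<Omega> A) \<otimes>\<^sub>a merge X \<Omega> B D) \<bullet>
      assoc (fsum X \<Omega> A, fsum X \<Omega> B, fsum X \<Omega> D)"
proof (induction \<Omega>)
  case Nil
  then show ?case by (simp add: triangle) (simp add: lunit_eq_runit)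
next
  case (Cons m \<Omega>)
  let ?x = "X m" and ?a = "fsum X \<Omega> A" and ?b = "fsum X \<Omega> B" and ?d = "fsum X \<Omega> D"
  let ?ab = "fsum X \<Omega> (A \<union> B)" and ?bd = "fsum X \<Omega> (B \<union> D)"
  let ?AB = "merge X \<Omega> A B" and ?BD = "merge X \<Omega> B D"
    and ?l = "merge X \<Omega> (A \<union> B) D" and ?r = "merge X \<Omega> A (B \<union> D)"
  have dj' [simp]: "(A \<union> B) \<inter> D = {}" "A \<inter> (B \<union> D) = {}" using dj by blast+
  note IH = Cons.IH
  have key: "(\<ii> ?x \<otimes>\<^sub>a ?l) \<bullet> (\<ii> ?x \<otimes>\<^sub>a (?AB \<otimes>\<^sub>a \<ii> ?d)) =
      (\<ii> ?x \<otimes>\<^sub>a ?r) \<bullet> (\<ii> ?x \<otimes>\<^sub>a (\<ii> ?a \<otimes>\<^sub>a ?BD)) \<bullet> (\<ii> ?x \<otimes>\<^sub>a assoc (?a, ?b, ?d))"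
    using arg_cong[OF IH, of "\<lambda>f. \<ii> ?x \<otimes>\<^sub>a f"] by (simp add: interchange_right)
  consider "m \<in> A" "m \<notin> B" "m \<notin> D" | "m \<notin> A" "m \<in> B" "m \<notin> D" | "m \<notin> A" "m \<notin> B" "m \<in> D"
    | "m \<notin> A" "m \<notin> B" "m \<notin> D" using dj by blast
  then show ?case
  proof cases
    case 1
    have "merge X (m # \<Omega>) (A \<union> B) D \<bullet> (merge X (m # \<Omega>) A B \<otimes>\<^sub>a \<ii> (fsum X (m # \<Omega>) D)) =
      (\<ii> ?x \<otimes>\<^sub>a ?l) \<bullet> (assoc (?x, ?ab, ?d) \<bullet> ((\<ii> ?x \<otimes>\<^sub>a ?AB) \<otimes>\<^sub>a \<ii> ?d)) \<bullet> (assoc (?x, ?a, ?b) \<otimes>\<^sub>a \<ii> ?d)"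
      using 1 by (simp add: interchange_left cmp_assoc)
    also have "\<dots> = ((\<ii> ?x \<otimes>\<^sub>a ?l) \<bullet> (\<ii> ?x \<otimes>\<^sub>a (?AB \<otimes>\<^sub>a \<ii> ?d))) \<bullet> assoc (?x, ?a \<otimes>\<^sub>o ?b, ?d) \<bullet> (assoc (?x, ?a, ?b) \<otimes>\<^sub>a \<ii> ?d)"
      using assoc_natural[of "\<ii> ?x" ?AB "\<ii> ?d"] by (simp add: cmp_assoc)
    also have "\<dots> = (\<ii> ?x \<otimes>\<^sub>a ?r) \<bullet> ((\<ii> ?x \<otimes>\<^sub>a (\<ii> ?a \<otimes>\<^sub>a ?BD)) \<bullet> assoc (?x, ?a, ?b \<otimes>\<^sub>o ?d)) \<bullet> assoc (?x \<otimes>\<^sub>o ?a, ?b, ?d)"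
      unfolding key by (simp add: cmp_assoc pentagon)
    also have "\<dots> = merge X (m # \<Omega>) A (B \<union> D) \<bullet> (\<ii> (fsum X (m # \<Omega>) A) \<otimes>\<^sub>a merge X (m # \<Omega>) B D) \<bullet>
      assoc (fsum X (m # \<Omega>) A, fsum X (m # \<Omega>) B, fsum X (m # \<Omega>) D)"
      using 1 assoc_natural[of "\<ii> ?x" "\<ii> ?a" ?BD, symmetric] by (simp add: cmp_assoc)
    finally show ?thesis .
  next
    case 2
    have "merge X (m # \<Omega>) (A \<union> B) D \<bullet> (merge X (m # \<Omega>) A B \<otimes>\<^sub>a \<ii> (fsum X (m # \<Omega>) D)) =
      (\<ii> ?x \<otimes>\<^sub>a ?l) \<bullet> (assoc (?x, ?ab, ?d) \<bullet> ((\<ii> ?x \<otimes>\<^sub>a ?AB) \<otimes>\<^sub>a \<ii> ?d)) \<bullet> (exch ?a ?x ?b \<otimes>\<^sub>a \<ii> ?d)"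
      using 2 by (simp add: interchange_left cmp_assoc)
    also have "\<dots> = ((\<ii> ?x \<otimes>\<^sub>a ?l) \<bullet> (\<ii> ?x \<otimes>\<^sub>a (?AB \<otimes>\<^sub>a \<ii> ?d))) \<bullet> assoc (?x, ?a \<otimes>\<^sub>o ?b, ?d) \<bullet> (exch ?a ?x ?b \<otimes>\<^sub>a \<ii> ?d)"
      using assoc_natural[of "\<ii> ?x" ?AB "\<ii> ?d"] by (simp add: cmp_assoc)
    also have "\<dots> = (\<ii> ?x \<otimes>\<^sub>a ?r) \<bullet> ((\<ii> ?x \<otimes>\<^sub>a (\<ii> ?a \<otimes>\<^sub>a ?BD)) \<bullet> exch ?a ?x (?b \<otimes>\<^sub>o ?d)) \<bullet>
        (\<ii> ?a \<otimes>\<^sub>a assoc (?x, ?b, ?d)) \<bullet> assoc (?a, ?x \<otimes>\<^sub>o ?b, ?d)"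
      unfolding key by (simp add: cmp_assoc exch_assoc_middle)
    also have "\<dots> = merge X (m # \<Omega>) A (B \<union> D) \<bullet> (\<ii> (fsum X (m # \<Omega>) A) \<otimes>\<^sub>a merge X (m # \<Omega>) B D) \<bullet>
      assoc (fsum X (m # \<Omega>) A, fsum X (m # \<Omega>) B, fsum X (m # \<Omega>) D)"
      using 2 exch_natural[of "\<ii> ?a" "\<ii> ?x" ?BD, symmetric] by (simp add: interchange_right cmp_assoc)
    finally show ?thesis .
  next
    case 3
    have "merge X (m # \<Omega>) (A \<union> B) D \<bullet> (merge X (m # \<Omega>) A B \<otimes>\<^sub>a \<ii> (fsum X (m # \<Omega>) D)) =
      (\<ii> ?x \<otimes>\<^sub>a ?l) \<bullet> (exch ?ab ?x ?d \<bullet> (?AB \<otimes>\<^sub>a \<ii> ?x \<otimes>\<^sub>a \<ii> ?d))"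
      using 3 by (simp add: cmp_assoc)
    also have "\<dots> = ((\<ii> ?x \<otimes>\<^sub>a ?l) \<bullet> (\<ii> ?x \<otimes>\<^sub>a (?AB \<otimes>\<^sub>a \<ii> ?d))) \<bullet> exch (?a \<otimes>\<^sub>o ?b) ?x ?d"
      using exch_natural[of ?AB "\<ii> ?x" "\<ii> ?d"] by (simp add: cmp_assoc)
    also have "\<dots> = (\<ii> ?x \<otimes>\<^sub>a ?r) \<bullet> ((\<ii> ?x \<otimes>\<^sub>a (\<ii> ?a \<otimes>\<^sub>a ?BD)) \<bullet> exch ?a ?x (?b \<otimes>\<^sub>o ?d)) \<bullet>
        (\<ii> ?a \<otimes>\<^sub>a exch ?b ?x ?d) \<bullet> assoc (?a, ?b, ?x \<otimes>\<^sub>o ?d)"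
      unfolding key by (simp add: cmp_assoc exch_assoc_right)
    also have "\<dots> = merge X (m # \<Omega>) A (B \<union> D) \<bullet> (\<ii> (fsum X (m # \<Omega>) A) \<otimes>\<^sub>a merge X (m # \<Omega>) B D) \<bullet>
      assoc (fsum X (m # \<Omega>) A, fsum X (m # \<Omega>) B, fsum X (m # \<Omega>) D)"
      using 3 exch_natural[of "\<ii> ?a" "\<ii> ?x" ?BD, symmetric] by (simp add: interchange_right cmp_assoc)
    finally show ?thesis .
  next
    case 4
    then show ?thesis using IH by simp
  qed
qed

lemma merge_empty: "(\<And>m. X m \<in> Obj C) \<Longrightarrow> merge X \<Omega> {} B = lunit (fsum X \<Omega> B)"
  by (induction \<Omega>) (auto simp: exch_lunit)

text \<open>A sum indexed by a set, free of the ambient list. \<open>fsum_enum\<close> and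
  \<open>merge_enum\<close> pass between this form and the list-based one.\<close>

definition wsum :: "('v list \<Rightarrow> 'o) \<Rightarrow> 'v list set \<Rightarrow> 'o" where
  "wsum X A = lsum X (enum A)"

definition mu :: "('v list \<Rightarrow> 'o) \<Rightarrow> 'v list set \<Rightarrow> 'v list set \<Rightarrow> 'a" where
  "mu X A B = merge X (enum (A \<union> B)) A B"

lemma wsum_Obj [simp]: "(\<And>m. X m \<in> Obj C) \<Longrightarrow> wsum X A \<in> Obj C"
  by (simp add: wsum_def)

lemma fsum_enum: "finite A \<Longrightarrow> B \<subseteq> A \<Longrightarrow> fsum X (enum A) B = wsum X B"
  by (simp add: wsum_def filter_enum)

lemma merge_enum: "finite D \<Longrightarrow> A \<union> B \<subseteq> D \<Longrightarrow> merge X (enum D) A B = mu X A B"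
  using merge_filter[of A B "A \<union> B" X "enum D"] by (simp add: mu_def filter_enum del: Un_iff)

lemma mu_simps [simp]:
  assumes "\<And>m. X m \<in> Obj C" "finite A" "finite B" "A \<inter> B = {}"
  shows "mu X A B \<in> Arr C" "iso (mu X A B)" "Dom C (mu X A B) = wsum X A \<otimes>\<^sub>o wsum X B"
    "Cod C (mu X A B) = wsum X (A \<union> B)"
  using assms by (simp_all add: mu_def fsum_enum del: Un_iff)

lemma mu_comm:
  assumes "\<And>m. X m \<in> Obj C" "finite A" "finite B" "A \<inter> B = {}"
  shows "mu X B A \<bullet> sym (wsum X A, wsum X B) = mu X A B"
  using merge_comm[of X A B "enum (A \<union> B)"] assms by (simp add: merge_enum fsum_enum del: Un_iff)

lemma mu_empty: "(\<And>m. X m \<in> Obj C) \<Longrightarrow> finite B \<Longrightarrow> mu X {} B = lunit (wsum X B)"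
  using merge_empty[of X "enum B" B] by (simp add: mu_def fsum_enum)

lemma wsum_empty [simp]: "wsum X {} = I"
  by (simp add: wsum_def)

lemma mu_assoc:
  assumes "\<And>m. X m \<in> Obj C" "finite A" "finite B" "finite D" "A \<inter> B = {}" "A \<inter> D = {}" "B \<inter> D = {}"
  shows "mu X (A \<union> B) D \<bullet> (mu X A B \<otimes>\<^sub>a \<ii> (wsum X D)) =
    mu X A (B \<union> D) \<bullet> (\<ii> (wsum X A) \<otimes>\<^sub>a mu X B D) \<bullet> assoc (wsum X A, wsum X B, wsum X D)"
proof -
  have "A \<subseteq> A \<union> B \<union> D" "B \<subseteq> A \<union> B \<union> D" "D \<subseteq> A \<union> B \<union> D" "A \<union> B \<subseteq> A \<union> B \<union> D" "A \<union> (B \<union> D) \<subseteq> A \<union> B \<union> D"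
    "B \<union> D \<subseteq> A \<union> B \<union> D"
    by auto
  then show ?thesis
    using merge_assoc[of X A B D "enum (A \<union> B \<union> D)"] assms by (simp add: merge_enum fsum_enum del: Un_iff)
qed

text \<open>A formal consequence of associativity and commutativity of shuffles: both sides combine
  \<open>A\<close>, \<open>B\<close> and \<open>D\<close>, and after composition with an
  associativity they become the two sides of \<open>mu_comm\<close> tensored with
  \<open>D\<close>.\<close>

lemma mu_exch:
  assumes X [simp]: "\<And>m. X m \<in> Obj C" and fin [simp]: "finite A" "finite B" "finite D"
    and dj [simp]: "A \<inter> B = {}" "A \<inter> D = {}" "B \<inter> D = {}"
  shows "mu X B (A \<union> D) \<bullet> (\<ii> (wsum X B) \<otimes>\<^sub>a mu X A D) \<bullet> exch (wsum X A) (wsum X B) (wsum X D) =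
    mu X A (B \<union> D) \<bullet> (\<ii> (wsum X A) \<otimes>\<^sub>a mu X B D)" (is "?l = ?r")
proof -
  let ?a = "wsum X A" and ?b = "wsum X B" and ?d = "wsum X D"
  have dj' [simp]: "B \<inter> A = {}" "A \<inter> (B \<union> D) = {}" "B \<inter> (A \<union> D) = {}" "(B \<union> A) \<inter> D = {}"
    "A \<union> (B \<union> D) = B \<union> (A \<union> D)" using dj by blast+
  have "?l \<bullet> assoc (?a, ?b, ?d) =
      (mu X B (A \<union> D) \<bullet> (\<ii> ?b \<otimes>\<^sub>a mu X A D) \<bullet> assoc (?b, ?a, ?d)) \<bullet> (sym (?a, ?b) \<otimes>\<^sub>a \<ii> ?d)"
    by (simp add: exch_assoc cmp_assoc)
  also have "\<dots> = mu X (B \<union> A) D \<bullet> ((mu X B A \<bullet> sym (?a, ?b)) \<otimes>\<^sub>a \<ii> ?d)"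
    by (simp add: mu_assoc[symmetric] interchange_left cmp_assoc)
  also have "\<dots> = mu X (A \<union> B) D \<bullet> (mu X A B \<otimes>\<^sub>a \<ii> ?d)"
    by (simp add: mu_comm Un_commute)
  also have "\<dots> = ?r \<bullet> assoc (?a, ?b, ?d)"
    by (simp add: mu_assoc cmp_assoc)
  finally show ?thesis by (rule iso_cancel_right) auto
qed

text \<open>Rewrites the shuffle of two shuffles as one nested to the right, the form in which the
  two middle sets can be exchanged.\<close>

lemma mu_assoc4:
  assumes X [simp]: "\<And>m. X m \<in> Obj C" and fin [simp]: "finite A" "finite B" "finite D" "finite E"
    and dj [simp]: "A \<inter> B = {}" "A \<inter> D = {}" "B \<inter> D = {}" "A \<inter> E = {}" "B \<inter> E = {}" "D \<inter> E = {}"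
  shows "mu X (A \<union> B) (D \<union> E) \<bullet> (mu X A B \<otimes>\<^sub>a mu X D E) =
    mu X A (B \<union> (D \<union> E)) \<bullet> (\<ii> (wsum X A) \<otimes>\<^sub>a (mu X B (D \<union> E) \<bullet> (\<ii> (wsum X B) \<otimes>\<^sub>a mu X D E))) \<bullet>
      assoc (wsum X A, wsum X B, wsum X D \<otimes>\<^sub>o wsum X E)"
proof -
  let ?a = "wsum X A" and ?b = "wsum X B" and ?d = "wsum X D"
  have dj' [simp]: "A \<inter> (D \<union> E) = {}" "B \<inter> (D \<union> E) = {}" "(A \<union> B) \<inter> (D \<union> E) = {}"
     "A \<inter> (B \<union> (D \<union> E)) = {}" using dj by blast+
  have "mu X (A \<union> B) (D \<union> E) \<bullet> (mu X A B \<otimes>\<^sub>a mu X D E) =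
      (mu X (A \<union> B) (D \<union> E) \<bullet> (mu X A B \<otimes>\<^sub>a \<ii> (wsum X (D \<union> E)))) \<bullet> (\<ii> (?a \<otimes>\<^sub>o ?b) \<otimes>\<^sub>a mu X D E)"
    by (simp add: interchange cmp_assoc)
  also have "\<dots> = mu X A (B \<union> (D \<union> E)) \<bullet> (\<ii> ?a \<otimes>\<^sub>a mu X B (D \<union> E)) \<bullet>
      (assoc (?a, ?b, wsum X (D \<union> E)) \<bullet> (\<ii> (?a \<otimes>\<^sub>o ?b) \<otimes>\<^sub>a mu X D E))"
    by (simp add: mu_assoc cmp_assoc)
  also have "\<dots> = mu X A (B \<union> (D \<union> E)) \<bullet> (\<ii> ?a \<otimes>\<^sub>a (mu X B (D \<union> E) \<bullet> (\<ii> ?b \<otimes>\<^sub>a mu X D E))) \<bullet>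
      assoc (?a, ?b, ?d \<otimes>\<^sub>o wsum X E)"
    using assoc_natural[of "\<ii> ?a" "\<ii> ?b" "mu X D E"] by (simp add: interchange_right cmp_assoc)
  finally show ?thesis .
qed

text \<open>Bracketed in the same way as the exchange of the two middle summands in the axiom
  \<open>dl_dr\<close>, so that the axiom can be restated with it.\<close>

definition middle :: "'o \<Rightarrow> 'o \<Rightarrow> 'o \<Rightarrow> 'o \<Rightarrow> 'a" where
  "middle p q r s = inv_arr (assoc (p, r, q \<otimes>\<^sub>o s)) \<bullet> (\<ii> p \<otimes>\<^sub>a exch q r s) \<bullet> assoc (p, q, r \<otimes>\<^sub>o s)"

lemma middle_simps [simp]:
  assumes "p \<in> Obj C" "q \<in> Obj C" "r \<in> Obj C" "s \<in> Obj C"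
  shows "middle p q r s \<in> Arr C" "iso (middle p q r s)"
    "Dom C (middle p q r s) = (p \<otimes>\<^sub>o q) \<otimes>\<^sub>o (r \<otimes>\<^sub>o s)" "Cod C (middle p q r s) = (p \<otimes>\<^sub>o r) \<otimes>\<^sub>o (q \<otimes>\<^sub>o s)"
  using assms by (simp_all add: middle_def)

lemma middle_natural:
  assumes [simp]: "f \<in> Arr C" "g \<in> Arr C" "h \<in> Arr C" "k \<in> Arr C"
  shows "middle (Cod C f) (Cod C g) (Cod C h) (Cod C k) \<bullet> ((f \<otimes>\<^sub>a g) \<otimes>\<^sub>a (h \<otimes>\<^sub>a k)) =
    ((f \<otimes>\<^sub>a h) \<otimes>\<^sub>a (g \<otimes>\<^sub>a k)) \<bullet> middle (Dom C f) (Dom C g) (Dom C h) (Dom C k)" (is "?l = ?r")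
proof -
  let ?a = "assoc (Cod C f, Cod C h, Cod C g \<otimes>\<^sub>o Cod C k)"
  let ?b = "assoc (Dom C f, Dom C g, Dom C h \<otimes>\<^sub>o Dom C k)"
  have "?a \<bullet> ?l = (\<ii> (Cod C f) \<otimes>\<^sub>a exch (Cod C g) (Cod C h) (Cod C k)) \<bullet>
      (assoc (Cod C f, Cod C g, Cod C h \<otimes>\<^sub>o Cod C k) \<bullet> ((f \<otimes>\<^sub>a g) \<otimes>\<^sub>a (h \<otimes>\<^sub>a k)))"
    by (simp add: middle_def cmp_assoc inv_reduce)
  also have "\<dots> = (f \<otimes>\<^sub>a (exch (Cod C g) (Cod C h) (Cod C k) \<bullet> (g \<otimes>\<^sub>a h \<otimes>\<^sub>a k))) \<bullet> ?b"
    using assoc_natural[of f g "h \<otimes>\<^sub>a k"]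
    by (simp add: cmp_reduce[OF interchange] interchange)
  also have "\<dots> = (f \<otimes>\<^sub>a (h \<otimes>\<^sub>a g \<otimes>\<^sub>a k)) \<bullet> (\<ii> (Dom C f) \<otimes>\<^sub>a exch (Dom C g) (Dom C h) (Dom C k)) \<bullet> ?b"
    by (simp add: cmp_reduce[OF interchange] exch_natural)
  also have "\<dots> = ((f \<otimes>\<^sub>a (h \<otimes>\<^sub>a g \<otimes>\<^sub>a k)) \<bullet> assoc (Dom C f, Dom C h, Dom C g \<otimes>\<^sub>o Dom C k)) \<bullet>
      middle (Dom C f) (Dom C g) (Dom C h) (Dom C k)"
    by (simp add: middle_def cmp_assoc inv_reduce)
  also have "\<dots> = ?a \<bullet> ?r"
    using assoc_natural[of f h "g \<otimes>\<^sub>a k", symmetric] by (simp add: cmp_assoc)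
  finally show ?thesis by (rule iso_cancel_left) auto
qed

text \<open>Both sides are brought to the form nested to the right by \<open>mu_assoc4\<close>; what
  is left is \<open>mu_exch\<close> for the three sets after \<open>A\<close>.\<close>

lemma mu_middle:
  assumes X [simp]: "\<And>m. X m \<in> Obj C" and fin [simp]: "finite A" "finite B" "finite D" "finite E"
    and dj [simp]: "A \<inter> B = {}" "A \<inter> D = {}" "B \<inter> D = {}" "A \<inter> E = {}" "B \<inter> E = {}" "D \<inter> E = {}"
  shows "mu X (A \<union> D) (B \<union> E) \<bullet> (mu X A D \<otimes>\<^sub>a mu X B E) \<bullet>
      middle (wsum X A) (wsum X B) (wsum X D) (wsum X E) =
    mu X (A \<union> B) (D \<union> E) \<bullet> (mu X A B \<otimes>\<^sub>a mu X D E)" (is "?l = ?r")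
proof -
  let ?a = "wsum X A" and ?b = "wsum X B" and ?d = "wsum X D" and ?e = "wsum X E"
  have dj' [simp]: "D \<inter> B = {}" "A \<inter> (D \<union> E) = {}" "B \<inter> (D \<union> E) = {}" "(A \<union> B) \<inter> (D \<union> E) = {}"
     "(A \<union> D) \<inter> (B \<union> E) = {}" "D \<inter> (B \<union> E) = {}" "A \<inter> (D \<union> (B \<union> E)) = {}"
     "B \<union> (D \<union> E) = D \<union> (B \<union> E)" using dj by blast+
  have "?l = (mu X (A \<union> D) (B \<union> E) \<bullet> (mu X A D \<otimes>\<^sub>a mu X B E)) \<bullet>
      inv_arr (assoc (?a, ?d, ?b \<otimes>\<^sub>o ?e)) \<bullet> (\<ii> ?a \<otimes>\<^sub>a exch ?b ?d ?e) \<bullet> assoc (?a, ?b, ?d \<otimes>\<^sub>o ?e)"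
    by (simp add: cmp_assoc middle_def)
  also have "\<dots> = mu X A (D \<union> (B \<union> E)) \<bullet>
      (\<ii> ?a \<otimes>\<^sub>a (mu X D (B \<union> E) \<bullet> (\<ii> ?d \<otimes>\<^sub>a mu X B E) \<bullet> exch ?b ?d ?e)) \<bullet> assoc (?a, ?b, ?d \<otimes>\<^sub>o ?e)"
    by (simp add: mu_assoc4 cmp_assoc inv_reduce interchange_right)
  also have "\<dots> = ?r"
    by (simp add: mu_exch mu_assoc4)
  finally show ?thesis .
qed

end

section \<open>Coherence for distributive categories\<close>

datatype 'v rig_term = Var 'v | Nul | Unt | Add "'v rig_term" "'v rig_term" | Mul "'v rig_term" "'v rig_term"

primrec t_ob :: "('o, 'a) bifunctor \<Rightarrow> 'o \<Rightarrow> ('o, 'a) bifunctor \<Rightarrow> 'o \<Rightarrow> ('v \<Rightarrow> 'o) \<Rightarrow> 'v rig_term \<Rightarrow> 'o" where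
  "t_ob P z T e J (Var a) = J a"
| "t_ob P z T e J Nul = z"
| "t_ob P z T e J Unt = e"
| "t_ob P z T e J (Add t u) = FOb P (t_ob P z T e J t, t_ob P z T e J u)"
| "t_ob P z T e J (Mul t u) = FOb T (t_ob P z T e J t, t_ob P z T e J u)"

text \<open>The set \<open>mons t B\<close> consists of the words obtained by prefixing the monomials of \<open>t\<close> to the words
  in \<open>B\<close>; regularity means that no word arises twice in this way.\<close>

primrec mons :: "'v rig_term \<Rightarrow> 'v list set \<Rightarrow> 'v list set" where
  "mons (Var a) B = Cons a ` B"
| "mons Nul B = {}"
| "mons Unt B = B"
| "mons (Add t u) B = mons t B \<union> mons u B"
| "mons (Mul t u) B = mons t (mons u B)"

primrec regular :: "'v rig_term \<Rightarrow> 'v list set \<Rightarrow> bool" where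
  "regular (Var a) B = True"
| "regular Nul B = True"
| "regular Unt B = True"
| "regular (Add t u) B = (regular t B \<and> regular u B \<and> mons t B \<inter> mons u B = {})"
| "regular (Mul t u) B = (regular u B \<and> regular t (mons u B))"

lemma finite_mons [simp]: "finite B \<Longrightarrow> finite (mons t B)"
  by (induction t arbitrary: B) auto

lemma mons_Un: "mons t (A \<union> B) = mons t A \<union> mons t B"
  by (induction t arbitrary: A B) auto

lemma mons_empty [simp]: "mons t {} = {}"
  by (induction t) auto

lemma mons_mono: "A \<subseteq> B \<Longrightarrow> mons t A \<subseteq> mons t B"
  by (metis mons_Un sup.order_iff subset_Un_eq)

lemma regular_mono: "regular t B \<Longrightarrow> A \<subseteq> B \<Longrightarrow> regular t A"
proof (induction t arbitrary: A B)
  case (Add t u)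
  then show ?case using mons_mono[of A B t] mons_mono[of A B u] by fastforce
next
  case (Mul t u)
  then show ?case using mons_mono[of A B u] by fastforce
qed auto

text \<open>Regularity on \<open>A \<union> B\<close> also separates words that come from different
  tails. For \<open>Add t u\<close> the mixed intersections, such as
  \<open>mons t A \<inter> mons u B\<close>, are empty because \<open>mons t\<close> and
  \<open>mons u\<close> are disjoint on the whole union.\<close>

lemma mons_disjoint: "regular t (A \<union> B) \<Longrightarrow> A \<inter> B = {} \<Longrightarrow> mons t A \<inter> mons t B = {}"
proof (induction t arbitrary: A B)
  case (Add t u)
  then have "mons t A \<inter> mons t B = {}" "mons u A \<inter> mons u B = {}" by auto
  moreover have "mons t (A \<union> B) \<inter> mons u (A \<union> B) = {}" using Add.prems by simp
  ultimately show ?case by (auto simp: mons_Un)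
qed (auto simp: mons_Un)

section \<open>The action of a term on sums of words, and reductions between terms\<close>

context coherent_distributive_category begin

abbreviation iso where "iso \<equiv> is_isomorphism C"
abbreviation inv_arr where "inv_arr \<equiv> inverse_arrow C"

lemmas cmp_assoc = sum.cmp_assoc and cmp_reduce = sum.cmp_reduce and inv_reduce = sum.inv_reduce
  and iso_cancel_right = sum.iso_cancel_right and iso_cancel_left = sum.iso_cancel_left

text \<open>Referred to by position: 1-4 relate distributivity to symmetry and associativity of the
  sum, 5-7 to associativity of the product, 8-15 concern annihilation, 16-18 the unit of the sum and
  19-20 the unit of the product.\<close>

lemmas coh = dl_sP[unfolded \<i>_def] dr_sP[unfolded \<i>_def] dr_aP[unfolded \<i>_def] dl_aP[unfolded \<i>_def]
  dl_aT[unfolded \<i>_def] dr_aT[unfolded \<i>_def] dl_dr_aT[unfolded \<i>_def]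
  nl_nr_zero nr_plus nl_plus nr_one nl_one nr_times[unfolded \<i>_def] nr_nl[unfolded \<i>_def]
  nl_times[unfolded \<i>_def] dl_lP[unfolded \<i>_def] dr_lP[unfolded \<i>_def] dr_rP[unfolded \<i>_def]
  dl_lT dr_rT

lemma dl_dr_middle:
  assumes "w \<in> Obj C" "x \<in> Obj C" "y \<in> Obj C" "z \<in> Obj C"
  shows "sum.middle (w \<otimes>\<^sub>o y) (x \<otimes>\<^sub>o y) (w \<otimes>\<^sub>o z) (x \<otimes>\<^sub>o z) \<bullet>
      (dr (w, x, y) \<oplus>\<^sub>a dr (w, x, z)) \<bullet> dl (w \<oplus>\<^sub>o x, y, z) =
    (dl (w, y, z) \<oplus>\<^sub>a dl (x, y, z)) \<bullet> dr (w, x, y \<oplus>\<^sub>o z)"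
proof -
  have [simp]: "dl (w \<oplus>\<^sub>o x, y, z) \<in> Arr C" "Cod C (dl (w \<oplus>\<^sub>o x, y, z)) = (w \<oplus>\<^sub>o x) \<otimes>\<^sub>o y \<oplus>\<^sub>o (w \<oplus>\<^sub>o x) \<otimes>\<^sub>o z"
    using natural_isoD(4,6)[OF dl_iso, of "(w \<oplus>\<^sub>o x, y, z)"] assms by auto
  have [simp]: "dr (w, x, t) \<in> Arr C" "Dom C (dr (w, x, t)) = (w \<oplus>\<^sub>o x) \<otimes>\<^sub>o t"
    "Cod C (dr (w, x, t)) = w \<otimes>\<^sub>o t \<oplus>\<^sub>o x \<otimes>\<^sub>o t" if "t \<in> Obj C" for t
    using natural_isoD(4-6)[OF dr_iso, of "(w, x, t)"] assms that by auto
  show ?thesis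
    using dl_dr[OF assms] assms unfolding \<i>_def Let_def
    by (simp add: sum.middle_def sum.exch_def cmp_assoc)
qed

lemma dist_simps [simp]:
  assumes "x \<in> Obj C" "y \<in> Obj C" "z \<in> Obj C"
  shows "dl (x, y, z) \<in> Arr C" "iso (dl (x, y, z))"
    "Dom C (dl (x, y, z)) = x \<otimes>\<^sub>o (y \<oplus>\<^sub>o z)" "Cod C (dl (x, y, z)) = x \<otimes>\<^sub>o y \<oplus>\<^sub>o x \<otimes>\<^sub>o z"
    "dr (x, y, z) \<in> Arr C" "iso (dr (x, y, z))"
    "Dom C (dr (x, y, z)) = (x \<oplus>\<^sub>o y) \<otimes>\<^sub>o z" "Cod C (dr (x, y, z)) = x \<otimes>\<^sub>o z \<oplus>\<^sub>o y \<otimes>\<^sub>o z"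
  using natural_isoD(3-6)[OF dl_iso, of "(x, y, z)"] natural_isoD(3-6)[OF dr_iso, of "(x, y, z)"] assms
  by simp_all

lemma ann_simps [simp]:
  assumes "x \<in> Obj C"
  shows "nl x \<in> Arr C" "iso (nl x)" "Dom C (nl x) = zeroC \<otimes>\<^sub>o x" "Cod C (nl x) = zeroC"
    "nr x \<in> Arr C" "iso (nr x)" "Dom C (nr x) = x \<otimes>\<^sub>o zeroC" "Cod C (nr x) = zeroC"
  using natural_isoD(3-6)[OF nl_iso, of x] natural_isoD(3-6)[OF nr_iso, of x] assms
  by simp_all

lemma dist_natural:
  assumes "f \<in> Arr C" "g \<in> Arr C" "h \<in> Arr C"
  shows "dl (Cod C f, Cod C g, Cod C h) \<bullet> (f \<otimes>\<^sub>a (g \<oplus>\<^sub>a h)) =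
      (f \<otimes>\<^sub>a g \<oplus>\<^sub>a f \<otimes>\<^sub>a h) \<bullet> dl (Dom C f, Dom C g, Dom C h)"
    "dr (Cod C f, Cod C g, Cod C h) \<bullet> ((f \<oplus>\<^sub>a g) \<otimes>\<^sub>a h) =
      (f \<otimes>\<^sub>a h \<oplus>\<^sub>a g \<otimes>\<^sub>a h) \<bullet> dr (Dom C f, Dom C g, Dom C h)"
  using natural_isoD(7)[OF dl_iso, of "(f, g, h)"] natural_isoD(7)[OF dr_iso, of "(f, g, h)"] assms
  by simp_all

lemma ann_natural:
  assumes "f \<in> Arr C"
  shows "nl (Cod C f) \<bullet> (\<ii> zeroC \<otimes>\<^sub>a f) = nl (Dom C f)"
    "nr (Cod C f) \<bullet> (f \<otimes>\<^sub>a \<ii> zeroC) = nr (Dom C f)"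
  using natural_isoD(7)[OF nl_iso, of f] natural_isoD(7)[OF nr_iso, of f] assms
  by (simp_all add: \<i>_def)

text \<open>Distributivity commutes with the exchange of two summands because it commutes with
  associativity (\<open>coh(4)\<close>, used twice) and with symmetry
  (\<open>coh(1)\<close>).\<close>

lemma dl_exch:
  assumes [simp]: "x \<in> Obj C" "p \<in> Obj C" "m \<in> Obj C" "q \<in> Obj C"
  shows "sum.exch (x \<otimes>\<^sub>o p) (x \<otimes>\<^sub>o m) (x \<otimes>\<^sub>o q) \<bullet> (\<ii> (x \<otimes>\<^sub>o p) \<oplus>\<^sub>a dl (x, m, q)) \<bullet> dl (x, p, m \<oplus>\<^sub>o q) =
    (\<ii> (x \<otimes>\<^sub>o m) \<oplus>\<^sub>a dl (x, p, q)) \<bullet> dl (x, m, p \<oplus>\<^sub>o q) \<bullet> (\<ii> x \<otimes>\<^sub>a sum.exch p m q)" (is "?l = ?r")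
proof -
  have "?r \<bullet> (\<ii> x \<otimes>\<^sub>a aP (p, m, q)) =
      (\<ii> (x \<otimes>\<^sub>o m) \<oplus>\<^sub>a dl (x, p, q)) \<bullet> dl (x, m, p \<oplus>\<^sub>o q) \<bullet> (\<ii> x \<otimes>\<^sub>a (sum.exch p m q \<bullet> aP (p, m, q)))"
    by (simp add: prod.interchange_right cmp_assoc)
  also have "\<dots> = ((\<ii> (x \<otimes>\<^sub>o m) \<oplus>\<^sub>a dl (x, p, q)) \<bullet> dl (x, m, p \<oplus>\<^sub>o q) \<bullet> (\<ii> x \<otimes>\<^sub>a aP (m, p, q))) \<bullet>
      (\<ii> x \<otimes>\<^sub>a (sP (p, m) \<oplus>\<^sub>a \<ii> q))"
    by (simp add: sum.exch_assoc prod.interchange_right cmp_assoc)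
  also have "\<dots> = aP (x \<otimes>\<^sub>o m, x \<otimes>\<^sub>o p, x \<otimes>\<^sub>o q) \<bullet> (dl (x, m, p) \<oplus>\<^sub>a \<ii> (x \<otimes>\<^sub>o q)) \<bullet>
      (dl (x, m \<oplus>\<^sub>o p, q) \<bullet> (\<ii> x \<otimes>\<^sub>a (sP (p, m) \<oplus>\<^sub>a \<ii> q)))"
    by (simp add: coh(4)[symmetric] cmp_assoc)
  also have "\<dots> = aP (x \<otimes>\<^sub>o m, x \<otimes>\<^sub>o p, x \<otimes>\<^sub>o q) \<bullet>
      ((dl (x, m, p) \<bullet> (\<ii> x \<otimes>\<^sub>a sP (p, m))) \<oplus>\<^sub>a \<ii> (x \<otimes>\<^sub>o q)) \<bullet> dl (x, p \<oplus>\<^sub>o m, q)"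
    using dist_natural(1)[of "\<ii> x" "sP (p, m)" "\<ii> q"] by (simp add: sum.interchange_left cmp_assoc)
  also have "\<dots> = (aP (x \<otimes>\<^sub>o m, x \<otimes>\<^sub>o p, x \<otimes>\<^sub>o q) \<bullet> (sP (x \<otimes>\<^sub>o p, x \<otimes>\<^sub>o m) \<oplus>\<^sub>a \<ii> (x \<otimes>\<^sub>o q))) \<bullet>
      (dl (x, p, m) \<oplus>\<^sub>a \<ii> (x \<otimes>\<^sub>o q)) \<bullet> dl (x, p \<oplus>\<^sub>o m, q)"
    by (simp add: coh(1)[symmetric] sum.interchange_left cmp_assoc)
  also have "\<dots> = sum.exch (x \<otimes>\<^sub>o p) (x \<otimes>\<^sub>o m) (x \<otimes>\<^sub>o q) \<bullet>
      (aP (x \<otimes>\<^sub>o p, x \<otimes>\<^sub>o m, x \<otimes>\<^sub>o q) \<bullet> (dl (x, p, m) \<oplus>\<^sub>a \<ii> (x \<otimes>\<^sub>o q)) \<bullet> dl (x, p \<oplus>\<^sub>o m, q))"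
    by (simp add: sum.exch_assoc[symmetric] cmp_assoc)
  also have "\<dots> = ?l \<bullet> (\<ii> x \<otimes>\<^sub>a aP (p, m, q))"
    by (simp add: coh(4) cmp_assoc)
  finally show ?thesis by (rule iso_cancel_right[symmetric]) auto
qed

abbreviation ob :: "('v \<Rightarrow> 'o) \<Rightarrow> 'v rig_term \<Rightarrow> 'o" where
  "ob \<equiv> t_ob plusC zeroC timesC oneC"

lemma ob_simps [simp]:
  "ob J (Add t u) = ob J t \<oplus>\<^sub>o ob J u" "ob J (Mul t u) = ob J t \<otimes>\<^sub>o ob J u"
  by (simp_all add: sum.tob_def prod.tob_def)

declare t_ob.simps(4,5) [simp del]

lemma ob_Obj [simp]: "(\<And>a. J a \<in> Obj C) \<Longrightarrow> ob J t \<in> Obj C"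
  by (induction t) auto

text \<open>A word is bracketed to the right and ends with the unit, so that prefixing a letter is
  literally multiplication from the left.\<close>

primrec word :: "('v \<Rightarrow> 'o) \<Rightarrow> 'v list \<Rightarrow> 'o" where
  "word J [] = oneC"
| "word J (a # m) = J a \<otimes>\<^sub>o word J m"

text \<open>Multiplication of a sum of words by one letter: distribute over the summands one by one,
  and annihilate the zero that ends the sum.\<close>

primrec row :: "('v \<Rightarrow> 'o) \<Rightarrow> 'v \<Rightarrow> 'v list list \<Rightarrow> 'a" where
  "row J a [] = nr (J a)"
| "row J a (w # ws) = (\<ii> (word J (a # w)) \<oplus>\<^sub>a row J a ws) \<bullet> dl (J a, word J w, sum.lsum (word J) ws)"

text \<open>On regular terms this is an isomorphism from
  \<open>ob J t \<otimes>\<^sub>o sum.wsum (word J) B\<close> to the sum over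
  \<open>mons t B\<close>. A sum of terms distributes from the right and shuffles the two results.
  In a product \<open>u\<close> acts first, since its letters stand to the right of those of
  \<open>t\<close>.\<close>

primrec act :: "('v \<Rightarrow> 'o) \<Rightarrow> 'v rig_term \<Rightarrow> 'v list set \<Rightarrow> 'a" where
  "act J (Var a) B = row J a (enum B)"
| "act J Nul B = nl (sum.wsum (word J) B)"
| "act J Unt B = lT (sum.wsum (word J) B)"
| "act J (Add t u) B = sum.mu (word J) (mons t B) (mons u B) \<bullet> (act J t B \<oplus>\<^sub>a act J u B) \<bullet>
    dr (ob J t, ob J u, sum.wsum (word J) B)"
| "act J (Mul t u) B = act J t (mons u B) \<bullet> (\<ii> (ob J t) \<otimes>\<^sub>a act J u B) \<bullet>
    aT (ob J t, ob J u, sum.wsum (word J) B)"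

text \<open>Not every inverse may be allowed: the inverse of annihilation, for example, leads from a regular
  term to one that is not.\<close>

inductive red :: "('v \<Rightarrow> 'o) \<Rightarrow> 'v rig_term \<Rightarrow> 'v rig_term \<Rightarrow> 'a \<Rightarrow> bool" for J where
  refl: "red J t t (\<ii> (ob J t))"
| trans: "red J t u f \<Longrightarrow> red J u w g \<Longrightarrow> red J t w (g \<bullet> f)"
| Add: "red J t t' f \<Longrightarrow> red J u u' g \<Longrightarrow> red J (Add t u) (Add t' u') (f \<oplus>\<^sub>a g)"
| Mul: "red J t t' f \<Longrightarrow> red J u u' g \<Longrightarrow> red J (Mul t u) (Mul t' u') (f \<otimes>\<^sub>a g)"
| aP: "red J (Add (Add t u) w) (Add t (Add u w)) (aP (ob J t, ob J u, ob J w))"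
| aP_inv: "red J (Add t (Add u w)) (Add (Add t u) w) (inv_arr (aP (ob J t, ob J u, ob J w)))"
| sP: "red J (Add t u) (Add u t) (sP (ob J t, ob J u))"
| lP: "red J (Add Nul t) t (lP (ob J t))"
| rP: "red J (Add t Nul) t (rP (ob J t))"
| rP_inv: "red J t (Add t Nul) (inv_arr (rP (ob J t)))"
| aT: "red J (Mul (Mul t u) w) (Mul t (Mul u w)) (aT (ob J t, ob J u, ob J w))"
| lT: "red J (Mul Unt t) t (lT (ob J t))"
| rT: "red J (Mul t Unt) t (rT (ob J t))"
| rT_inv: "red J t (Mul t Unt) (inv_arr (rT (ob J t)))"
| dl: "red J (Mul t (Add u w)) (Add (Mul t u) (Mul t w)) (dl (ob J t, ob J u, ob J w))"
| dr: "red J (Mul (Add t u) w) (Add (Mul t w) (Mul u w)) (dr (ob J t, ob J u, ob J w))"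
| nl: "red J (Mul Nul t) Nul (nl (ob J t))"
| nr: "red J (Mul t Nul) Nul (nr (ob J t))"

end

text \<open>One environment is fixed, giving every variable an object of \<open>C\<close>, so that
  typing can be left to the simplifier. The locale is interpreted anew for each environment that
  occurs.\<close>

locale coherent_env =
  coherent_distributive_category C plusC zeroC aP lP rP plus_o plus_a sP timesC oneC aT lT rT
    times_o times_a dl dr nl nr \<i>
  for C :: "('o, 'a) cat" (structure)
    and plusC zeroC aP lP rP
    and plus_o (infixr "\<oplus>\<^sub>o" 70) and plus_a (infixr "\<oplus>\<^sub>a" 70) and sP
    and timesC oneC aT lT rT
    and times_o (infixr "\<otimes>\<^sub>o" 75) and times_a (infixr "\<otimes>\<^sub>a" 75)
    and dl dr :: "'o \<times> 'o \<times> 'o \<Rightarrow> 'a" and nl nr :: "'o \<Rightarrow> 'a" and \<i> +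
  fixes J :: "'v \<Rightarrow> 'o"
  assumes J_Obj [simp]: "J a \<in> Obj C"
begin

lemma word_Obj [simp]: "word J m \<in> Obj C"
  by (induction m) auto

abbreviation SS where "SS \<equiv> sum.wsum (word J)"
abbreviation MM where "MM \<equiv> sum.mu (word J)"

lemma row_simps [simp]:
  "row J a ws \<in> Arr C" "iso (row J a ws)"
  "Dom C (row J a ws) = J a \<otimes>\<^sub>o sum.lsum (word J) ws" "Cod C (row J a ws) = sum.lsum (word J) (map (Cons a) ws)"
proof -
  have "iso (row J a ws) \<and> Dom C (row J a ws) = J a \<otimes>\<^sub>o sum.lsum (word J) ws \<and>
      Cod C (row J a ws) = sum.lsum (word J) (map (Cons a) ws)"
    by (induction ws) auto
  then show "row J a ws \<in> Arr C" "iso (row J a ws)"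
    "Dom C (row J a ws) = J a \<otimes>\<^sub>o sum.lsum (word J) ws" "Cod C (row J a ws) = sum.lsum (word J) (map (Cons a) ws)"
    by auto
qed

lemma filter_Cons_image: "filter (\<lambda>m. m \<in> Cons a ` A) (map (Cons a) ws) = map (Cons a) (filter (\<lambda>m. m \<in> A) ws)"
  by (auto simp: filter_map o_def intro!: arg_cong[of _ _ "map _"] filter_cong)

text \<open>Additivity of the action of a single letter. Prefixing preserves the listing, so the
  induction runs along \<Omega> and its image in parallel: a head from \<open>A\<close> uses
  \<open>coh(4)\<close>, a head from \<open>B\<close> uses \<open>dl_exch\<close>, and the empty
  list uses \<open>coh(16)\<close>.\<close>

lemma row_merge:
  assumes dj [simp]: "A \<inter> B = {}"
  shows "row J a (filter (\<lambda>m. m \<in> A \<union> B) \<Omega>) \<bullet> (\<ii> (J a) \<otimes>\<^sub>a sum.merge (word J) \<Omega> A B) =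
    sum.merge (word J) (map (Cons a) \<Omega>) (Cons a ` A) (Cons a ` B) \<bullet>
    (row J a (filter (\<lambda>m. m \<in> A) \<Omega>) \<oplus>\<^sub>a row J a (filter (\<lambda>m. m \<in> B) \<Omega>)) \<bullet>
    dl (J a, sum.fsum (word J) \<Omega> A, sum.fsum (word J) \<Omega> B)"
proof (induction \<Omega>)
  case Nil
  have "nr (J a) \<bullet> (\<ii> (J a) \<otimes>\<^sub>a lP zeroC) =
      (nr (J a) \<bullet> lP (J a \<otimes>\<^sub>o zeroC)) \<bullet> (nr (J a) \<oplus>\<^sub>a \<ii> (J a \<otimes>\<^sub>o zeroC)) \<bullet> dl (J a, zeroC, zeroC)"
    by (simp add: coh(16)[symmetric] cmp_assoc)
  also have "\<dots> = lP zeroC \<bullet> ((\<ii> zeroC \<oplus>\<^sub>a nr (J a)) \<bullet> (nr (J a) \<oplus>\<^sub>a \<ii> (J a \<otimes>\<^sub>o zeroC))) \<bullet> dl (J a, zeroC, zeroC)"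
    using sum.unit_natural(1)[of "nr (J a)", symmetric] by (simp add: cmp_assoc)
  also have "\<dots> = lP zeroC \<bullet> (nr (J a) \<oplus>\<^sub>a nr (J a)) \<bullet> dl (J a, zeroC, zeroC)"
    by (simp add: sum.interchange)
  finally show ?case by simp
next
  case (Cons m \<Omega>)
  let ?j = "J a" and ?x = "word J m" and ?p = "sum.fsum (word J) \<Omega> A" and ?q = "sum.fsum (word J) \<Omega> B"
  let ?M = "sum.merge (word J) \<Omega> A B"
  let ?N = "sum.merge (word J) (map (Cons a) \<Omega>) (Cons a ` A) (Cons a ` B)"
  let ?r = "row J a (filter (\<lambda>m. m \<in> A \<union> B) \<Omega>)" and ?ra = "row J a (filter (\<lambda>m. m \<in> A) \<Omega>)"
    and ?rb = "row J a (filter (\<lambda>m. m \<in> B) \<Omega>)"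
  have dj' [simp]: "Cons a ` A \<inter> Cons a ` B = {}" using dj by blast
  have [simp]: "filter (\<lambda>m. m \<in> Cons a ` A \<union> Cons a ` B) (map (Cons a) \<Omega>) = map (Cons a) (filter (\<lambda>m. m \<in> A \<union> B) \<Omega>)"
    using filter_Cons_image[of a "A \<union> B" \<Omega>] by (simp add: image_Un)
  note [simp] = filter_Cons_image and [simp del] = Un_iff
  have IH: "(\<ii> (?j \<otimes>\<^sub>o ?x) \<oplus>\<^sub>a ?r) \<bullet> (\<ii> (?j \<otimes>\<^sub>o ?x) \<oplus>\<^sub>a (\<ii> ?j \<otimes>\<^sub>a ?M)) =
      (\<ii> (?j \<otimes>\<^sub>o ?x) \<oplus>\<^sub>a ?N) \<bullet> (\<ii> (?j \<otimes>\<^sub>o ?x) \<oplus>\<^sub>a (?ra \<oplus>\<^sub>a ?rb)) \<bullet> (\<ii> (?j \<otimes>\<^sub>o ?x) \<oplus>\<^sub>a dl (?j, ?p, ?q))"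
    using arg_cong[OF Cons.IH, of "\<lambda>f. \<ii> (?j \<otimes>\<^sub>o ?x) \<oplus>\<^sub>a f"] by (simp add: sum.interchange_right)
  consider "m \<in> A" "m \<notin> B" | "m \<notin> A" "m \<in> B" | "m \<notin> A" "m \<notin> B" using dj by blast
  then show ?case
  proof cases
    case 1
    then have "row J a (filter (\<lambda>m. m \<in> A \<union> B) (m # \<Omega>)) \<bullet> (\<ii> ?j \<otimes>\<^sub>a sum.merge (word J) (m # \<Omega>) A B) =
       (\<ii> (?j \<otimes>\<^sub>o ?x) \<oplus>\<^sub>a ?r) \<bullet> (dl (?j, ?x, sum.fsum (word J) \<Omega> (A \<union> B)) \<bullet> (\<ii> ?j \<otimes>\<^sub>a (\<ii> ?x \<oplus>\<^sub>a ?M))) \<bullet>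
        (\<ii> ?j \<otimes>\<^sub>a aP (?x, ?p, ?q))"
      by (simp add: Un_iff[of m] prod.interchange_right cmp_assoc)
    also have "\<dots> = ((\<ii> (?j \<otimes>\<^sub>o ?x) \<oplus>\<^sub>a ?r) \<bullet> (\<ii> (?j \<otimes>\<^sub>o ?x) \<oplus>\<^sub>a (\<ii> ?j \<otimes>\<^sub>a ?M))) \<bullet> dl (?j, ?x, ?p \<oplus>\<^sub>o ?q) \<bullet>
        (\<ii> ?j \<otimes>\<^sub>a aP (?x, ?p, ?q))"
      using dist_natural(1)[of "\<ii> ?j" "\<ii> ?x" ?M] by (simp add: cmp_assoc)
    also have "\<dots> = (\<ii> (?j \<otimes>\<^sub>o ?x) \<oplus>\<^sub>a ?N) \<bullet> ((\<ii> (?j \<otimes>\<^sub>o ?x) \<oplus>\<^sub>a (?ra \<oplus>\<^sub>a ?rb)) \<bullet>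
        aP (?j \<otimes>\<^sub>o ?x, ?j \<otimes>\<^sub>o ?p, ?j \<otimes>\<^sub>o ?q)) \<bullet> (dl (?j, ?x, ?p) \<oplus>\<^sub>a \<ii> (?j \<otimes>\<^sub>o ?q)) \<bullet> dl (?j, ?x \<oplus>\<^sub>o ?p, ?q)"
      unfolding IH by (simp add: coh(4) cmp_assoc)
    also have "\<dots> = (\<ii> (?j \<otimes>\<^sub>o ?x) \<oplus>\<^sub>a ?N) \<bullet>
        aP (?j \<otimes>\<^sub>o ?x, sum.lsum (word J) (map (Cons a) (filter (\<lambda>m. m \<in> A) \<Omega>)), sum.lsum (word J) (map (Cons a) (filter (\<lambda>m. m \<in> B) \<Omega>))) \<bullet>
        (((\<ii> (?j \<otimes>\<^sub>o ?x) \<oplus>\<^sub>a ?ra) \<bullet> dl (?j, ?x, ?p)) \<oplus>\<^sub>a ?rb) \<bullet> dl (?j, ?x \<oplus>\<^sub>o ?p, ?q)"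
      using sum.assoc_natural[of "\<ii> (?j \<otimes>\<^sub>o ?x)" ?ra ?rb, symmetric]
      by (simp add: cmp_reduce[OF sum.interchange] cmp_assoc)
    finally show ?thesis using 1 by (simp add: inj_image_mem_iff cmp_assoc)
  next
    case 2
    then have "row J a (filter (\<lambda>m. m \<in> A \<union> B) (m # \<Omega>)) \<bullet> (\<ii> ?j \<otimes>\<^sub>a sum.merge (word J) (m # \<Omega>) A B) =
       (\<ii> (?j \<otimes>\<^sub>o ?x) \<oplus>\<^sub>a ?r) \<bullet> (dl (?j, ?x, sum.fsum (word J) \<Omega> (A \<union> B)) \<bullet> (\<ii> ?j \<otimes>\<^sub>a (\<ii> ?x \<oplus>\<^sub>a ?M))) \<bullet>
        (\<ii> ?j \<otimes>\<^sub>a sum.exch ?p ?x ?q)"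
      by (simp add: Un_iff[of m] prod.interchange_right cmp_assoc)
    also have "\<dots> = ((\<ii> (?j \<otimes>\<^sub>o ?x) \<oplus>\<^sub>a ?r) \<bullet> (\<ii> (?j \<otimes>\<^sub>o ?x) \<oplus>\<^sub>a (\<ii> ?j \<otimes>\<^sub>a ?M))) \<bullet> dl (?j, ?x, ?p \<oplus>\<^sub>o ?q) \<bullet>
        (\<ii> ?j \<otimes>\<^sub>a sum.exch ?p ?x ?q)"
      using dist_natural(1)[of "\<ii> ?j" "\<ii> ?x" ?M] by (simp add: cmp_assoc)
    also have "\<dots> = (\<ii> (?j \<otimes>\<^sub>o ?x) \<oplus>\<^sub>a ?N) \<bullet> ((\<ii> (?j \<otimes>\<^sub>o ?x) \<oplus>\<^sub>a (?ra \<oplus>\<^sub>a ?rb)) \<bullet>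
        sum.exch (?j \<otimes>\<^sub>o ?p) (?j \<otimes>\<^sub>o ?x) (?j \<otimes>\<^sub>o ?q)) \<bullet> (\<ii> (?j \<otimes>\<^sub>o ?p) \<oplus>\<^sub>a dl (?j, ?x, ?q)) \<bullet> dl (?j, ?p, ?x \<oplus>\<^sub>o ?q)"
      unfolding IH by (simp add: dl_exch cmp_assoc)
    also have "\<dots> = (\<ii> (?j \<otimes>\<^sub>o ?x) \<oplus>\<^sub>a ?N) \<bullet>
        sum.exch (sum.lsum (word J) (map (Cons a) (filter (\<lambda>m. m \<in> A) \<Omega>))) (?j \<otimes>\<^sub>o ?x) (sum.lsum (word J) (map (Cons a) (filter (\<lambda>m. m \<in> B) \<Omega>))) \<bullet>
        (?ra \<oplus>\<^sub>a ((\<ii> (?j \<otimes>\<^sub>o ?x) \<oplus>\<^sub>a ?rb) \<bullet> dl (?j, ?x, ?q))) \<bullet> dl (?j, ?p, ?x \<oplus>\<^sub>o ?q)"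
      using sum.exch_natural[of ?ra "\<ii> (?j \<otimes>\<^sub>o ?x)" ?rb, symmetric]
      by (simp add: cmp_reduce[OF sum.interchange] cmp_assoc)
    finally show ?thesis using 2 by (simp add: inj_image_mem_iff cmp_assoc)
  next
    case 3
    then show ?thesis using Cons.IH by (simp add: Un_iff[of m] inj_image_mem_iff)
  qed
qed

end

section \<open>Uniqueness of canonical isomorphisms\<close>

context coherent_distributive_category begin

text \<open>A \<open>span\<close> only mentions the terms and the values of the variables, so it is stable under
  substitution and naturality; \<open>co\<close> is the invariant from which uniqueness follows.\<close>

definition span :: "('v \<Rightarrow> 'o) \<Rightarrow> 'v rig_term \<Rightarrow> 'v rig_term \<Rightarrow> 'a \<Rightarrow> bool" where
  "span J t u f \<longleftrightarrow> (\<exists>w g h. red J t w g \<and> red J u w h \<and> f = inv_arr h \<bullet> g)"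

definition co :: "('v \<Rightarrow> 'o) \<Rightarrow> 'v list set \<Rightarrow> 'v rig_term \<Rightarrow> 'v rig_term \<Rightarrow> 'a \<Rightarrow> bool" where
  "co J B t u f \<longleftrightarrow> regular t B \<and> regular u B \<and> mons u B = mons t B \<and> iso f \<and> Dom C f = ob J t \<and>
    Cod C f = ob J u \<and> act J u B \<bullet> (f \<otimes>\<^sub>a Idn C (sum.wsum (word J) B)) = act J t B"

end

context coherent_env begin

lemma SS_Cons_image: "finite B \<Longrightarrow> sum.lsum (word J) (map (Cons a) (enum B)) = SS (Cons a ` B)"
  by (simp add: sum.wsum_def enum_Cons)

lemma act_simps [simp]:
  assumes "finite B" "regular t B"
  shows "act J t B \<in> Arr C" "iso (act J t B)" "Dom C (act J t B) = ob J t \<otimes>\<^sub>o SS B"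
    "Cod C (act J t B) = SS (mons t B)"
proof -
  have "iso (act J t B) \<and> Dom C (act J t B) = ob J t \<otimes>\<^sub>o SS B \<and> Cod C (act J t B) = SS (mons t B)"
    using assms
  proof (induction t arbitrary: B)
    case (Var a)
    then show ?case by (simp add: SS_Cons_image) (simp add: sum.wsum_def)
  qed auto
  then show "act J t B \<in> Arr C" "iso (act J t B)" "Dom C (act J t B) = ob J t \<otimes>\<^sub>o SS B"
    "Cod C (act J t B) = SS (mons t B)" by auto
qed

text \<open>The empty set of words has sum zero, so the annihilation axioms \<open>coh(8)\<close>,
  \<open>nr_one\<close>, \<open>nr_plus\<close> and \<open>nr_times\<close> are precisely the
  recursion of \<open>act\<close> at the empty set.\<close>

lemma act_empty: "act J t {} = nr (ob J t)"
proof (induction t)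
  case (Mul t u)
  then show ?case by (simp add: coh(13))
qed (simp_all add: coh sum.mu_empty)

text \<open>Additivity of the action in the set of words. It is needed because the action of
  \<open>Mul t (Add u w)\<close> lets \<open>t\<close> act on a shuffle. The letters are
  \<open>row_merge\<close>; zero uses \<open>nl_plus\<close>, the unit \<open>dl_lT\<close>, a sum
  \<open>dl_dr\<close> and a product \<open>dl_aT\<close>.\<close>

lemma act_mu:
  assumes "regular t (A \<union> B)" "A \<inter> B = {}" "finite A" "finite B"
  shows "act J t (A \<union> B) \<bullet> (\<ii> (ob J t) \<otimes>\<^sub>a MM A B) =
    MM (mons t A) (mons t B) \<bullet> (act J t A \<oplus>\<^sub>a act J t B) \<bullet> dl (ob J t, SS A, SS B)"
  using assms
proof (induction t arbitrary: A B)
  case (Var a)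
  have "row J a (filter (\<lambda>m. m \<in> A \<union> B) (enum (A \<union> B))) \<bullet> (\<ii> (J a) \<otimes>\<^sub>a sum.merge (word J) (enum (A \<union> B)) A B) =
    sum.merge (word J) (enum (Cons a ` A \<union> Cons a ` B)) (Cons a ` A) (Cons a ` B) \<bullet>
    (row J a (filter (\<lambda>m. m \<in> A) (enum (A \<union> B))) \<oplus>\<^sub>a row J a (filter (\<lambda>m. m \<in> B) (enum (A \<union> B)))) \<bullet>
    dl (J a, sum.fsum (word J) (enum (A \<union> B)) A, sum.fsum (word J) (enum (A \<union> B)) B)"
    using Var row_merge[of A B a "enum (A \<union> B)"]
    by (simp add: enum_Cons image_Un[symmetric] del: Un_iff)
  then show ?case
    using Var by (simp add: sum.mu_def sum.fsum_enum filter_enum sum.wsum_def del: Un_iff)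
next
  case Nul
  have "nl (SS (A \<union> B)) \<bullet> (\<ii> zeroC \<otimes>\<^sub>a MM A B) = nl (SS A \<oplus>\<^sub>o SS B)"
    using ann_natural(1)[of "MM A B"] Nul by simp
  then show ?case using Nul by (simp add: coh sum.mu_empty)
next
  case Unt
  have "lT (SS (A \<union> B)) \<bullet> (\<ii> oneC \<otimes>\<^sub>a MM A B) = MM A B \<bullet> lT (SS A \<oplus>\<^sub>o SS B)"
    using prod.unit_natural(1)[of "MM A B"] Unt by simp
  then show ?case using Unt by (simp add: coh(19)[symmetric])
next
  case (Add t u)
  let ?T = "ob J t" and ?U = "ob J u" and ?a = "SS A" and ?b = "SS B"
  have [simp]: "regular t A" "regular t B" "regular u A" "regular u B" "regular t (A \<union> B)" "regular u (A \<union> B)"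
    "finite A" "finite B" "A \<inter> B = {}"
    using Add.prems regular_mono[of t "A \<union> B"] regular_mono[of u "A \<union> B"] by auto
  have [simp]: "mons t (A \<union> B) \<inter> mons u (A \<union> B) = {}" using Add.prems(1) by simp
  then have dj [simp]: "mons t A \<inter> mons u A = {}" "mons t B \<inter> mons u B = {}" "mons t A \<inter> mons u B = {}"
      "mons u A \<inter> mons t B = {}" "mons t A \<inter> mons t B = {}" "mons u A \<inter> mons u B = {}"
    using mons_disjoint[of t A B] mons_disjoint[of u A B]
    by (simp_all add: mons_Un) blast+
  have dj' [simp]: "(mons t A \<union> mons u A) \<inter> (mons t B \<union> mons u B) = {}"
    "(mons t A \<union> mons t B) \<inter> (mons u A \<union> mons u B) = {}"
    using dj by blast+
  let ?ta = "act J t A" and ?tb = "act J t B" and ?ua = "act J u A" and ?ub = "act J u B"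
  have "act J (Add t u) (A \<union> B) \<bullet> (\<ii> (ob J (Add t u)) \<otimes>\<^sub>a MM A B) =
    MM (mons t (A \<union> B)) (mons u (A \<union> B)) \<bullet> (act J t (A \<union> B) \<oplus>\<^sub>a act J u (A \<union> B)) \<bullet>
      (dr (?T, ?U, SS (A \<union> B)) \<bullet> ((\<ii> ?T \<oplus>\<^sub>a \<ii> ?U) \<otimes>\<^sub>a MM A B))"
    by (simp add: cmp_assoc)
  also have "\<dots> = MM (mons t (A \<union> B)) (mons u (A \<union> B)) \<bullet>
      ((act J t (A \<union> B) \<bullet> (\<ii> ?T \<otimes>\<^sub>a MM A B)) \<oplus>\<^sub>a (act J u (A \<union> B) \<bullet> (\<ii> ?U \<otimes>\<^sub>a MM A B))) \<bullet>
      dr (?T, ?U, ?a \<oplus>\<^sub>o ?b)"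
    using dist_natural(2)[of "\<ii> ?T" "\<ii> ?U" "MM A B"]
    by (simp del: sum.tensor_simps(5) add: sum.tensor_simps(5)[of "SS _"] cmp_reduce[OF sum.interchange])
  also have "\<dots> = MM (mons t A \<union> mons t B) (mons u A \<union> mons u B) \<bullet>
      (MM (mons t A) (mons t B) \<oplus>\<^sub>a MM (mons u A) (mons u B)) \<bullet>
      ((?ta \<oplus>\<^sub>a ?tb) \<oplus>\<^sub>a (?ua \<oplus>\<^sub>a ?ub)) \<bullet>
      (dl (?T, ?a, ?b) \<oplus>\<^sub>a dl (?U, ?a, ?b)) \<bullet> dr (?T, ?U, ?a \<oplus>\<^sub>o ?b)"
    by (simp add: Add.IH mons_Un cmp_reduce[OF sum.interchange] cmp_assoc)
  \<comment> \<open>The two orders of expanding the product of two sums differ by the exchange of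
    the middle summands. On the side of words this exchange is then absorbed by
    \<open>sum.mu_middle\<close>.\<close>
  also have "\<dots> = MM (mons t A \<union> mons t B) (mons u A \<union> mons u B) \<bullet>
      (MM (mons t A) (mons t B) \<oplus>\<^sub>a MM (mons u A) (mons u B)) \<bullet>
      (((?ta \<oplus>\<^sub>a ?tb) \<oplus>\<^sub>a (?ua \<oplus>\<^sub>a ?ub)) \<bullet>
      sum.middle (?T \<otimes>\<^sub>o ?a) (?U \<otimes>\<^sub>o ?a) (?T \<otimes>\<^sub>o ?b) (?U \<otimes>\<^sub>o ?b)) \<bullet>
      (dr (?T, ?U, ?a) \<oplus>\<^sub>a dr (?T, ?U, ?b)) \<bullet> dl (?T \<oplus>\<^sub>o ?U, ?a, ?b)"
    by (simp add: dl_dr_middle[symmetric] cmp_assoc)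
  also have "\<dots> = (MM (mons t A \<union> mons t B) (mons u A \<union> mons u B) \<bullet>
      (MM (mons t A) (mons t B) \<oplus>\<^sub>a MM (mons u A) (mons u B)) \<bullet>
      sum.middle (SS (mons t A)) (SS (mons u A)) (SS (mons t B)) (SS (mons u B))) \<bullet>
      ((?ta \<oplus>\<^sub>a ?ua) \<oplus>\<^sub>a (?tb \<oplus>\<^sub>a ?ub)) \<bullet>
      (dr (?T, ?U, ?a) \<oplus>\<^sub>a dr (?T, ?U, ?b)) \<bullet> dl (?T \<oplus>\<^sub>o ?U, ?a, ?b)"
    using sum.middle_natural[of ?ta ?ua ?tb ?ub, symmetric] by (simp add: cmp_assoc)
  also have "\<dots> = MM (mons t A \<union> mons u A) (mons t B \<union> mons u B) \<bullet>
      (MM (mons t A) (mons u A) \<oplus>\<^sub>a MM (mons t B) (mons u B)) \<bullet>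
      ((?ta \<oplus>\<^sub>a ?ua) \<oplus>\<^sub>a (?tb \<oplus>\<^sub>a ?ub)) \<bullet>
      (dr (?T, ?U, ?a) \<oplus>\<^sub>a dr (?T, ?U, ?b)) \<bullet> dl (?T \<oplus>\<^sub>o ?U, ?a, ?b)"
    by (subst sum.mu_middle) (simp_all add: cmp_assoc)
  also have "\<dots> = MM (mons (Add t u) A) (mons (Add t u) B) \<bullet>
      (act J (Add t u) A \<oplus>\<^sub>a act J (Add t u) B) \<bullet> dl (ob J (Add t u), ?a, ?b)"
    by (simp add: cmp_reduce[OF sum.interchange] sum.interchange cmp_assoc)
  finally show ?case .
next
  case (Mul t u)
  let ?T = "ob J t" and ?U = "ob J u" and ?a = "SS A" and ?b = "SS B"
  have [simp]: "regular u A" "regular u B" "regular u (A \<union> B)" "regular t (mons u A \<union> mons u B)"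
    "finite A" "finite B" "A \<inter> B = {}"
    using Mul.prems regular_mono[of u "A \<union> B"] by (auto simp: mons_Un)
  then have [simp]: "mons u A \<inter> mons u B = {}" "regular t (mons u A)" "regular t (mons u B)"
    using mons_disjoint[of u A B] regular_mono[of t "mons u A \<union> mons u B"] by auto
  have [simp]: "mons t (mons u A) \<inter> mons t (mons u B) = {}"
    by (rule mons_disjoint) auto
  let ?ta = "act J t (mons u A)" and ?tb = "act J t (mons u B)" and ?ua = "act J u A" and ?ub = "act J u B"
  have "act J (Mul t u) (A \<union> B) \<bullet> (\<ii> (ob J (Mul t u)) \<otimes>\<^sub>a MM A B) =
    act J t (mons u A \<union> mons u B) \<bullet> (\<ii> ?T \<otimes>\<^sub>a act J u (A \<union> B)) \<bullet> (aT (?T, ?U, SS (A \<union> B)) \<bullet> ((\<ii> ?T \<otimes>\<^sub>a \<ii> ?U) \<otimes>\<^sub>a MM A B))"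
    by (simp add: cmp_assoc mons_Un)
  also have "\<dots> = act J t (mons u A \<union> mons u B) \<bullet> (\<ii> ?T \<otimes>\<^sub>a (act J u (A \<union> B) \<bullet> (\<ii> ?U \<otimes>\<^sub>a MM A B))) \<bullet>
      aT (?T, ?U, ?a \<oplus>\<^sub>o ?b)"
    using prod.assoc_natural[of "\<ii> ?T" "\<ii> ?U" "MM A B"]
    by (simp add: prod.interchange_right mons_Un cmp_assoc)
  also have "\<dots> = (act J t (mons u A \<union> mons u B) \<bullet> (\<ii> ?T \<otimes>\<^sub>a MM (mons u A) (mons u B))) \<bullet>
      (\<ii> ?T \<otimes>\<^sub>a (?ua \<oplus>\<^sub>a ?ub)) \<bullet> (\<ii> ?T \<otimes>\<^sub>a dl (?U, ?a, ?b)) \<bullet> aT (?T, ?U, ?a \<oplus>\<^sub>o ?b)"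
    by (simp add: Mul.IH(2) prod.interchange_right cmp_assoc)
  also have "\<dots> = MM (mons t (mons u A)) (mons t (mons u B)) \<bullet> (?ta \<oplus>\<^sub>a ?tb) \<bullet>
      (dl (?T, SS (mons u A), SS (mons u B)) \<bullet> (\<ii> ?T \<otimes>\<^sub>a (?ua \<oplus>\<^sub>a ?ub))) \<bullet>
      (\<ii> ?T \<otimes>\<^sub>a dl (?U, ?a, ?b)) \<bullet> aT (?T, ?U, ?a \<oplus>\<^sub>o ?b)"
    by (simp add: Mul.IH(1) cmp_assoc)
  also have "\<dots> = MM (mons t (mons u A)) (mons t (mons u B)) \<bullet> (?ta \<oplus>\<^sub>a ?tb) \<bullet>
      ((\<ii> ?T \<otimes>\<^sub>a ?ua) \<oplus>\<^sub>a (\<ii> ?T \<otimes>\<^sub>a ?ub)) \<bullet> (dl (?T, ?U \<otimes>\<^sub>o ?a, ?U \<otimes>\<^sub>o ?b) \<bullet>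
      (\<ii> ?T \<otimes>\<^sub>a dl (?U, ?a, ?b)) \<bullet> aT (?T, ?U, ?a \<oplus>\<^sub>o ?b))"
    using dist_natural(1)[of "\<ii> ?T" ?ua ?ub] by (simp add: cmp_assoc)
  also have "\<dots> = MM (mons t (mons u A)) (mons t (mons u B)) \<bullet> (?ta \<oplus>\<^sub>a ?tb) \<bullet>
      ((\<ii> ?T \<otimes>\<^sub>a ?ua) \<oplus>\<^sub>a (\<ii> ?T \<otimes>\<^sub>a ?ub)) \<bullet> (aT (?T, ?U, ?a) \<oplus>\<^sub>a aT (?T, ?U, ?b)) \<bullet>
      dl (?T \<otimes>\<^sub>o ?U, ?a, ?b)"
    by (simp add: coh(5))
  also have "\<dots> = MM (mons (Mul t u) A) (mons (Mul t u) B) \<bullet>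
      (act J (Mul t u) A \<oplus>\<^sub>a act J (Mul t u) B) \<bullet> dl (ob J (Mul t u), ?a, ?b)"
    by (simp add: cmp_reduce[OF sum.interchange] cmp_assoc)
  finally show ?case .
qed

text \<open>The axiom \<open>coh(3)\<close> moves associativity past the distributivities, its
  naturality moves it past the actions, and \<open>sum.mu_assoc\<close> absorbs it into the
  shuffles. Stated separately because the inverse arrow is a reduction too.\<close>

lemma act_aP:
  assumes "regular (Add t (Add u w)) B" "finite B"
  shows "act J (Add t (Add u w)) B \<bullet> (aP (ob J t, ob J u, ob J w) \<otimes>\<^sub>a \<ii> (SS B)) = act J (Add (Add t u) w) B"
proof -
  let ?T = "ob J t" and ?U = "ob J u" and ?W = "ob J w" and ?b = "SS B"
  have [simp]: "finite B" "regular t B" "regular u B" "regular w B" using assms by auto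
  have dj: "mons t B \<inter> mons u B = {}" "mons t B \<inter> mons w B = {}" "mons u B \<inter> mons w B = {}"
    using assms by auto
  then have dj' [simp]: "mons t B \<inter> (mons u B \<union> mons w B) = {}" "(mons t B \<union> mons u B) \<inter> mons w B = {}" by auto
  note [simp] = dj
  have "act J (Add t (Add u w)) B \<bullet> (aP (?T, ?U, ?W) \<otimes>\<^sub>a \<ii> ?b) =
      MM (mons t B) (mons u B \<union> mons w B) \<bullet> (act J t B \<oplus>\<^sub>a (MM (mons u B) (mons w B) \<bullet> (act J u B \<oplus>\<^sub>a act J w B))) \<bullet>
      (\<ii> (?T \<otimes>\<^sub>o ?b) \<oplus>\<^sub>a dr (?U, ?W, ?b)) \<bullet> dr (?T, ?U \<oplus>\<^sub>o ?W, ?b) \<bullet> (aP (?T, ?U, ?W) \<otimes>\<^sub>a \<ii> ?b)"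
    by (simp add: cmp_assoc cmp_reduce[OF sum.interchange])
  also have "\<dots> = MM (mons t B) (mons u B \<union> mons w B) \<bullet> (act J t B \<oplus>\<^sub>a (MM (mons u B) (mons w B) \<bullet> (act J u B \<oplus>\<^sub>a act J w B))) \<bullet>
      aP (?T \<otimes>\<^sub>o ?b, ?U \<otimes>\<^sub>o ?b, ?W \<otimes>\<^sub>o ?b) \<bullet> (dr (?T, ?U, ?b) \<oplus>\<^sub>a \<ii> (?W \<otimes>\<^sub>o ?b)) \<bullet> dr (?T \<oplus>\<^sub>o ?U, ?W, ?b)"
    by (simp add: coh(3))
  also have "\<dots> = MM (mons t B) (mons u B \<union> mons w B) \<bullet> (\<ii> (SS (mons t B)) \<oplus>\<^sub>a MM (mons u B) (mons w B)) \<bullet>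
      ((act J t B \<oplus>\<^sub>a (act J u B \<oplus>\<^sub>a act J w B)) \<bullet>
      aP (?T \<otimes>\<^sub>o ?b, ?U \<otimes>\<^sub>o ?b, ?W \<otimes>\<^sub>o ?b)) \<bullet> (dr (?T, ?U, ?b) \<oplus>\<^sub>a \<ii> (?W \<otimes>\<^sub>o ?b)) \<bullet> dr (?T \<oplus>\<^sub>o ?U, ?W, ?b)"
    by (simp add: cmp_assoc cmp_reduce[OF sum.interchange])
  also have "\<dots> = (MM (mons t B) (mons u B \<union> mons w B) \<bullet> (\<ii> (SS (mons t B)) \<oplus>\<^sub>a MM (mons u B) (mons w B)) \<bullet>
      aP (SS (mons t B), SS (mons u B), SS (mons w B))) \<bullet>
      ((act J t B \<oplus>\<^sub>a act J u B) \<oplus>\<^sub>a act J w B) \<bullet> (dr (?T, ?U, ?b) \<oplus>\<^sub>a \<ii> (?W \<otimes>\<^sub>o ?b)) \<bullet> dr (?T \<oplus>\<^sub>o ?U, ?W, ?b)"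
    using sum.assoc_natural[of "act J t B" "act J u B" "act J w B", symmetric] by (simp add: cmp_assoc)
  also have "\<dots> = MM (mons t B \<union> mons u B) (mons w B) \<bullet> (MM (mons t B) (mons u B) \<oplus>\<^sub>a \<ii> (SS (mons w B))) \<bullet>
      ((act J t B \<oplus>\<^sub>a act J u B) \<oplus>\<^sub>a act J w B) \<bullet> (dr (?T, ?U, ?b) \<oplus>\<^sub>a \<ii> (?W \<otimes>\<^sub>o ?b)) \<bullet> dr (?T \<oplus>\<^sub>o ?U, ?W, ?b)"
    by (simp add: sum.mu_assoc[symmetric] cmp_assoc)
  also have "\<dots> = act J (Add (Add t u) w) B"
    by (simp add: cmp_assoc cmp_reduce[OF sum.interchange])
  finally show ?thesis .
qed

lemma act_rP:
  assumes "regular t B" "finite B"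
  shows "act J t B \<bullet> (rP (ob J t) \<otimes>\<^sub>a \<ii> (SS B)) = act J (Add t Nul) B"
proof -
  let ?T = "ob J t" and ?b = "SS B"
  have [simp]: "finite B" "regular t B" using assms by auto
  \<comment> \<open>Shuffles with the empty set on the left are known; commutativity of shuffles
    transfers this to the right.\<close>
  have unit: "MM (mons t B) {} = rP (SS (mons t B))"
    using sum.mu_comm[of "word J" "mons t B" "{}"] sum.lunit_sym[of "SS (mons t B)"] by (simp add: sum.mu_empty)
  have "act J t B \<bullet> (rP ?T \<otimes>\<^sub>a \<ii> ?b) = (act J t B \<bullet> rP (?T \<otimes>\<^sub>o ?b)) \<bullet> (\<ii> (?T \<otimes>\<^sub>o ?b) \<oplus>\<^sub>a nl ?b) \<bullet> dr (?T, zeroC, ?b)"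
    by (simp add: coh(18)[symmetric] cmp_assoc)
  also have "\<dots> = rP (SS (mons t B)) \<bullet> ((act J t B \<oplus>\<^sub>a \<ii> zeroC) \<bullet> (\<ii> (?T \<otimes>\<^sub>o ?b) \<oplus>\<^sub>a nl ?b)) \<bullet> dr (?T, zeroC, ?b)"
    using sum.unit_natural(2)[of "act J t B", symmetric] by (simp add: cmp_assoc)
  also have "\<dots> = act J (Add t Nul) B"
    by (simp add: sum.interchange unit)
  finally show ?thesis .
qed

lemma act_inv:
  assumes "act J u B \<bullet> (f \<otimes>\<^sub>a \<ii> (SS B)) = act J t B" "iso f" "Dom C f = ob J t" "Cod C f = ob J u"
    "regular u B" "finite B"
  shows "act J t B \<bullet> (inv_arr f \<otimes>\<^sub>a \<ii> (SS B)) = act J u B"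
  unfolding assms(1)[symmetric] using assms(2-) by (simp add: cmp_assoc prod.interchange)

lemma red_iso:
  assumes "red J t u f"
  shows "iso f" "f \<in> Arr C" "Dom C f = ob J t" "Cod C f = ob J u"
proof -
  have "iso f \<and> Dom C f = ob J t \<and> Cod C f = ob J u"
    using assms by induction auto
  then show "iso f" "f \<in> Arr C" "Dom C f = ob J t" "Cod C f = ob J u" by auto
qed

lemma co_refl: "regular t B \<Longrightarrow> finite B \<Longrightarrow> co J B t t (\<ii> (ob J t))"
  by (simp add: co_def)

lemma co_inv: "co J B t u f \<Longrightarrow> finite B \<Longrightarrow> co J B u t (inv_arr f)"
  using act_inv[of u B f t] by (auto simp: co_def)

lemma co_trans:
  assumes "co J B t u f" "co J B u w g" "finite B"
  shows "co J B t w (g \<bullet> f)"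
proof -
  have eq: "act J w B \<bullet> (g \<otimes>\<^sub>a \<ii> (SS B)) = act J u B" using assms by (simp add: co_def)
  have "act J w B \<bullet> ((g \<bullet> f) \<otimes>\<^sub>a \<ii> (SS B)) = act J u B \<bullet> (f \<otimes>\<^sub>a \<ii> (SS B))"
    using assms by (simp add: co_def prod.interchange_left cmp_reduce[OF eq])
  then show ?thesis using assms by (simp add: co_def)
qed

lemma co_Add:
  assumes "co J B t t' f" "co J B u u' g" "mons t B \<inter> mons u B = {}" and [simp]: "finite B"
  shows "co J B (Add t u) (Add t' u') (f \<oplus>\<^sub>a g)"
proof -
  have [simp]: "regular t B" "regular u B" "regular t' B" "mons t' B = mons t B" "regular u' B" "mons u' B = mons u B"
    "act J t' B \<bullet> (f \<otimes>\<^sub>a \<ii> (SS B)) = act J t B" "act J u' B \<bullet> (g \<otimes>\<^sub>a \<ii> (SS B)) = act J u B"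
    "iso f" "Dom C f = ob J t" "Cod C f = ob J t'" "iso g" "Dom C g = ob J u" "Cod C g = ob J u'"
    "mons t B \<inter> mons u B = {}"
    using assms by (auto simp: co_def)
  have "act J (Add t' u') B \<bullet> ((f \<oplus>\<^sub>a g) \<otimes>\<^sub>a \<ii> (SS B)) = MM (mons t B) (mons u B) \<bullet> (act J t' B \<oplus>\<^sub>a act J u' B) \<bullet>
      (dr (ob J t', ob J u', SS B) \<bullet> ((f \<oplus>\<^sub>a g) \<otimes>\<^sub>a \<ii> (SS B)))"
    by (simp add: cmp_assoc)
  also have "\<dots> = act J (Add t u) B"
    using dist_natural(2)[of f g "\<ii> (SS B)"] by (simp add: cmp_reduce[OF sum.interchange])
  finally show ?thesis by (simp add: co_def del: act.simps)
qed

text \<open>Since \<open>u\<close> acts before \<open>t\<close>, compatibility of \<open>f\<close>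
  is required at the set \<open>mons u B\<close>, on which \<open>t\<close> and \<open>t'\<close>
  act.\<close>

lemma co_Mul:
  assumes "co J (mons u B) t t' f" "co J B u u' g" and [simp]: "finite B"
  shows "co J B (Mul t u) (Mul t' u') (f \<otimes>\<^sub>a g)"
proof -
  have [simp]: "regular u B" "regular t (mons u B)" "regular u' B" "mons u' B = mons u B"
    "act J u' B \<bullet> (g \<otimes>\<^sub>a \<ii> (SS B)) = act J u B"
    "regular t' (mons u B)" "mons t' (mons u B) = mons t (mons u B)"
    "act J t' (mons u B) \<bullet> (f \<otimes>\<^sub>a \<ii> (SS (mons u B))) = act J t (mons u B)"
    "iso f" "Dom C f = ob J t" "Cod C f = ob J t'" "iso g" "Dom C g = ob J u" "Cod C g = ob J u'"
    using assms by (auto simp: co_def)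
  have "act J (Mul t' u') B \<bullet> ((f \<otimes>\<^sub>a g) \<otimes>\<^sub>a \<ii> (SS B)) = act J t' (mons u B) \<bullet> (\<ii> (ob J t') \<otimes>\<^sub>a act J u' B) \<bullet>
      (aT (ob J t', ob J u', SS B) \<bullet> ((f \<otimes>\<^sub>a g) \<otimes>\<^sub>a \<ii> (SS B)))"
    by (simp add: cmp_assoc)
  also have "\<dots> = act J t' (mons u B) \<bullet> (f \<otimes>\<^sub>a (act J u' B \<bullet> (g \<otimes>\<^sub>a \<ii> (SS B)))) \<bullet> aT (ob J t, ob J u, SS B)"
    using prod.assoc_natural[of f g "\<ii> (SS B)"] by (simp add: cmp_reduce[OF prod.interchange])
  also have "\<dots> = act J t' (mons u B) \<bullet> ((f \<otimes>\<^sub>a \<ii> (SS (mons u B))) \<bullet> (\<ii> (ob J t) \<otimes>\<^sub>a act J u B)) \<bullet> aT (ob J t, ob J u, SS B)"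
    by (simp add: prod.interchange)
  also have "\<dots> = act J (Mul t u) B"
    by (simp add: cmp_reduce[of "act J t' (mons u B)"] cmp_assoc)
  finally show ?thesis by (simp add: co_def del: act.simps)
qed

text \<open>The action of \<open>u\<close> is invertible, so \<open>f\<close> and \<open>g\<close>
  agree after tensoring with the sum over \<open>{[]}\<close>. This sum is
  \<open>oneC \<oplus>\<^sub>o zeroC\<close>, hence isomorphic to the unit by
  \<open>rP oneC\<close>, and tensoring with the unit is faithful.\<close>

lemma co_unique:
  assumes "co J {[]} t u f" "co J {[]} t u g"
  shows "f = g"
proof -
  have [simp]: "iso f" "iso g" "Dom C f = ob J t" "Cod C f = ob J u" "Dom C g = ob J t" "Cod C g = ob J u" "regular u {[]}"
    using assms by (auto simp: co_def)
  have SS: "SS {[]} = oneC \<oplus>\<^sub>o zeroC" by (simp add: sum.wsum_def)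
  have "act J u {[]} \<bullet> (f \<otimes>\<^sub>a \<ii> (SS {[]})) = act J u {[]} \<bullet> (g \<otimes>\<^sub>a \<ii> (SS {[]}))"
    using assms by (simp add: co_def)
  then have eq: "f \<otimes>\<^sub>a \<ii> (SS {[]}) = g \<otimes>\<^sub>a \<ii> (SS {[]})"
    by (rule iso_cancel_left) auto
  have "(f \<otimes>\<^sub>a \<ii> oneC) \<bullet> (\<ii> (ob J t) \<otimes>\<^sub>a rP oneC) = (\<ii> (ob J u) \<otimes>\<^sub>a rP oneC) \<bullet> (f \<otimes>\<^sub>a \<ii> (SS {[]}))"
    by (simp add: prod.interchange SS)
  also have "\<dots> = (g \<otimes>\<^sub>a \<ii> oneC) \<bullet> (\<ii> (ob J t) \<otimes>\<^sub>a rP oneC)"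
    unfolding eq by (simp add: prod.interchange SS)
  finally have "f \<otimes>\<^sub>a \<ii> oneC = g \<otimes>\<^sub>a \<ii> oneC" by (rule iso_cancel_right) auto
  then show ?thesis by (rule prod.tensor_unit_faithful(2)[rotated 4]) auto
qed

text \<open>Each generator is settled by the axiom describing its product with a further factor:
  symmetry and units of the sum by \<open>dr_sP\<close>, \<open>dr_lP\<close> and
  \<open>dr_rP\<close>, associativity and units of the product by pentagon,
  \<open>prod.lunit_tensor\<close> and triangle, \<open>dr\<close> by \<open>dr_aT\<close>,
  \<open>nl\<close> by \<open>nl_times\<close>. Only \<open>dl\<close> and \<open>nr\<close> also
  need the behaviour of the action on shuffles and on the empty set.\<close>

lemma red_co: "red J t u f \<Longrightarrow> finite B \<Longrightarrow> regular t B \<Longrightarrow> co J B t u f"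
proof -
  \<comment> \<open>This is \<open>co\<close> without its typing part, which \<open>red_iso\<close>
    provides for every reduction. \<open>B\<close> has to vary in the induction because a product
    evaluates its left factor at another set.\<close>
  have "regular u B \<and> mons u B = mons t B \<and> act J u B \<bullet> (f \<otimes>\<^sub>a \<ii> (SS B)) = act J t B"
    if "red J t u f" "finite B" "regular t B"
  using that
proof (induction arbitrary: B)
  case (refl t)
  then show ?case by simp
next
  case (trans t u f w g)
  then show ?case
    using co_trans[of B t u f w g] red_iso[OF trans(1)] red_iso[OF trans(2)] by (auto simp: co_def)
next
  case (Add t t' f u u' g)
  then show ?case
    using co_Add[of B t t' f u u' g] red_iso[OF Add(1)] red_iso[OF Add(2)]
    by (auto simp: co_def simp del: act.simps)
next
  case (Mul t t' f u u' g)
  then show ?case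
    using co_Mul[of u B t t' f u' g] red_iso[OF Mul(1)] red_iso[OF Mul(2)]
    by (auto simp: co_def simp del: act.simps)
next
  case (aP t u w)
  then show ?case
    using act_aP[of t u w B] by (auto simp del: act.simps simp: Int_Un_distrib Int_Un_distrib2)
next
  case (sP t u)
  let ?T = "ob J t" and ?U = "ob J u" and ?b = "SS B"
  have [simp]: "finite B" "regular t B" "regular u B" "mons t B \<inter> mons u B = {}" "mons u B \<inter> mons t B = {}" using sP by auto
  have "act J (Add u t) B \<bullet> (sP (?T, ?U) \<otimes>\<^sub>a \<ii> ?b) =
      MM (mons u B) (mons t B) \<bullet> ((act J u B \<oplus>\<^sub>a act J t B) \<bullet> sP (?T \<otimes>\<^sub>o ?b, ?U \<otimes>\<^sub>o ?b)) \<bullet> dr (?T, ?U, ?b)"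
    by (simp add: coh(2) cmp_assoc)
  also have "\<dots> = (MM (mons u B) (mons t B) \<bullet> sP (SS (mons t B), SS (mons u B))) \<bullet> (act J t B \<oplus>\<^sub>a act J u B) \<bullet> dr (?T, ?U, ?b)"
    using sum.sym_natural[of "act J t B" "act J u B", symmetric] by (simp add: cmp_assoc)
  also have "\<dots> = act J (Add t u) B"
    by (simp add: sum.mu_comm)
  finally show ?case by (simp add: Un_commute)
next
  case (lP t)
  let ?T = "ob J t" and ?b = "SS B"
  have [simp]: "finite B" "regular t B" using lP by auto
  have "act J t B \<bullet> (lP ?T \<otimes>\<^sub>a \<ii> ?b) = (act J t B \<bullet> lP (?T \<otimes>\<^sub>o ?b)) \<bullet> (nl ?b \<oplus>\<^sub>a \<ii> (?T \<otimes>\<^sub>o ?b)) \<bullet> dr (zeroC, ?T, ?b)"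
    by (simp add: coh(17)[symmetric] cmp_assoc)
  also have "\<dots> = lP (SS (mons t B)) \<bullet> ((\<ii> zeroC \<oplus>\<^sub>a act J t B) \<bullet> (nl ?b \<oplus>\<^sub>a \<ii> (?T \<otimes>\<^sub>o ?b))) \<bullet> dr (zeroC, ?T, ?b)"
    using sum.unit_natural(1)[of "act J t B", symmetric] by (simp add: cmp_assoc)
  also have "\<dots> = act J (Add Nul t) B"
    by (simp add: sum.interchange sum.mu_empty)
  finally show ?case by simp
next
  case (rP t)
  then show ?case by (simp del: act.simps add: act_rP)
next
  case (aT t u w)
  let ?T = "ob J t" and ?U = "ob J u" and ?W = "ob J w" and ?b = "SS B"
  have [simp]: "finite B" "regular t (mons u (mons w B))" "regular u (mons w B)" "regular w B" using aT by auto
  have "act J (Mul t (Mul u w)) B \<bullet> (aT (?T, ?U, ?W) \<otimes>\<^sub>a \<ii> ?b) =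
      act J t (mons u (mons w B)) \<bullet> (\<ii> ?T \<otimes>\<^sub>a act J u (mons w B)) \<bullet> (\<ii> ?T \<otimes>\<^sub>a (\<ii> ?U \<otimes>\<^sub>a act J w B)) \<bullet>
      (\<ii> ?T \<otimes>\<^sub>a aT (?U, ?W, ?b)) \<bullet> aT (?T, ?U \<otimes>\<^sub>o ?W, ?b) \<bullet> (aT (?T, ?U, ?W) \<otimes>\<^sub>a \<ii> ?b)"
    by (simp add: prod.interchange_right cmp_assoc)
  also have "\<dots> = act J t (mons u (mons w B)) \<bullet> (\<ii> ?T \<otimes>\<^sub>a act J u (mons w B)) \<bullet> ((\<ii> ?T \<otimes>\<^sub>a (\<ii> ?U \<otimes>\<^sub>a act J w B)) \<bullet>
      aT (?T, ?U, ?W \<otimes>\<^sub>o ?b)) \<bullet> aT (?T \<otimes>\<^sub>o ?U, ?W, ?b)"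
    by (simp add: prod.pentagon[symmetric] cmp_assoc)
  also have "\<dots> = act J (Mul (Mul t u) w) B"
    using prod.assoc_natural[of "\<ii> ?T" "\<ii> ?U" "act J w B", symmetric] by (simp add: cmp_assoc)
  finally show ?case by simp
next
  case (lT t)
  let ?T = "ob J t" and ?b = "SS B"
  have [simp]: "finite B" "regular t B" using lT by auto
  have "act J t B \<bullet> (lT ?T \<otimes>\<^sub>a \<ii> ?b) = (act J t B \<bullet> lT (?T \<otimes>\<^sub>o ?b)) \<bullet> aT (oneC, ?T, ?b)"
    by (simp add: prod.lunit_tensor[symmetric] cmp_assoc)
  also have "\<dots> = act J (Mul Unt t) B"
    using prod.unit_natural(1)[of "act J t B", symmetric] by (simp add: cmp_assoc)
  finally show ?case by simp
next
  case (rT t)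
  have [simp]: "finite B" "regular t B" using rT by auto
  show ?case by (simp add: prod.triangle)
next
  case (dl t u w)
  let ?T = "ob J t" and ?U = "ob J u" and ?W = "ob J w" and ?b = "SS B"
  have [simp]: "finite B" "regular u B" "regular w B" "mons u B \<inter> mons w B = {}" and reg: "regular t (mons u B \<union> mons w B)"
    using dl by auto
  have [simp]: "regular t (mons u B)" "regular t (mons w B)" by (rule regular_mono[OF reg]; simp)+
  have [simp]: "mons t (mons u B) \<inter> mons t (mons w B) = {}" using reg by (rule mons_disjoint) simp
  note [simp] = reg
  \<comment> \<open>Here \<open>t\<close> acts on a shuffle; \<open>act_mu\<close> splits this
    action, and \<open>coh(7)\<close> compares the two distributivities.\<close>
  have "act J (Mul t (Add u w)) B =
      (act J t (mons u B \<union> mons w B) \<bullet> (\<ii> ?T \<otimes>\<^sub>a MM (mons u B) (mons w B))) \<bullet> (\<ii> ?T \<otimes>\<^sub>a (act J u B \<oplus>\<^sub>a act J w B)) \<bullet>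
      (\<ii> ?T \<otimes>\<^sub>a dr (?U, ?W, ?b)) \<bullet> aT (?T, ?U \<oplus>\<^sub>o ?W, ?b)"
    by (simp add: prod.interchange_right cmp_assoc)
  also have "\<dots> = MM (mons t (mons u B)) (mons t (mons w B)) \<bullet> (act J t (mons u B) \<oplus>\<^sub>a act J t (mons w B)) \<bullet>
      (dl (?T, SS (mons u B), SS (mons w B)) \<bullet> (\<ii> ?T \<otimes>\<^sub>a (act J u B \<oplus>\<^sub>a act J w B))) \<bullet>
      (\<ii> ?T \<otimes>\<^sub>a dr (?U, ?W, ?b)) \<bullet> aT (?T, ?U \<oplus>\<^sub>o ?W, ?b)"
    by (simp add: act_mu cmp_assoc)
  also have "\<dots> = MM (mons t (mons u B)) (mons t (mons w B)) \<bullet> (act J t (mons u B) \<oplus>\<^sub>a act J t (mons w B)) \<bullet>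
      ((\<ii> ?T \<otimes>\<^sub>a act J u B) \<oplus>\<^sub>a (\<ii> ?T \<otimes>\<^sub>a act J w B)) \<bullet>
      (dl (?T, ?U \<otimes>\<^sub>o ?b, ?W \<otimes>\<^sub>o ?b) \<bullet> (\<ii> ?T \<otimes>\<^sub>a dr (?U, ?W, ?b)) \<bullet> aT (?T, ?U \<oplus>\<^sub>o ?W, ?b))"
    using dist_natural(1)[of "\<ii> ?T" "act J u B" "act J w B"] by (simp add: cmp_assoc)
  also have "\<dots> = act J (Add (Mul t u) (Mul t w)) B \<bullet> (dl (?T, ?U, ?W) \<otimes>\<^sub>a \<ii> ?b)"
    by (simp add: coh(7) cmp_reduce[OF sum.interchange] cmp_assoc)
  finally show ?case by (simp add: mons_Un)
next
  case (dr t u w)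
  let ?T = "ob J t" and ?U = "ob J u" and ?W = "ob J w" and ?b = "SS B" and ?B = "mons w B"
  have [simp]: "finite B" "regular w B" "regular t ?B" "regular u ?B" "mons t ?B \<inter> mons u ?B = {}"
    using dr by auto
  have "act J (Mul (Add t u) w) B = MM (mons t ?B) (mons u ?B) \<bullet> (act J t ?B \<oplus>\<^sub>a act J u ?B) \<bullet>
      (dr (?T, ?U, SS ?B) \<bullet> (\<ii> (?T \<oplus>\<^sub>o ?U) \<otimes>\<^sub>a act J w B)) \<bullet> aT (?T \<oplus>\<^sub>o ?U, ?W, ?b)"
    by (simp add: cmp_assoc)
  also have "\<dots> = MM (mons t ?B) (mons u ?B) \<bullet> (act J t ?B \<oplus>\<^sub>a act J u ?B) \<bullet>
      ((\<ii> ?T \<otimes>\<^sub>a act J w B) \<oplus>\<^sub>a (\<ii> ?U \<otimes>\<^sub>a act J w B)) \<bullet> dr (?T, ?U, ?W \<otimes>\<^sub>o ?b) \<bullet> aT (?T \<oplus>\<^sub>o ?U, ?W, ?b)"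
    using dist_natural(2)[of "\<ii> ?T" "\<ii> ?U" "act J w B"] by (simp add: cmp_assoc)
  also have "\<dots> = act J (Add (Mul t w) (Mul u w)) B \<bullet> (dr (?T, ?U, ?W) \<otimes>\<^sub>a \<ii> ?b)"
    by (simp add: coh(6)[symmetric] cmp_reduce[OF sum.interchange] cmp_assoc)
  finally show ?case by simp
next
  case (nl t)
  let ?T = "ob J t" and ?b = "SS B"
  have [simp]: "finite B" "regular t B" using nl by auto
  have "act J (Mul Nul t) B = (nl (SS (mons t B)) \<bullet> (\<ii> zeroC \<otimes>\<^sub>a act J t B)) \<bullet> aT (zeroC, ?T, ?b)"
    by (simp add: cmp_assoc)
  also have "\<dots> = act J Nul B \<bullet> (nl ?T \<otimes>\<^sub>a \<ii> ?b)"
    using ann_natural(1)[of "act J t B"] by (simp add: coh(15))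
  finally show ?case by simp
next
  case (nr t)
  have [simp]: "finite B" using nr by auto
  show ?case by (simp add: act_empty coh(14))
next
  case (aP_inv t u w)
  then show ?case
    using act_inv[OF act_aP, of t u w B] by (auto simp del: act.simps)
next
  case (rP_inv t)
  then show ?case using act_inv[OF act_rP, of t B] by (auto simp del: act.simps)
next
  case (rT_inv t)
  have "act J t B \<bullet> (rT (ob J t) \<otimes>\<^sub>a \<ii> (SS B)) = act J (Mul t Unt) B"
    using rT_inv by (simp add: prod.triangle)
  from act_inv[OF this] rT_inv show ?case by (auto simp del: act.simps)
qed
  then show "red J t u f \<Longrightarrow> finite B \<Longrightarrow> regular t B \<Longrightarrow> co J B t u f"
    using red_iso by (auto simp: co_def)
qed

text \<open>Reductions carry regularity forward only. Both \<open>t\<close> and \<open>u\<close>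
  must be regular, after which their common target is regular and the second leg can be
  inverted.\<close>

lemma span_co: "span J t u f \<Longrightarrow> finite B \<Longrightarrow> regular t B \<Longrightarrow> regular u B \<Longrightarrow> co J B t u f"
  unfolding span_def using co_trans co_inv red_co by blast

lemma span_simps:
  assumes "span J t u f"
  shows "iso f" "Dom C f = ob J t" "Cod C f = ob J u"
  using assms by (auto simp: span_def red_iso)

end

section \<open>Evaluation of terms at arrows, naturality and substitution\<close>

primrec t_ar :: "('o, 'a) cat \<Rightarrow> ('o, 'a) bifunctor \<Rightarrow> 'o \<Rightarrow> ('o, 'a) bifunctor \<Rightarrow> 'o \<Rightarrow> ('v \<Rightarrow> 'a) \<Rightarrow> 'v rig_term \<Rightarrow> 'a" where
  "t_ar C P z T e h (Var a) = h a"
| "t_ar C P z T e h Nul = Idn C z"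
| "t_ar C P z T e h Unt = Idn C e"
| "t_ar C P z T e h (Add t u) = FAr P (t_ar C P z T e h t, t_ar C P z T e h u)"
| "t_ar C P z T e h (Mul t u) = FAr T (t_ar C P z T e h t, t_ar C P z T e h u)"

primrec t_sub :: "('v \<Rightarrow> 'w rig_term) \<Rightarrow> 'v rig_term \<Rightarrow> 'w rig_term" where
  "t_sub s (Var a) = s a"
| "t_sub s Nul = Nul"
| "t_sub s Unt = Unt"
| "t_sub s (Add t u) = Add (t_sub s t) (t_sub s u)"
| "t_sub s (Mul t u) = Mul (t_sub s t) (t_sub s u)"

lemma t_ob_sub: "t_ob P z T e J (t_sub s t) = t_ob P z T e (\<lambda>a. t_ob P z T e J (s a)) t"
  by (induction t) simp_all

text \<open>Only what is required to evaluate terms, without structure isomorphisms. It is used for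
  \<open>C\<close> and also for \<open>C^L\<close>, where terms have to make sense before coherence
  is established.\<close>

locale rig_data = category C
  for C :: "('o, 'a) cat" (structure) +
  fixes plusC :: "('o, 'a) bifunctor" and zeroC :: 'o and timesC :: "('o, 'a) bifunctor" and oneC :: 'o
  assumes plus_functor: "is_functor (C \<times>\<^sub>C C) C plusC"
    and times_functor: "is_functor (C \<times>\<^sub>C C) C timesC"
    and zero_Obj [simp]: "zeroC \<in> Obj C"
    and one_Obj [simp]: "oneC \<in> Obj C"
begin

lemmas plus_simps [simp] = bifunctor_simps(1-5,7)[OF plus_functor]
lemmas times_simps [simp] = bifunctor_simps(1-5,7)[OF times_functor]
lemmas plus_Cmp = bifunctor_simps(6)[OF plus_functor]
lemmas times_Cmp = bifunctor_simps(6)[OF times_functor]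

abbreviation "tob \<equiv> t_ob plusC zeroC timesC oneC"
abbreviation "tar \<equiv> t_ar C plusC zeroC timesC oneC"

lemma tob_Obj [simp]: "(\<And>a. J a \<in> Obj C) \<Longrightarrow> tob J t \<in> Obj C"
  by (induction t) auto

lemma tar_simps [simp]:
  assumes "\<And>a. h a \<in> Arr C"
  shows "tar h t \<in> Arr C" "Dom C (tar h t) = tob (\<lambda>a. Dom C (h a)) t" "Cod C (tar h t) = tob (\<lambda>a. Cod C (h a)) t"
proof -
  have "tar h t \<in> Arr C \<and> Dom C (tar h t) = tob (\<lambda>a. Dom C (h a)) t \<and> Cod C (tar h t) = tob (\<lambda>a. Cod C (h a)) t"
    using assms by (induction t) auto
  then show "tar h t \<in> Arr C" "Dom C (tar h t) = tob (\<lambda>a. Dom C (h a)) t" "Cod C (tar h t) = tob (\<lambda>a. Cod C (h a)) t"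
    by auto
qed

lemma tar_Idn: "(\<And>a. J a \<in> Obj C) \<Longrightarrow> tar (\<lambda>a. Idn C (J a)) t = Idn C (tob J t)"
  by (induction t) auto

lemma tar_Cmp:
  assumes "\<And>a. h a \<in> Arr C" "\<And>a. k a \<in> Arr C" "\<And>a. Dom C (k a) = Cod C (h a)"
  shows "tar (\<lambda>a. k a \<bullet> h a) t = tar k t \<bullet> tar h t"
  using assms by (induction t) (auto simp: plus_Cmp times_Cmp)

end

context coherent_distributive_category begin

lemma rig_data: "rig_data C plusC zeroC timesC oneC"
  by (simp add: rig_data_def rig_data_axioms_def sum.category_axioms sum.T_functor prod.T_functor)

abbreviation ar :: "('v \<Rightarrow> 'a) \<Rightarrow> 'v rig_term \<Rightarrow> 'a" where
  "ar \<equiv> t_ar C plusC zeroC timesC oneC"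

lemma ar_simps [simp]:
  "ar h (Add t u) = ar h t \<oplus>\<^sub>a ar h u" "ar h (Mul t u) = ar h t \<otimes>\<^sub>a ar h u"
  by (simp_all add: sum.tar_def prod.tar_def)

declare t_ar.simps(4,5) [simp del]

lemma ar_typing [simp]:
  assumes "\<And>a. h a \<in> Arr C"
  shows "ar h t \<in> Arr C" "Dom C (ar h t) = ob (\<lambda>a. Dom C (h a)) t" "Cod C (ar h t) = ob (\<lambda>a. Cod C (h a)) t"
  using rig_data.tar_simps[OF rig_data, of h] assms by simp_all

text \<open>Turns the naturality square of an isomorphism into that of its inverse.\<close>

lemma inv_natural:
  assumes "k \<bullet> f = g \<bullet> h" "iso f" "iso g" "h \<in> Arr C" "k \<in> Arr C"
    "Dom C k = Cod C f" "Dom C h = Dom C f" "Cod C h = Dom C g" "Cod C k = Cod C g"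
  shows "h \<bullet> inv_arr f = inv_arr g \<bullet> k"
proof -
  have "(h \<bullet> inv_arr f) \<bullet> f = inv_arr g \<bullet> (g \<bullet> h)" using assms(2-) by (simp add: cmp_assoc inv_reduce)
  also have "\<dots> = (inv_arr g \<bullet> k) \<bullet> f" unfolding assms(1)[symmetric] using assms(2-) by (simp add: cmp_assoc)
  finally show ?thesis by (rule iso_cancel_right) (use assms in auto)
qed

text \<open>A reduction is a formal recipe: applying the same rules in the environment of codomains
  gives \<open>g\<close>, and the square commutes because every generator is natural. The arrow
  \<open>g\<close> is only asserted to exist since \<open>red\<close> does not record the recipe;
  uniqueness identifies it later.\<close>

lemma red_natural:
  assumes "red (\<lambda>a. Dom C (h a)) t u f" and h [simp]: "\<And>a. h a \<in> Arr C"
  shows "\<exists>g. red (\<lambda>a. Cod C (h a)) t u g \<and> ar h u \<bullet> f = g \<bullet> ar h t"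
proof -
  interpret D: coherent_env C plusC zeroC aP lP rP plus_o plus_a sP timesC oneC aT lT rT
    times_o times_a dl dr nl nr \<i> "\<lambda>a. Dom C (h a)" by unfold_locales auto
  interpret E: coherent_env C plusC zeroC aP lP rP plus_o plus_a sP timesC oneC aT lT rT
    times_o times_a dl dr nl nr \<i> "\<lambda>a. Cod C (h a)" by unfold_locales auto
  show ?thesis
    using assms(1)
  proof induction
    case (refl t)
    show ?case by (intro exI conjI, rule red.refl) simp
  next
    case (trans t u f w g)
    then obtain f' g' where *: "red (\<lambda>a. Cod C (h a)) t u f'" "red (\<lambda>a. Cod C (h a)) u w g'"
      and f: "ar h u \<bullet> f = f' \<bullet> ar h t" and g: "ar h w \<bullet> g = g' \<bullet> ar h u" by auto
    note [simp] = D.red_iso[OF trans(1)] D.red_iso[OF trans(2)] E.red_iso[OF *(1)] E.red_iso[OF *(2)]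
    have "ar h w \<bullet> g \<bullet> f = g' \<bullet> ar h u \<bullet> f"
      by (simp add: cmp_reduce[OF g] cmp_assoc)
    also have "\<dots> = (g' \<bullet> f') \<bullet> ar h t" by (simp add: f cmp_assoc)
    finally show ?case using red.trans[OF *] by blast
  next
    case (Add t t' f u u' g)
    then obtain f' g' where *: "red (\<lambda>a. Cod C (h a)) t t' f'" "red (\<lambda>a. Cod C (h a)) u u' g'"
      and fg: "ar h t' \<bullet> f = f' \<bullet> ar h t" "ar h u' \<bullet> g = g' \<bullet> ar h u" by auto
    note [simp] = D.red_iso[OF Add(1)] D.red_iso[OF Add(2)] E.red_iso[OF *(1)] E.red_iso[OF *(2)]
    have "ar h (Add t' u') \<bullet> (f \<oplus>\<^sub>a g) = (f' \<oplus>\<^sub>a g') \<bullet> ar h (Add t u)"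
      by (simp add: sum.interchange fg)
    then show ?case using red.Add[OF *] by blast
  next
    case (Mul t t' f u u' g)
    then obtain f' g' where *: "red (\<lambda>a. Cod C (h a)) t t' f'" "red (\<lambda>a. Cod C (h a)) u u' g'"
      and fg: "ar h t' \<bullet> f = f' \<bullet> ar h t" "ar h u' \<bullet> g = g' \<bullet> ar h u" by auto
    note [simp] = D.red_iso[OF Mul(1)] D.red_iso[OF Mul(2)] E.red_iso[OF *(1)] E.red_iso[OF *(2)]
    have "ar h (Mul t' u') \<bullet> (f \<otimes>\<^sub>a g) = (f' \<otimes>\<^sub>a g') \<bullet> ar h (Mul t u)"
      by (simp add: prod.interchange fg)
    then show ?case using red.Mul[OF *] by blast
  next
    case (aP t u w)
    show ?case
      by (intro exI conjI, rule red.aP, use sum.assoc_natural[of "ar h t" "ar h u" "ar h w"] in simp)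
  next
    case (aP_inv t u w)
    show ?case
      by (intro exI conjI, rule red.aP_inv, rule inv_natural, use sum.assoc_natural[of "ar h t" "ar h u" "ar h w"] in simp_all)
  next
    case (sP t u)
    show ?case
      by (intro exI conjI, rule red.sP, use sum.sym_natural[of "ar h t" "ar h u"] in simp)
  next
    case (lP t)
    show ?case
      by (intro exI conjI, rule red.lP, use sum.unit_natural(1)[of "ar h t"] in simp)
  next
    case (rP t)
    show ?case
      by (intro exI conjI, rule red.rP, use sum.unit_natural(2)[of "ar h t"] in simp)
  next
    case (rP_inv t)
    show ?case
      by (intro exI conjI, rule red.rP_inv, rule inv_natural, use sum.unit_natural(2)[of "ar h t"] in simp_all)
  next
    case (aT t u w)
    show ?case
      by (intro exI conjI, rule red.aT, use prod.assoc_natural[of "ar h t" "ar h u" "ar h w"] in simp)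
  next
    case (lT t)
    show ?case
      by (intro exI conjI, rule red.lT, use prod.unit_natural(1)[of "ar h t"] in simp)
  next
    case (rT t)
    show ?case
      by (intro exI conjI, rule red.rT, use prod.unit_natural(2)[of "ar h t"] in simp)
  next
    case (rT_inv t)
    show ?case
      by (intro exI conjI, rule red.rT_inv, rule inv_natural, use prod.unit_natural(2)[of "ar h t"] in simp_all)
  next
    case (dl t u w)
    show ?case
      by (intro exI conjI, rule red.dl, use dist_natural(1)[of "ar h t" "ar h u" "ar h w"] in simp)
  next
    case (dr t u w)
    show ?case
      by (intro exI conjI, rule red.dr, use dist_natural(2)[of "ar h t" "ar h u" "ar h w"] in simp)
  next
    case (nl t)
    show ?case
      by (intro exI conjI, rule red.nl, use ann_natural(1)[of "ar h t"] in simp)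
  next
    case (nr t)
    show ?case
      by (intro exI conjI, rule red.nr, use ann_natural(2)[of "ar h t"] in simp)
  qed
qed

lemma span_natural:
  assumes "span (\<lambda>a. Dom C (h a)) t u f" and h [simp]: "\<And>a. h a \<in> Arr C"
  shows "\<exists>g. span (\<lambda>a. Cod C (h a)) t u g \<and> ar h u \<bullet> f = g \<bullet> ar h t"
proof -
  interpret D: coherent_env C plusC zeroC aP lP rP plus_o plus_a sP timesC oneC aT lT rT
    times_o times_a dl dr nl nr \<i> "\<lambda>a. Dom C (h a)" by unfold_locales auto
  interpret E: coherent_env C plusC zeroC aP lP rP plus_o plus_a sP timesC oneC aT lT rT
    times_o times_a dl dr nl nr \<i> "\<lambda>a. Cod C (h a)" by unfold_locales auto
  obtain w p q where p: "red (\<lambda>a. Dom C (h a)) t w p" and q: "red (\<lambda>a. Dom C (h a)) u w q" and f: "f = inv_arr q \<bullet> p"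
    using assms unfolding span_def by blast
  obtain p' q' where p': "red (\<lambda>a. Cod C (h a)) t w p'" "ar h w \<bullet> p = p' \<bullet> ar h t"
    and q': "red (\<lambda>a. Cod C (h a)) u w q'" "ar h w \<bullet> q = q' \<bullet> ar h u"
    using red_natural[OF p h] red_natural[OF q h] by blast
  note [simp] = D.red_iso[OF p] D.red_iso[OF q] E.red_iso[OF p'(1)] E.red_iso[OF q'(1)]
  have "ar h u \<bullet> inv_arr q = inv_arr q' \<bullet> ar h w"
    using q'(2) by (rule inv_natural) auto
  then have "ar h u \<bullet> f = inv_arr q' \<bullet> ar h w \<bullet> p"
    unfolding f by (subst cmp_assoc[symmetric]) (auto simp: cmp_assoc)
  also have "\<dots> = (inv_arr q' \<bullet> p') \<bullet> ar h t"
    by (simp add: p'(2) cmp_assoc)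
  finally show ?thesis using p'(1) q'(1) unfolding span_def by blast
qed

lemma ob_sub: "ob (\<lambda>a. ob J (s a)) t = ob J (t_sub s t)"
  by (rule t_ob_sub[symmetric])

text \<open>The rules of \<open>red\<close> are schematic in the terms, so every rule instance stays
  one after substitution, with the very same arrow.\<close>

lemma red_sub: "red (\<lambda>a. ob J (s a)) t u f \<Longrightarrow> red J (t_sub s t) (t_sub s u) f"
  by (induction rule: red.induct) (auto simp only: ob_sub t_sub.simps intro: red.intros)

lemma span_sub: "span (\<lambda>a. ob J (s a)) t u f \<Longrightarrow> span J (t_sub s t) (t_sub s u) f"
  unfolding span_def using red_sub by blast

end

section \<open>Existence of canonical isomorphisms\<close>

primrec word_term :: "'v list \<Rightarrow> 'v rig_term" where
  "word_term [] = Unt"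
| "word_term (a # m) = Mul (Var a) (word_term m)"

primrec sum_term :: "'v rig_term list \<Rightarrow> 'v rig_term" where
  "sum_term [] = Nul"
| "sum_term (t # ts) = Add t (sum_term ts)"

abbreviation poly :: "'v list list \<Rightarrow> 'v rig_term" where
  "poly ms \<equiv> sum_term (map word_term ms)"

context coherent_distributive_category begin

text \<open>For existence the arrow is irrelevant, and without it the rules of \<open>red\<close>
  can be chained like ordinary rewriting.\<close>

definition reduces :: "('v \<Rightarrow> 'o) \<Rightarrow> 'v rig_term \<Rightarrow> 'v rig_term \<Rightarrow> bool" where
  "reduces J t u \<longleftrightarrow> (\<exists>f. red J t u f)"

lemma reduces:
  "reduces J t t" "reduces J t u \<Longrightarrow> reduces J u w \<Longrightarrow> reduces J t w"
  "reduces J t t' \<Longrightarrow> reduces J u u' \<Longrightarrow> reduces J (Add t u) (Add t' u')"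
  "reduces J t t' \<Longrightarrow> reduces J u u' \<Longrightarrow> reduces J (Mul t u) (Mul t' u')"
  "reduces J (Add (Add t u) w) (Add t (Add u w))" "reduces J (Add t (Add u w)) (Add (Add t u) w)"
  "reduces J (Add t u) (Add u t)" "reduces J (Add Nul t) t" "reduces J t (Add t Nul)"
  "reduces J (Mul (Mul t u) w) (Mul t (Mul u w))" "reduces J (Mul Unt t) t" "reduces J t (Mul t Unt)"
  "reduces J (Mul t (Add u w)) (Add (Mul t u) (Mul t w))"
  "reduces J (Mul (Add t u) w) (Add (Mul t w) (Mul u w))"
  "reduces J (Mul Nul t) Nul" "reduces J (Mul t Nul) Nul"
  unfolding reduces_def
  by (rule exI, rule red.refl, blast intro: red.trans, blast intro: red.Add, blast intro: red.Mul,
      rule exI, rule red.aP, rule exI, rule red.aP_inv, rule exI, rule red.sP,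
      rule exI, rule red.lP, rule exI, rule red.rP_inv, rule exI, rule red.aT,
      rule exI, rule red.lT, rule exI, rule red.rT_inv, rule exI, rule red.dl,
      rule exI, rule red.dr, rule exI, rule red.nl, rule exI, rule red.nr)

lemma reduces_append: "reduces J (Add (poly xs) (poly ys)) (poly (xs @ ys))"
proof (induction xs)
  case (Cons x xs)
  then have "reduces J (Add (word_term x) (Add (poly xs) (poly ys))) (poly ((x # xs) @ ys))"
    using reduces(3)[OF reduces(1) Cons.IH] by simp
  then show ?case using reduces(2)[OF reduces(5)] by simp
qed (use reduces(8) in simp)

lemma reduces_row: "reduces J (Mul (Var a) (poly ms)) (poly (map (Cons a) ms))"
proof (induction ms)
  case (Cons m ms)
  then have "reduces J (Add (Mul (Var a) (word_term m)) (Mul (Var a) (poly ms))) (poly (map (Cons a) (m # ms)))"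
    using reduces(3)[OF reduces(1) Cons.IH] by simp
  then show ?case using reduces(2)[OF reduces(13)] by simp
qed (use reduces(16) in simp)

text \<open>The syntactic counterpart of \<open>act\<close>: a term times a sum of words is
  rewritten to a sum of words by the same recursion. The resulting list \<open>ns\<close> need not
  be sorted; regularity keeps it free of repetitions.\<close>

lemma reduces_act:
  assumes "regular t (set ms)" "distinct ms"
  shows "\<exists>ns. reduces J (Mul t (poly ms)) (poly ns) \<and> distinct ns \<and> set ns = mons t (set ms)"
  using assms
proof (induction t arbitrary: ms)
  case (Var a)
  then show ?case
    using reduces_row[of J a ms] by (intro exI[of _ "map (Cons a) ms"]) (auto simp: distinct_map)
next
  case Nul
  then show ?case using reduces(15) by (intro exI[of _ "[]"]) auto
next
  case Unt
  then show ?case using reduces(11) by auto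
next
  case (Add t u)
  then obtain xs ys where *: "reduces J (Mul t (poly ms)) (poly xs)" "distinct xs" "set xs = mons t (set ms)"
      "reduces J (Mul u (poly ms)) (poly ys)" "distinct ys" "set ys = mons u (set ms)"
    by (metis regular.simps(4))
  then have "reduces J (Mul (Add t u) (poly ms)) (poly (xs @ ys))"
    using reduces(2)[OF reduces(14) reduces(2)[OF reduces(3) reduces_append]] by blast
  then show ?case using * Add.prems by (intro exI[of _ "xs @ ys"]) auto
next
  case (Mul t u)
  then obtain xs where xs: "reduces J (Mul u (poly ms)) (poly xs)" "distinct xs" "set xs = mons u (set ms)"
    by (metis regular.simps(5))
  then obtain ys where ys: "reduces J (Mul t (poly xs)) (poly ys)" "distinct ys" "set ys = mons t (set xs)"
    using Mul by (metis regular.simps(5))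
  have "reduces J (Mul (Mul t u) (poly ms)) (poly ys)"
    by (rule reduces(2)[OF reduces(10) reduces(2)[OF reduces(4)[OF reduces(1) xs(1)] ys(1)]])
  then show ?case using xs ys by auto
qed

lemma reduces_poly:
  assumes "regular t {[]}"
  shows "\<exists>ns. reduces J t (poly ns) \<and> distinct ns \<and> set ns = mons t {[]}"
proof -
  \<comment> \<open>The sum over the empty word is \<open>Add Unt Nul\<close>. Creating this factor
    is what the inverse rules \<open>rT_inv\<close> and \<open>rP_inv\<close> of \<open>red\<close>
    are for.\<close>
  have "reduces J t (Mul t (poly [[]]))"
    using reduces(2)[OF reduces(12) reduces(4)[OF reduces(1) reduces(9)]] by simp
  moreover obtain ns where "reduces J (Mul t (poly [[]])) (poly ns)" "distinct ns" "set ns = mons t {[]}"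
    using reduces_act[of t "[[]]" J] assms by auto
  ultimately show ?thesis using reduces(2) by blast
qed

text \<open>Moving a summand past another one in a sum bracketed to the right takes
  \<open>aP_inv\<close>, \<open>sP\<close> and \<open>aP\<close>; here the inverse of associativity
  is needed in \<open>red\<close>.\<close>

lemma reduces_insert: "reduces J (poly (x # xs @ ys)) (poly (xs @ x # ys))"
proof (induction xs)
  case (Cons z xs)
  let ?x = "word_term x" and ?z = "word_term z" and ?r = "poly (xs @ ys)"
  have "reduces J (Add ?x (Add ?z ?r)) (Add (Add ?z ?x) ?r)"
    by (rule reduces(2)[OF reduces(6) reduces(3)[OF reduces(7) reduces(1)]])
  moreover have "reduces J (Add (Add ?z ?x) ?r) (Add ?z (poly (xs @ x # ys)))"
    by (rule reduces(2)[OF reduces(5) reduces(3)[OF reduces(1)]]) (use Cons in simp)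
  ultimately show ?case using reduces(2) by fastforce
qed (simp add: reduces(1))

lemma reduces_perm:
  "distinct xs \<Longrightarrow> distinct ys \<Longrightarrow> set xs = set ys \<Longrightarrow> reduces J (poly xs) (poly ys)"
proof (induction xs arbitrary: ys)
  case (Cons x xs)
  then have "x \<in> set ys" by (metis list.set_intros(1))
  then obtain as bs where ys: "ys = as @ x # bs" by (meson split_list)
  then have "set xs = set (as @ bs)" using Cons.prems by auto
  then have "reduces J (poly xs) (poly (as @ bs))"
    by (intro Cons.IH) (use Cons.prems ys in auto)
  from reduces(3)[OF reduces(1) this] have "reduces J (poly (x # xs)) (poly (x # as @ bs))" by simp
  then show ?case unfolding ys using reduces(2) reduces_insert by blast
qed (simp add: reduces(1))

text \<open>Both terms reduce to sums over their monomials, and reordering one of the two lists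
  makes the targets equal.\<close>

lemma span_exists:
  assumes "regular t {[]}" "regular u {[]}" "mons t {[]} = mons u {[]}"
  shows "\<exists>f. span J t u f"
proof -
  obtain xs ys where *: "reduces J t (poly xs)" "distinct xs" "set xs = mons t {[]}"
      "reduces J u (poly ys)" "distinct ys" "set ys = mons u {[]}"
    using reduces_poly assms(1,2) by meson
  then have "reduces J t (poly ys)" using reduces(2)[OF *(1) reduces_perm] assms(3) by simp
  then show ?thesis using *(4) unfolding span_def reduces_def by blast
qed

end

section \<open>Functors on finite linearly ordered sets\<close>

abbreviation cmpt :: "'f \<times> 'f \<times> ('o \<Rightarrow> 'b) \<Rightarrow> 'o \<Rightarrow> 'b" where "cmpt \<tau> \<equiv> snd (snd \<tau>)"

locale fun_cat = A: category A + B: category B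
  for A :: "('o, 'a) cat" and B :: "('p, 'b) cat"
begin

abbreviation "FC \<equiv> functor_cat A B"

lemma FC_Obj: "F \<in> Obj FC \<longleftrightarrow> is_functor A B F \<and> FOb F \<in> extensional (Obj A) \<and> FAr F \<in> extensional (Arr A)"
  by (simp add: functor_cat_def Let_def)

lemma FC_Dom [simp]: "Dom FC \<tau> = fst \<tau>" "Cod FC \<tau> = fst (snd \<tau>)"
  by (simp_all add: functor_cat_def Let_def case_prod_beta)

lemma FC_Idn: "Idn FC F = (F, F, \<lambda>x \<in> Obj A. Idn B (FOb F x))"
  by (simp add: functor_cat_def Let_def)

lemma FC_Cmp: "\<sigma> \<bullet>\<^bsub>FC\<^esub> \<tau> = (fst \<tau>, fst (snd \<sigma>), \<lambda>x \<in> Obj A. cmpt \<sigma> x \<bullet>\<^bsub>B\<^esub> cmpt \<tau> x)"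
  by (simp add: functor_cat_def Let_def case_prod_beta)

lemma FC_cmpt [simp]:
  "x \<in> Obj A \<Longrightarrow> cmpt (Idn FC F) x = Idn B (FOb F x)"
  "x \<in> Obj A \<Longrightarrow> cmpt (\<sigma> \<bullet>\<^bsub>FC\<^esub> \<tau>) x = cmpt \<sigma> x \<bullet>\<^bsub>B\<^esub> cmpt \<tau> x"
  by (simp_all add: FC_Idn FC_Cmp)

lemma FC_Arr: "\<tau> \<in> Arr FC \<longleftrightarrow> fst \<tau> \<in> Obj FC \<and> fst (snd \<tau>) \<in> Obj FC \<and> cmpt \<tau> \<in> extensional (Obj A) \<and>
    (\<forall>x \<in> Obj A. cmpt \<tau> x \<in> Arr B \<and> Dom B (cmpt \<tau> x) = FOb (fst \<tau>) x \<and> Cod B (cmpt \<tau> x) = FOb (fst (snd \<tau>)) x) \<and>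
    (\<forall>f \<in> Arr A. cmpt \<tau> (Cod A f) \<bullet>\<^bsub>B\<^esub> FAr (fst \<tau>) f = FAr (fst (snd \<tau>)) f \<bullet>\<^bsub>B\<^esub> cmpt \<tau> (Dom A f))"
  by (cases \<tau>) (auto simp: functor_cat_def Let_def is_natural_def B.Hom_iff)

lemma ObjD:
  assumes "F \<in> Obj FC"
  shows "x \<in> Obj A \<Longrightarrow> FOb F x \<in> Obj B" "f \<in> Arr A \<Longrightarrow> FAr F f \<in> Arr B"
    "f \<in> Arr A \<Longrightarrow> Dom B (FAr F f) = FOb F (Dom A f)" "f \<in> Arr A \<Longrightarrow> Cod B (FAr F f) = FOb F (Cod A f)"
    "x \<in> Obj A \<Longrightarrow> FAr F (Idn A x) = Idn B (FOb F x)"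
    "f \<in> Arr A \<Longrightarrow> g \<in> Arr A \<Longrightarrow> Dom A g = Cod A f \<Longrightarrow> FAr F (g \<bullet>\<^bsub>A\<^esub> f) = FAr F g \<bullet>\<^bsub>B\<^esub> FAr F f"
proof -
  interpret is_functor A B F using assms by (simp add: FC_Obj)
  show "x \<in> Obj A \<Longrightarrow> FOb F x \<in> Obj B" "f \<in> Arr A \<Longrightarrow> FAr F f \<in> Arr B"
    "f \<in> Arr A \<Longrightarrow> Dom B (FAr F f) = FOb F (Dom A f)" "f \<in> Arr A \<Longrightarrow> Cod B (FAr F f) = FOb F (Cod A f)"
    "x \<in> Obj A \<Longrightarrow> FAr F (Idn A x) = Idn B (FOb F x)"
    "f \<in> Arr A \<Longrightarrow> g \<in> Arr A \<Longrightarrow> Dom A g = Cod A f \<Longrightarrow> FAr F (g \<bullet>\<^bsub>A\<^esub> f) = FAr F g \<bullet>\<^bsub>B\<^esub> FAr F f"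
    by (simp_all add: FOb_Obj FAr_Idn functor_Cmp)
qed

lemma ObjI:
  assumes "\<And>x. x \<in> Obj A \<Longrightarrow> ob x \<in> Obj B"
    and "\<And>f. f \<in> Arr A \<Longrightarrow> ar f \<in> Arr B \<and> Dom B (ar f) = ob (Dom A f) \<and> Cod B (ar f) = ob (Cod A f)"
    and "\<And>x. x \<in> Obj A \<Longrightarrow> ar (Idn A x) = Idn B (ob x)"
    and "\<And>f g. f \<in> Arr A \<Longrightarrow> g \<in> Arr A \<Longrightarrow> Dom A g = Cod A f \<Longrightarrow> ar (g \<bullet>\<^bsub>A\<^esub> f) = ar g \<bullet>\<^bsub>B\<^esub> ar f"
  shows "\<lparr>FOb = \<lambda>x \<in> Obj A. ob x, FAr = \<lambda>f \<in> Arr A. ar f\<rparr> \<in> Obj FC"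
  unfolding FC_Obj
  by (auto intro!: is_functorI A.category_axioms B.category_axioms simp: assms)

lemma ArrI:
  assumes "F \<in> Obj FC" "G \<in> Obj FC"
    and "\<And>x. x \<in> Obj A \<Longrightarrow> t x \<in> Arr B \<and> Dom B (t x) = FOb F x \<and> Cod B (t x) = FOb G x"
    and "\<And>f. f \<in> Arr A \<Longrightarrow> t (Cod A f) \<bullet>\<^bsub>B\<^esub> FAr F f = FAr G f \<bullet>\<^bsub>B\<^esub> t (Dom A f)"
  shows "(F, G, \<lambda>x \<in> Obj A. t x) \<in> Arr FC"
  using assms by (auto simp: FC_Arr)

lemma ArrD:
  assumes "\<tau> \<in> Arr FC"
  shows "fst \<tau> \<in> Obj FC" "fst (snd \<tau>) \<in> Obj FC" "x \<in> Obj A \<Longrightarrow> cmpt \<tau> x \<in> Arr B"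
    "x \<in> Obj A \<Longrightarrow> Dom B (cmpt \<tau> x) = FOb (fst \<tau>) x" "x \<in> Obj A \<Longrightarrow> Cod B (cmpt \<tau> x) = FOb (fst (snd \<tau>)) x"
    "f \<in> Arr A \<Longrightarrow> cmpt \<tau> (Cod A f) \<bullet>\<^bsub>B\<^esub> FAr (fst \<tau>) f = FAr (fst (snd \<tau>)) f \<bullet>\<^bsub>B\<^esub> cmpt \<tau> (Dom A f)"
  using assms unfolding FC_Arr by blast+

lemma Arr_eqI:
  assumes "\<tau> \<in> Arr FC" "\<sigma> \<in> Arr FC" "fst \<tau> = fst \<sigma>" "fst (snd \<tau>) = fst (snd \<sigma>)"
    "\<And>x. x \<in> Obj A \<Longrightarrow> cmpt \<tau> x = cmpt \<sigma> x"
  shows "\<tau> = \<sigma>"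
proof -
  have "cmpt \<tau> = cmpt \<sigma>"
    by (rule extensionalityI[of _ "Obj A"]) (use assms FC_Arr in blast)+
  then show ?thesis using assms(3,4) by (simp add: prod_eq_iff)
qed

lemma category_FC: "category FC"
proof
  fix f assume "f \<in> Arr FC"
  then show "Dom FC f \<in> Obj FC" "Cod FC f \<in> Obj FC" by (simp_all add: ArrD)
next
  fix F assume "F \<in> Obj FC"
  then show "Idn FC F \<in> Hom FC F F"
    by (auto simp: Hom_def FC_Idn FC_Arr ObjD)
next
  fix f x y g z assume *: "f \<in> Hom FC x y" "g \<in> Hom FC y z"
  have "cmpt g (Cod A h) \<bullet>\<^bsub>B\<^esub> cmpt f (Cod A h) \<bullet>\<^bsub>B\<^esub> FAr x h = FAr z h \<bullet>\<^bsub>B\<^esub> cmpt g (Dom A h) \<bullet>\<^bsub>B\<^esub> cmpt f (Dom A h)"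
    if "h \<in> Arr A" for h
  proof -
    have fg: "f \<in> Arr FC" "g \<in> Arr FC" "fst f = x" "fst (snd f) = y" "fst g = y" "fst (snd g) = z" using * by (auto simp: Hom_def)
    note t [simp] = ArrD(1-5)[OF fg(1), unfolded fg] ArrD(1-5)[OF fg(2), unfolded fg] that
      ObjD[OF ArrD(1)[OF fg(1)], unfolded fg] ObjD[OF ArrD(1)[OF fg(2)], unfolded fg] ObjD[OF ArrD(2)[OF fg(2)], unfolded fg]
    have n: "cmpt f (Cod A h) \<bullet>\<^bsub>B\<^esub> FAr x h = FAr y h \<bullet>\<^bsub>B\<^esub> cmpt f (Dom A h)" "cmpt g (Cod A h) \<bullet>\<^bsub>B\<^esub> FAr y h = FAr z h \<bullet>\<^bsub>B\<^esub> cmpt g (Dom A h)"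
      using ArrD(6)[OF fg(1) that] ArrD(6)[OF fg(2) that] fg by auto
    show ?thesis using B.cmp_reduce[OF n(2), of "cmpt f (Dom A h)"] by (simp add: n(1) B.cmp_assoc)
  qed
  then show "g \<bullet>\<^bsub>FC\<^esub> f \<in> Hom FC x z"
    using * by (auto simp: Hom_def FC_Cmp FC_Arr B.cmp_assoc ObjD)
next
  fix f x y assume *: "f \<in> Hom FC x y"
  then have f: "f \<in> Arr FC" by (simp add: Hom_def)
  have **: "f = (x, y, \<lambda>a \<in> Obj A. cmpt f a)" if "f \<in> Hom FC x y"
    using * by (cases f) (auto simp: Hom_def FC_Arr extensional_restrict)
  show "f \<bullet>\<^bsub>FC\<^esub> Idn FC x = f"
    by (subst (2) **[OF *]) (use * ArrD[OF f] in \<open>auto simp: FC_Cmp FC_Idn Hom_def intro!: restrict_ext\<close>)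
  show "Idn FC y \<bullet>\<^bsub>FC\<^esub> f = f"
    by (subst (2) **[OF *]) (use * ArrD[OF f] in \<open>auto simp: FC_Cmp FC_Idn Hom_def intro!: restrict_ext\<close>)
next
  fix f w x g y h z assume "f \<in> Hom FC w x" "g \<in> Hom FC x y" "h \<in> Hom FC y z"
  then show "(h \<bullet>\<^bsub>FC\<^esub> g) \<bullet>\<^bsub>FC\<^esub> f = h \<bullet>\<^bsub>FC\<^esub> g \<bullet>\<^bsub>FC\<^esub> f"
    by (auto simp: FC_Cmp Hom_def ArrD B.cmp_assoc intro!: restrict_ext)
qed

sublocale FC: category FC by (rule category_FC)

text \<open>The componentwise inverses are natural again. The second conclusion is what allows
  inverses occurring in coherence diagrams to be computed in \<open>C\<close>.\<close>

lemma FC_isoI: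
  assumes \<tau>: "\<tau> \<in> Arr FC" and iso: "\<And>x. x \<in> Obj A \<Longrightarrow> is_isomorphism B (cmpt \<tau> x)"
  shows "is_isomorphism FC \<tau>" "x \<in> Obj A \<Longrightarrow> cmpt (inverse_arrow FC \<tau>) x = inverse_arrow B (cmpt \<tau> x)"
proof -
  define \<sigma> where "\<sigma> = (fst (snd \<tau>), fst \<tau>, \<lambda>x \<in> Obj A. inverse_arrow B (cmpt \<tau> x))"
  note [simp] = ArrD(1-5)[OF \<tau>] iso ObjD[OF ArrD(1)[OF \<tau>]] ObjD[OF ArrD(2)[OF \<tau>]]
  have \<sigma>: "\<sigma> \<in> Arr FC"
    unfolding \<sigma>_def
  proof (rule ArrI)
    fix f assume f [simp]: "f \<in> Arr A"
    let ?t = "cmpt \<tau> (Cod A f)" and ?s = "cmpt \<tau> (Dom A f)"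
    have "FAr (fst \<tau>) f = inverse_arrow B ?t \<bullet>\<^bsub>B\<^esub> FAr (fst (snd \<tau>)) f \<bullet>\<^bsub>B\<^esub> ?s"
      unfolding ArrD(6)[OF \<tau> f, symmetric] by (simp add: B.inv_reduce)
    then show "inverse_arrow B (cmpt \<tau> (Cod A f)) \<bullet>\<^bsub>B\<^esub> FAr (fst (snd \<tau>)) f =
        FAr (fst \<tau>) f \<bullet>\<^bsub>B\<^esub> inverse_arrow B (cmpt \<tau> (Dom A f))"
      by (simp add: B.cmp_assoc)
  qed auto
  have *: "\<sigma> \<bullet>\<^bsub>FC\<^esub> \<tau> = Idn FC (Dom FC \<tau>)" "\<tau> \<bullet>\<^bsub>FC\<^esub> \<sigma> = Idn FC (Cod FC \<tau>)"
    by (auto simp: FC_Cmp FC_Idn \<sigma>_def intro!: restrict_ext)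
  have d: "Dom FC \<sigma> = Cod FC \<tau>" "Cod FC \<sigma> = Dom FC \<tau>" by (simp_all add: \<sigma>_def)
  show "is_isomorphism FC \<tau>" by (rule FC.isoI[OF \<tau> \<sigma> d *])
  show "x \<in> Obj A \<Longrightarrow> cmpt (inverse_arrow FC \<tau>) x = inverse_arrow B (cmpt \<tau> x)"
    unfolding FC.inv_unique[OF \<tau> \<sigma> d *] by (simp add: \<sigma>_def)
qed

lemma FC_isoD:
  assumes "is_isomorphism FC \<tau>" "x \<in> Obj A"
  shows "is_isomorphism B (cmpt \<tau> x)"
proof -
  have \<tau>: "\<tau> \<in> Arr FC" using assms by simp
  let ?s = "inverse_arrow FC \<tau>"
  have s: "?s \<in> Arr FC" "fst ?s = fst (snd \<tau>)" "fst (snd ?s) = fst \<tau>"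
    using FC.inv_simps[OF assms(1)] by simp_all
  have "cmpt (?s \<bullet>\<^bsub>FC\<^esub> \<tau>) x = cmpt (Idn FC (Dom FC \<tau>)) x" "cmpt (\<tau> \<bullet>\<^bsub>FC\<^esub> ?s) x = cmpt (Idn FC (Cod FC \<tau>)) x"
    using assms by simp_all
  then show ?thesis
    using assms(2) by (intro B.isoI[of _ "cmpt ?s x"]) (simp_all add: ArrD[OF \<tau>] ArrD[OF s(1)] s)
qed

end

section \<open>Finite linear orders and their restrictions\<close>

lemma lin_Obj: "x \<in> Obj lin_cat \<longleftrightarrow> finite (fst x) \<and> linear_order_on (fst x) (snd x)"
  by (cases x) (simp add: lin_cat_def)

lemma lin_Arr: "\<phi> \<in> Arr lin_cat \<longleftrightarrow> fst \<phi> \<in> Obj lin_cat \<and> fst (snd \<phi>) \<in> Obj lin_cat \<and>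
    cmpt \<phi> \<in> extensional (fst (fst \<phi>)) \<and> bij_betw (cmpt \<phi>) (fst (fst \<phi>)) (fst (fst (snd \<phi>))) \<and>
    (\<forall>a \<in> fst (fst \<phi>). \<forall>b \<in> fst (fst \<phi>). (a, b) \<in> snd (fst \<phi>) \<longrightarrow> (cmpt \<phi> a, cmpt \<phi> b) \<in> snd (fst (snd \<phi>)))"
  by (cases \<phi>) (auto simp: lin_cat_def Let_def)

lemma lin_simps [simp]:
  "Dom lin_cat \<phi> = fst \<phi>" "Cod lin_cat \<phi> = fst (snd \<phi>)"
  "Idn lin_cat x = (x, x, \<lambda>a \<in> fst x. a)"
  "\<psi> \<bullet>\<^bsub>lin_cat\<^esub> \<phi> = (fst \<phi>, fst (snd \<psi>), compose (fst (fst \<phi>)) (cmpt \<psi>) (cmpt \<phi>))"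
  by (simp_all add: lin_cat_def Let_def case_prod_beta)

lemma category_lin: "category (lin_cat :: ('e lin, 'e lin_arr) cat)"
proof
  fix f :: "'e lin_arr" and x y
  assume *: "f \<in> Hom lin_cat x y"
  then have f: "f = (x, y, cmpt f)" "cmpt f \<in> extensional (fst x)" "bij_betw (cmpt f) (fst x) (fst y)"
    by (cases f, auto simp: Hom_def lin_Arr)+
  show "f \<bullet>\<^bsub>lin_cat\<^esub> Idn lin_cat x = f" "Idn lin_cat y \<bullet>\<^bsub>lin_cat\<^esub> f = f"
    using f by (auto simp: prod_eq_iff fun_eq_iff compose_def extensional_def bij_betw_def Pi_def)
next
  fix f g :: "'e lin_arr" and x y z
  assume "f \<in> Hom lin_cat x y" "g \<in> Hom lin_cat y z"
  then show "g \<bullet>\<^bsub>lin_cat\<^esub> f \<in> Hom lin_cat x z"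
    by (auto simp: Hom_def lin_Arr compose_eq intro: bij_betw_compose) (meson bij_betw_apply)
next
  fix f g h :: "'e lin_arr" and w x y z
  assume "f \<in> Hom lin_cat w x" "g \<in> Hom lin_cat x y" "h \<in> Hom lin_cat y z"
  then show "(h \<bullet>\<^bsub>lin_cat\<^esub> g) \<bullet>\<^bsub>lin_cat\<^esub> f = h \<bullet>\<^bsub>lin_cat\<^esub> g \<bullet>\<^bsub>lin_cat\<^esub> f"
    by (auto simp: Hom_def lin_Arr bij_betw_def compose_def fun_eq_iff)
qed (auto simp: Hom_def lin_Arr bij_betw_def)

lemma restr_simps [simp]: "fst (x \<restriction> B) = B"
  by (simp add: lin_restrict_def)

lemma restr_restr: "D \<subseteq> B \<Longrightarrow> x \<restriction> B \<restriction> D = x \<restriction> D"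
  by (auto simp: lin_restrict_def)

lemma restr_self: "x \<in> Obj lin_cat \<Longrightarrow> x \<restriction> fst x = x"
  by (cases x) (auto simp: lin_restrict_def lin_Obj order_on_defs refl_on_def)

lemma restr_Obj:
  assumes "x \<in> Obj lin_cat" "B \<subseteq> fst x"
  shows "x \<restriction> B \<in> Obj lin_cat"
proof -
  have x: "finite (fst x)" "\<forall>a\<in>fst x. (a, a) \<in> snd x" "trans (snd x)" "antisym (snd x)" "total_on (fst x) (snd x)"
    using assms(1) by (auto simp: lin_Obj order_on_defs refl_on_def)
  have "finite B" using x(1) assms(2) by (rule finite_subset[rotated])
  moreover have "linear_order_on B (snd x \<inter> B \<times> B)"
    unfolding order_on_defs refl_on_def
  proof (intro conjI)
    show "snd x \<inter> B \<times> B \<subseteq> B \<times> B" by blast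
    show "\<forall>a\<in>B. (a, a) \<in> snd x \<inter> B \<times> B" using x(2) assms(2) by blast
    show "trans (snd x \<inter> B \<times> B)" using x(3) unfolding trans_def by blast
    show "antisym (snd x \<inter> B \<times> B)" using x(4) unfolding antisym_def by blast
    show "total_on B (snd x \<inter> B \<times> B)" using x(5) assms(2) unfolding total_on_def by blast
  qed
  ultimately show ?thesis by (simp add: lin_restrict_def lin_Obj)
qed

lemma arr_restr_simps [simp]:
  "fst (\<phi> \<restriction>\<^sub>a B) = fst \<phi> \<restriction> B" "fst (snd (\<phi> \<restriction>\<^sub>a B)) = fst (snd \<phi>) \<restriction> (cmpt \<phi> ` B)"
  "cmpt (\<phi> \<restriction>\<^sub>a B) = restrict (cmpt \<phi>) B"
  by (simp_all add: arr_restrict_def case_prod_beta)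

lemma arr_restr_Arr:
  assumes "\<phi> \<in> Arr lin_cat" "B \<subseteq> fst (fst \<phi>)"
  shows "\<phi> \<restriction>\<^sub>a B \<in> Arr lin_cat"
proof -
  have "cmpt \<phi> ` B \<subseteq> fst (fst (snd \<phi>))" using assms by (auto simp: lin_Arr bij_betw_def)
  moreover have "inj_on (cmpt \<phi>) B" using assms by (auto simp: lin_Arr bij_betw_def inj_on_subset)
  ultimately show ?thesis
    using assms unfolding lin_Arr[of "\<phi> \<restriction>\<^sub>a B"]
    by (simp add: restr_Obj lin_Arr bij_betw_def) (simp add: lin_restrict_def subset_iff)
qed

lemma arr_restr_Idn: "B \<subseteq> fst x \<Longrightarrow> Idn lin_cat x \<restriction>\<^sub>a B = Idn lin_cat (x \<restriction> B)"
proof -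
  assume B: "B \<subseteq> fst x"
  then have "(\<lambda>a\<in>fst x. a) ` B = B" by force
  then show ?thesis using B by (auto simp: arr_restrict_def fun_eq_iff)
qed

lemma arr_restr_Cmp:
  assumes "B \<subseteq> fst (fst \<phi>)"
  shows "(\<psi> \<bullet>\<^bsub>lin_cat\<^esub> \<phi>) \<restriction>\<^sub>a B = \<psi> \<restriction>\<^sub>a (cmpt \<phi> ` B) \<bullet>\<^bsub>lin_cat\<^esub> (\<phi> \<restriction>\<^sub>a B)"
proof -
  have "compose (fst (fst \<phi>)) (cmpt \<psi>) (cmpt \<phi>) ` B = cmpt \<psi> ` cmpt \<phi> ` B"
    using assms by (force simp: compose_def)
  then show ?thesis using assms
    by (auto simp: arr_restrict_def case_prod_beta compose_def fun_eq_iff)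
qed

lemma arr_restr_restr: "D \<subseteq> B \<Longrightarrow> \<phi> \<restriction>\<^sub>a B \<restriction>\<^sub>a D = \<phi> \<restriction>\<^sub>a D"
proof -
  assume D: "D \<subseteq> B"
  then have "restrict (cmpt \<phi>) B ` D = cmpt \<phi> ` D" by force
  then show ?thesis using D by (simp add: arr_restrict_def case_prod_beta restr_restr image_mono Int_absorb1)
qed

lemma decompsD:
  assumes "x \<in> Obj lin_cat" "(B, B') \<in> set (decomps x)"
  shows "B \<subseteq> fst x" "B' \<subseteq> fst x" "B \<inter> B' = {}" "B \<union> B' = fst x"
  using assms set_decomps[OF assms(1)] by auto

lemma subseqs_map: "subseqs (map f xs) = map (map f) (subseqs xs)"
  by (induction xs) (auto simp: Let_def)

lemma elts_desc_eqI:
  assumes "x \<in> Obj lin_cat" "set as = fst x" "sorted_wrt (\<lambda>a b. a \<noteq> b \<and> (b, a) \<in> snd x) as"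
  shows "elts_desc x = as"
proof (rule sorted_wrt_set_unique)
  show "set (elts_desc x) = set as" using elts_desc(1)[of "fst x" "snd x"] assms by simp
  show "sorted_wrt (\<lambda>a b. a \<noteq> b \<and> (b, a) \<in> snd x) (elts_desc x)"
    using elts_desc(2)[of "fst x" "snd x"] assms by simp
  show "sorted_wrt (\<lambda>a b. a \<noteq> b \<and> (b, a) \<in> snd x) as" by fact
  show "a \<noteq> b \<and> (b, a) \<in> snd x \<Longrightarrow> \<not> (b \<noteq> a \<and> (a, b) \<in> snd x)" for a b
    using assms(1) by (auto simp: lin_Obj order_on_defs antisym_def)
qed

text \<open>The image of the decreasing list is decreasing again and has the right elements, so it
  is the decreasing list of the target.\<close>

lemma elts_desc_Cod:
  assumes \<phi>: "\<phi> \<in> Arr lin_cat"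
  shows "elts_desc (fst (snd \<phi>)) = map (cmpt \<phi>) (elts_desc (fst \<phi>))"
proof (rule elts_desc_eqI)
  let ?x = "fst \<phi>" and ?y = "fst (snd \<phi>)" and ?f = "cmpt \<phi>"
  have x: "?x \<in> Obj lin_cat" and bij: "bij_betw ?f (fst ?x) (fst ?y)"
    using \<phi> by (auto simp: lin_Arr)
  have s: "set (elts_desc ?x) = fst ?x" "sorted_wrt (\<lambda>a b. a \<noteq> b \<and> (b, a) \<in> snd ?x) (elts_desc ?x)"
    using elts_desc(1,2)[of "fst ?x" "snd ?x"] x by auto
  show "?y \<in> Obj lin_cat" using \<phi> by (auto simp: lin_Arr)
  show "set (map ?f (elts_desc ?x)) = fst ?y" using s(1) bij by (simp add: bij_betw_def)
  show "sorted_wrt (\<lambda>a b. a \<noteq> b \<and> (b, a) \<in> snd ?y) (map ?f (elts_desc ?x))"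
    unfolding sorted_wrt_map
    by (rule sorted_wrt_mono_rel[OF _ s(2)])
      (use \<phi> s(1) bij in \<open>auto simp: lin_Arr bij_betw_def inj_on_def\<close>)
qed

text \<open>An equality of lists and not just of sets: the summands at the source and the target of
  \<phi> correspond position by position. This is why the convolution acts on arrows summand by
  summand, with no reordering isomorphism.\<close>

lemma decomps_Cod:
  assumes \<phi>: "\<phi> \<in> Arr lin_cat"
  shows "decomps (fst (snd \<phi>)) = map (\<lambda>(B, B'). (cmpt \<phi> ` B, cmpt \<phi> ` B')) (decomps (fst \<phi>))"
proof -
  let ?x = "fst \<phi>" and ?y = "fst (snd \<phi>)" and ?f = "cmpt \<phi>"
  have s: "set (elts_desc ?x) = fst ?x" and bij: "bij_betw ?f (fst ?x) (fst ?y)"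
    using elts_desc(1)[of "fst ?x" "snd ?x"] \<phi> by (auto simp: lin_Arr)
  have "fst ?y - ?f ` set as = ?f ` (fst ?x - set as)" if "as \<in> set (subseqs (elts_desc ?x))" for as
  proof -
    have "set as \<in> set ` set (subseqs (elts_desc ?x))" using that by (rule imageI)
    then have "set as \<subseteq> fst ?x" by (simp add: subseqs_powset s)
    then show ?thesis
      using bij inj_on_image_set_diff[of ?f "fst ?x" "fst ?x" "set as"] by (simp add: bij_betw_def)
  qed
  then show ?thesis by (auto simp: decomps_def subseqs_map elts_desc_Cod[OF \<phi>])
qed

declare lin_simps [simp del]

section \<open>Iterated sums over lists\<close>

context rig_data begin

abbreviation "bpo \<equiv> big_plus_ob plusC zeroC"
abbreviation "bpa \<equiv> big_plus_ar C plusC zeroC"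

lemma bp_simps [simp]: "bpo [] = zeroC" "bpo (x # xs) = FOb plusC (x, bpo xs)"
  "bpa [] = Idn C zeroC" "bpa (f # fs) = FAr plusC (f, bpa fs)"
  by (simp_all add: big_plus_ob_def big_plus_ar_def)

lemma bpo_Obj: "(\<And>d. d \<in> set ds \<Longrightarrow> g d \<in> Obj C) \<Longrightarrow> bpo (map g ds) \<in> Obj C"
  by (induction ds) auto

lemma bpa_Arr:
  assumes "\<And>d. d \<in> set ds \<Longrightarrow> f d \<in> Arr C"
  shows "bpa (map f ds) \<in> Arr C" "Dom C (bpa (map f ds)) = bpo (map (\<lambda>d. Dom C (f d)) ds)"
    "Cod C (bpa (map f ds)) = bpo (map (\<lambda>d. Cod C (f d)) ds)"
proof -
  have "bpa (map f ds) \<in> Arr C \<and> Dom C (bpa (map f ds)) = bpo (map (\<lambda>d. Dom C (f d)) ds) \<and>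
    Cod C (bpa (map f ds)) = bpo (map (\<lambda>d. Cod C (f d)) ds)"
    using assms by (induction ds) auto
  then show "bpa (map f ds) \<in> Arr C" "Dom C (bpa (map f ds)) = bpo (map (\<lambda>d. Dom C (f d)) ds)"
    "Cod C (bpa (map f ds)) = bpo (map (\<lambda>d. Cod C (f d)) ds)" by auto
qed

lemma bpa_Idn:
  assumes "\<And>d. d \<in> set ds \<Longrightarrow> g d \<in> Obj C" "\<And>d. d \<in> set ds \<Longrightarrow> f d = Idn C (g d)"
  shows "bpa (map f ds) = Idn C (bpo (map g ds))"
  using assms by (induction ds) (auto simp: bpo_Obj)

lemma bpa_Cmp:
  assumes "\<And>d. d \<in> set ds \<Longrightarrow> f d \<in> Arr C \<and> g d \<in> Arr C \<and> Dom C (g d) = Cod C (f d)"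
  shows "bpa (map g ds) \<bullet> bpa (map f ds) = bpa (map (\<lambda>d. g d \<bullet> f d) ds)"
  using assms
proof (induction ds)
  case (Cons d ds)
  have "bpo (map (\<lambda>d. Dom C (g d)) ds) = bpo (map (\<lambda>d. Cod C (f d)) ds)"
    by (rule arg_cong[of _ _ bpo]) (use Cons.prems in auto)
  then have "Dom C (bpa (map g ds)) = Cod C (bpa (map f ds))"
    "bpa (map g ds) \<in> Arr C" "bpa (map f ds) \<in> Arr C"
    using Cons.prems by (simp_all add: bpa_Arr)
  then show ?case using Cons by (simp flip: plus_Cmp)
qed simp

lemma tob_sum_term: "tob J (sum_term ts) = bpo (map (tob J) ts)"
  by (induction ts) auto

lemma tar_sum_term: "tar h (sum_term ts) = bpa (map (tar h) ts)"
  by (induction ts) auto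

end

section \<open>Sum, convolution and units on \<open>C^L\<close>\<close>

type_synonym ('e, 'o, 'a) lin_fun = "('e lin, 'e lin_arr, 'o, 'a) fun_data"
type_synonym ('e, 'o, 'a) lin_nat = "('e, 'o, 'a) lin_fun \<times> ('e, 'o, 'a) lin_fun \<times> ('e lin \<Rightarrow> 'a)"

text \<open>The argument \<open>E\<close> carries no data; it fixes the type \<open>'e\<close> of
  the elements of the linear orders.\<close>

locale rig_lin = rig_data C plusC zeroC timesC oneC
  for C :: "('o, 'a) cat" (structure) and plusC zeroC timesC oneC +
  fixes E :: "'e itself"
begin

abbreviation L :: "('e lin, 'e lin_arr) cat" where "L \<equiv> lin_cat"

sublocale FL: fun_cat L C
  by (simp add: fun_cat_def category_lin category_axioms)

abbreviation CL where "CL \<equiv> FL.FC"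
abbreviation plusL :: "(('e, 'o, 'a) lin_fun, ('e, 'o, 'a) lin_nat) bifunctor" where "plusL \<equiv> pointwise_plus plusC"
abbreviation timesL :: "(('e, 'o, 'a) lin_fun, ('e, 'o, 'a) lin_nat) bifunctor" where "timesL \<equiv> convolution C plusC zeroC timesC"
abbreviation zeroL :: "('e, 'o, 'a) lin_fun" where "zeroL \<equiv> const_fun C zeroC"
abbreviation oneL :: "('e, 'o, 'a) lin_fun" where "oneL \<equiv> unit_fun C zeroC oneC"

lemma plusL_FOb [simp]: "FOb plusL (F, G) =
    \<lparr>FOb = \<lambda>x \<in> Obj L. FOb plusC (FOb F x, FOb G x), FAr = \<lambda>\<phi> \<in> Arr L. FAr plusC (FAr F \<phi>, FAr G \<phi>)\<rparr>"
  by (simp add: pointwise_plus_def)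

lemma plusL_FAr: "FAr plusL (\<sigma>, \<tau>) = (FOb plusL (fst \<sigma>, fst \<tau>), FOb plusL (fst (snd \<sigma>), fst (snd \<tau>)),
    \<lambda>x \<in> Obj L. FAr plusC (cmpt \<sigma> x, cmpt \<tau> x))"
  by (cases \<sigma>; cases \<tau>) (simp add: pointwise_plus_def Let_def)

lemma timesL_FOb [simp]: "FOb timesL (F, G) =
    \<lparr>FOb = \<lambda>x \<in> Obj L. bpo (map (\<lambda>(B, B'). FOb timesC (FOb F (x \<restriction> B), FOb G (x \<restriction> B'))) (decomps x)),
     FAr = \<lambda>\<phi> \<in> Arr L. bpa (map (\<lambda>(B, B'). FAr timesC (FAr F (\<phi> \<restriction>\<^sub>a B), FAr G (\<phi> \<restriction>\<^sub>a B'))) (decomps (fst \<phi>)))\<rparr>"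
  by (simp add: convolution_def Let_def lin_simps)

lemma timesL_FAr: "FAr timesL (\<sigma>, \<tau>) = (FOb timesL (fst \<sigma>, fst \<tau>), FOb timesL (fst (snd \<sigma>), fst (snd \<tau>)),
    \<lambda>x \<in> Obj L. bpa (map (\<lambda>(B, B'). FAr timesC (cmpt \<sigma> (x \<restriction> B), cmpt \<tau> (x \<restriction> B'))) (decomps x)))"
  by (cases \<sigma>; cases \<tau>) (simp add: convolution_def Let_def lin_simps)

lemma plusL_Obj:
  assumes "F \<in> Obj CL" "G \<in> Obj CL"
  shows "FOb plusL (F, G) \<in> Obj CL"
  unfolding plusL_FOb by (rule FL.ObjI) (simp_all add: FL.ObjD[OF assms(1)] FL.ObjD[OF assms(2)] plus_Cmp)

lemma plusL_functor: "is_functor (CL \<times>\<^sub>C CL) CL plusL"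
proof (rule is_functorI)
  show "category (CL \<times>\<^sub>C CL)" "category CL" by (simp_all add: category_prod_cat FL.category_FC)
  show "x \<in> Obj (CL \<times>\<^sub>C CL) \<Longrightarrow> FOb plusL x \<in> Obj CL" for x
    using plusL_Obj by auto
next
  fix f assume "f \<in> Arr (CL \<times>\<^sub>C CL)"
  then obtain \<sigma> \<tau> where f: "f = (\<sigma>, \<tau>)" and st: "\<sigma> \<in> Arr CL" "\<tau> \<in> Arr CL" by auto
  note d = FL.ArrD(1-5)[OF st(1)] FL.ArrD(1-5)[OF st(2)]
  note o = FL.ObjD[OF d(1)] FL.ObjD[OF d(2)] FL.ObjD[OF d(6)] FL.ObjD[OF d(7)]
  have "FAr plusL (\<sigma>, \<tau>) \<in> Arr CL"
    unfolding plusL_FAr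
    by (rule FL.ArrI) (use d(1,2,6,7) in \<open>auto simp: plusL_Obj simp del: plusL_FOb\<close>,
      use d o FL.ArrD(6)[OF st(1)] FL.ArrD(6)[OF st(2)] in \<open>auto simp flip: plus_Cmp\<close>)
  then show "FAr plusL f \<in> Arr CL \<and> Dom CL (FAr plusL f) = FOb plusL (Dom (CL \<times>\<^sub>C CL) f) \<and>
      Cod CL (FAr plusL f) = FOb plusL (Cod (CL \<times>\<^sub>C CL) f)"
    by (simp add: f plusL_FAr)
next
  fix x assume "x \<in> Obj (CL \<times>\<^sub>C CL)"
  then show "FAr plusL (Idn (CL \<times>\<^sub>C CL) x) = Idn CL (FOb plusL x)"
    by (auto simp: plusL_FAr FL.FC_Idn FL.ObjD intro!: restrict_ext)
next
  fix f g assume fg: "f \<in> Arr (CL \<times>\<^sub>C CL)" "g \<in> Arr (CL \<times>\<^sub>C CL)" "Dom (CL \<times>\<^sub>C CL) g = Cod (CL \<times>\<^sub>C CL) f"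
  obtain \<sigma> \<tau> where f: "f = (\<sigma>, \<tau>)" by (cases f)
  obtain \<sigma>' \<tau>' where g: "g = (\<sigma>', \<tau>')" by (cases g)
  have st: "\<sigma> \<in> Arr CL" "\<tau> \<in> Arr CL" "\<sigma>' \<in> Arr CL" "\<tau>' \<in> Arr CL" "fst \<sigma>' = fst (snd \<sigma>)" "fst \<tau>' = fst (snd \<tau>)"
    using fg by (auto simp: f g)
  have "FAr plusC (cmpt \<sigma>' x \<bullet> cmpt \<sigma> x, cmpt \<tau>' x \<bullet> cmpt \<tau> x) =
      FAr plusC (cmpt \<sigma>' x, cmpt \<tau>' x) \<bullet> FAr plusC (cmpt \<sigma> x, cmpt \<tau> x)" if "x \<in> Obj L" for x
    using st that FL.ArrD(3-5)[OF st(1)] FL.ArrD(3-5)[OF st(2)] FL.ArrD(3-5)[OF st(3)] FL.ArrD(3-5)[OF st(4)]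
    by (simp add: plus_Cmp)
  then show "FAr plusL (g \<bullet>\<^bsub>CL \<times>\<^sub>C CL\<^esub> f) = FAr plusL g \<bullet>\<^bsub>CL\<^esub> FAr plusL f"
    by (auto simp: f g plusL_FAr FL.FC_Cmp intro!: restrict_ext)
qed

text \<open>By \<open>decomps_Cod\<close> composable order isomorphisms give lists of arrows that
  are composable position by position, so functoriality reduces to that of the product in each
  summand.\<close>

lemma timesL_Obj:
  assumes F: "F \<in> Obj CL" and G: "G \<in> Obj CL"
  shows "FOb timesL (F, G) \<in> Obj CL"
  unfolding timesL_FOb
proof (rule FL.ObjI)
  fix x assume x: "x \<in> Obj L"
  have o: "FOb F (x \<restriction> B) \<in> Obj C \<and> FOb G (x \<restriction> B') \<in> Obj C" if "(B, B') \<in> set (decomps x)" for B B'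
    using decompsD[OF x that] by (simp add: FL.ObjD[OF F] FL.ObjD[OF G] restr_Obj x)
  then show "bpo (map (\<lambda>(B, B'). FOb timesC (FOb F (x \<restriction> B), FOb G (x \<restriction> B'))) (decomps x)) \<in> Obj C"
    by (intro bpo_Obj) auto
  show "bpa (map (\<lambda>(B, B'). FAr timesC (FAr F (Idn L x \<restriction>\<^sub>a B), FAr G (Idn L x \<restriction>\<^sub>a B'))) (decomps (fst (Idn L x)))) =
      Idn C (bpo (map (\<lambda>(B, B'). FOb timesC (FOb F (x \<restriction> B), FOb G (x \<restriction> B'))) (decomps x)))"
  proof -
    have "fst (Idn L x) = x" by (simp add: lin_simps)
    then show ?thesis using o decompsD[OF x]
      by (auto intro!: bpa_Idn simp: arr_restr_Idn FL.ObjD[OF F] FL.ObjD[OF G] restr_Obj x)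
  qed
next
  fix \<phi> assume \<phi>: "\<phi> \<in> Arr L"
  then have x: "fst \<phi> \<in> Obj L" by (simp add: lin_Arr)
  have o: "FAr F (\<phi> \<restriction>\<^sub>a B) \<in> Arr C \<and> FAr G (\<phi> \<restriction>\<^sub>a B') \<in> Arr C \<and>
      Dom C (FAr F (\<phi> \<restriction>\<^sub>a B)) = FOb F (fst \<phi> \<restriction> B) \<and> Dom C (FAr G (\<phi> \<restriction>\<^sub>a B')) = FOb G (fst \<phi> \<restriction> B') \<and>
      Cod C (FAr F (\<phi> \<restriction>\<^sub>a B)) = FOb F (fst (snd \<phi>) \<restriction> (cmpt \<phi> ` B)) \<and>
      Cod C (FAr G (\<phi> \<restriction>\<^sub>a B')) = FOb G (fst (snd \<phi>) \<restriction> (cmpt \<phi> ` B'))"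
    if "(B, B') \<in> set (decomps (fst \<phi>))" for B B'
    using decompsD[OF x that] by (simp add: FL.ObjD[OF F] FL.ObjD[OF G] arr_restr_Arr \<phi> lin_simps)
  then show "bpa (map (\<lambda>(B, B'). FAr timesC (FAr F (\<phi> \<restriction>\<^sub>a B), FAr G (\<phi> \<restriction>\<^sub>a B'))) (decomps (fst \<phi>))) \<in> Arr C \<and>
      Dom C (bpa (map (\<lambda>(B, B'). FAr timesC (FAr F (\<phi> \<restriction>\<^sub>a B), FAr G (\<phi> \<restriction>\<^sub>a B'))) (decomps (fst \<phi>)))) =
      bpo (map (\<lambda>(B, B'). FOb timesC (FOb F (Dom L \<phi> \<restriction> B), FOb G (Dom L \<phi> \<restriction> B'))) (decomps (Dom L \<phi>))) \<and>
      Cod C (bpa (map (\<lambda>(B, B'). FAr timesC (FAr F (\<phi> \<restriction>\<^sub>a B), FAr G (\<phi> \<restriction>\<^sub>a B'))) (decomps (fst \<phi>)))) =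
      bpo (map (\<lambda>(B, B'). FOb timesC (FOb F (Cod L \<phi> \<restriction> B), FOb G (Cod L \<phi> \<restriction> B'))) (decomps (Cod L \<phi>)))"
    by (subst bpa_Arr; (subst bpa_Arr)?; (subst bpa_Arr)?)
      (auto simp: lin_simps decomps_Cod[OF \<phi>] intro!: arg_cong[of _ _ bpo])
next
  fix \<phi> \<psi> assume \<phi>: "\<phi> \<in> Arr L" and \<psi>: "\<psi> \<in> Arr L" and c: "Dom L \<psi> = Cod L \<phi>"
  then have x: "fst \<phi> \<in> Obj L" and y: "fst (snd \<phi>) \<in> Obj L" and c': "fst \<psi> = fst (snd \<phi>)"
    and im: "cmpt \<phi> ` fst (fst \<phi>) = fst (fst (snd \<phi>))"
    by (auto simp: lin_Arr lin_simps bij_betw_def)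
  have o: "FAr F (\<phi> \<restriction>\<^sub>a B) \<in> Arr C" "FAr F (\<psi> \<restriction>\<^sub>a (cmpt \<phi> ` B)) \<in> Arr C"
      "Dom C (FAr F (\<psi> \<restriction>\<^sub>a (cmpt \<phi> ` B))) = Cod C (FAr F (\<phi> \<restriction>\<^sub>a B))"
      "FAr F ((\<psi> \<bullet>\<^bsub>L\<^esub> \<phi>) \<restriction>\<^sub>a B) = FAr F (\<psi> \<restriction>\<^sub>a (cmpt \<phi> ` B)) \<bullet> FAr F (\<phi> \<restriction>\<^sub>a B)"
    if "B \<subseteq> fst (fst \<phi>)" "F \<in> Obj CL" for B F
  proof -
    have B: "cmpt \<phi> ` B \<subseteq> fst (fst \<psi>)" using that im c' by auto
    show "FAr F (\<phi> \<restriction>\<^sub>a B) \<in> Arr C" "FAr F (\<psi> \<restriction>\<^sub>a (cmpt \<phi> ` B)) \<in> Arr C"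
      "Dom C (FAr F (\<psi> \<restriction>\<^sub>a (cmpt \<phi> ` B))) = Cod C (FAr F (\<phi> \<restriction>\<^sub>a B))"
      using that B by (simp_all add: FL.ObjD[OF that(2)] arr_restr_Arr \<phi> \<psi> lin_simps(1,2) c')
    show "FAr F ((\<psi> \<bullet>\<^bsub>L\<^esub> \<phi>) \<restriction>\<^sub>a B) = FAr F (\<psi> \<restriction>\<^sub>a (cmpt \<phi> ` B)) \<bullet> FAr F (\<phi> \<restriction>\<^sub>a B)"
      unfolding arr_restr_Cmp[OF that(1)]
      using that B by (intro FL.ObjD(6)[OF that(2)]) (simp_all add: arr_restr_Arr \<phi> \<psi> lin_simps(1,2) c')
  qed
  have "bpa (map (\<lambda>(B, B'). FAr timesC (FAr F (\<psi> \<restriction>\<^sub>a B), FAr G (\<psi> \<restriction>\<^sub>a B'))) (decomps (fst \<psi>))) \<bullet>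
      bpa (map (\<lambda>(B, B'). FAr timesC (FAr F (\<phi> \<restriction>\<^sub>a B), FAr G (\<phi> \<restriction>\<^sub>a B'))) (decomps (fst \<phi>))) =
    bpa (map (\<lambda>(B, B'). FAr timesC (FAr F (\<psi> \<restriction>\<^sub>a (cmpt \<phi> ` B)), FAr G (\<psi> \<restriction>\<^sub>a (cmpt \<phi> ` B'))) \<bullet>
      FAr timesC (FAr F (\<phi> \<restriction>\<^sub>a B), FAr G (\<phi> \<restriction>\<^sub>a B'))) (decomps (fst \<phi>)))"
    unfolding c' decomps_Cod[OF \<phi>] map_map
    by (subst bpa_Cmp) (auto simp: o[OF _ F] o[OF _ G] decompsD[OF x] intro!: arg_cong[of _ _ bpa])
  also have "\<dots> = bpa (map (\<lambda>(B, B'). FAr timesC (FAr F ((\<psi> \<bullet>\<^bsub>L\<^esub> \<phi>) \<restriction>\<^sub>a B), FAr G ((\<psi> \<bullet>\<^bsub>L\<^esub> \<phi>) \<restriction>\<^sub>a B'))) (decomps (fst \<phi>)))"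
    using decompsD[OF x] by (auto intro!: arg_cong[of _ _ bpa] simp: plus_Cmp times_Cmp o[OF _ F] o[OF _ G])
  finally show "bpa (map (\<lambda>(B, B'). FAr timesC (FAr F ((\<psi> \<bullet>\<^bsub>L\<^esub> \<phi>) \<restriction>\<^sub>a B), FAr G ((\<psi> \<bullet>\<^bsub>L\<^esub> \<phi>) \<restriction>\<^sub>a B'))) (decomps (fst (\<psi> \<bullet>\<^bsub>L\<^esub> \<phi>)))) =
    bpa (map (\<lambda>(B, B'). FAr timesC (FAr F (\<psi> \<restriction>\<^sub>a B), FAr G (\<psi> \<restriction>\<^sub>a B'))) (decomps (fst \<psi>))) \<bullet>
      bpa (map (\<lambda>(B, B'). FAr timesC (FAr F (\<phi> \<restriction>\<^sub>a B), FAr G (\<phi> \<restriction>\<^sub>a B'))) (decomps (fst \<phi>)))"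
    by (simp add: lin_simps(4))
qed

lemma timesL_functor: "is_functor (CL \<times>\<^sub>C CL) CL timesL"
proof (rule is_functorI)
  show "category (CL \<times>\<^sub>C CL)" "category CL" by (simp_all add: category_prod_cat FL.category_FC)
  show "x \<in> Obj (CL \<times>\<^sub>C CL) \<Longrightarrow> FOb timesL x \<in> Obj CL" for x
    using timesL_Obj by auto
next
  fix f assume "f \<in> Arr (CL \<times>\<^sub>C CL)"
  then obtain \<sigma> \<tau> where f: "f = (\<sigma>, \<tau>)" and st: "\<sigma> \<in> Arr CL" "\<tau> \<in> Arr CL" by auto
  have "FAr timesL (\<sigma>, \<tau>) \<in> Arr CL"
    unfolding timesL_FAr
  proof (rule FL.ArrI)
    show "FOb timesL (fst \<sigma>, fst \<tau>) \<in> Obj CL" "FOb timesL (fst (snd \<sigma>), fst (snd \<tau>)) \<in> Obj CL"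
      using FL.ArrD(1,2)[OF st(1)] FL.ArrD(1,2)[OF st(2)] by (auto simp: timesL_Obj simp del: timesL_FOb)
  next
    fix x assume x: "x \<in> Obj L"
    show "bpa (map (\<lambda>(B, B'). FAr timesC (cmpt \<sigma> (x \<restriction> B), cmpt \<tau> (x \<restriction> B'))) (decomps x)) \<in> Arr C \<and>
      Dom C (bpa (map (\<lambda>(B, B'). FAr timesC (cmpt \<sigma> (x \<restriction> B), cmpt \<tau> (x \<restriction> B'))) (decomps x))) = FOb (FOb timesL (fst \<sigma>, fst \<tau>)) x \<and>
      Cod C (bpa (map (\<lambda>(B, B'). FAr timesC (cmpt \<sigma> (x \<restriction> B), cmpt \<tau> (x \<restriction> B'))) (decomps x))) = FOb (FOb timesL (fst (snd \<sigma>), fst (snd \<tau>))) x"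
      using decompsD[OF x]
      by (subst bpa_Arr; (subst bpa_Arr)?; (subst bpa_Arr)?)
        (auto simp: FL.ArrD[OF st(1)] FL.ArrD[OF st(2)] restr_Obj x intro!: arg_cong[of _ _ bpo])
  next
    fix \<phi> assume \<phi>: "\<phi> \<in> Arr L"
    then have x: "fst \<phi> \<in> Obj L" and y: "fst (snd \<phi>) \<in> Obj L"
      and im: "cmpt \<phi> ` fst (fst \<phi>) = fst (fst (snd \<phi>))"
      by (auto simp: lin_Arr bij_betw_def)
    have n: "cmpt \<tau> (fst (snd \<phi>) \<restriction> (cmpt \<phi> ` B)) \<bullet> FAr (fst \<tau>) (\<phi> \<restriction>\<^sub>a B) = FAr (fst (snd \<tau>)) (\<phi> \<restriction>\<^sub>a B) \<bullet> cmpt \<tau> (fst \<phi> \<restriction> B)"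
      "cmpt \<tau> (fst (snd \<phi>) \<restriction> (cmpt \<phi> ` B)) \<in> Arr C" "FAr (fst \<tau>) (\<phi> \<restriction>\<^sub>a B) \<in> Arr C"
      "FAr (fst (snd \<tau>)) (\<phi> \<restriction>\<^sub>a B) \<in> Arr C" "cmpt \<tau> (fst \<phi> \<restriction> B) \<in> Arr C"
      "Dom C (cmpt \<tau> (fst (snd \<phi>) \<restriction> (cmpt \<phi> ` B))) = Cod C (FAr (fst \<tau>) (\<phi> \<restriction>\<^sub>a B))"
      "Dom C (FAr (fst (snd \<tau>)) (\<phi> \<restriction>\<^sub>a B)) = Cod C (cmpt \<tau> (fst \<phi> \<restriction> B))"
      if "B \<subseteq> fst (fst \<phi>)" "\<tau> \<in> Arr CL" for B and \<tau> :: "_ \<times> _ \<times> ('e lin \<Rightarrow> 'a)"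
    proof -
      have B: "cmpt \<phi> ` B \<subseteq> fst (fst (snd \<phi>))" using that im by auto
      show "cmpt \<tau> (fst (snd \<phi>) \<restriction> (cmpt \<phi> ` B)) \<bullet> FAr (fst \<tau>) (\<phi> \<restriction>\<^sub>a B) = FAr (fst (snd \<tau>)) (\<phi> \<restriction>\<^sub>a B) \<bullet> cmpt \<tau> (fst \<phi> \<restriction> B)"
        using FL.ArrD(6)[OF that(2) arr_restr_Arr[OF \<phi> that(1)]] by (simp add: lin_simps)
      show "cmpt \<tau> (fst (snd \<phi>) \<restriction> (cmpt \<phi> ` B)) \<in> Arr C" "FAr (fst \<tau>) (\<phi> \<restriction>\<^sub>a B) \<in> Arr C"
        "FAr (fst (snd \<tau>)) (\<phi> \<restriction>\<^sub>a B) \<in> Arr C" "cmpt \<tau> (fst \<phi> \<restriction> B) \<in> Arr C"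
        "Dom C (cmpt \<tau> (fst (snd \<phi>) \<restriction> (cmpt \<phi> ` B))) = Cod C (FAr (fst \<tau>) (\<phi> \<restriction>\<^sub>a B))"
        "Dom C (FAr (fst (snd \<tau>)) (\<phi> \<restriction>\<^sub>a B)) = Cod C (cmpt \<tau> (fst \<phi> \<restriction> B))"
        using that B FL.ArrD(1-5)[OF that(2)] FL.ObjD[OF FL.ArrD(1)[OF that(2)]] FL.ObjD[OF FL.ArrD(2)[OF that(2)]]
          arr_restr_Arr[OF \<phi> that(1)] restr_Obj[OF x that(1)] restr_Obj[OF y B] by (auto simp: lin_simps)
    qed
    have "bpa (map (\<lambda>(B, B'). FAr timesC (cmpt \<sigma> (fst (snd \<phi>) \<restriction> B), cmpt \<tau> (fst (snd \<phi>) \<restriction> B'))) (decomps (fst (snd \<phi>)))) \<bullet>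
        bpa (map (\<lambda>(B, B'). FAr timesC (FAr (fst \<sigma>) (\<phi> \<restriction>\<^sub>a B), FAr (fst \<tau>) (\<phi> \<restriction>\<^sub>a B'))) (decomps (fst \<phi>))) =
      bpa (map (\<lambda>(B, B'). FAr timesC (cmpt \<sigma> (fst (snd \<phi>) \<restriction> (cmpt \<phi> ` B)), cmpt \<tau> (fst (snd \<phi>) \<restriction> (cmpt \<phi> ` B'))) \<bullet>
        FAr timesC (FAr (fst \<sigma>) (\<phi> \<restriction>\<^sub>a B), FAr (fst \<tau>) (\<phi> \<restriction>\<^sub>a B'))) (decomps (fst \<phi>)))"
      unfolding decomps_Cod[OF \<phi>] map_map
      by (subst bpa_Cmp) (auto simp: n[OF _ st(1)] n[OF _ st(2)] decompsD[OF x] intro!: arg_cong[of _ _ bpa])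
    also have "\<dots> = bpa (map (\<lambda>(B, B'). FAr timesC (FAr (fst (snd \<sigma>)) (\<phi> \<restriction>\<^sub>a B), FAr (fst (snd \<tau>)) (\<phi> \<restriction>\<^sub>a B')) \<bullet>
        FAr timesC (cmpt \<sigma> (fst \<phi> \<restriction> B), cmpt \<tau> (fst \<phi> \<restriction> B'))) (decomps (fst \<phi>)))"
      using decompsD[OF x] by (auto intro!: arg_cong[of _ _ bpa] simp: n[OF _ st(1)] n[OF _ st(2)] simp flip: times_Cmp)
    also have "\<dots> = bpa (map (\<lambda>(B, B'). FAr timesC (FAr (fst (snd \<sigma>)) (\<phi> \<restriction>\<^sub>a B), FAr (fst (snd \<tau>)) (\<phi> \<restriction>\<^sub>a B'))) (decomps (fst \<phi>))) \<bullet>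
      bpa (map (\<lambda>(B, B'). FAr timesC (cmpt \<sigma> (fst \<phi> \<restriction> B), cmpt \<tau> (fst \<phi> \<restriction> B'))) (decomps (fst \<phi>)))"
      by (subst bpa_Cmp) (auto simp: n[OF _ st(1)] n[OF _ st(2)] decompsD[OF x] intro!: arg_cong[of _ _ bpa])
    finally show "bpa (map (\<lambda>(B, B'). FAr timesC (cmpt \<sigma> (Cod L \<phi> \<restriction> B), cmpt \<tau> (Cod L \<phi> \<restriction> B'))) (decomps (Cod L \<phi>))) \<bullet>
        FAr (FOb timesL (fst \<sigma>, fst \<tau>)) \<phi> =
      FAr (FOb timesL (fst (snd \<sigma>), fst (snd \<tau>))) \<phi> \<bullet>
        bpa (map (\<lambda>(B, B'). FAr timesC (cmpt \<sigma> (Dom L \<phi> \<restriction> B), cmpt \<tau> (Dom L \<phi> \<restriction> B'))) (decomps (Dom L \<phi>)))"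
      using \<phi> by (simp add: lin_simps)
  qed
  then show "FAr timesL f \<in> Arr CL \<and> Dom CL (FAr timesL f) = FOb timesL (Dom (CL \<times>\<^sub>C CL) f) \<and>
      Cod CL (FAr timesL f) = FOb timesL (Cod (CL \<times>\<^sub>C CL) f)"
    by (simp add: f timesL_FAr)
next
  fix x assume "x \<in> Obj (CL \<times>\<^sub>C CL)"
  then show "FAr timesL (Idn (CL \<times>\<^sub>C CL) x) = Idn CL (FOb timesL x)"
  proof -
    assume "x \<in> Obj (CL \<times>\<^sub>C CL)"
    then obtain F G where x: "x = (F, G)" and FG: "F \<in> Obj CL" "G \<in> Obj CL" by auto
    have "bpa (map (\<lambda>(B, B'). FAr timesC (cmpt (Idn CL F) (y \<restriction> B), cmpt (Idn CL G) (y \<restriction> B'))) (decomps y)) =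
        Idn C (bpo (map (\<lambda>(B, B'). FOb timesC (FOb F (y \<restriction> B), FOb G (y \<restriction> B'))) (decomps y)))" if y: "y \<in> Obj L" for y
      using decompsD[OF y]
      by (intro bpa_Idn) (auto simp: FL.ObjD(1)[OF FG(1)] FL.ObjD(1)[OF FG(2)] restr_Obj[OF y])
    then show ?thesis
      by (auto simp: x timesL_FAr FL.FC_Idn[of "_ :: ('e, 'o, 'a) lin_fun"] intro!: restrict_ext)
  qed
next
  fix f g assume fg: "f \<in> Arr (CL \<times>\<^sub>C CL)" "g \<in> Arr (CL \<times>\<^sub>C CL)" "Dom (CL \<times>\<^sub>C CL) g = Cod (CL \<times>\<^sub>C CL) f"
  obtain \<sigma> \<tau> where f: "f = (\<sigma>, \<tau>)" by (cases f)
  obtain \<sigma>' \<tau>' where g: "g = (\<sigma>', \<tau>')" by (cases g)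
  have st: "\<sigma> \<in> Arr CL" "\<tau> \<in> Arr CL" "\<sigma>' \<in> Arr CL" "\<tau>' \<in> Arr CL" "fst \<sigma>' = fst (snd \<sigma>)" "fst \<tau>' = fst (snd \<tau>)"
    using fg by (auto simp: f g)
  have "bpa (map (\<lambda>(B, B'). FAr timesC (cmpt (\<sigma>' \<bullet>\<^bsub>CL\<^esub> \<sigma>) (x \<restriction> B), cmpt (\<tau>' \<bullet>\<^bsub>CL\<^esub> \<tau>) (x \<restriction> B'))) (decomps x)) =
      bpa (map (\<lambda>(B, B'). FAr timesC (cmpt \<sigma>' (x \<restriction> B), cmpt \<tau>' (x \<restriction> B'))) (decomps x)) \<bullet>
      bpa (map (\<lambda>(B, B'). FAr timesC (cmpt \<sigma> (x \<restriction> B), cmpt \<tau> (x \<restriction> B'))) (decomps x))" if x: "x \<in> Obj L" for x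
  proof -
    have o: "x \<restriction> B \<in> Obj L \<and> x \<restriction> B' \<in> Obj L" if "(B, B') \<in> set (decomps x)" for B B'
      using decompsD[OF x that] by (simp add: restr_Obj[OF x])
    then show ?thesis
      using st(5,6) by (subst bpa_Cmp) (auto simp: FL.ArrD(3-5)[OF st(1)] FL.ArrD(3-5)[OF st(2)]
        FL.ArrD(3-5)[OF st(3)] FL.ArrD(3-5)[OF st(4)] times_Cmp dest!: o intro!: arg_cong[of _ _ bpa])
  qed
  then show "FAr timesL (g \<bullet>\<^bsub>CL \<times>\<^sub>C CL\<^esub> f) = FAr timesL g \<bullet>\<^bsub>CL\<^esub> FAr timesL f"
    by (auto simp: f g timesL_FAr FL.FC_Cmp[of "(_, _, _)"] FL.FC_Cmp[of _ \<sigma>] FL.FC_Cmp[of _ \<tau>] simp del: FL.FC_cmpt timesL_FOb intro!: restrict_ext)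
qed

lemma zeroL_Obj: "zeroL \<in> Obj CL"
  unfolding const_fun_def by (rule FL.ObjI) auto

lemma oneL_Obj: "oneL \<in> Obj CL"
proof -
  have e: "fst (Cod L \<phi>) = {} \<longleftrightarrow> fst (Dom L \<phi>) = {}" if "\<phi> \<in> Arr L" for \<phi>
    using that by (auto simp: lin_Arr lin_simps bij_betw_def)
  have Cmp: "Dom L (\<psi> \<bullet>\<^bsub>L\<^esub> \<phi>) = Dom L \<phi>" for \<phi> \<psi> by (simp add: lin_simps)
  have Idn: "Dom L (Idn L x) = x" for x by (simp add: lin_simps)
  show ?thesis
    unfolding unit_fun_def Let_def
    by (rule FL.ObjI) (simp_all add: e Cmp Idn)
qed

text \<open>From here on terms can be evaluated in \<open>C^L\<close>, at functors by
  \<open>RL.tob\<close> and at natural transformations by \<open>RL.tar\<close>.\<close>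

sublocale RL: rig_data CL plusL zeroL timesL oneL
  by (simp add: rig_data_def rig_data_axioms_def FL.category_FC plusL_functor timesL_functor zeroL_Obj oneL_Obj)

end

section \<open>Coherence for the convolution product\<close>

text \<open>The term \<open>expand x t A\<close> in the variables \<open>(i, B)\<close>, standing for \<open>F\<^sub>i(B)\<close>, computes the value at
  \<open>A \<subseteq> x\<close> of the term \<open>t\<close> in the functors \<open>F\<^sub>i\<close>.\<close>

primrec expand :: "'e lin \<Rightarrow> 'v rig_term \<Rightarrow> 'e set \<Rightarrow> ('v \<times> 'e set) rig_term" where
  "expand x (Var i) A = Var (i, A)"
| "expand x Nul A = Nul"
| "expand x Unt A = (if A = {} then Unt else Nul)"
| "expand x (Add t u) A = Add (expand x t A) (expand x u A)"
| "expand x (Mul t u) A = sum_term (map (\<lambda>(B, B'). Mul (expand x t B) (expand x u B')) (decomps (x \<restriction> A)))"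

lemma map_sum_term: "map_rig_term r (sum_term ts) = sum_term (map (map_rig_term r) ts)"
  by (induction ts) auto

lemma t_sub_sum_term: "t_sub s (sum_term ts) = sum_term (map (t_sub s) ts)"
  by (induction ts) auto

lemma decomps_restrD:
  assumes "x \<in> Obj lin_cat" "A \<subseteq> fst x" "(B, B') \<in> set (decomps (x \<restriction> A))"
  shows "B \<subseteq> A" "B' \<subseteq> A" "B' = A - B" "B \<subseteq> fst x" "B' \<subseteq> fst x"
  using decompsD[OF restr_Obj[OF assms(1,2)] assms(3)] assms(2) by auto

lemma decomps_Cod_restr:
  assumes \<phi>: "\<phi> \<in> Arr lin_cat" and A: "A \<subseteq> fst (fst \<phi>)"
  shows "decomps (fst (snd \<phi>) \<restriction> (cmpt \<phi> ` A)) = map (\<lambda>(B, B'). (cmpt \<phi> ` B, cmpt \<phi> ` B')) (decomps (fst \<phi> \<restriction> A))"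
proof -
  have x: "fst \<phi> \<in> Obj lin_cat" using \<phi> by (simp add: lin_Arr)
  have im: "restrict (cmpt \<phi>) A ` B = cmpt \<phi> ` B" if "B \<subseteq> A" for B
    using that by force
  have "decomps (fst (snd \<phi>) \<restriction> (cmpt \<phi> ` A)) =
      map (\<lambda>(B, B'). (restrict (cmpt \<phi>) A ` B, restrict (cmpt \<phi>) A ` B')) (decomps (fst \<phi> \<restriction> A))"
    using decomps_Cod[OF arr_restr_Arr[OF \<phi> A]] by (simp only: arr_restr_simps)
  also have "\<dots> = map (\<lambda>(B, B'). (cmpt \<phi> ` B, cmpt \<phi> ` B')) (decomps (fst \<phi> \<restriction> A))"
  proof (rule map_cong[OF refl])
    fix d assume d: "d \<in> set (decomps (fst \<phi> \<restriction> A))"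
    obtain B B' where d': "d = (B, B')" by (cases d)
    note D = decomps_restrD(1,2)[OF x A d[unfolded d']]
    show "(case d of (B, B') \<Rightarrow> (restrict (cmpt \<phi>) A ` B, restrict (cmpt \<phi>) A ` B')) = (case d of (B, B') \<Rightarrow> (cmpt \<phi> ` B, cmpt \<phi> ` B'))"
      by (simp only: d' prod.case im[OF D(1)] im[OF D(2)])
  qed
  finally show ?thesis .
qed

text \<open>An order isomorphism respects the listing of decompositions, so it only renames the
  letters of an expansion. The intersection mirrors the one in the environments and changes nothing
  on letters that occur.\<close>

lemma expand_map:
  assumes \<phi>: "\<phi> \<in> Arr lin_cat" and A: "A \<subseteq> fst (fst \<phi>)"
  shows "expand (fst (snd \<phi>)) t (cmpt \<phi> ` A) =
    map_rig_term (\<lambda>(i, B). (i, cmpt \<phi> ` (fst (fst \<phi>) \<inter> B))) (expand (fst \<phi>) t A)"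
  using A
proof (induction t arbitrary: A)
  case (Var i)
  then show ?case by (simp add: Int_absorb1)
next
  case (Mul t u)
  have x: "fst \<phi> \<in> Obj lin_cat" using \<phi> by (simp add: lin_Arr)
  note d = decomps_Cod_restr[OF \<phi> Mul.prems]
  show ?case
    by (auto simp: d map_sum_term Mul.IH decomps_restrD[OF x Mul.prems] intro!: arg_cong[of _ _ sum_term])
qed auto

text \<open>Expanding a substituted term is expanding the outer term and then every letter. It is
  used to view a structure isomorphism at composite functors as one in the letters of the basic
  functors.\<close>

lemma expand_sub:
  assumes x: "x \<in> Obj lin_cat" "A \<subseteq> fst x" "D \<subseteq> A"
  shows "t_sub (\<lambda>(i, B). expand x (s i) (A \<inter> B)) (expand (x \<restriction> A) t D) = expand x (t_sub s t) D"
  using assms(3)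
proof (induction t arbitrary: D)
  case (Var i)
  then show ?case by (simp add: Int_absorb1)
next
  case (Mul t u)
  have D: "D \<subseteq> fst x" using Mul.prems x by auto
  have r: "x \<restriction> A \<restriction> D = x \<restriction> D" using Mul.prems by (rule restr_restr)
  have "t_sub (\<lambda>(i, B). expand x (s i) (A \<inter> B)) (expand (x \<restriction> A) t B) = expand x (t_sub s t) B"
    "t_sub (\<lambda>(i, B). expand x (s i) (A \<inter> B)) (expand (x \<restriction> A) u B') = expand x (t_sub s u) B'"
    if "(B, B') \<in> set (decomps (x \<restriction> D))" for B B'
    using Mul.IH(1)[of B] Mul.IH(2)[of B'] decomps_restrD(1,2)[OF x(1) D that] Mul.prems by simp_all
  then show ?case
    by (auto simp: t_sub_sum_term r intro!: arg_cong[of _ _ sum_term])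
qed auto

section \<open>Monomials of an expansion\<close>

lemma mons_conc: "mons t B = {m @ b | m b. m \<in> mons t {[]} \<and> b \<in> B}"
proof (induction t arbitrary: B)
  case (Mul t u)
  have "mons t (mons u B) = {m @ m' @ b | m m' b. m \<in> mons t {[]} \<and> m' \<in> mons u {[]} \<and> b \<in> B}"
    by (subst Mul.IH(1), subst Mul.IH(2)) blast
  moreover have "mons t (mons u {[]}) = {m @ m' | m m'. m \<in> mons t {[]} \<and> m' \<in> mons u {[]}}"
    by (rule Mul.IH(1))
  ultimately show ?case by (simp, safe) (metis append.assoc)+
next
  case (Add t u)
  show ?case by (subst mons.simps, subst Add.IH(1), subst Add.IH(2)) auto
qed auto

lemma mons_letters: "m \<in> mons t {[]} \<Longrightarrow> set m \<subseteq> set_rig_term t"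
proof (induction t arbitrary: m)
  case (Mul t u)
  then obtain p q where "m = p @ q" "p \<in> mons t {[]}" "q \<in> mons u {[]}"
    using mons_conc[of t "mons u {[]}"] by auto
  then show ?case using Mul.IH by fastforce
qed auto

text \<open>A condition on terms in functors that makes all their expansions regular. Disjointness
  of the variables of two factors lets the boundary between the factors be read off a word.\<close>

primrec linear :: "'v rig_term \<Rightarrow> bool" where
  "linear (Var i) = True"
| "linear Nul = True"
| "linear Unt = True"
| "linear (Add t u) = (linear t \<and> linear u \<and> mons t {[]} \<inter> mons u {[]} = {})"
| "linear (Mul t u) = (linear t \<and> linear u \<and> set_rig_term t \<inter> set_rig_term u = {})"

text \<open>Ordered decompositions of \<open>A\<close> into disjoint, possibly empty pieces, one for
  each letter of a monomial.\<close>

primrec splits :: "'e set list \<Rightarrow> 'e set \<Rightarrow> bool" where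
  "splits [] A \<longleftrightarrow> A = {}"
| "splits (B # Bs) A \<longleftrightarrow> B \<subseteq> A \<and> splits Bs (A - B)"

lemma splits_Union: "splits Bs A \<Longrightarrow> A = \<Union> (set Bs)"
  by (induction Bs arbitrary: A) auto

lemma splits_append: "splits (Bs @ Bs') A \<longleftrightarrow> (\<exists>B \<subseteq> A. splits Bs B \<and> splits Bs' (A - B))"
proof (induction Bs arbitrary: A)
  case (Cons D Bs)
  show ?case (is "?l \<longleftrightarrow> ?r")
  proof
    assume ?l
    then obtain B where "D \<subseteq> A" "B \<subseteq> A - D" "splits Bs B" "splits Bs' (A - D - B)" using Cons.IH by auto
    moreover from this have "A - (B \<union> D) = A - D - B" "B \<union> D - D = B" by auto
    ultimately show ?r by (intro exI[of _ "B \<union> D"]) auto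
  next
    assume ?r
    then obtain B where "B \<subseteq> A" "D \<subseteq> B" "splits Bs (B - D)" "splits Bs' (A - B)" by auto
    moreover from this have "A - D - (B - D) = A - B" by auto
    ultimately have "D \<subseteq> A" "B - D \<subseteq> A - D" "splits Bs (B - D)" "splits Bs' (A - D - (B - D))" by auto
    then show ?l using Cons.IH by auto
  qed
qed simp

lemma mons_sum_term: "mons (sum_term ts) B = (\<Union>t \<in> set ts. mons t B)"
  by (induction ts) auto

text \<open>Nested decompositions along a product flatten to one ordered decomposition, whatever the
  bracketing. The right-hand side depends on \<open>t\<close> only through
  \<open>mons t {[]}\<close>, so terms with equal monomials have expansions with equal
  monomials.\<close>

lemma mons_expand:
  assumes x: "x \<in> Obj lin_cat" and A: "A \<subseteq> fst x"
  shows "mons (expand x t A) B = {m @ b | m b. b \<in> B \<and> map fst m \<in> mons t {[]} \<and> splits (map snd m) A}"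
  using A
proof (induction t arbitrary: A B)
  case (Var i)
  have "map fst m = [i] \<and> splits (map snd m) A \<longleftrightarrow> m = [(i, A)]" for m
    by (cases m) auto
  then show ?case by auto
next
  case (Mul t u)
  have set: "set (decomps (x \<restriction> A)) = (\<lambda>D. (D, A - D)) ` {D. D \<subseteq> A}"
    using set_decomps[OF restr_Obj[OF x Mul.prems]] by auto
  have IHt: "mons (expand x t D) B' = {m @ b | m b. b \<in> B' \<and> map fst m \<in> mons t {[]} \<and> splits (map snd m) D}" if "D \<subseteq> A" for D B'
    using that Mul.prems by (intro Mul.IH) auto
  have IHu: "mons (expand x u (A - D)) B = {m @ b | m b. b \<in> B \<and> map fst m \<in> mons u {[]} \<and> splits (map snd m) (A - D)}" for D
    using Mul.prems by (intro Mul.IH) auto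
  let ?S = "{m @ m' @ b | m m' b. \<exists>D \<subseteq> A. map fst m \<in> mons t {[]} \<and> splits (map snd m) D \<and> b \<in> B \<and>
      map fst m' \<in> mons u {[]} \<and> splits (map snd m') (A - D)}"
  have "mons (expand x (Mul t u) A) B = (\<Union>D \<in> {D. D \<subseteq> A}. mons (expand x t D) (mons (expand x u (A - D)) B))"
    by (simp add: mons_sum_term set)
  also have "\<dots> = ?S"
  proof (intro Set.set_eqI iffI)
    fix w assume "w \<in> (\<Union>D \<in> {D. D \<subseteq> A}. mons (expand x t D) (mons (expand x u (A - D)) B))"
    then obtain D where D: "D \<subseteq> A" "w \<in> mons (expand x t D) (mons (expand x u (A - D)) B)" by blast
    then obtain m c where m: "w = m @ c" "c \<in> mons (expand x u (A - D)) B" "map fst m \<in> mons t {[]}" "splits (map snd m) D"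
      unfolding IHt[OF D(1)] by blast
    then obtain m' b where "c = m' @ b" "b \<in> B" "map fst m' \<in> mons u {[]}" "splits (map snd m') (A - D)"
      unfolding IHu by blast
    then show "w \<in> ?S" using D(1) m by blast
  next
    fix w assume "w \<in> ?S"
    then obtain m m' b D where *: "w = m @ m' @ b" "b \<in> B" "D \<subseteq> A" "map fst m \<in> mons t {[]}" "splits (map snd m) D"
      "map fst m' \<in> mons u {[]}" "splits (map snd m') (A - D)" by blast
    then have "m' @ b \<in> mons (expand x u (A - D)) B" unfolding IHu by blast
    then have "w \<in> mons (expand x t D) (mons (expand x u (A - D)) B)" unfolding IHt[OF *(3)] using * by blast
    then show "w \<in> (\<Union>D \<in> {D. D \<subseteq> A}. mons (expand x t D) (mons (expand x u (A - D)) B))" using *(3) by blast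
  qed
  also have "\<dots> = {n @ b | n b. b \<in> B \<and> map fst n \<in> mons (Mul t u) {[]} \<and> splits (map snd n) A}"
  proof (intro Set.set_eqI iffI)
    fix w assume "w \<in> {m @ m' @ b | m m' b. \<exists>D \<subseteq> A. map fst m \<in> mons t {[]} \<and> splits (map snd m) D \<and> b \<in> B \<and>
      map fst m' \<in> mons u {[]} \<and> splits (map snd m') (A - D)}"
    then obtain m m' b D where *: "w = (m @ m') @ b" "b \<in> B" "D \<subseteq> A" "map fst m \<in> mons t {[]}" "splits (map snd m) D"
      "map fst m' \<in> mons u {[]}" "splits (map snd m') (A - D)" by auto
    then have "map fst (m @ m') \<in> mons (Mul t u) {[]}"
      using mons_conc[of t "mons u {[]}"] by auto
    moreover have "splits (map snd (m @ m')) A" using * splits_append by (metis map_append)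
    ultimately show "w \<in> {n @ b | n b. b \<in> B \<and> map fst n \<in> mons (Mul t u) {[]} \<and> splits (map snd n) A}"
      using * by blast
  next
    fix w assume "w \<in> {n @ b | n b. b \<in> B \<and> map fst n \<in> mons (Mul t u) {[]} \<and> splits (map snd n) A}"
    then obtain n b where *: "w = n @ b" "b \<in> B" "map fst n \<in> mons t (mons u {[]})" "splits (map snd n) A" by auto
    from *(3) obtain p q where pq: "map fst n = p @ q" "p \<in> mons t {[]}" "q \<in> mons u {[]}"
      using mons_conc[of t "mons u {[]}"] by auto
    then obtain m m' where n: "n = m @ m'" "map fst m = p" "map fst m' = q"
      by (metis map_eq_append_conv)
    then obtain D where "D \<subseteq> A" "splits (map snd m) D" "splits (map snd m') (A - D)"
      using *(4) splits_append[of "map snd m" "map snd m'" A] by auto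
    then show "w \<in> {m @ m' @ b | m m' b. \<exists>D \<subseteq> A. map fst m \<in> mons t {[]} \<and> splits (map snd m) D \<and> b \<in> B \<and>
      map fst m' \<in> mons u {[]} \<and> splits (map snd m') (A - D)}"
      using * n pq by auto
  qed
  finally show ?case .
qed auto

lemma regular_sum_term:
  assumes "\<And>d. d \<in> set ds \<Longrightarrow> regular (f d) B" "distinct ds"
    and "\<And>d d'. d \<in> set ds \<Longrightarrow> d' \<in> set ds \<Longrightarrow> d \<noteq> d' \<Longrightarrow> mons (f d) B \<inter> mons (f d') B = {}"
  shows "regular (sum_term (map f ds)) B"
  using assms
proof (induction ds)
  case (Cons d ds)
  then have "mons (f d) B \<inter> mons (f d') B = {}" if "d' \<in> set ds" for d'
    using that by (metis distinct.simps(2) list.set_intros)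
  then show ?case using Cons by (auto simp: mons_sum_term)
qed simp

text \<open>If the letters of the first parts have labels in \<open>V\<close> and those of the
  remainders do not, the first part is the longest prefix with labels in \<open>V\<close>.\<close>

lemma takeWhile_letters:
  assumes "m @ b = m' @ b'" "P ` set m \<subseteq> V" "P ` set m' \<subseteq> V" "P ` set b \<inter> V = {}" "P ` set b' \<inter> V = {}"
  shows "m = m' \<and> b = b'"
proof -
  have *: "takeWhile (\<lambda>a. P a \<in> V) (n @ c) = n" if "P ` set n \<subseteq> V" "P ` set c \<inter> V = {}" for n c
  proof -
    have "takeWhile (\<lambda>a. P a \<in> V) c = []" using that(2) by (cases c) auto
    then show ?thesis using that(1) by (subst takeWhile_append2) auto
  qed
  have "m = takeWhile (\<lambda>a. P a \<in> V) (m @ b)" using *[OF assms(2,4)] by simp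
  also have "\<dots> = m'" unfolding assms(1) by (rule *[OF assms(3,5)])
  finally show ?thesis using assms(1) by simp
qed

text \<open>The words of \<open>B\<close> avoid the variables of \<open>t\<close>, so a word of the
  expansion determines the part contributed by \<open>t\<close>. For a sum this part would be a
  monomial of both summands, and for a product it determines the decomposition.\<close>

lemma regular_expand:
  assumes x: "x \<in> Obj lin_cat" and "A \<subseteq> fst x" "linear t" "\<And>b. b \<in> B \<Longrightarrow> fst ` set b \<inter> set_rig_term t = {}"
  shows "regular (expand x t A) B"
  using assms(2-)
proof (induction t arbitrary: A B)
  case (Add t u)
  have "mons (expand x t A) B \<inter> mons (expand x u A) B = {}"
  proof (rule ccontr)
    assume "mons (expand x t A) B \<inter> mons (expand x u A) B \<noteq> {}"
    then obtain m b m' b' where *: "m @ b = m' @ b'" "b \<in> B" "b' \<in> B" "map fst m \<in> mons t {[]}" "map fst m' \<in> mons u {[]}"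
      unfolding mons_expand[OF x Add.prems(1)] by auto
    have "m = m' \<and> b = b'"
      by (rule takeWhile_letters[of _ _ _ _ fst "set_rig_term (Add t u)"])
        (use * Add.prems(3) mons_letters[OF *(4)] mons_letters[OF *(5)] in auto)
    then show False using * Add.prems(2) by auto
  qed
  moreover have "fst ` set b \<inter> set_rig_term t = {}" "fst ` set b \<inter> set_rig_term u = {}" if "b \<in> B" for b
    using Add.prems(3)[OF that] by auto
  ultimately show ?case using Add by simp
next
  case (Mul t u)
  note dD = decomps_restrD[OF x Mul.prems(1)]
  have B: "fst ` set b \<inter> set_rig_term t = {}" "fst ` set b \<inter> set_rig_term u = {}" if "b \<in> B" for b
    using Mul.prems(3)[OF that] by auto
  have B': "fst ` set b \<inter> set_rig_term t = {}" if "b \<in> mons (expand x u D) B" "D \<subseteq> fst x" for b D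
  proof -
    note h = that
    obtain m b' where b: "b = m @ b'" "b' \<in> B" "map fst m \<in> mons u {[]}"
      using h unfolding mons_expand[OF x h(2)] by auto
    then show ?thesis using mons_letters[OF b(3)] B(1)[OF b(2)] Mul.prems(2) by (auto simp: image_Un)
  qed
  show ?case
    unfolding expand.simps
  proof (rule regular_sum_term)
    show "distinct (decomps (x \<restriction> A))" using x Mul.prems(1) by (intro distinct_decomps restr_Obj)
  next
    fix d assume d: "d \<in> set (decomps (x \<restriction> A))"
    obtain D D' where d': "d = (D, D')" by (cases d)
    note D = dD[OF d[unfolded d']]
    have "regular (expand x u D') B"
      using D B Mul.prems by (intro Mul.IH) auto
    moreover have "regular (expand x t D) (mons (expand x u D') B)"
      using D B' Mul.prems by (intro Mul.IH) auto
    ultimately show "regular (case d of (B, B') \<Rightarrow> Mul (expand x t B) (expand x u B')) B"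
      by (simp add: d')
  next
    fix d e assume d: "d \<in> set (decomps (x \<restriction> A))" "e \<in> set (decomps (x \<restriction> A))" and ne: "d \<noteq> e"
    obtain D D' E E' where de: "d = (D, D')" "e = (E, E')" by (cases d; cases e) auto
    note D = dD[OF d(1)[unfolded de]] and E = dD[OF d(2)[unfolded de]]
    show "mons (case d of (B, B') \<Rightarrow> Mul (expand x t B) (expand x u B')) B \<inter>
        mons (case e of (B, B') \<Rightarrow> Mul (expand x t B) (expand x u B')) B = {}"
    proof (rule ccontr)
      assume "\<not> ?thesis"
      then obtain m b m' b' where *: "m @ b = m' @ b'" "b \<in> mons (expand x u D') B" "b' \<in> mons (expand x u E') B"
          "map fst m \<in> mons t {[]}" "map fst m' \<in> mons t {[]}" "splits (map snd m) D" "splits (map snd m') E"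
        unfolding de by (auto simp: mons_expand[OF x D(4)] mons_expand[OF x E(4)])
      have "m = m' \<and> b = b'"
        by (rule takeWhile_letters[of _ _ _ _ fst "set_rig_term t"])
          (use * B'[OF *(2) D(5)] B'[OF *(3) E(5)] mons_letters[OF *(4)] mons_letters[OF *(5)] in auto)
      \<comment> \<open>The pieces attached to the letters of the left factor have the first set of
        the decomposition as their union.\<close>
      then have "D = E" using splits_Union[OF *(6)] splits_Union[OF *(7)] by simp
      then show False using ne de D(3) E(3) by simp
    qed
  qed
qed auto

section \<open>Values of terms in functors\<close>

context rig_lin begin

text \<open>Intersecting with \<open>fst x\<close> makes the environments total: every variable has a value in \<open>C\<close>.\<close>

definition lenv :: "('v \<Rightarrow> ('e, 'o, 'a) lin_fun) \<Rightarrow> 'e lin \<Rightarrow> 'v \<times> 'e set \<Rightarrow> 'o" where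
  "lenv F x = (\<lambda>(i, B). FOb (F i) (x \<restriction> (fst x \<inter> B)))"

definition lenv_ar :: "('v \<Rightarrow> ('e, 'o, 'a) lin_fun) \<Rightarrow> 'e lin_arr \<Rightarrow> 'v \<times> 'e set \<Rightarrow> 'a" where
  "lenv_ar F \<phi> = (\<lambda>(i, B). FAr (F i) (\<phi> \<restriction>\<^sub>a (fst (fst \<phi>) \<inter> B)))"

definition lenv_nat :: "('v \<Rightarrow> ('e, 'o, 'a) lin_nat) \<Rightarrow> 'e lin \<Rightarrow> 'v \<times> 'e set \<Rightarrow> 'a" where
  "lenv_nat \<tau> x = (\<lambda>(i, B). cmpt (\<tau> i) (x \<restriction> (fst x \<inter> B)))"

lemma lenv_Obj: "(\<And>i. F i \<in> Obj CL) \<Longrightarrow> x \<in> Obj L \<Longrightarrow> lenv F x a \<in> Obj C"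
  by (cases a) (simp add: lenv_def FL.ObjD restr_Obj)

text \<open>Stated for all subsets \<open>A\<close> of one fixed \<open>x\<close>, so that in a
  product the values of the factors at smaller sets live in the same environment.\<close>

lemma value_FOb:
  assumes x: "x \<in> Obj L" and A: "A \<subseteq> fst x"
  shows "FOb (RL.tob F t) (x \<restriction> A) = tob (lenv F x) (expand x t A)"
  using A
proof (induction t arbitrary: A)
  case (Var i)
  then show ?case by (simp add: lenv_def Int_absorb1)
next
  case (Mul t u)
  then show ?case
    using decomps_restrD[OF x Mul.prems] restr_Obj[OF x Mul.prems]
    by (auto simp: tob_sum_term restr_restr intro!: arg_cong[of _ _ bpo])
qed (auto simp: const_fun_def unit_fun_def Let_def restr_Obj[OF x])

lemma value_FAr:
  assumes \<phi>: "\<phi> \<in> Arr L" and A: "A \<subseteq> fst (fst \<phi>)"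
  shows "FAr (RL.tob F t) (\<phi> \<restriction>\<^sub>a A) = tar (lenv_ar F \<phi>) (expand (fst \<phi>) t A)"
  using A
proof (induction t arbitrary: A)
  case (Var i)
  then show ?case by (simp add: lenv_ar_def Int_absorb1)
next
  case (Mul t u)
  have x: "fst \<phi> \<in> Obj L" using \<phi> by (simp add: lin_Arr)
  from Mul show ?case
    using decomps_restrD[OF x Mul.prems] arr_restr_Arr[OF \<phi> Mul.prems]
    by (auto simp: tar_sum_term arr_restr_restr lin_simps intro!: arg_cong[of _ _ bpa])
qed (auto simp: const_fun_def unit_fun_def Let_def arr_restr_Arr[OF \<phi>] lin_simps)

lemma value_nat:
  assumes x: "x \<in> Obj L" and A: "A \<subseteq> fst x"
  shows "cmpt (RL.tar \<tau> t) (x \<restriction> A) = tar (lenv_nat \<tau> x) (expand x t A)"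
  using A
proof (induction t arbitrary: A)
  case (Var i)
  then show ?case by (simp add: lenv_nat_def Int_absorb1)
next
  case (Mul t u)
  then show ?case
    using decomps_restrD[OF x Mul.prems] restr_Obj[OF x Mul.prems]
    by (auto simp: tar_sum_term timesL_FAr restr_restr intro!: arg_cong[of _ _ bpa])
qed (auto simp: FL.FC_Idn plusL_FAr const_fun_def unit_fun_def Let_def restr_Obj[OF x])

end

lemma arr_restr_self: "\<phi> \<in> Arr lin_cat \<Longrightarrow> \<phi> \<restriction>\<^sub>a fst (fst \<phi>) = \<phi>"
proof -
  assume \<phi>: "\<phi> \<in> Arr lin_cat"
  then have "cmpt \<phi> ` fst (fst \<phi>) = fst (fst (snd \<phi>))" "restrict (cmpt \<phi>) (fst (fst \<phi>)) = cmpt \<phi>"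
    "fst \<phi> \<in> Obj lin_cat" "fst (snd \<phi>) \<in> Obj lin_cat"
    by (auto simp: lin_Arr bij_betw_def extensional_restrict)
  then show ?thesis by (simp add: prod_eq_iff restr_self)
qed

lemma t_sub_Var_map: "t_sub (\<lambda>a. Var (r a)) t = map_rig_term r t"
  by (induction t) auto

section \<open>Canonical isomorphisms between terms in functors\<close>

definition similar :: "'v rig_term \<Rightarrow> 'v rig_term \<Rightarrow> bool" where
  "similar t u \<longleftrightarrow> linear t \<and> linear u \<and> mons t {[]} = mons u {[]}"

locale coherent_lin =
  coherent_distributive_category C plusC zeroC aP lP rP plus_o plus_a sP timesC oneC aT lT rT
    times_o times_a dl dr nl nr \<i>
  for C :: "('o, 'a) cat" (structure)
    and plusC zeroC aP lP rP
    and plus_o (infixr "\<oplus>\<^sub>o" 70) and plus_a (infixr "\<oplus>\<^sub>a" 70) and sP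
    and timesC oneC aT lT rT
    and times_o (infixr "\<otimes>\<^sub>o" 75) and times_a (infixr "\<otimes>\<^sub>a" 75)
    and dl dr :: "'o \<times> 'o \<times> 'o \<Rightarrow> 'a" and nl nr :: "'o \<Rightarrow> 'a" and \<i> +
  fixes E :: "'e itself"
begin

sublocale rig_lin C plusC zeroC timesC oneC E
  unfolding rig_lin_def by (rule rig_data)

lemma span_unique:
  assumes "\<And>a. J a \<in> Obj C" "regular t {[]}" "regular u {[]}" "span J t u f" "span J t u g"
  shows "f = g"
proof -
  interpret coherent_env C plusC zeroC aP lP rP plus_o plus_a sP timesC oneC aT lT rT
    times_o times_a dl dr nl nr \<i> J by unfold_locales (rule assms)
  show ?thesis using co_unique span_co assms by blast
qed

text \<open>One isomorphism is chosen for each \<open>x\<close>, with no relation between the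
  choices. For similar terms \<open>span_unique\<close> leaves only one candidate, and this is what
  makes the family natural.\<close>

definition KL :: "'v rig_term \<Rightarrow> 'v rig_term \<Rightarrow> ('v \<Rightarrow> ('e, 'o, 'a) lin_fun) \<Rightarrow> ('e, 'o, 'a) lin_nat" where
  "KL t u F = (RL.tob F t, RL.tob F u,
    \<lambda>x \<in> Obj L. SOME f. span (lenv F x) (expand x t (fst x)) (expand x u (fst x)) f)"

lemma KL_simps [simp]: "fst (KL t u F) = RL.tob F t" "fst (snd (KL t u F)) = RL.tob F u"
  by (simp_all add: KL_def)

lemma regular_expand_top: "x \<in> Obj L \<Longrightarrow> linear t \<Longrightarrow> regular (expand x t (fst x)) {[]}"
  by (rule regular_expand) auto

lemma KL_span:
  assumes "similar t u" "x \<in> Obj L"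
  shows "span (lenv F x) (expand x t (fst x)) (expand x u (fst x)) (cmpt (KL t u F) x)"
proof -
  have "mons (expand x t (fst x)) {[]} = mons (expand x u (fst x)) {[]}"
    using assms by (simp add: mons_expand similar_def)
  then have "\<exists>f. span (lenv F x) (expand x t (fst x)) (expand x u (fst x)) f"
    using assms by (intro span_exists regular_expand_top) (auto simp: similar_def)
  then show ?thesis using assms(2) by (simp add: KL_def someI_ex)
qed

lemma KL_component:
  assumes tu: "similar t u" and x: "x \<in> Obj L" and F: "\<And>i. F i \<in> Obj CL"
  shows "iso (cmpt (KL t u F) x)" "Dom C (cmpt (KL t u F) x) = FOb (RL.tob F t) x"
    "Cod C (cmpt (KL t u F) x) = FOb (RL.tob F u) x"
proof -
  interpret coherent_env C plusC zeroC aP lP rP plus_o plus_a sP timesC oneC aT lT rT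
    times_o times_a dl dr nl nr \<i> "lenv F x" by unfold_locales (simp add: lenv_Obj F x)
  show "iso (cmpt (KL t u F) x)" "Dom C (cmpt (KL t u F) x) = FOb (RL.tob F t) x"
    "Cod C (cmpt (KL t u F) x) = FOb (RL.tob F u) x"
    using span_simps[OF KL_span[OF tu x]] value_FOb[OF x order_refl, of F] by (simp_all add: restr_self x)
qed

text \<open>Naturality along \<phi>: transporting the component at the source by
  \<open>span_natural\<close> gives a canonical isomorphism in the environment of codomains, which
  after renaming letters is one at the target and hence the chosen one.\<close>

lemma KL_Arr:
  assumes tu: "similar t u" and F: "\<And>i. F i \<in> Obj CL"
  shows "KL t u F \<in> Arr CL"
proof -
  have "(RL.tob F t, RL.tob F u, \<lambda>x \<in> Obj L. cmpt (KL t u F) x) \<in> Arr CL"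
  proof (rule FL.ArrI)
    show "RL.tob F t \<in> Obj CL" "RL.tob F u \<in> Obj CL" using F by auto
    show "cmpt (KL t u F) x \<in> Arr C \<and> Dom C (cmpt (KL t u F) x) = FOb (RL.tob F t) x \<and>
        Cod C (cmpt (KL t u F) x) = FOb (RL.tob F u) x" if "x \<in> Obj L" for x
      using KL_component[OF tu that F] by simp
  next
    fix \<phi> assume \<phi>: "\<phi> \<in> Arr L"
    let ?x = "fst \<phi>" and ?y = "fst (snd \<phi>)" and ?r = "\<lambda>(i :: 'v, B). (i, cmpt \<phi> ` (fst (fst \<phi>) \<inter> B))"
    have x: "?x \<in> Obj L" and y: "?y \<in> Obj L" and im: "cmpt \<phi> ` fst ?x = fst ?y"
      using \<phi> by (auto simp: lin_Arr bij_betw_def)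
    have h: "lenv_ar F \<phi> a \<in> Arr C" "Dom C (lenv_ar F \<phi> a) = lenv F ?x a"
      "Cod C (lenv_ar F \<phi> a) = lenv F ?y (?r a)" for a
    proof -
      obtain i B where a: "a = (i, B)" by (cases a)
      have "cmpt \<phi> ` (fst ?x \<inter> B) \<subseteq> fst ?y" using im by auto
      then have "fst ?y \<inter> cmpt \<phi> ` (fst ?x \<inter> B) = cmpt \<phi> ` (fst ?x \<inter> B)" by auto
      then show "lenv_ar F \<phi> a \<in> Arr C" "Dom C (lenv_ar F \<phi> a) = lenv F ?x a"
        "Cod C (lenv_ar F \<phi> a) = lenv F ?y (?r a)"
        by (simp_all add: a lenv_ar_def lenv_def FL.ObjD[OF F] arr_restr_Arr[OF \<phi>] lin_simps)
    qed
    have e: "expand ?y w (fst ?y) = t_sub (\<lambda>a. Var (?r a)) (expand ?x w (fst ?x))" for w :: "'v rig_term"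
      using expand_map[OF \<phi> order_refl, of w] by (simp add: im t_sub_Var_map)
    obtain g where g: "span (\<lambda>a. Cod C (lenv_ar F \<phi> a)) (expand ?x t (fst ?x)) (expand ?x u (fst ?x)) g"
      and eq: "ar (lenv_ar F \<phi>) (expand ?x u (fst ?x)) \<bullet> cmpt (KL t u F) ?x = g \<bullet> ar (lenv_ar F \<phi>) (expand ?x t (fst ?x))"
      using span_natural[of "lenv_ar F \<phi>" "expand ?x t (fst ?x)" "expand ?x u (fst ?x)" "cmpt (KL t u F) ?x"]
        KL_span[OF tu x, of F] h(1) by (auto simp: h(2))
    have "span (lenv F ?y) (expand ?y t (fst ?y)) (expand ?y u (fst ?y)) g"
      unfolding e by (rule span_sub) (use g in \<open>simp add: h(3)\<close>)
    \<comment> \<open>Both arrows are spans between the same regular terms in the same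
      environment.\<close>
    then have "g = cmpt (KL t u F) ?y"
      using KL_span[OF tu y, of F] tu y by (intro span_unique[of "lenv F ?y", OF _ regular_expand_top regular_expand_top]) (auto simp: lenv_Obj F similar_def)
    then show "cmpt (KL t u F) (Cod L \<phi>) \<bullet> FAr (RL.tob F t) \<phi> = FAr (RL.tob F u) \<phi> \<bullet> cmpt (KL t u F) (Dom L \<phi>)"
      using eq value_FAr[OF \<phi> order_refl, of F] by (simp add: arr_restr_self[OF \<phi>] lin_simps)
  qed
  moreover have "(RL.tob F t, RL.tob F u, \<lambda>x \<in> Obj L. cmpt (KL t u F) x) = KL t u F"
    by (auto simp: KL_def restrict_def fun_eq_iff)
  ultimately show ?thesis by simp
qed

lemma KL_iso:
  assumes "similar t u" "\<And>i. F i \<in> Obj CL"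
  shows "is_isomorphism CL (KL t u F)"
  using assms by (intro FL.FC_isoI KL_Arr KL_component)

text \<open>The argument of \<open>KL_Arr\<close> with the components of a family of natural
  transformations in place of the values at \<phi>; the set \<open>x\<close> is fixed, so no letter
  is renamed.\<close>

lemma KL_natural:
  assumes tu: "similar t u" and \<tau>: "\<And>i. \<tau> i \<in> Arr CL"
  shows "KL t u (\<lambda>i. Cod CL (\<tau> i)) \<bullet>\<^bsub>CL\<^esub> RL.tar \<tau> t = RL.tar \<tau> u \<bullet>\<^bsub>CL\<^esub> KL t u (\<lambda>i. Dom CL (\<tau> i))"
proof (rule FL.Arr_eqI)
  have o: "fst (\<tau> i) \<in> Obj CL" "fst (snd (\<tau> i)) \<in> Obj CL" for i using FL.ArrD(1,2)[OF \<tau>] by simp_all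
  have ts: "RL.tar \<tau> w \<in> Arr CL" "fst (RL.tar \<tau> w) = RL.tob (\<lambda>i. fst (\<tau> i)) w"
    "fst (snd (RL.tar \<tau> w)) = RL.tob (\<lambda>i. fst (snd (\<tau> i))) w" for w
    using RL.tar_simps[of \<tau> w, OF \<tau>] by simp_all
  note [simp] = KL_Arr[OF tu] \<tau> o ts
  show "KL t u (\<lambda>i. Cod CL (\<tau> i)) \<bullet>\<^bsub>CL\<^esub> RL.tar \<tau> t \<in> Arr CL" "RL.tar \<tau> u \<bullet>\<^bsub>CL\<^esub> KL t u (\<lambda>i. Dom CL (\<tau> i)) \<in> Arr CL"
    by (rule FL.FC.Cmp_simps(1); simp)+
  show "fst (KL t u (\<lambda>i. Cod CL (\<tau> i)) \<bullet>\<^bsub>CL\<^esub> RL.tar \<tau> t) = fst (RL.tar \<tau> u \<bullet>\<^bsub>CL\<^esub> KL t u (\<lambda>i. Dom CL (\<tau> i)))"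
    "fst (snd (KL t u (\<lambda>i. Cod CL (\<tau> i)) \<bullet>\<^bsub>CL\<^esub> RL.tar \<tau> t)) = fst (snd (RL.tar \<tau> u \<bullet>\<^bsub>CL\<^esub> KL t u (\<lambda>i. Dom CL (\<tau> i))))"
    by (simp_all add: FL.FC_Cmp)
next
  fix x assume x: "x \<in> Obj L"
  have h: "lenv_nat \<tau> x a \<in> Arr C" "Dom C (lenv_nat \<tau> x a) = lenv (\<lambda>i. Dom CL (\<tau> i)) x a"
    "Cod C (lenv_nat \<tau> x a) = lenv (\<lambda>i. Cod CL (\<tau> i)) x a" for a
    by (cases a; simp add: lenv_nat_def lenv_def FL.ArrD(3-5)[OF \<tau>] restr_Obj[OF x])+
  let ?t = "expand x t (fst x)" and ?u = "expand x u (fst x)" and ?K = "cmpt (KL t u (\<lambda>i. Dom CL (\<tau> i))) x"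
  obtain g where g: "span (lenv (\<lambda>i. Cod CL (\<tau> i)) x) ?t ?u g"
      and eq: "ar (lenv_nat \<tau> x) ?u \<bullet> ?K = g \<bullet> ar (lenv_nat \<tau> x) ?t"
    using span_natural[of "lenv_nat \<tau> x" ?t ?u ?K] KL_span[OF tu x, of "\<lambda>i. Dom CL (\<tau> i)"] h(1)
    by (auto simp: h(2,3))
  have "g = cmpt (KL t u (\<lambda>i. Cod CL (\<tau> i))) x"
    using KL_span[OF tu x, of "\<lambda>i. Cod CL (\<tau> i)"] g tu x \<tau>
    by (intro span_unique[of "lenv (\<lambda>i. Cod CL (\<tau> i)) x", OF lenv_Obj regular_expand_top regular_expand_top])
      (auto simp: similar_def FL.ArrD)
  then show "cmpt (KL t u (\<lambda>i. Cod CL (\<tau> i)) \<bullet>\<^bsub>CL\<^esub> RL.tar \<tau> t) x = cmpt (RL.tar \<tau> u \<bullet>\<^bsub>CL\<^esub> KL t u (\<lambda>i. Dom CL (\<tau> i))) x"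
    using eq value_nat[OF x order_refl, of \<tau>] x by (simp add: restr_self)
qed

text \<open>The lift of \<open>co\<close> to \<open>C^L\<close>. It ranges over subsets
  \<open>A\<close>, because a product evaluates its factors at proper subsets, and over sets
  \<open>B\<close> of tails, because the right factor places its letters behind those of the left
  one. Tails must avoid the variables of both terms so that the expansions stay regular.\<close>

definition coL :: "('v \<Rightarrow> ('e, 'o, 'a) lin_fun) \<Rightarrow> 'v rig_term \<Rightarrow> 'v rig_term \<Rightarrow> ('e, 'o, 'a) lin_nat \<Rightarrow> bool" where
  "coL F t u \<tau> \<longleftrightarrow> linear t \<and> linear u \<and> is_isomorphism CL \<tau> \<and> fst \<tau> = RL.tob F t \<and> fst (snd \<tau>) = RL.tob F u \<and>
    (\<forall>x \<in> Obj L. \<forall>A \<subseteq> fst x. \<forall>B. finite B \<longrightarrow> (\<forall>b \<in> B. fst ` set b \<inter> (set_rig_term t \<union> set_rig_term u) = {}) \<longrightarrow>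
      co (lenv F x) B (expand x t A) (expand x u A) (cmpt \<tau> (x \<restriction> A)))"

lemma coL_D:
  assumes "coL F t u \<tau>"
  shows "linear t" "linear u" "is_isomorphism CL \<tau>" "\<tau> \<in> Arr CL" "fst \<tau> = RL.tob F t" "fst (snd \<tau>) = RL.tob F u"
    "\<And>x A B. x \<in> Obj L \<Longrightarrow> A \<subseteq> fst x \<Longrightarrow> finite B \<Longrightarrow>
      (\<And>b. b \<in> B \<Longrightarrow> fst ` set b \<inter> (set_rig_term t \<union> set_rig_term u) = {}) \<Longrightarrow>
      co (lenv F x) B (expand x t A) (expand x u A) (cmpt \<tau> (x \<restriction> A))"
  using assms unfolding coL_def by auto

text \<open>The functors may themselves be values of terms \<open>s i\<close>; this covers structure
  isomorphisms at composite arguments. Regularity is needed only for the substituted terms, hence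
  the hypotheses on \<open>t_sub\<close>.\<close>

lemma coL_KL:
  assumes tu: "similar t u" and F: "\<And>i. F i \<in> Obj CL" and lin: "linear (t_sub s t)" "linear (t_sub s u)"
  shows "coL F (t_sub s t) (t_sub s u) (KL t u (\<lambda>i. RL.tob F (s i)))"
  unfolding coL_def
proof (intro conjI ballI allI impI)
  have G: "RL.tob F (s i) \<in> Obj CL" for i using F by simp
  show "is_isomorphism CL (KL t u (\<lambda>i. RL.tob F (s i)))" by (rule KL_iso[OF tu G])
  show "fst (KL t u (\<lambda>i. RL.tob F (s i))) = RL.tob F (t_sub s t)"
    "fst (snd (KL t u (\<lambda>i. RL.tob F (s i)))) = RL.tob F (t_sub s u)"
    by (simp_all add: t_ob_sub)
  fix x A and B :: "(_ \<times> 'e set) list set"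
  assume x: "x \<in> Obj L" and A: "A \<subseteq> fst x" and "finite B"
    and B: "\<forall>b \<in> B. fst ` set b \<inter> (set_rig_term (t_sub s t) \<union> set_rig_term (t_sub s u)) = {}"
  interpret coherent_env C plusC zeroC aP lP rP plus_o plus_a sP timesC oneC aT lT rT
    times_o times_a dl dr nl nr \<i> "lenv F x" by unfold_locales (simp add: lenv_Obj F x)
  let ?s = "\<lambda>(i, B). expand x (s i) (A \<inter> B)"
  have y: "x \<restriction> A \<in> Obj L" by (rule restr_Obj[OF x A])
  have sub: "A \<inter> B \<subseteq> fst x" for B using A by auto
  \<comment> \<open>The environment of the composite functors on \<open>A\<close> is the
    substitution of expansions into the environment of \<open>F\<close> on \<open>x\<close>, so
    \<open>span_sub\<close> and \<open>expand_sub\<close> apply.\<close>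
  have "lenv (\<lambda>i. RL.tob F (s i)) (x \<restriction> A) = (\<lambda>a. ob (lenv F x) (?s a))"
    by (auto simp: lenv_def[of "\<lambda>i. RL.tob F (s i)"] restr_restr value_FOb[OF x sub] fun_eq_iff)
  then have "span (lenv F x) (t_sub ?s (expand (x \<restriction> A) t A)) (t_sub ?s (expand (x \<restriction> A) u A)) (cmpt (KL t u (\<lambda>i. RL.tob F (s i))) (x \<restriction> A))"
    using KL_span[OF tu y, of "\<lambda>i. RL.tob F (s i)"] by (intro span_sub) simp
  then have "span (lenv F x) (expand x (t_sub s t) A) (expand x (t_sub s u) A) (cmpt (KL t u (\<lambda>i. RL.tob F (s i))) (x \<restriction> A))"
    by (simp only: expand_sub[OF x A order_refl])
  then show "co (lenv F x) B (expand x (t_sub s t) A) (expand x (t_sub s u) A) (cmpt (KL t u (\<lambda>i. RL.tob F (s i))) (x \<restriction> A))"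
    by (rule span_co[OF _ \<open>finite B\<close>]) (rule regular_expand[OF x A]; use B lin in blast)+
qed (rule lin)+

lemma coL_refl:
  assumes t: "linear t" and F: "\<And>i. F i \<in> Obj CL"
  shows "coL F t t (Idn CL (RL.tob F t))"
  unfolding coL_def
proof (intro conjI ballI allI impI t)
  show "is_isomorphism CL (Idn CL (RL.tob F t))" using F by simp
  show "fst (Idn CL (RL.tob F t)) = RL.tob F t" "fst (snd (Idn CL (RL.tob F t))) = RL.tob F t"
    by (simp_all add: FL.FC_Idn)
  fix x A and B :: "(_ \<times> 'e set) list set"
  assume x: "x \<in> Obj L" and A: "A \<subseteq> fst x" and "finite B"
    and B: "\<forall>b \<in> B. fst ` set b \<inter> (set_rig_term t \<union> set_rig_term t) = {}"
  interpret coherent_env C plusC zeroC aP lP rP plus_o plus_a sP timesC oneC aT lT rT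
    times_o times_a dl dr nl nr \<i> "lenv F x" by unfold_locales (simp add: lenv_Obj F x)
  have "co (lenv F x) B (expand x t A) (expand x t A) (Idn C (ob (lenv F x) (expand x t A)))"
    by (rule co_refl[OF regular_expand[OF x A t] \<open>finite B\<close>]) (use B in blast)
  then show "co (lenv F x) B (expand x t A) (expand x t A) (cmpt (Idn CL (RL.tob F t)) (x \<restriction> A))"
    by (simp add: restr_Obj[OF x A] value_FOb[OF x A])
qed

text \<open>The tails are only known to avoid the variables of the end terms; the inclusion extends
  this to the middle term.\<close>

lemma coL_trans:
  assumes f: "coL F t u \<sigma>" and g: "coL F u w \<tau>" and F: "\<And>i. F i \<in> Obj CL"
    and sub: "set_rig_term u \<subseteq> set_rig_term t \<union> set_rig_term w"
  shows "coL F t w (\<tau> \<bullet>\<^bsub>CL\<^esub> \<sigma>)"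
  unfolding coL_def
proof (intro conjI ballI allI impI)
  note [simp] = coL_D(3-6)[OF f] coL_D(3-6)[OF g]
  show "linear t" "linear w" using coL_D[OF f] coL_D[OF g] by auto
  show "is_isomorphism CL (\<tau> \<bullet>\<^bsub>CL\<^esub> \<sigma>)" by (rule FL.FC.iso_Cmp) simp_all
  show "fst (\<tau> \<bullet>\<^bsub>CL\<^esub> \<sigma>) = RL.tob F t" "fst (snd (\<tau> \<bullet>\<^bsub>CL\<^esub> \<sigma>)) = RL.tob F w"
    by (simp_all add: FL.FC_Cmp)
  fix x A and B :: "(_ \<times> 'e set) list set"
  assume x: "x \<in> Obj L" and A: "A \<subseteq> fst x" and "finite B"
    and B: "\<forall>b \<in> B. fst ` set b \<inter> (set_rig_term t \<union> set_rig_term w) = {}"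
  interpret coherent_env C plusC zeroC aP lP rP plus_o plus_a sP timesC oneC aT lT rT
    times_o times_a dl dr nl nr \<i> "lenv F x" by unfold_locales (simp add: lenv_Obj F x)
  have "co (lenv F x) B (expand x t A) (expand x u A) (cmpt \<sigma> (x \<restriction> A))"
    by (rule coL_D(7)[OF f x A \<open>finite B\<close>]) (use B sub in blast)
  moreover have "co (lenv F x) B (expand x u A) (expand x w A) (cmpt \<tau> (x \<restriction> A))"
    by (rule coL_D(7)[OF g x A \<open>finite B\<close>]) (use B sub in blast)
  ultimately show "co (lenv F x) B (expand x t A) (expand x w A) (cmpt (\<tau> \<bullet>\<^bsub>CL\<^esub> \<sigma>) (x \<restriction> A))"
    using co_trans \<open>finite B\<close> by (simp add: restr_Obj[OF x A])
qed

lemma coL_inv: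
  assumes f: "coL F t u \<sigma>" and F: "\<And>i. F i \<in> Obj CL"
  shows "coL F u t (inverse_arrow CL \<sigma>)"
  unfolding coL_def
proof (intro conjI ballI allI impI)
  note [simp] = coL_D(3-6)[OF f]
  show "linear t" "linear u" using coL_D[OF f] by auto
  show "is_isomorphism CL (inverse_arrow CL \<sigma>)" by simp
  show "fst (inverse_arrow CL \<sigma>) = RL.tob F u" "fst (snd (inverse_arrow CL \<sigma>)) = RL.tob F t"
    using FL.FC.inv_simps(2,3)[OF coL_D(3)[OF f]] by simp_all
  fix x A and B :: "(_ \<times> 'e set) list set"
  assume x: "x \<in> Obj L" and A: "A \<subseteq> fst x" and "finite B"
    and B: "\<forall>b \<in> B. fst ` set b \<inter> (set_rig_term u \<union> set_rig_term t) = {}"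
  interpret coherent_env C plusC zeroC aP lP rP plus_o plus_a sP timesC oneC aT lT rT
    times_o times_a dl dr nl nr \<i> "lenv F x" by unfold_locales (simp add: lenv_Obj F x)
  have "co (lenv F x) B (expand x t A) (expand x u A) (cmpt \<sigma> (x \<restriction> A))"
    by (rule coL_D(7)[OF f x A \<open>finite B\<close>]) (use B in blast)
  moreover have "cmpt (inverse_arrow CL \<sigma>) (x \<restriction> A) = inv_arr (cmpt \<sigma> (x \<restriction> A))"
    using FL.FC_isoD[OF coL_D(3)[OF f]] by (intro FL.FC_isoI(2)) (simp_all add: restr_Obj[OF x A])
  ultimately show "co (lenv F x) B (expand x u A) (expand x t A) (cmpt (inverse_arrow CL \<sigma>) (x \<restriction> A))"
    using co_inv \<open>finite B\<close> by simp
qed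

lemma coL_Add:
  assumes f: "coL F t t' \<sigma>" and g: "coL F u u' \<tau>" and F: "\<And>i. F i \<in> Obj CL"
    and lin: "linear (Add t u)" "linear (Add t' u')"
  shows "coL F (Add t u) (Add t' u') (FAr plusL (\<sigma>, \<tau>))"
  unfolding coL_def
proof (intro conjI ballI allI impI lin)
  note [simp] = coL_D(3-6)[OF f] coL_D(3-6)[OF g]
  show "is_isomorphism CL (FAr plusL (\<sigma>, \<tau>))" by simp
  show "fst (FAr plusL (\<sigma>, \<tau>)) = RL.tob F (Add t u)" "fst (snd (FAr plusL (\<sigma>, \<tau>))) = RL.tob F (Add t' u')"
    by (simp_all add: plusL_FAr t_ob.simps del: plusL_FOb)
  fix x A and B :: "(_ \<times> 'e set) list set"
  assume x: "x \<in> Obj L" and A: "A \<subseteq> fst x" and "finite B"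
    and B: "\<forall>b \<in> B. fst ` set b \<inter> (set_rig_term (Add t u) \<union> set_rig_term (Add t' u')) = {}"
  interpret coherent_env C plusC zeroC aP lP rP plus_o plus_a sP timesC oneC aT lT rT
    times_o times_a dl dr nl nr \<i> "lenv F x" by unfold_locales (simp add: lenv_Obj F x)
  have "regular (expand x (Add t u) A) B"
    by (rule regular_expand[OF x A lin(1)]) (use B in blast)
  moreover have "co (lenv F x) B (expand x t A) (expand x t' A) (cmpt \<sigma> (x \<restriction> A))"
    by (rule coL_D(7)[OF f x A \<open>finite B\<close>]) (use B in auto)
  moreover have "co (lenv F x) B (expand x u A) (expand x u' A) (cmpt \<tau> (x \<restriction> A))"
    by (rule coL_D(7)[OF g x A \<open>finite B\<close>]) (use B in auto)
  ultimately show "co (lenv F x) B (expand x (Add t u) A) (expand x (Add t' u') A) (cmpt (FAr plusL (\<sigma>, \<tau>)) (x \<restriction> A))"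
    using co_Add \<open>finite B\<close> by (simp add: restr_Obj[OF x A] plusL_FAr sum.tar_def)
qed

text \<open>At each decomposition \<open>co_Mul\<close> applies, with the words produced by the
  right factor as tails for the left one. The disjointness ensures that these tails are
  admissible.\<close>

lemma coL_Mul:
  assumes f: "coL F t t' \<sigma>" and g: "coL F u u' \<tau>" and F: "\<And>i. F i \<in> Obj CL"
    and dj: "(set_rig_term t \<union> set_rig_term t') \<inter> (set_rig_term u \<union> set_rig_term u') = {}"
  shows "coL F (Mul t u) (Mul t' u') (FAr timesL (\<sigma>, \<tau>))"
  unfolding coL_def
proof (intro conjI ballI allI impI)
  note [simp] = coL_D(3-6)[OF f] coL_D(3-6)[OF g]
  show lin: "linear (Mul t u)" "linear (Mul t' u')" using coL_D(1,2)[OF f] coL_D(1,2)[OF g] dj by auto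
  show "is_isomorphism CL (FAr timesL (\<sigma>, \<tau>))" by simp
  show "fst (FAr timesL (\<sigma>, \<tau>)) = RL.tob F (Mul t u)" "fst (snd (FAr timesL (\<sigma>, \<tau>))) = RL.tob F (Mul t' u')"
    by (simp_all add: timesL_FAr t_ob.simps del: timesL_FOb)
  fix x A and B :: "(_ \<times> 'e set) list set"
  assume x: "x \<in> Obj L" and A: "A \<subseteq> fst x" and fin: "finite B"
    and B: "\<forall>b \<in> B. fst ` set b \<inter> (set_rig_term (Mul t u) \<union> set_rig_term (Mul t' u')) = {}"
  interpret coherent_env C plusC zeroC aP lP rP plus_o plus_a sP timesC oneC aT lT rT
    times_o times_a dl dr nl nr \<i> "lenv F x" by unfold_locales (simp add: lenv_Obj F x)
  \<comment> \<open>Iterates \<open>co_Add\<close>; regularity of the source sum supplies the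
    disjointness required at every step.\<close>
  have sum: "co (lenv F x) B (sum_term (map p ds)) (sum_term (map q ds)) (bpa (map k ds))"
    if "regular (sum_term (map p ds)) B" "\<And>d. d \<in> set ds \<Longrightarrow> co (lenv F x) B (p d) (q d) (k d)"
    for ds :: "('e set \<times> 'e set) list" and p q k
    using that
  proof (induction ds)
    case Nil
    then show ?case using co_refl[of Nul B] fin by simp
  next
    case (Cons d ds)
    then have "co (lenv F x) B (Add (p d) (sum_term (map p ds))) (Add (q d) (sum_term (map q ds))) (k d \<oplus>\<^sub>a bpa (map k ds))"
      by (intro co_Add fin) auto
    then show ?case by (simp add: sum.tar_def)
  qed
  have reg: "regular (expand x (Mul t u) A) B"
    by (rule regular_expand[OF x A lin(1)]) (use B in blast)
  have "co (lenv F x) B (Mul (expand x t D) (expand x u D')) (Mul (expand x t' D) (expand x u' D'))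
      (cmpt \<sigma> (x \<restriction> D) \<otimes>\<^sub>a cmpt \<tau> (x \<restriction> D'))" if d: "(D, D') \<in> set (decomps (x \<restriction> A))" for D D'
  proof (rule co_Mul)
    note D = decomps_restrD[OF x A d]
    show "co (lenv F x) B (expand x u D') (expand x u' D') (cmpt \<tau> (x \<restriction> D'))"
      by (rule coL_D(7)[OF g x D(5) fin]) (use B in auto)
    have "fst ` set b \<inter> (set_rig_term t \<union> set_rig_term t') = {}" if b: "b \<in> mons (expand x u D') B" for b
    proof -
      obtain m c where b': "b = m @ c" "c \<in> B" "map fst m \<in> mons u {[]}"
        using b unfolding mons_expand[OF x D(5)] by auto
      then show ?thesis using mons_letters[OF b'(3)] B dj by (fastforce simp: image_Un)
    qed
    then show "co (lenv F x) (mons (expand x u D') B) (expand x t D) (expand x t' D) (cmpt \<sigma> (x \<restriction> D))"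
      by (intro coL_D(7)[OF f x D(4)]) (simp add: fin)
  qed (rule fin)
  then have "co (lenv F x) B (expand x (Mul t u) A) (expand x (Mul t' u') A)
      (bpa (map (\<lambda>(D, D'). FAr timesC (cmpt \<sigma> (x \<restriction> D), cmpt \<tau> (x \<restriction> D'))) (decomps (x \<restriction> A))))"
    using reg unfolding expand.simps by (intro sum) (auto simp: prod.tar_def)
  moreover have "cmpt (FAr timesL (\<sigma>, \<tau>)) (x \<restriction> A) =
      bpa (map (\<lambda>(D, D'). FAr timesC (cmpt \<sigma> (x \<restriction> D), cmpt \<tau> (x \<restriction> D'))) (decomps (x \<restriction> A)))"
    using decomps_restrD(1,2)[OF x A]
    by (auto simp: restr_Obj[OF x A] timesL_FAr restr_restr intro!: arg_cong[of _ _ bpa])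
  ultimately show "co (lenv F x) B (expand x (Mul t u) A) (expand x (Mul t' u') A) (cmpt (FAr timesL (\<sigma>, \<tau>)) (x \<restriction> A))"
    by (simp only:)
qed

text \<open>The invariant is evaluated at the whole set and at the single tail \<open>[]\<close>,
  where \<open>co_unique\<close> applies.\<close>

lemma coL_unique:
  assumes f: "coL F t u \<sigma>" and g: "coL F t u \<tau>" and F: "\<And>i. F i \<in> Obj CL"
  shows "\<sigma> = \<tau>"
proof (rule FL.Arr_eqI)
  fix x assume x: "x \<in> Obj L"
  interpret coherent_env C plusC zeroC aP lP rP plus_o plus_a sP timesC oneC aT lT rT
    times_o times_a dl dr nl nr \<i> "lenv F x" by unfold_locales (simp add: lenv_Obj F x)
  have "cmpt \<sigma> (x \<restriction> fst x) = cmpt \<tau> (x \<restriction> fst x)"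
    by (rule co_unique; rule coL_D(7)[OF _ x order_refl]) (auto intro: f g)
  then show "cmpt \<sigma> x = cmpt \<tau> x" by (simp add: restr_self[OF x])
qed (use coL_D[OF f] coL_D[OF g] in auto)

end

section \<open>The structure isomorphisms of \<open>C^L\<close>\<close>

context coherent_lin begin

text \<open>Environments are total, so the finitely many functors of a diagram are extended by the
  zero functor.\<close>

definition lst :: "('e, 'o, 'a) lin_fun list \<Rightarrow> nat \<Rightarrow> ('e, 'o, 'a) lin_fun" where
  "lst Fs i = (if i < length Fs then Fs ! i else zeroL)"

definition lst_nat :: "('e, 'o, 'a) lin_nat list \<Rightarrow> nat \<Rightarrow> ('e, 'o, 'a) lin_nat" where
  "lst_nat fs i = (if i < length fs then fs ! i else Idn CL zeroL)"

declare plusL_FOb [simp del] timesL_FOb [simp del] FL.FC_Dom [simp del]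

lemma lst_Obj: "set Fs \<subseteq> Obj CL \<Longrightarrow> lst Fs i \<in> Obj CL"
  using RL.zero_Obj by (auto simp: lst_def subset_iff)

lemma lst_nat:
  assumes "set fs \<subseteq> Arr CL"
  shows "lst_nat fs i \<in> Arr CL" "(\<lambda>i. Dom CL (lst_nat fs i)) = lst (map (Dom CL) fs)"
    "(\<lambda>i. Cod CL (lst_nat fs i)) = lst (map (Cod CL) fs)"
proof -
  show "lst_nat fs i \<in> Arr CL"
    using subsetD[OF assms nth_mem] RL.zero_Obj by (simp add: lst_nat_def)
  show "(\<lambda>i. Dom CL (lst_nat fs i)) = lst (map (Dom CL) fs)"
    "(\<lambda>i. Cod CL (lst_nat fs i)) = lst (map (Cod CL) fs)"
    using RL.zero_Obj by (auto simp: lst_nat_def lst_def fun_eq_iff)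
qed

lemma lst_nat_Idn: "lst_nat (map (Idn CL) Fs) = (\<lambda>i. Idn CL (lst Fs i))"
  by (auto simp: lst_nat_def lst_def fun_eq_iff)

lemma tob_lst_Obj [simp]: "set Fs \<subseteq> Obj CL \<Longrightarrow> RL.tob (lst Fs) t \<in> Obj CL"
  by (rule RL.tob_Obj) (rule lst_Obj)

lemma tar_lst [simp]:
  assumes "set fs \<subseteq> Arr CL"
  shows "RL.tar (lst_nat fs) t \<in> Arr CL"
    "Dom CL (RL.tar (lst_nat fs) t) = RL.tob (lst (map (Dom CL) fs)) t"
    "Cod CL (RL.tar (lst_nat fs) t) = RL.tob (lst (map (Cod CL) fs)) t"
  using RL.tar_simps[of "lst_nat fs" t, OF lst_nat(1)[OF assms]] lst_nat(2,3)[OF assms] by simp_all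

lemma tar_lst_Idn: "set Fs \<subseteq> Obj CL \<Longrightarrow> RL.tar (lst_nat (map (Idn CL) Fs)) t = Idn CL (RL.tob (lst Fs) t)"
  unfolding lst_nat_Idn by (rule RL.tar_Idn) (rule lst_Obj)

lemma tar_lst_Cmp:
  assumes "set fs \<subseteq> Arr CL" "set gs \<subseteq> Arr CL" "map (Dom CL) gs = map (Cod CL) fs"
  shows "RL.tar (lst_nat (map2 (\<lambda>g f. g \<bullet>\<^bsub>CL\<^esub> f) gs fs)) t = RL.tar (lst_nat gs) t \<bullet>\<^bsub>CL\<^esub> RL.tar (lst_nat fs) t"
proof -
  have len: "length gs = length fs" using assms(3) by (metis length_map)
  have "lst_nat (map2 (\<lambda>g f. g \<bullet>\<^bsub>CL\<^esub> f) gs fs) = (\<lambda>i. lst_nat gs i \<bullet>\<^bsub>CL\<^esub> lst_nat fs i)"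
    using len RL.zero_Obj by (auto simp: lst_nat_def fun_eq_iff)
  moreover have "Dom CL (lst_nat gs i) = Cod CL (lst_nat fs i)" for i
    using fun_cong[OF lst_nat(2)[OF assms(2)], of i] fun_cong[OF lst_nat(3)[OF assms(1)], of i] assms(3) by simp
  ultimately show ?thesis
    using RL.tar_Cmp[of "lst_nat fs" "lst_nat gs" t] lst_nat(1)[OF assms(1)] lst_nat(1)[OF assms(2)] by simp
qed

lemma KL_natural_lst:
  assumes "similar t u" "set fs \<subseteq> Arr CL"
  shows "KL t u (lst (map (Cod CL) fs)) \<bullet>\<^bsub>CL\<^esub> RL.tar (lst_nat fs) t =
    RL.tar (lst_nat fs) u \<bullet>\<^bsub>CL\<^esub> KL t u (lst (map (Dom CL) fs))"
  using KL_natural[OF assms(1), of "lst_nat fs", OF lst_nat(1)[OF assms(2)]] lst_nat(2,3)[OF assms(2)] by simp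

lemma KL_lst:
  assumes "similar t u" "set Fs \<subseteq> Obj CL"
  shows "is_isomorphism CL (KL t u (lst Fs))" "Dom CL (KL t u (lst Fs)) = RL.tob (lst Fs) t"
    "Cod CL (KL t u (lst Fs)) = RL.tob (lst Fs) u"
  using KL_iso[OF assms(1) lst_Obj[OF assms(2)]] by (simp_all add: FL.FC_Dom)

lemma category_CL3: "category (CL \<times>\<^sub>C CL \<times>\<^sub>C CL)" "category (CL \<times>\<^sub>C CL)"
  by (simp_all add: category_prod_cat FL.category_FC)

lemma functor3: "is_functor (CL \<times>\<^sub>C CL \<times>\<^sub>C CL) CL
    \<lparr>FOb = \<lambda>(x, y, z). RL.tob (lst [x, y, z]) t, FAr = \<lambda>(f, g, h). RL.tar (lst_nat [f, g, h]) t\<rparr>"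
proof (rule is_functorI[OF category_CL3(1) FL.category_FC])
  fix f g assume "f \<in> Arr (CL \<times>\<^sub>C CL \<times>\<^sub>C CL)" "g \<in> Arr (CL \<times>\<^sub>C CL \<times>\<^sub>C CL)" "Dom (CL \<times>\<^sub>C CL \<times>\<^sub>C CL) g = Cod (CL \<times>\<^sub>C CL \<times>\<^sub>C CL) f"
  then show "FAr \<lparr>FOb = \<lambda>(x, y, z). RL.tob (lst [x, y, z]) t, FAr = \<lambda>(f, g, h). RL.tar (lst_nat [f, g, h]) t\<rparr> (g \<bullet>\<^bsub>CL \<times>\<^sub>C CL \<times>\<^sub>C CL\<^esub> f) =
    FAr \<lparr>FOb = \<lambda>(x, y, z). RL.tob (lst [x, y, z]) t, FAr = \<lambda>(f, g, h). RL.tar (lst_nat [f, g, h]) t\<rparr> g \<bullet>\<^bsub>CL\<^esub>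
    FAr \<lparr>FOb = \<lambda>(x, y, z). RL.tob (lst [x, y, z]) t, FAr = \<lambda>(f, g, h). RL.tar (lst_nat [f, g, h]) t\<rparr> f"
    using tar_lst_Cmp[of "[fst f, fst (snd f), snd (snd f)]" "[fst g, fst (snd g), snd (snd g)]" t]
    by (cases f; cases g) auto
next
  fix x assume "x \<in> Obj (CL \<times>\<^sub>C CL \<times>\<^sub>C CL)"
  then show "FAr \<lparr>FOb = \<lambda>(x, y, z). RL.tob (lst [x, y, z]) t, FAr = \<lambda>(f, g, h). RL.tar (lst_nat [f, g, h]) t\<rparr> (Idn (CL \<times>\<^sub>C CL \<times>\<^sub>C CL) x) =
    Idn CL (FOb \<lparr>FOb = \<lambda>(x, y, z). RL.tob (lst [x, y, z]) t, FAr = \<lambda>(f, g, h). RL.tar (lst_nat [f, g, h]) t\<rparr> x)"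
    using tar_lst_Idn[of "[fst x, fst (snd x), snd (snd x)]" t] by (cases x) auto
qed auto

lemma functor2: "is_functor (CL \<times>\<^sub>C CL) CL
    \<lparr>FOb = \<lambda>(x, y). RL.tob (lst [x, y]) t, FAr = \<lambda>(f, g). RL.tar (lst_nat [f, g]) t\<rparr>"
proof (rule is_functorI[OF category_CL3(2) FL.category_FC])
  fix f g assume "f \<in> Arr (CL \<times>\<^sub>C CL)" "g \<in> Arr (CL \<times>\<^sub>C CL)" "Dom (CL \<times>\<^sub>C CL) g = Cod (CL \<times>\<^sub>C CL) f"
  then show "FAr \<lparr>FOb = \<lambda>(x, y). RL.tob (lst [x, y]) t, FAr = \<lambda>(f, g). RL.tar (lst_nat [f, g]) t\<rparr> (g \<bullet>\<^bsub>CL \<times>\<^sub>C CL\<^esub> f) =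
    FAr \<lparr>FOb = \<lambda>(x, y). RL.tob (lst [x, y]) t, FAr = \<lambda>(f, g). RL.tar (lst_nat [f, g]) t\<rparr> g \<bullet>\<^bsub>CL\<^esub>
    FAr \<lparr>FOb = \<lambda>(x, y). RL.tob (lst [x, y]) t, FAr = \<lambda>(f, g). RL.tar (lst_nat [f, g]) t\<rparr> f"
    using tar_lst_Cmp[of "[fst f, snd f]" "[fst g, snd g]" t] by (cases f; cases g) auto
next
  fix x assume "x \<in> Obj (CL \<times>\<^sub>C CL)"
  then show "FAr \<lparr>FOb = \<lambda>(x, y). RL.tob (lst [x, y]) t, FAr = \<lambda>(f, g). RL.tar (lst_nat [f, g]) t\<rparr> (Idn (CL \<times>\<^sub>C CL) x) =
    Idn CL (FOb \<lparr>FOb = \<lambda>(x, y). RL.tob (lst [x, y]) t, FAr = \<lambda>(f, g). RL.tar (lst_nat [f, g]) t\<rparr> x)"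
    using tar_lst_Idn[of "[fst x, snd x]" t] by (cases x) auto
qed auto

lemma functor1: "is_functor CL CL
    \<lparr>FOb = \<lambda>x. RL.tob (lst [x]) t, FAr = \<lambda>f. RL.tar (lst_nat [f]) t\<rparr>"
proof (rule is_functorI[OF FL.category_FC FL.category_FC])
  fix f g assume "f \<in> Arr CL" "g \<in> Arr CL" "Dom CL g = Cod CL f"
  then show "FAr \<lparr>FOb = \<lambda>x. RL.tob (lst [x]) t, FAr = \<lambda>f. RL.tar (lst_nat [f]) t\<rparr> (g \<bullet>\<^bsub>CL\<^esub> f) =
    FAr \<lparr>FOb = \<lambda>x. RL.tob (lst [x]) t, FAr = \<lambda>f. RL.tar (lst_nat [f]) t\<rparr> g \<bullet>\<^bsub>CL\<^esub>
    FAr \<lparr>FOb = \<lambda>x. RL.tob (lst [x]) t, FAr = \<lambda>f. RL.tar (lst_nat [f]) t\<rparr> f"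
    using tar_lst_Cmp[of "[f]" "[g]" t] by auto
next
  fix x assume "x \<in> Obj CL"
  then show "FAr \<lparr>FOb = \<lambda>x. RL.tob (lst [x]) t, FAr = \<lambda>f. RL.tar (lst_nat [f]) t\<rparr> (Idn CL x) =
    Idn CL (FOb \<lparr>FOb = \<lambda>x. RL.tob (lst [x]) t, FAr = \<lambda>f. RL.tar (lst_nat [f]) t\<rparr> x)"
    using tar_lst_Idn[of "[x]" t] by auto
qed auto

lemma natural3:
  assumes "similar t u"
  shows "natural_iso (CL \<times>\<^sub>C CL \<times>\<^sub>C CL) CL
    \<lparr>FOb = \<lambda>(x, y, z). RL.tob (lst [x, y, z]) t, FAr = \<lambda>(f, g, h). RL.tar (lst_nat [f, g, h]) t\<rparr>
    \<lparr>FOb = \<lambda>(x, y, z). RL.tob (lst [x, y, z]) u, FAr = \<lambda>(f, g, h). RL.tar (lst_nat [f, g, h]) u\<rparr>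
    (\<lambda>(x, y, z). KL t u (lst [x, y, z]))"
proof (rule natural_isoI[OF functor3 functor3])
  fix f assume "f \<in> Arr (CL \<times>\<^sub>C CL \<times>\<^sub>C CL)"
  then show "(case Cod (CL \<times>\<^sub>C CL \<times>\<^sub>C CL) f of (x, y, z) \<Rightarrow> KL t u (lst [x, y, z])) \<bullet>\<^bsub>CL\<^esub>
      FAr \<lparr>FOb = \<lambda>(x, y, z). RL.tob (lst [x, y, z]) t, FAr = \<lambda>(f, g, h). RL.tar (lst_nat [f, g, h]) t\<rparr> f =
    FAr \<lparr>FOb = \<lambda>(x, y, z). RL.tob (lst [x, y, z]) u, FAr = \<lambda>(f, g, h). RL.tar (lst_nat [f, g, h]) u\<rparr> f \<bullet>\<^bsub>CL\<^esub>
      (case Dom (CL \<times>\<^sub>C CL \<times>\<^sub>C CL) f of (x, y, z) \<Rightarrow> KL t u (lst [x, y, z]))"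
    using KL_natural_lst[OF assms, of "[fst f, fst (snd f), snd (snd f)]"] by (cases f) auto
qed (auto simp: KL_lst[OF assms])

lemma natural2:
  assumes "similar t u"
  shows "natural_iso (CL \<times>\<^sub>C CL) CL
    \<lparr>FOb = \<lambda>(x, y). RL.tob (lst [x, y]) t, FAr = \<lambda>(f, g). RL.tar (lst_nat [f, g]) t\<rparr>
    \<lparr>FOb = \<lambda>(x, y). RL.tob (lst [x, y]) u, FAr = \<lambda>(f, g). RL.tar (lst_nat [f, g]) u\<rparr>
    (\<lambda>(x, y). KL t u (lst [x, y]))"
proof (rule natural_isoI[OF functor2 functor2])
  fix f assume "f \<in> Arr (CL \<times>\<^sub>C CL)"
  then show "(case Cod (CL \<times>\<^sub>C CL) f of (x, y) \<Rightarrow> KL t u (lst [x, y])) \<bullet>\<^bsub>CL\<^esub>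
      FAr \<lparr>FOb = \<lambda>(x, y). RL.tob (lst [x, y]) t, FAr = \<lambda>(f, g). RL.tar (lst_nat [f, g]) t\<rparr> f =
    FAr \<lparr>FOb = \<lambda>(x, y). RL.tob (lst [x, y]) u, FAr = \<lambda>(f, g). RL.tar (lst_nat [f, g]) u\<rparr> f \<bullet>\<^bsub>CL\<^esub>
      (case Dom (CL \<times>\<^sub>C CL) f of (x, y) \<Rightarrow> KL t u (lst [x, y]))"
    using KL_natural_lst[OF assms, of "[fst f, snd f]"] by (cases f) auto
qed (auto simp: KL_lst[OF assms])

lemma natural1:
  assumes "similar t u"
  shows "natural_iso CL CL
    \<lparr>FOb = \<lambda>x. RL.tob (lst [x]) t, FAr = \<lambda>f. RL.tar (lst_nat [f]) t\<rparr>
    \<lparr>FOb = \<lambda>x. RL.tob (lst [x]) u, FAr = \<lambda>f. RL.tar (lst_nat [f]) u\<rparr>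
    (\<lambda>x. KL t u (lst [x]))"
proof (rule natural_isoI[OF functor1 functor1])
  fix f assume "f \<in> Arr CL"
  then show "KL t u (lst [Cod CL f]) \<bullet>\<^bsub>CL\<^esub>
      FAr \<lparr>FOb = \<lambda>x. RL.tob (lst [x]) t, FAr = \<lambda>f. RL.tar (lst_nat [f]) t\<rparr> f =
    FAr \<lparr>FOb = \<lambda>x. RL.tob (lst [x]) u, FAr = \<lambda>f. RL.tar (lst_nat [f]) u\<rparr> f \<bullet>\<^bsub>CL\<^esub> KL t u (lst [Dom CL f])"
    using KL_natural_lst[OF assms, of "[f]"] by auto
qed (auto simp: KL_lst[OF assms])

text \<open>An equation hidden behind a predicate, so that resolution can reconstruct the term
  \<open>t\<close> from the shape of the functor \<open>G\<close>.\<close>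

definition rep :: "(nat \<Rightarrow> ('e, 'o, 'a) lin_fun) \<Rightarrow> nat rig_term \<Rightarrow> ('e, 'o, 'a) lin_fun \<Rightarrow> bool" where
  "rep F t G \<longleftrightarrow> RL.tob F t = G"

lemma rep_intros:
  "rep F Nul zeroL" "rep F Unt oneL"
  "rep F t G \<Longrightarrow> rep F u H \<Longrightarrow> rep F (Add t u) (FOb plusL (G, H))"
  "rep F t G \<Longrightarrow> rep F u H \<Longrightarrow> rep F (Mul t u) (FOb timesL (G, H))"
  by (auto simp: rep_def t_ob.simps)

definition sub_list :: "nat rig_term list \<Rightarrow> nat \<Rightarrow> nat rig_term" where
  "sub_list ts i = (if i < length ts then ts ! i else Nul)"

lemma coL_struct:
  assumes "similar t u" "\<And>i. F i \<in> Obj CL" "list_all2 (rep F) ts Gs" "linear (t_sub (sub_list ts) t)" "linear (t_sub (sub_list ts) u)"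
  shows "coL F (t_sub (sub_list ts) t) (t_sub (sub_list ts) u) (KL t u (lst Gs))"
proof -
  have "lst Gs = (\<lambda>i. RL.tob F (sub_list ts i))"
    using assms(3) by (auto simp: lst_def sub_list_def fun_eq_iff list_all2_conv_all_nth rep_def)
  then show ?thesis using coL_KL[OF assms(1,2,4,5)] by simp
qed

abbreviation (input) "V0 \<equiv> Var (0 :: nat)"
abbreviation (input) "V1 \<equiv> Var (1 :: nat)"
abbreviation (input) "V2 \<equiv> Var (2 :: nat)"

definition "aPL = (\<lambda>(x, y, z). KL (Add (Add V0 V1) V2) (Add V0 (Add V1 V2)) (lst [x, y, z]))"
definition "sPL = (\<lambda>(x, y). KL (Add V0 V1) (Add V1 V0) (lst [x, y]))"
definition "lPL = (\<lambda>x. KL (Add Nul V0) V0 (lst [x]))"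
definition "rPL = (\<lambda>x. KL (Add V0 Nul) V0 (lst [x]))"
definition "aTL = (\<lambda>(x, y, z). KL (Mul (Mul V0 V1) V2) (Mul V0 (Mul V1 V2)) (lst [x, y, z]))"
definition "lTL = (\<lambda>x. KL (Mul Unt V0) V0 (lst [x]))"
definition "rTL = (\<lambda>x. KL (Mul V0 Unt) V0 (lst [x]))"
definition "dlL = (\<lambda>(x, y, z). KL (Mul V0 (Add V1 V2)) (Add (Mul V0 V1) (Mul V0 V2)) (lst [x, y, z]))"
definition "drL = (\<lambda>(x, y, z). KL (Mul (Add V0 V1) V2) (Add (Mul V0 V2) (Mul V1 V2)) (lst [x, y, z]))"
definition "nlL = (\<lambda>x. KL (Mul Nul V0) Nul (lst [x]))"
definition "nrL = (\<lambda>x. KL (Mul V0 Nul) Nul (lst [x]))"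

lemmas struct_defs = aPL_def sPL_def lPL_def rPL_def aTL_def lTL_def rTL_def dlL_def drL_def nlL_def nrL_def

lemma struct_natural:
  "natural_iso (CL \<times>\<^sub>C CL \<times>\<^sub>C CL) CL
    \<lparr>FOb = \<lambda>(x, y, z). FOb plusL (FOb plusL (x, y), z), FAr = \<lambda>(f, g, h). FAr plusL (FAr plusL (f, g), h)\<rparr>
    \<lparr>FOb = \<lambda>(x, y, z). FOb plusL (x, FOb plusL (y, z)), FAr = \<lambda>(f, g, h). FAr plusL (f, FAr plusL (g, h))\<rparr> aPL"
  "natural_iso CL CL \<lparr>FOb = \<lambda>x. FOb plusL (zeroL, x), FAr = \<lambda>f. FAr plusL (Idn CL zeroL, f)\<rparr> id_functor lPL"
  "natural_iso CL CL \<lparr>FOb = \<lambda>x. FOb plusL (x, zeroL), FAr = \<lambda>f. FAr plusL (f, Idn CL zeroL)\<rparr> id_functor rPL"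
  "natural_iso (CL \<times>\<^sub>C CL) CL plusL \<lparr>FOb = \<lambda>(x, y). FOb plusL (y, x), FAr = \<lambda>(f, g). FAr plusL (g, f)\<rparr> sPL"
  "natural_iso (CL \<times>\<^sub>C CL \<times>\<^sub>C CL) CL
    \<lparr>FOb = \<lambda>(x, y, z). FOb timesL (FOb timesL (x, y), z), FAr = \<lambda>(f, g, h). FAr timesL (FAr timesL (f, g), h)\<rparr>
    \<lparr>FOb = \<lambda>(x, y, z). FOb timesL (x, FOb timesL (y, z)), FAr = \<lambda>(f, g, h). FAr timesL (f, FAr timesL (g, h))\<rparr> aTL"
  "natural_iso CL CL \<lparr>FOb = \<lambda>x. FOb timesL (oneL, x), FAr = \<lambda>f. FAr timesL (Idn CL oneL, f)\<rparr> id_functor lTL"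
  "natural_iso CL CL \<lparr>FOb = \<lambda>x. FOb timesL (x, oneL), FAr = \<lambda>f. FAr timesL (f, Idn CL oneL)\<rparr> id_functor rTL"
  "natural_iso (CL \<times>\<^sub>C CL \<times>\<^sub>C CL) CL
    \<lparr>FOb = \<lambda>(x, y, z). FOb timesL (x, FOb plusL (y, z)), FAr = \<lambda>(f, g, h). FAr timesL (f, FAr plusL (g, h))\<rparr>
    \<lparr>FOb = \<lambda>(x, y, z). FOb plusL (FOb timesL (x, y), FOb timesL (x, z)),
     FAr = \<lambda>(f, g, h). FAr plusL (FAr timesL (f, g), FAr timesL (f, h))\<rparr> dlL"
  "natural_iso (CL \<times>\<^sub>C CL \<times>\<^sub>C CL) CL
    \<lparr>FOb = \<lambda>(x, y, z). FOb timesL (FOb plusL (x, y), z), FAr = \<lambda>(f, g, h). FAr timesL (FAr plusL (f, g), h)\<rparr>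
    \<lparr>FOb = \<lambda>(x, y, z). FOb plusL (FOb timesL (x, z), FOb timesL (y, z)),
     FAr = \<lambda>(f, g, h). FAr plusL (FAr timesL (f, h), FAr timesL (g, h))\<rparr> drL"
  "natural_iso CL CL \<lparr>FOb = \<lambda>x. FOb timesL (zeroL, x), FAr = \<lambda>f. FAr timesL (Idn CL zeroL, f)\<rparr>
    \<lparr>FOb = \<lambda>x. zeroL, FAr = \<lambda>f. Idn CL zeroL\<rparr> nlL"
  "natural_iso CL CL \<lparr>FOb = \<lambda>x. FOb timesL (x, zeroL), FAr = \<lambda>f. FAr timesL (f, Idn CL zeroL)\<rparr>
    \<lparr>FOb = \<lambda>x. zeroL, FAr = \<lambda>f. Idn CL zeroL\<rparr> nrL"
proof -
  note simps = similar_def lst_def lst_nat_def t_ob.simps t_ar.simps id_functor_def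
  have id2: "\<lparr>FOb = FOb plusL, FAr = FAr plusL\<rparr> = plusL" by simp
  show "natural_iso (CL \<times>\<^sub>C CL \<times>\<^sub>C CL) CL
    \<lparr>FOb = \<lambda>(x, y, z). FOb plusL (FOb plusL (x, y), z), FAr = \<lambda>(f, g, h). FAr plusL (FAr plusL (f, g), h)\<rparr>
    \<lparr>FOb = \<lambda>(x, y, z). FOb plusL (x, FOb plusL (y, z)), FAr = \<lambda>(f, g, h). FAr plusL (f, FAr plusL (g, h))\<rparr> aPL"
    unfolding aPL_def using natural3[of "Add (Add V0 V1) V2" "Add V0 (Add V1 V2)"] by (simp add: simps)
  show "natural_iso CL CL \<lparr>FOb = \<lambda>x. FOb plusL (zeroL, x), FAr = \<lambda>f. FAr plusL (Idn CL zeroL, f)\<rparr> id_functor lPL"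
    unfolding lPL_def using natural1[of "Add Nul V0" V0] by (simp add: simps)
  show "natural_iso CL CL \<lparr>FOb = \<lambda>x. FOb plusL (x, zeroL), FAr = \<lambda>f. FAr plusL (f, Idn CL zeroL)\<rparr> id_functor rPL"
    unfolding rPL_def using natural1[of "Add V0 Nul" V0] by (simp add: simps)
  show "natural_iso (CL \<times>\<^sub>C CL) CL plusL \<lparr>FOb = \<lambda>(x, y). FOb plusL (y, x), FAr = \<lambda>(f, g). FAr plusL (g, f)\<rparr> sPL"
    unfolding sPL_def using natural2[of "Add V0 V1" "Add V1 V0"] by (simp add: simps id2 insert_commute)
  show "natural_iso (CL \<times>\<^sub>C CL \<times>\<^sub>C CL) CL
    \<lparr>FOb = \<lambda>(x, y, z). FOb timesL (FOb timesL (x, y), z), FAr = \<lambda>(f, g, h). FAr timesL (FAr timesL (f, g), h)\<rparr>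
    \<lparr>FOb = \<lambda>(x, y, z). FOb timesL (x, FOb timesL (y, z)), FAr = \<lambda>(f, g, h). FAr timesL (f, FAr timesL (g, h))\<rparr> aTL"
    unfolding aTL_def using natural3[of "Mul (Mul V0 V1) V2" "Mul V0 (Mul V1 V2)"] by (simp add: simps)
  show "natural_iso CL CL \<lparr>FOb = \<lambda>x. FOb timesL (oneL, x), FAr = \<lambda>f. FAr timesL (Idn CL oneL, f)\<rparr> id_functor lTL"
    unfolding lTL_def using natural1[of "Mul Unt V0" V0] by (simp add: simps)
  show "natural_iso CL CL \<lparr>FOb = \<lambda>x. FOb timesL (x, oneL), FAr = \<lambda>f. FAr timesL (f, Idn CL oneL)\<rparr> id_functor rTL"
    unfolding rTL_def using natural1[of "Mul V0 Unt" V0] by (simp add: simps)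
  show "natural_iso (CL \<times>\<^sub>C CL \<times>\<^sub>C CL) CL
    \<lparr>FOb = \<lambda>(x, y, z). FOb timesL (x, FOb plusL (y, z)), FAr = \<lambda>(f, g, h). FAr timesL (f, FAr plusL (g, h))\<rparr>
    \<lparr>FOb = \<lambda>(x, y, z). FOb plusL (FOb timesL (x, y), FOb timesL (x, z)),
     FAr = \<lambda>(f, g, h). FAr plusL (FAr timesL (f, g), FAr timesL (f, h))\<rparr> dlL"
    unfolding dlL_def using natural3[of "Mul V0 (Add V1 V2)" "Add (Mul V0 V1) (Mul V0 V2)"] by (simp add: simps)
  show "natural_iso (CL \<times>\<^sub>C CL \<times>\<^sub>C CL) CL
    \<lparr>FOb = \<lambda>(x, y, z). FOb timesL (FOb plusL (x, y), z), FAr = \<lambda>(f, g, h). FAr timesL (FAr plusL (f, g), h)\<rparr>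
    \<lparr>FOb = \<lambda>(x, y, z). FOb plusL (FOb timesL (x, z), FOb timesL (y, z)),
     FAr = \<lambda>(f, g, h). FAr plusL (FAr timesL (f, h), FAr timesL (g, h))\<rparr> drL"
    unfolding drL_def using natural3[of "Mul (Add V0 V1) V2" "Add (Mul V0 V2) (Mul V1 V2)"] by (simp add: simps)
  show "natural_iso CL CL \<lparr>FOb = \<lambda>x. FOb timesL (zeroL, x), FAr = \<lambda>f. FAr timesL (Idn CL zeroL, f)\<rparr>
    \<lparr>FOb = \<lambda>x. zeroL, FAr = \<lambda>f. Idn CL zeroL\<rparr> nlL"
    unfolding nlL_def using natural1[of "Mul Nul V0" Nul] by (simp add: simps)
  show "natural_iso CL CL \<lparr>FOb = \<lambda>x. FOb timesL (x, zeroL), FAr = \<lambda>f. FAr timesL (f, Idn CL zeroL)\<rparr>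
    \<lparr>FOb = \<lambda>x. zeroL, FAr = \<lambda>f. Idn CL zeroL\<rparr> nrL"
    unfolding nrL_def using natural1[of "Mul V0 Nul" Nul] by (simp add: simps)
qed

text \<open>One rule for each way of building an arrow in a coherence diagram. The structure
  isomorphisms are instances of \<open>coL_struct\<close>; the others are the closure properties of
  \<open>coL\<close>.\<close>

lemma coL_intros:
  assumes F: "\<And>i. F i \<in> Obj CL"
  shows
  "rep F t G \<Longrightarrow> linear t \<Longrightarrow> coL F t t (Idn CL G)"
  "coL F t u \<sigma> \<Longrightarrow> coL F u w \<tau> \<Longrightarrow> set_rig_term u \<subseteq> set_rig_term t \<union> set_rig_term w \<Longrightarrow> coL F t w (\<tau> \<bullet>\<^bsub>CL\<^esub> \<sigma>)"
  "coL F t u \<sigma> \<Longrightarrow> coL F u t (inverse_arrow CL \<sigma>)"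
  "coL F t t' \<sigma> \<Longrightarrow> coL F u u' \<tau> \<Longrightarrow> linear (Add t u) \<Longrightarrow> linear (Add t' u') \<Longrightarrow>
    coL F (Add t u) (Add t' u') (FAr plusL (\<sigma>, \<tau>))"
  "coL F t t' \<sigma> \<Longrightarrow> coL F u u' \<tau> \<Longrightarrow> (set_rig_term t \<union> set_rig_term t') \<inter> (set_rig_term u \<union> set_rig_term u') = {} \<Longrightarrow>
    coL F (Mul t u) (Mul t' u') (FAr timesL (\<sigma>, \<tau>))"
  "rep F t G \<Longrightarrow> rep F u H \<Longrightarrow> rep F w K \<Longrightarrow> linear (Add (Add t u) w) \<Longrightarrow> linear (Add t (Add u w)) \<Longrightarrow>
    coL F (Add (Add t u) w) (Add t (Add u w)) (aPL (G, H, K))"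
  "rep F t G \<Longrightarrow> rep F u H \<Longrightarrow> linear (Add t u) \<Longrightarrow> linear (Add u t) \<Longrightarrow> coL F (Add t u) (Add u t) (sPL (G, H))"
  "rep F t G \<Longrightarrow> linear t \<Longrightarrow> coL F (Add Nul t) t (lPL G)"
  "rep F t G \<Longrightarrow> linear t \<Longrightarrow> coL F (Add t Nul) t (rPL G)"
  "rep F t G \<Longrightarrow> rep F u H \<Longrightarrow> rep F w K \<Longrightarrow> linear (Mul (Mul t u) w) \<Longrightarrow> linear (Mul t (Mul u w)) \<Longrightarrow>
    coL F (Mul (Mul t u) w) (Mul t (Mul u w)) (aTL (G, H, K))"
  "rep F t G \<Longrightarrow> linear t \<Longrightarrow> coL F (Mul Unt t) t (lTL G)"
  "rep F t G \<Longrightarrow> linear t \<Longrightarrow> coL F (Mul t Unt) t (rTL G)"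
  "rep F t G \<Longrightarrow> rep F u H \<Longrightarrow> rep F w K \<Longrightarrow> linear (Mul t (Add u w)) \<Longrightarrow> linear (Add (Mul t u) (Mul t w)) \<Longrightarrow>
    coL F (Mul t (Add u w)) (Add (Mul t u) (Mul t w)) (dlL (G, H, K))"
  "rep F t G \<Longrightarrow> rep F u H \<Longrightarrow> rep F w K \<Longrightarrow> linear (Mul (Add t u) w) \<Longrightarrow> linear (Add (Mul t w) (Mul u w)) \<Longrightarrow>
    coL F (Mul (Add t u) w) (Add (Mul t w) (Mul u w)) (drL (G, H, K))"
  "rep F t G \<Longrightarrow> linear t \<Longrightarrow> coL F (Mul Nul t) Nul (nlL G)"
  "rep F t G \<Longrightarrow> linear t \<Longrightarrow> coL F (Mul t Nul) Nul (nrL G)"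
proof -
  note simps = similar_def sub_list_def struct_defs
  show "rep F t G \<Longrightarrow> linear t \<Longrightarrow> coL F t t (Idn CL G)"
    using coL_refl[of t F] F by (simp add: rep_def)
  show "coL F t u \<sigma> \<Longrightarrow> coL F u w \<tau> \<Longrightarrow> set_rig_term u \<subseteq> set_rig_term t \<union> set_rig_term w \<Longrightarrow> coL F t w (\<tau> \<bullet>\<^bsub>CL\<^esub> \<sigma>)"
    by (rule coL_trans[OF _ _ F])
  show "coL F t u \<sigma> \<Longrightarrow> coL F u t (inverse_arrow CL \<sigma>)" by (rule coL_inv[OF _ F])
  show "coL F t t' \<sigma> \<Longrightarrow> coL F u u' \<tau> \<Longrightarrow> linear (Add t u) \<Longrightarrow> linear (Add t' u') \<Longrightarrow>
    coL F (Add t u) (Add t' u') (FAr plusL (\<sigma>, \<tau>))" by (rule coL_Add[OF _ _ F])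
  show "coL F t t' \<sigma> \<Longrightarrow> coL F u u' \<tau> \<Longrightarrow> (set_rig_term t \<union> set_rig_term t') \<inter> (set_rig_term u \<union> set_rig_term u') = {} \<Longrightarrow>
    coL F (Mul t u) (Mul t' u') (FAr timesL (\<sigma>, \<tau>))" by (rule coL_Mul[OF _ _ F])
  show "rep F t G \<Longrightarrow> rep F u H \<Longrightarrow> rep F w K \<Longrightarrow> linear (Add (Add t u) w) \<Longrightarrow> linear (Add t (Add u w)) \<Longrightarrow>
    coL F (Add (Add t u) w) (Add t (Add u w)) (aPL (G, H, K))"
    using coL_struct[of "Add (Add V0 V1) V2" "Add V0 (Add V1 V2)" F "[t, u, w]" "[G, H, K]"] F by (simp add: simps)
  show "rep F t G \<Longrightarrow> rep F u H \<Longrightarrow> linear (Add t u) \<Longrightarrow> linear (Add u t) \<Longrightarrow> coL F (Add t u) (Add u t) (sPL (G, H))"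
    using coL_struct[of "Add V0 V1" "Add V1 V0" F "[t, u]" "[G, H]"] F by (simp add: simps insert_commute)
  show "rep F t G \<Longrightarrow> linear t \<Longrightarrow> coL F (Add Nul t) t (lPL G)"
    using coL_struct[of "Add Nul V0" V0 F "[t]" "[G]"] F by (simp add: simps)
  show "rep F t G \<Longrightarrow> linear t \<Longrightarrow> coL F (Add t Nul) t (rPL G)"
    using coL_struct[of "Add V0 Nul" V0 F "[t]" "[G]"] F by (simp add: simps)
  show "rep F t G \<Longrightarrow> rep F u H \<Longrightarrow> rep F w K \<Longrightarrow> linear (Mul (Mul t u) w) \<Longrightarrow> linear (Mul t (Mul u w)) \<Longrightarrow>
    coL F (Mul (Mul t u) w) (Mul t (Mul u w)) (aTL (G, H, K))"
    using coL_struct[of "Mul (Mul V0 V1) V2" "Mul V0 (Mul V1 V2)" F "[t, u, w]" "[G, H, K]"] F by (simp add: simps)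
  show "rep F t G \<Longrightarrow> linear t \<Longrightarrow> coL F (Mul Unt t) t (lTL G)"
    using coL_struct[of "Mul Unt V0" V0 F "[t]" "[G]"] F by (simp add: simps)
  show "rep F t G \<Longrightarrow> linear t \<Longrightarrow> coL F (Mul t Unt) t (rTL G)"
    using coL_struct[of "Mul V0 Unt" V0 F "[t]" "[G]"] F by (simp add: simps)
  show "rep F t G \<Longrightarrow> rep F u H \<Longrightarrow> rep F w K \<Longrightarrow> linear (Mul t (Add u w)) \<Longrightarrow> linear (Add (Mul t u) (Mul t w)) \<Longrightarrow>
    coL F (Mul t (Add u w)) (Add (Mul t u) (Mul t w)) (dlL (G, H, K))"
    using coL_struct[of "Mul V0 (Add V1 V2)" "Add (Mul V0 V1) (Mul V0 V2)" F "[t, u, w]" "[G, H, K]"] F by (simp add: simps)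
  show "rep F t G \<Longrightarrow> rep F u H \<Longrightarrow> rep F w K \<Longrightarrow> linear (Mul (Add t u) w) \<Longrightarrow> linear (Add (Mul t w) (Mul u w)) \<Longrightarrow>
    coL F (Mul (Add t u) w) (Add (Mul t w) (Mul u w)) (drL (G, H, K))"
    using coL_struct[of "Mul (Add V0 V1) V2" "Add (Mul V0 V2) (Mul V1 V2)" F "[t, u, w]" "[G, H, K]"] F by (simp add: simps)
  show "rep F t G \<Longrightarrow> linear t \<Longrightarrow> coL F (Mul Nul t) Nul (nlL G)"
    using coL_struct[of "Mul Nul V0" Nul F "[t]" "[G]"] F by (simp add: simps)
  show "rep F t G \<Longrightarrow> linear t \<Longrightarrow> coL F (Mul t Nul) Nul (nrL G)"
    using coL_struct[of "Mul V0 Nul" Nul F "[t]" "[G]"] F by (simp add: simps)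
qed

end

section \<open>The coherence diagrams of \<open>C^L\<close>\<close>

context coherent_lin begin

text \<open>The last argument collects the side conditions, so that the rules below determine the terms
  from the arrow by resolution alone.\<close>

definition coLs where "coLs F t u \<sigma> P \<longleftrightarrow> (P \<longrightarrow> coL F t u \<sigma>)"

lemma coLs_intros:
  assumes F: "\<And>i. F i \<in> Obj CL"
  shows
  "rep F t G \<Longrightarrow> coLs F t t (Idn CL G) (linear t)"
  "coLs F t u \<sigma> P \<Longrightarrow> coLs F u w \<tau> Q \<Longrightarrow> coLs F t w (\<tau> \<bullet>\<^bsub>CL\<^esub> \<sigma>) (P \<and> Q \<and> set_rig_term u \<subseteq> set_rig_term t \<union> set_rig_term w)"
  "coLs F t u \<sigma> P \<Longrightarrow> coLs F u t (inverse_arrow CL \<sigma>) P"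
  "coLs F t t' \<sigma> P \<Longrightarrow> coLs F u u' \<tau> Q \<Longrightarrow>
    coLs F (Add t u) (Add t' u') (FAr plusL (\<sigma>, \<tau>)) (P \<and> Q \<and> linear (Add t u) \<and> linear (Add t' u'))"
  "coLs F t t' \<sigma> P \<Longrightarrow> coLs F u u' \<tau> Q \<Longrightarrow> coLs F (Mul t u) (Mul t' u') (FAr timesL (\<sigma>, \<tau>))
    (P \<and> Q \<and> (set_rig_term t \<union> set_rig_term t') \<inter> (set_rig_term u \<union> set_rig_term u') = {})"
  "rep F t G \<Longrightarrow> rep F u H \<Longrightarrow> rep F w K \<Longrightarrow>
    coLs F (Add (Add t u) w) (Add t (Add u w)) (aPL (G, H, K)) (linear (Add (Add t u) w) \<and> linear (Add t (Add u w)))"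
  "rep F t G \<Longrightarrow> rep F u H \<Longrightarrow> coLs F (Add t u) (Add u t) (sPL (G, H)) (linear (Add t u) \<and> linear (Add u t))"
  "rep F t G \<Longrightarrow> coLs F (Add Nul t) t (lPL G) (linear t)"
  "rep F t G \<Longrightarrow> coLs F (Add t Nul) t (rPL G) (linear t)"
  "rep F t G \<Longrightarrow> rep F u H \<Longrightarrow> rep F w K \<Longrightarrow>
    coLs F (Mul (Mul t u) w) (Mul t (Mul u w)) (aTL (G, H, K)) (linear (Mul (Mul t u) w) \<and> linear (Mul t (Mul u w)))"
  "rep F t G \<Longrightarrow> coLs F (Mul Unt t) t (lTL G) (linear t)"
  "rep F t G \<Longrightarrow> coLs F (Mul t Unt) t (rTL G) (linear t)"
  "rep F t G \<Longrightarrow> rep F u H \<Longrightarrow> rep F w K \<Longrightarrow>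
    coLs F (Mul t (Add u w)) (Add (Mul t u) (Mul t w)) (dlL (G, H, K)) (linear (Mul t (Add u w)) \<and> linear (Add (Mul t u) (Mul t w)))"
  "rep F t G \<Longrightarrow> rep F u H \<Longrightarrow> rep F w K \<Longrightarrow>
    coLs F (Mul (Add t u) w) (Add (Mul t w) (Mul u w)) (drL (G, H, K)) (linear (Mul (Add t u) w) \<and> linear (Add (Mul t w) (Mul u w)))"
  "rep F t G \<Longrightarrow> coLs F (Mul Nul t) Nul (nlL G) (linear t)"
  "rep F t G \<Longrightarrow> coLs F (Mul t Nul) Nul (nrL G) (linear t)"
  unfolding coLs_def
  by ((intro impI, (elim conjE)?, (rule coL_intros[OF F]; (assumption | (erule mp, assumption))))+)

text \<open>Also postpones the requirement that the functors are objects of \<open>C^L\<close>,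
  since the list \<open>Fs\<close> is itself found by unification.\<close>

definition coherent_if :: "('e, 'o, 'a) lin_fun list \<Rightarrow> nat rig_term \<Rightarrow> nat rig_term \<Rightarrow> ('e, 'o, 'a) lin_nat \<Rightarrow> bool \<Rightarrow> bool" where
  "coherent_if Fs t u \<sigma> P \<longleftrightarrow> (set Fs \<subseteq> Obj CL \<longrightarrow> coLs (lst Fs) t u \<sigma> P)"

lemma coherent_if_intros:
  "rep (lst Fs) t G \<Longrightarrow> coherent_if Fs t t (Idn CL G) (linear t)"
  "coherent_if Fs t u \<sigma> P \<Longrightarrow> coherent_if Fs u w \<tau> Q \<Longrightarrow>
    coherent_if Fs t w (\<tau> \<bullet>\<^bsub>CL\<^esub> \<sigma>) (P \<and> Q \<and> set_rig_term u \<subseteq> set_rig_term t \<union> set_rig_term w)"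
  "coherent_if Fs t u \<sigma> P \<Longrightarrow> coherent_if Fs u t (inverse_arrow CL \<sigma>) P"
  "coherent_if Fs t t' \<sigma> P \<Longrightarrow> coherent_if Fs u u' \<tau> Q \<Longrightarrow>
    coherent_if Fs (Add t u) (Add t' u') (FAr plusL (\<sigma>, \<tau>)) (P \<and> Q \<and> linear (Add t u) \<and> linear (Add t' u'))"
  "coherent_if Fs t t' \<sigma> P \<Longrightarrow> coherent_if Fs u u' \<tau> Q \<Longrightarrow> coherent_if Fs (Mul t u) (Mul t' u') (FAr timesL (\<sigma>, \<tau>))
    (P \<and> Q \<and> (set_rig_term t \<union> set_rig_term t') \<inter> (set_rig_term u \<union> set_rig_term u') = {})"
  "rep (lst Fs) t G \<Longrightarrow> rep (lst Fs) u H \<Longrightarrow> rep (lst Fs) w K \<Longrightarrow>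
    coherent_if Fs (Add (Add t u) w) (Add t (Add u w)) (aPL (G, H, K)) (linear (Add (Add t u) w) \<and> linear (Add t (Add u w)))"
  "rep (lst Fs) t G \<Longrightarrow> rep (lst Fs) u H \<Longrightarrow>
    coherent_if Fs (Add t u) (Add u t) (sPL (G, H)) (linear (Add t u) \<and> linear (Add u t))"
  "rep (lst Fs) t G \<Longrightarrow> coherent_if Fs (Add Nul t) t (lPL G) (linear t)"
  "rep (lst Fs) t G \<Longrightarrow> coherent_if Fs (Add t Nul) t (rPL G) (linear t)"
  "rep (lst Fs) t G \<Longrightarrow> rep (lst Fs) u H \<Longrightarrow> rep (lst Fs) w K \<Longrightarrow>
    coherent_if Fs (Mul (Mul t u) w) (Mul t (Mul u w)) (aTL (G, H, K)) (linear (Mul (Mul t u) w) \<and> linear (Mul t (Mul u w)))"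
  "rep (lst Fs) t G \<Longrightarrow> coherent_if Fs (Mul Unt t) t (lTL G) (linear t)"
  "rep (lst Fs) t G \<Longrightarrow> coherent_if Fs (Mul t Unt) t (rTL G) (linear t)"
  "rep (lst Fs) t G \<Longrightarrow> rep (lst Fs) u H \<Longrightarrow> rep (lst Fs) w K \<Longrightarrow>
    coherent_if Fs (Mul t (Add u w)) (Add (Mul t u) (Mul t w)) (dlL (G, H, K))
      (linear (Mul t (Add u w)) \<and> linear (Add (Mul t u) (Mul t w)))"
  "rep (lst Fs) t G \<Longrightarrow> rep (lst Fs) u H \<Longrightarrow> rep (lst Fs) w K \<Longrightarrow>
    coherent_if Fs (Mul (Add t u) w) (Add (Mul t w) (Mul u w)) (drL (G, H, K))
      (linear (Mul (Add t u) w) \<and> linear (Add (Mul t w) (Mul u w)))"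
  "rep (lst Fs) t G \<Longrightarrow> coherent_if Fs (Mul Nul t) Nul (nlL G) (linear t)"
  "rep (lst Fs) t G \<Longrightarrow> coherent_if Fs (Mul t Nul) Nul (nrL G) (linear t)"
  unfolding coherent_if_def
  by ((intro impI, (rule coLs_intros[OF lst_Obj]; (assumption | (erule mp, assumption))))+)

text \<open>The lists have an open end: meeting a new functor instantiates the unknown tail and
  gives the functor the next index, and a functor met before gets its index back.\<close>

lemma rep_lst:
  "rep (lst (G # Fs)) (Var 0) G" "rep (lst (G # H # Fs)) (Var 1) H"
  "rep (lst (G # H # K # Fs)) (Var 2) K" "rep (lst (G # H # K # M # Fs)) (Var 3) M"
  by (simp_all add: rep_def lst_def)

lemma set_list_subset: "set [] \<subseteq> S" "x \<in> S \<Longrightarrow> set xs \<subseteq> S \<Longrightarrow> set (x # xs) \<subseteq> S"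
  by auto

lemma coherent_unique:
  "coherent_if Fs t u \<sigma> P \<Longrightarrow> coherent_if Fs t u \<tau> Q \<Longrightarrow> set Fs \<subseteq> Obj CL \<Longrightarrow> P \<Longrightarrow> Q \<Longrightarrow> \<sigma> = \<tau>"
  unfolding coherent_if_def coLs_def using coL_unique[of "lst Fs", OF _ _ lst_Obj] by blast

text \<open>Every diagram is an equation between two arrows built from structure isomorphisms, so it
  is an instance of \<open>coherent_unique\<close>.\<close>

theorem coherent_distributive_category_CL:
  "coherent_distributive_category CL plusL zeroL aPL lPL rPL sPL timesL oneL aTL lTL rTL dlL drL nlL nrL"
proof -
  interpret P: is_functor "CL \<times>\<^sub>C CL" CL plusL by (rule plusL_functor)
  interpret T: is_functor "CL \<times>\<^sub>C CL" CL timesL by (rule timesL_functor)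
  show ?thesis
    \<comment> \<open>Resolution on the left arrow finds the two terms and the list of functors, and
      on the right arrow checks that it joins the same terms. \<open>set_list_subset\<close> closes
      the open list, and the simplifier decides linearity and the inclusions of variables.\<close>
    by (unfold_locales; (unfold Let_def)?;
      (rule struct_natural RL.zero_Obj RL.one_Obj
        | (rule coherent_unique, (rule coherent_if_intros rep_intros rep_lst)+,
            (rule set_list_subset | assumption)+, simp, simp)))
qed

end

section \<open>The Rota-Baxter structure\<close>

lemma functor_comp:
  assumes "is_functor A B F" "is_functor B D G"
  shows "is_functor A D \<lparr>FOb = \<lambda>x. FOb G (FOb F x), FAr = \<lambda>f. FAr G (FAr F f)\<rparr>"
proof -
  interpret F: is_functor A B F by fact
  interpret G: is_functor B D G by fact
  show ?thesis
    by (rule is_functorI[OF F.A.category_axioms G.B.category_axioms])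
      (simp_all add: F.FOb_Obj G.FOb_Obj F.FAr_Idn G.FAr_Idn F.functor_Cmp G.functor_Cmp)
qed

lemma functor_pair:
  assumes "is_functor A B F" "is_functor A D G"
  shows "is_functor A (B \<times>\<^sub>C D) \<lparr>FOb = \<lambda>x. (FOb F x, FOb G x), FAr = \<lambda>f. (FAr F f, FAr G f)\<rparr>"
proof -
  interpret F: is_functor A B F by fact
  interpret G: is_functor A D G by fact
  show ?thesis
    by (rule is_functorI[OF F.A.category_axioms category_prod_cat[OF F.B.category_axioms G.B.category_axioms]])
      (simp_all add: F.FOb_Obj G.FOb_Obj F.FAr_Idn G.FAr_Idn F.functor_Cmp G.functor_Cmp)
qed

lemma functor_bi:
  assumes "is_functor (B \<times>\<^sub>C B) B T" "is_functor A B F" "is_functor A B G"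
  shows "is_functor A B \<lparr>FOb = \<lambda>x. FOb T (FOb F x, FOb G x), FAr = \<lambda>f. FAr T (FAr F f, FAr G f)\<rparr>"
  using functor_comp[OF functor_pair[OF assms(2,3)] assms(1)] by simp

lemma functor_id: "category A \<Longrightarrow> is_functor A A id_functor"
  by (rule is_functorI) (auto simp: id_functor_def)

lemma functor_proj:
  assumes "category A" "category B"
  shows "is_functor (A \<times>\<^sub>C B) A \<lparr>FOb = fst, FAr = fst\<rparr>" "is_functor (A \<times>\<^sub>C B) B \<lparr>FOb = snd, FAr = snd\<rparr>"
  by (rule is_functorI[OF category_prod_cat[OF assms] assms(1)]; auto)
    (rule is_functorI[OF category_prod_cat[OF assms] assms(2)]; auto)

text \<open>The head of the decreasing list is the maximum; antisymmetry makes it the only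
  one.\<close>

lemma max_elt:
  assumes x: "x \<in> Obj lin_cat" and ne: "fst x \<noteq> {}"
  shows "max_elt x \<in> fst x" "a \<in> fst x \<Longrightarrow> (a, max_elt x) \<in> snd x"
proof -
  have s: "set (elts_desc x) = fst x" "sorted_wrt (\<lambda>a b. a \<noteq> b \<and> (b, a) \<in> snd x) (elts_desc x)"
    using elts_desc(1,2)[of "fst x" "snd x"] x by auto
  obtain m as where e: "elts_desc x = m # as" using s(1) ne by (cases "elts_desc x") auto
  have r: "(b, b) \<in> snd x" if "b \<in> fst x" for b
    using x that by (auto simp: lin_Obj order_on_defs refl_on_def)
  have m: "m \<in> fst x \<and> (\<forall>a \<in> fst x. (a, m) \<in> snd x)"
    using s e r by (auto simp flip: s(1))
  have "max_elt x \<in> fst x \<and> (\<forall>a \<in> fst x. (a, max_elt x) \<in> snd x)"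
    unfolding max_elt_def
  proof (rule theI[of _ m])
    fix m' assume "m' \<in> fst x \<and> (\<forall>a \<in> fst x. (a, m') \<in> snd x)"
    then show "m' = m" using m x unfolding lin_Obj order_on_defs antisym_def by blast
  qed (rule m)
  then show "max_elt x \<in> fst x" "a \<in> fst x \<Longrightarrow> (a, max_elt x) \<in> snd x" by auto
qed

lemma max_elt_eqI:
  assumes x: "x \<in> Obj lin_cat" and m: "m \<in> fst x" "\<And>a. a \<in> fst x \<Longrightarrow> (a, m) \<in> snd x"
  shows "max_elt x = m"
proof -
  have "fst x \<noteq> {}" using m by auto
  from max_elt[OF x this] m have "(max_elt x, m) \<in> snd x" "(m, max_elt x) \<in> snd x" by auto
  then show ?thesis using x unfolding lin_Obj order_on_defs antisym_def by blast
qed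

lemma without_max_subset: "without_max x \<subseteq> fst x"
  by (auto simp: without_max_def)

lemma max_elt_Cod:
  assumes \<phi>: "\<phi> \<in> Arr lin_cat" and ne: "fst (fst \<phi>) \<noteq> {}"
  shows "max_elt (fst (snd \<phi>)) = cmpt \<phi> (max_elt (fst \<phi>))"
proof (rule max_elt_eqI)
  have x: "fst \<phi> \<in> Obj lin_cat" and im: "cmpt \<phi> ` fst (fst \<phi>) = fst (fst (snd \<phi>))"
    and mono: "\<And>a b. a \<in> fst (fst \<phi>) \<Longrightarrow> b \<in> fst (fst \<phi>) \<Longrightarrow> (a, b) \<in> snd (fst \<phi>) \<Longrightarrow> (cmpt \<phi> a, cmpt \<phi> b) \<in> snd (fst (snd \<phi>))"
    using \<phi> by (auto simp: lin_Arr bij_betw_def)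
  show "fst (snd \<phi>) \<in> Obj lin_cat" using \<phi> by (auto simp: lin_Arr)
  show "cmpt \<phi> (max_elt (fst \<phi>)) \<in> fst (fst (snd \<phi>))" using max_elt(1)[OF x ne] im by blast
  fix b assume "b \<in> fst (fst (snd \<phi>))"
  then obtain a where "a \<in> fst (fst \<phi>)" "b = cmpt \<phi> a" using im by blast
  then show "(b, cmpt \<phi> (max_elt (fst \<phi>))) \<in> snd (fst (snd \<phi>))"
    using max_elt[OF x ne] mono by blast
qed

text \<open>An order isomorphism sends the maximum to the maximum, so it restricts to the sets
  without it. The functoriality of the shift rests on this.\<close>

lemma without_max_Cod:
  assumes \<phi>: "\<phi> \<in> Arr lin_cat"
  shows "without_max (fst (snd \<phi>)) = cmpt \<phi> ` without_max (fst \<phi>)"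
proof (cases "fst (fst \<phi>) = {}")
  case True
  then show ?thesis using \<phi> by (auto simp: lin_Arr bij_betw_def without_max_def)
next
  case False
  have x: "fst \<phi> \<in> Obj lin_cat" and im: "cmpt \<phi> ` fst (fst \<phi>) = fst (fst (snd \<phi>))"
    and inj: "inj_on (cmpt \<phi>) (fst (fst \<phi>))"
    using \<phi> by (auto simp: lin_Arr bij_betw_def)
  have "cmpt \<phi> ` (fst (fst \<phi>) - {max_elt (fst \<phi>)}) = cmpt \<phi> ` fst (fst \<phi>) - cmpt \<phi> ` {max_elt (fst \<phi>)}"
    by (rule inj_on_image_set_diff[OF inj]) (use max_elt(1)[OF x False] in auto)
  then show ?thesis by (simp add: without_max_def max_elt_Cod[OF \<phi> False] im)
qed

lemma empty_Cod: "\<phi> \<in> Arr lin_cat \<Longrightarrow> fst (fst (snd \<phi>)) = {} \<longleftrightarrow> fst (fst \<phi>) = {}"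
  by (auto simp: lin_Arr bij_betw_def)

lemma restr_without_max: "x \<in> Obj lin_cat \<Longrightarrow> x \<restriction> without_max x \<in> Obj lin_cat"
  by (rule restr_Obj[OF _ without_max_subset])

section \<open>The shift functor\<close>

context rig_lin begin

declare plusL_FOb [simp del] timesL_FOb [simp del] FL.FC_Dom [simp del]

text \<open>Two separate naturalities are required: \<open>nat\<close> along order isomorphisms
  makes each family an arrow of \<open>C^L\<close>, and \<open>nat'\<close> along arrows of
  \<open>A\<close> makes these arrows natural.\<close>

lemma pointwise_natural:
  assumes S: "is_functor A CL S" and T: "is_functor A CL T"
    and c: "\<And>F x. F \<in> Obj A \<Longrightarrow> x \<in> Obj L \<Longrightarrow> is_isomorphism C (c F x) \<and>
      Dom C (c F x) = FOb (FOb S F) x \<and> Cod C (c F x) = FOb (FOb T F) x"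
    and nat: "\<And>F \<phi>. F \<in> Obj A \<Longrightarrow> \<phi> \<in> Arr L \<Longrightarrow>
      c F (fst (snd \<phi>)) \<bullet> FAr (FOb S F) \<phi> = FAr (FOb T F) \<phi> \<bullet> c F (fst \<phi>)"
    and nat': "\<And>f x. f \<in> Arr A \<Longrightarrow> x \<in> Obj L \<Longrightarrow>
      c (Cod A f) x \<bullet> cmpt (FAr S f) x = cmpt (FAr T f) x \<bullet> c (Dom A f) x"
  shows "naturally_isomorphic A CL S T"
  unfolding naturally_isomorphic_def
proof
  interpret S: is_functor A CL S by (rule S)
  interpret T: is_functor A CL T by (rule T)
  let ?t = "\<lambda>F. (FOb S F, FOb T F, \<lambda>x \<in> Obj L. c F x)"
  have t: "?t F \<in> Arr CL" if "F \<in> Obj A" for F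
    using that by (intro FL.ArrI S.FOb_Obj T.FOb_Obj) (auto simp: c nat lin_simps)
  show "natural_iso A CL S T ?t"
  proof (rule natural_isoI[OF S T])
    show "is_isomorphism CL (?t F) \<and> Dom CL (?t F) = FOb S F \<and> Cod CL (?t F) = FOb T F" if "F \<in> Obj A" for F
      using FL.FC_isoI(1)[OF t[OF that]] c[OF that] by (simp add: FL.FC_Dom)
    fix f assume f: "f \<in> Arr A"
    have d: "Dom A f \<in> Obj A" "Cod A f \<in> Obj A" using f by auto
    have Sf: "FAr S f \<in> Arr CL" "fst (FAr S f) = FOb S (Dom A f)" "fst (snd (FAr S f)) = FOb S (Cod A f)"
      using S.functor_simps[OF f] by (simp_all add: FL.FC_Dom)
    have Tf: "FAr T f \<in> Arr CL" "fst (FAr T f) = FOb T (Dom A f)" "fst (snd (FAr T f)) = FOb T (Cod A f)"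
      using T.functor_simps[OF f] by (simp_all add: FL.FC_Dom)
    show "?t (Cod A f) \<bullet>\<^bsub>CL\<^esub> FAr S f = FAr T f \<bullet>\<^bsub>CL\<^esub> ?t (Dom A f)"
    proof (rule FL.Arr_eqI)
      show "?t (Cod A f) \<bullet>\<^bsub>CL\<^esub> FAr S f \<in> Arr CL" "FAr T f \<bullet>\<^bsub>CL\<^esub> ?t (Dom A f) \<in> Arr CL"
        by (rule FL.FC.Cmp_simps(1); simp add: t d Sf Tf FL.FC_Dom)+
      show "cmpt (?t (Cod A f) \<bullet>\<^bsub>CL\<^esub> FAr S f) x = cmpt (FAr T f \<bullet>\<^bsub>CL\<^esub> ?t (Dom A f)) x" if "x \<in> Obj L" for x
        using nat'[OF f that] that by simp
    qed (simp_all add: FL.FC_Cmp Sf Tf)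
  qed
qed

abbreviation P :: "(('e, 'o, 'a) lin_fun, ('e, 'o, 'a) lin_nat) endofunctor" where "P \<equiv> shift_functor C zeroC"

lemma P_FOb: "FOb P F =
    \<lparr>FOb = \<lambda>x \<in> Obj L. if fst x = {} then zeroC else FOb F (x \<restriction> without_max x),
     FAr = \<lambda>\<phi> \<in> Arr L. if fst (fst \<phi>) = {} then Idn C zeroC else FAr F (\<phi> \<restriction>\<^sub>a without_max (fst \<phi>))\<rparr>"
  by (simp add: shift_functor_def Let_def lin_simps)

lemma P_FAr: "FAr P \<tau> = (FOb P (fst \<tau>), FOb P (fst (snd \<tau>)),
    \<lambda>x \<in> Obj L. if fst x = {} then Idn C zeroC else cmpt \<tau> (x \<restriction> without_max x))"
  by (simp add: shift_functor_def Let_def lin_simps case_prod_beta)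

lemma P_Obj:
  assumes F: "F \<in> Obj CL"
  shows "FOb P F \<in> Obj CL"
  unfolding P_FOb
proof (rule FL.ObjI)
  show "(if fst x = {} then zeroC else FOb F (x \<restriction> without_max x)) \<in> Obj C" if "x \<in> Obj L" for x
    using that by (simp add: FL.ObjD[OF F] restr_without_max)
  show "(if fst (fst (Idn L x)) = {} then Idn C zeroC else FAr F (Idn L x \<restriction>\<^sub>a without_max (fst (Idn L x)))) =
      Idn C (if fst x = {} then zeroC else FOb F (x \<restriction> without_max x))" if "x \<in> Obj L" for x
  proof -
    have "fst (Idn L x) = x" by (simp add: lin_simps)
    then show ?thesis using that by (simp add: FL.ObjD[OF F] restr_without_max arr_restr_Idn[OF without_max_subset])
  qed
next
  fix \<phi> assume \<phi>: "\<phi> \<in> Arr L"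
  note w = arr_restr_Arr[OF \<phi> without_max_subset]
  show "(if fst (fst \<phi>) = {} then Idn C zeroC else FAr F (\<phi> \<restriction>\<^sub>a without_max (fst \<phi>))) \<in> Arr C \<and>
    Dom C (if fst (fst \<phi>) = {} then Idn C zeroC else FAr F (\<phi> \<restriction>\<^sub>a without_max (fst \<phi>))) =
      (if fst (Dom L \<phi>) = {} then zeroC else FOb F (Dom L \<phi> \<restriction> without_max (Dom L \<phi>))) \<and>
    Cod C (if fst (fst \<phi>) = {} then Idn C zeroC else FAr F (\<phi> \<restriction>\<^sub>a without_max (fst \<phi>))) =
      (if fst (Cod L \<phi>) = {} then zeroC else FOb F (Cod L \<phi> \<restriction> without_max (Cod L \<phi>)))"
    by (simp add: FL.ObjD[OF F] w lin_simps empty_Cod[OF \<phi>] without_max_Cod[OF \<phi>])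
  fix \<psi> assume \<psi>: "\<psi> \<in> Arr L" and c: "Dom L \<psi> = Cod L \<phi>"
  have c': "fst \<psi> = fst (snd \<phi>)" using c by (simp add: lin_simps)
  have w': "\<psi> \<restriction>\<^sub>a without_max (fst (snd \<phi>)) \<in> Arr L" using arr_restr_Arr[OF \<psi> without_max_subset] c' by simp
  have "FAr F ((\<psi> \<bullet>\<^bsub>L\<^esub> \<phi>) \<restriction>\<^sub>a without_max (fst \<phi>)) =
      FAr F (\<psi> \<restriction>\<^sub>a without_max (fst (snd \<phi>))) \<bullet> FAr F (\<phi> \<restriction>\<^sub>a without_max (fst \<phi>))"
    unfolding arr_restr_Cmp[OF without_max_subset] without_max_Cod[OF \<phi>, symmetric]
    by (rule FL.ObjD(6)[OF F w w']) (simp add: lin_simps c' without_max_Cod[OF \<phi>])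
  moreover have "fst (\<psi> \<bullet>\<^bsub>L\<^esub> \<phi>) = fst \<phi>" by (simp add: lin_simps)
  ultimately show "(if fst (fst (\<psi> \<bullet>\<^bsub>L\<^esub> \<phi>)) = {} then Idn C zeroC else FAr F ((\<psi> \<bullet>\<^bsub>L\<^esub> \<phi>) \<restriction>\<^sub>a without_max (fst (\<psi> \<bullet>\<^bsub>L\<^esub> \<phi>)))) =
    (if fst (fst \<psi>) = {} then Idn C zeroC else FAr F (\<psi> \<restriction>\<^sub>a without_max (fst \<psi>))) \<bullet>
    (if fst (fst \<phi>) = {} then Idn C zeroC else FAr F (\<phi> \<restriction>\<^sub>a without_max (fst \<phi>)))"
    by (simp add: c' empty_Cod[OF \<phi>])
qed

lemma P_functor: "is_functor CL CL P"
proof (rule is_functorI[OF FL.category_FC FL.category_FC])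
  show "F \<in> Obj CL \<Longrightarrow> FOb P F \<in> Obj CL" for F by (rule P_Obj)
next
  fix \<tau> assume \<tau>: "\<tau> \<in> Arr CL"
  note t = FL.ArrD[OF \<tau>]
  note o = FL.ObjD[OF t(1)] FL.ObjD[OF t(2)]
  have "FAr P \<tau> \<in> Arr CL"
    unfolding P_FAr
  proof (rule FL.ArrI[OF P_Obj[OF t(1)] P_Obj[OF t(2)]])
    fix x assume "x \<in> Obj L"
    then show "(if fst x = {} then Idn C zeroC else cmpt \<tau> (x \<restriction> without_max x)) \<in> Arr C \<and>
      Dom C (if fst x = {} then Idn C zeroC else cmpt \<tau> (x \<restriction> without_max x)) = FOb (FOb P (fst \<tau>)) x \<and>
      Cod C (if fst x = {} then Idn C zeroC else cmpt \<tau> (x \<restriction> without_max x)) = FOb (FOb P (fst (snd \<tau>))) x"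
      by (simp add: P_FOb t restr_without_max)
  next
    fix \<phi> assume \<phi>: "\<phi> \<in> Arr L"
    show "(if fst (Cod L \<phi>) = {} then Idn C zeroC else cmpt \<tau> (Cod L \<phi> \<restriction> without_max (Cod L \<phi>))) \<bullet> FAr (FOb P (fst \<tau>)) \<phi> =
      FAr (FOb P (fst (snd \<tau>))) \<phi> \<bullet> (if fst (Dom L \<phi>) = {} then Idn C zeroC else cmpt \<tau> (Dom L \<phi> \<restriction> without_max (Dom L \<phi>)))"
      using FL.ArrD(6)[OF \<tau> arr_restr_Arr[OF \<phi> without_max_subset]] \<phi>
      by (simp add: P_FOb lin_simps empty_Cod[OF \<phi>] without_max_Cod[OF \<phi>])
  qed
  then show "FAr P \<tau> \<in> Arr CL \<and> Dom CL (FAr P \<tau>) = FOb P (Dom CL \<tau>) \<and> Cod CL (FAr P \<tau>) = FOb P (Cod CL \<tau>)"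
    by (simp add: P_FAr FL.FC_Dom)
next
  fix F assume F: "F \<in> Obj CL"
  show "FAr P (Idn CL F) = Idn CL (FOb P F)"
    by (auto simp: P_FAr P_FOb FL.FC_Idn restr_without_max intro!: restrict_ext)
next
  fix \<sigma> \<tau> assume st: "\<sigma> \<in> Arr CL" "\<tau> \<in> Arr CL" "Dom CL \<tau> = Cod CL \<sigma>"
  show "FAr P (\<tau> \<bullet>\<^bsub>CL\<^esub> \<sigma>) = FAr P \<tau> \<bullet>\<^bsub>CL\<^esub> FAr P \<sigma>"
    by (auto simp: P_FAr FL.FC_Cmp restr_without_max intro!: restrict_ext)
qed

end

section \<open>Negatives in \<open>C^L\<close>\<close>

locale neg_lin = rig_lin C plusC zeroC timesC oneC E
  for C :: "('o, 'a) cat" (structure) and plusC zeroC timesC oneC and E :: "'e itself" +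
  fixes neg :: "('o, 'a) endofunctor"
  assumes neg: "negative_functor C plusC zeroC neg"
begin

abbreviation negL :: "(('e, 'o, 'a) lin_fun, ('e, 'o, 'a) lin_nat) endofunctor" where "negL \<equiv> pointwise_neg neg"

sublocale N: is_functor C C neg
  using neg by (simp add: negative_functor_def)

lemma negL_FOb: "FOb negL F = \<lparr>FOb = \<lambda>x \<in> Obj L. FOb neg (FOb F x), FAr = \<lambda>\<phi> \<in> Arr L. FAr neg (FAr F \<phi>)\<rparr>"
  by (simp add: pointwise_neg_def)

lemma negL_FAr: "FAr negL \<tau> = (FOb negL (fst \<tau>), FOb negL (fst (snd \<tau>)), \<lambda>x \<in> Obj L. FAr neg (cmpt \<tau> x))"
  by (cases \<tau>) (simp add: pointwise_neg_def Let_def)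

lemma negL_Obj:
  assumes "F \<in> Obj CL"
  shows "FOb negL F \<in> Obj CL"
  unfolding negL_FOb
  by (rule FL.ObjI) (simp_all add: FL.ObjD[OF assms] N.FOb_Obj N.FAr_Idn N.functor_Cmp)

lemma negL_functor: "is_functor CL CL negL"
proof (rule is_functorI[OF FL.category_FC FL.category_FC])
  show "F \<in> Obj CL \<Longrightarrow> FOb negL F \<in> Obj CL" for F by (rule negL_Obj)
next
  fix \<tau> assume \<tau>: "\<tau> \<in> Arr CL"
  note t = FL.ArrD[OF \<tau>]
  note o = FL.ObjD[OF t(1)] FL.ObjD[OF t(2)]
  have "FAr negL \<tau> \<in> Arr CL"
    unfolding negL_FAr
    by (rule FL.ArrI[OF negL_Obj[OF t(1)] negL_Obj[OF t(2)]])
      (simp_all add: negL_FOb t(3-5) o t(6) flip: N.functor_Cmp)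
  then show "FAr negL \<tau> \<in> Arr CL \<and> Dom CL (FAr negL \<tau>) = FOb negL (Dom CL \<tau>) \<and> Cod CL (FAr negL \<tau>) = FOb negL (Cod CL \<tau>)"
    by (simp add: negL_FAr FL.FC_Dom)
next
  fix F assume F: "F \<in> Obj CL"
  show "FAr negL (Idn CL F) = Idn CL (FOb negL F)"
    by (auto simp: negL_FAr negL_FOb FL.FC_Idn N.FAr_Idn FL.ObjD[OF F] intro!: restrict_ext)
next
  fix \<sigma> \<tau> assume st: "\<sigma> \<in> Arr CL" "\<tau> \<in> Arr CL" "Dom CL \<tau> = Cod CL \<sigma>"
  then show "FAr negL (\<tau> \<bullet>\<^bsub>CL\<^esub> \<sigma>) = FAr negL \<tau> \<bullet>\<^bsub>CL\<^esub> FAr negL \<sigma>"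
    using FL.ArrD(3-5)[OF st(1)] FL.ArrD(3-5)[OF st(2)]
    by (auto simp: negL_FAr FL.FC_Cmp N.functor_Cmp FL.FC_Dom intro!: restrict_ext)
qed

lemma plus_functor_comp:
  assumes "is_functor CL CL S"
  shows "is_functor (CL \<times>\<^sub>C CL) CL
      \<lparr>FOb = \<lambda>(x, y). FOb S (FOb plusL (x, y)), FAr = \<lambda>(f, g). FAr S (FAr plusL (f, g))\<rparr>"
    "is_functor (CL \<times>\<^sub>C CL) CL
      \<lparr>FOb = \<lambda>(x, y). FOb plusL (FOb S x, FOb S y), FAr = \<lambda>(f, g). FAr plusL (FAr S f, FAr S g)\<rparr>"
  using functor_comp[OF plusL_functor assms]
    functor_bi[OF plusL_functor functor_comp[OF functor_proj(1)[OF FL.category_FC FL.category_FC] assms]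
      functor_comp[OF functor_proj(2)[OF FL.category_FC FL.category_FC] assms]]
  by (simp_all add: case_prod_unfold)

text \<open>Sum and negative of functors are objectwise, so the isomorphisms of \<open>C\<close> at
  the values of the functors serve as components.\<close>

theorem negative_functor_CL: "negative_functor CL plusL zeroL negL"
proof -
  obtain n where n: "natural_iso (C \<times>\<^sub>C C) C
       \<lparr>FOb = \<lambda>(x, y). FOb neg (FOb plusC (x, y)), FAr = \<lambda>(f, g). FAr neg (FAr plusC (f, g))\<rparr>
       \<lparr>FOb = \<lambda>(x, y). FOb plusC (FOb neg x, FOb neg y), FAr = \<lambda>(f, g). FAr plusC (FAr neg f, FAr neg g)\<rparr> n"
    using neg by (auto simp: negative_functor_def naturally_isomorphic_def)
  obtain z where z: "is_isomorphism C z" "Dom C z = FOb neg zeroC" "Cod C z = zeroC"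
    using neg unfolding negative_functor_def by (meson isomorphicE)
  obtain d where d: "natural_iso C C \<lparr>FOb = \<lambda>x. FOb neg (FOb neg x), FAr = \<lambda>f. FAr neg (FAr neg f)\<rparr> id_functor d"
    using neg by (auto simp: negative_functor_def naturally_isomorphic_def)
  have nn: "is_isomorphism C (n (x, y))" "Dom C (n (x, y)) = FOb neg (FOb plusC (x, y))"
    "Cod C (n (x, y)) = FOb plusC (FOb neg x, FOb neg y)" if "x \<in> Obj C" "y \<in> Obj C" for x y
    using natural_isoD(3-6)[OF n, of "(x, y)"] that by auto
  have nnat: "n (Cod C f, Cod C g) \<bullet> FAr neg (FAr plusC (f, g)) = FAr plusC (FAr neg f, FAr neg g) \<bullet> n (Dom C f, Dom C g)"
    if "f \<in> Arr C" "g \<in> Arr C" for f g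
    using natural_isoD(7)[OF n, of "(f, g)"] that by auto
  have dd: "is_isomorphism C (d x)" "Dom C (d x) = FOb neg (FOb neg x)" "Cod C (d x) = x" if "x \<in> Obj C" for x
    using natural_isoD(3-6)[OF d, of x] that by (auto simp: id_functor_def)
  have dnat: "d (Cod C f) \<bullet> FAr neg (FAr neg f) = f \<bullet> d (Dom C f)" if "f \<in> Arr C" for f
    using natural_isoD(7)[OF d that] by (auto simp: id_functor_def)
  show ?thesis
    unfolding negative_functor_def
  proof (intro conjI negL_functor)
    show "naturally_isomorphic (CL \<times>\<^sub>C CL) CL
      \<lparr>FOb = \<lambda>(x, y). FOb negL (FOb plusL (x, y)), FAr = \<lambda>(f, g). FAr negL (FAr plusL (f, g))\<rparr>
      \<lparr>FOb = \<lambda>(x, y). FOb plusL (FOb negL x, FOb negL y), FAr = \<lambda>(f, g). FAr plusL (FAr negL f, FAr negL g)\<rparr>"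
    proof (rule pointwise_natural[where c = "\<lambda>(F, G) x. n (FOb F x, FOb G x)", OF plus_functor_comp[OF negL_functor]])
      fix F x assume "F \<in> Obj (CL \<times>\<^sub>C CL)" "x \<in> Obj L"
      then show "is_isomorphism C ((case F of (F, G) \<Rightarrow> \<lambda>x. n (FOb F x, FOb G x)) x) \<and>
        Dom C ((case F of (F, G) \<Rightarrow> \<lambda>x. n (FOb F x, FOb G x)) x) =
          FOb (FOb \<lparr>FOb = \<lambda>(x, y). FOb negL (FOb plusL (x, y)), FAr = \<lambda>(f, g). FAr negL (FAr plusL (f, g))\<rparr> F) x \<and>
        Cod C ((case F of (F, G) \<Rightarrow> \<lambda>x. n (FOb F x, FOb G x)) x) =
          FOb (FOb \<lparr>FOb = \<lambda>(x, y). FOb plusL (FOb negL x, FOb negL y), FAr = \<lambda>(f, g). FAr plusL (FAr negL f, FAr negL g)\<rparr> F) x"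
        by (auto simp: negL_FOb plusL_FOb nn FL.ObjD)
    next
      fix F \<phi> assume "F \<in> Obj (CL \<times>\<^sub>C CL)" and \<phi>: "\<phi> \<in> Arr L"
      then obtain G H where F: "F = (G, H)" and GH: "G \<in> Obj CL" "H \<in> Obj CL" by auto
      show "(case F of (F, G) \<Rightarrow> \<lambda>x. n (FOb F x, FOb G x)) (fst (snd \<phi>)) \<bullet>
          FAr (FOb \<lparr>FOb = \<lambda>(x, y). FOb negL (FOb plusL (x, y)), FAr = \<lambda>(f, g). FAr negL (FAr plusL (f, g))\<rparr> F) \<phi> =
        FAr (FOb \<lparr>FOb = \<lambda>(x, y). FOb plusL (FOb negL x, FOb negL y), FAr = \<lambda>(f, g). FAr plusL (FAr negL f, FAr negL g)\<rparr> F) \<phi> \<bullet>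
          (case F of (F, G) \<Rightarrow> \<lambda>x. n (FOb F x, FOb G x)) (fst \<phi>)"
        using nnat[of "FAr G \<phi>" "FAr H \<phi>"] \<phi>
        by (simp add: F negL_FOb plusL_FOb FL.ObjD[OF GH(1)] FL.ObjD[OF GH(2)] lin_simps)
    next
      fix f x assume "f \<in> Arr (CL \<times>\<^sub>C CL)" and x: "x \<in> Obj L"
      then obtain \<sigma> \<tau> where f: "f = (\<sigma>, \<tau>)" and st: "\<sigma> \<in> Arr CL" "\<tau> \<in> Arr CL" by auto
      show "(case Cod (CL \<times>\<^sub>C CL) f of (F, G) \<Rightarrow> \<lambda>x. n (FOb F x, FOb G x)) x \<bullet>
          cmpt (FAr \<lparr>FOb = \<lambda>(x, y). FOb negL (FOb plusL (x, y)), FAr = \<lambda>(f, g). FAr negL (FAr plusL (f, g))\<rparr> f) x =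
        cmpt (FAr \<lparr>FOb = \<lambda>(x, y). FOb plusL (FOb negL x, FOb negL y), FAr = \<lambda>(f, g). FAr plusL (FAr negL f, FAr negL g)\<rparr> f) x \<bullet>
          (case Dom (CL \<times>\<^sub>C CL) f of (F, G) \<Rightarrow> \<lambda>x. n (FOb F x, FOb G x)) x"
        using nnat[of "cmpt \<sigma> x" "cmpt \<tau> x"] x
        by (simp add: f negL_FAr plusL_FAr FL.ArrD(3-5)[OF st(1)] FL.ArrD(3-5)[OF st(2)] FL.FC_Dom)
    qed
  next
    let ?z = "(FOb negL zeroL, zeroL, \<lambda>x \<in> Obj L. z)"
    \<comment> \<open>The family is constant in \<open>x\<close>; it is natural because both
      functors send every order isomorphism to an identity.\<close>
    have "?z \<in> Arr CL"
      by (rule FL.ArrI[OF negL_Obj[OF zeroL_Obj] zeroL_Obj])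
        (use z in \<open>auto simp: negL_FOb const_fun_def N.FAr_Idn lin_Arr lin_simps\<close>)
    then have "is_isomorphism CL ?z" by (rule FL.FC_isoI) (simp add: z)
    from FL.FC.isomorphicI[OF this] show "isomorphic CL (FOb negL zeroL) zeroL" by (simp add: FL.FC_Dom)
  next
    show "naturally_isomorphic CL CL \<lparr>FOb = \<lambda>x. FOb negL (FOb negL x), FAr = \<lambda>f. FAr negL (FAr negL f)\<rparr> id_functor"
    proof (rule pointwise_natural[where c = "\<lambda>F x. d (FOb F x)", OF functor_comp[OF negL_functor negL_functor] functor_id[OF FL.category_FC]])
      fix F x assume "F \<in> Obj CL" "x \<in> Obj L"
      then show "is_isomorphism C (d (FOb F x)) \<and>
        Dom C (d (FOb F x)) = FOb (FOb \<lparr>FOb = \<lambda>x. FOb negL (FOb negL x), FAr = \<lambda>f. FAr negL (FAr negL f)\<rparr> F) x \<and>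
        Cod C (d (FOb F x)) = FOb (FOb id_functor F) x"
        by (auto simp: negL_FOb dd FL.ObjD id_functor_def)
    next
      fix F \<phi> assume F: "F \<in> Obj CL" and \<phi>: "\<phi> \<in> Arr L"
      show "d (FOb F (fst (snd \<phi>))) \<bullet> FAr (FOb \<lparr>FOb = \<lambda>x. FOb negL (FOb negL x), FAr = \<lambda>f. FAr negL (FAr negL f)\<rparr> F) \<phi> =
        FAr (FOb id_functor F) \<phi> \<bullet> d (FOb F (fst \<phi>))"
        using dnat[of "FAr F \<phi>"] \<phi> by (simp add: negL_FOb FL.ObjD[OF F] lin_simps id_functor_def)
    next
      fix f x assume f: "f \<in> Arr CL" and x: "x \<in> Obj L"
      show "d (FOb (Cod CL f) x) \<bullet> cmpt (FAr \<lparr>FOb = \<lambda>x. FOb negL (FOb negL x), FAr = \<lambda>f. FAr negL (FAr negL f)\<rparr> f) x =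
        cmpt (FAr id_functor f) x \<bullet> d (FOb (Dom CL f) x)"
        using dnat[of "cmpt f x"] x by (simp add: negL_FAr FL.ArrD(3-5)[OF f] id_functor_def FL.FC_Dom)
    qed
  qed
qed

end

section \<open>The Rota-Baxter identity at the level of terms\<close>

lemma without_max_insert:
  assumes x: "x \<in> Obj lin_cat" and ne: "fst x \<noteq> {}" and B: "B \<subseteq> without_max x"
  shows "without_max (x \<restriction> insert (max_elt x) B) = B"
proof -
  let ?m = "max_elt x"
  note m = max_elt[OF x ne]
  have sub: "insert ?m B \<subseteq> fst x" using B m by (auto simp: without_max_def)
  have "max_elt (x \<restriction> insert ?m B) = ?m"
  proof (rule max_elt_eqI[OF restr_Obj[OF x sub]])
    fix a assume "a \<in> fst (x \<restriction> insert ?m B)"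
    then have "a \<in> insert ?m B" "a \<in> fst x" using sub by auto
    then show "(a, ?m) \<in> snd (x \<restriction> insert ?m B)" using m unfolding lin_restrict_def by (simp only: fst_conv snd_conv) blast
  qed simp
  then show ?thesis using B by (auto simp: without_max_def)
qed

lemma without_max_restr: "without_max (x \<restriction> B) \<subseteq> B"
  using without_max_subset[of "x \<restriction> B"] by simp

text \<open>The value of a shifted functor at \<open>B\<close>. The case distinction is that of the
  shift, which is zero at the empty set.\<close>

definition pvar :: "nat \<Rightarrow> 'e set \<Rightarrow> (nat \<times> 'e set) rig_term" where
  "pvar i B = (if B = {} then Nul else Var (i, B))"

text \<open>The values of \<open>P(F) P(G)\<close> and of \<open>P(P(F) G) + P(F P(G))\<close> at \<open>x\<close>.  The letter \<open>(i, B)\<close>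
  stands for the value of \<open>F\<close> or \<open>G\<close> at \<open>B\<close> without its maximum; with these names each
  summand of either side occurs only once.\<close>

definition rb_left :: "'e lin \<Rightarrow> (nat \<times> 'e set) rig_term" where
  "rb_left x = sum_term (map (\<lambda>(B, B'). Mul (pvar 0 B) (pvar 1 B')) (decomps x))"

definition rb_right :: "'e lin \<Rightarrow> (nat \<times> 'e set) rig_term" where
  "rb_right x = (if fst x = {} then Add Nul Nul else
    Add (sum_term (map (\<lambda>(B, B'). Mul (pvar 0 B) (Var (1, insert (max_elt x) B'))) (decomps (x \<restriction> without_max x))))
        (sum_term (map (\<lambda>(B, B'). Mul (Var (0, insert (max_elt x) B)) (pvar 1 B')) (decomps (x \<restriction> without_max x)))))"

lemma pvar_simps [simp]: "mons (pvar i B) S = (if B = {} then {} else Cons (i, B) ` S)" "regular (pvar i B) S"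
  by (auto simp: pvar_def)

lemma mons_sum_pairs:
  "w \<in> mons (sum_term (map (\<lambda>(B, B'). f B B') ds)) S \<longleftrightarrow> (\<exists>B B'. (B, B') \<in> set ds \<and> w \<in> mons (f B B') S)"
  unfolding mons_sum_term by fastforce

lemma mons_Mul_pvar:
  "w \<in> mons (Mul (pvar i B) (pvar j B')) {[]} \<longleftrightarrow> B \<noteq> {} \<and> B' \<noteq> {} \<and> w = [(i, B), (j, B')]"
  "w \<in> mons (Mul (pvar i B) (Var a)) {[]} \<longleftrightarrow> B \<noteq> {} \<and> w = [(i, B), a]"
  "w \<in> mons (Mul (Var a) (pvar j B')) {[]} \<longleftrightarrow> B' \<noteq> {} \<and> w = [a, (j, B')]"
  by auto

lemma mons_rb_left:
  assumes x: "x \<in> Obj lin_cat"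
  shows "w \<in> mons (rb_left x) {[]} \<longleftrightarrow>
    (\<exists>B B'. w = [(0, B), (1, B')] \<and> B \<noteq> {} \<and> B' \<noteq> {} \<and> B \<inter> B' = {} \<and> B \<union> B' = fst x)"
  unfolding rb_left_def mons_sum_pairs mons_Mul_pvar set_decomps[OF x] by (simp only: mem_Collect_eq prod.case) blast

lemma mons_rb_right:
  assumes x: "x \<in> Obj lin_cat"
  shows "mons (rb_right x) {[]} = mons (rb_left x) {[]}"
proof (cases "fst x = {}")
  case True
  then show ?thesis using mons_rb_left[OF x] by (fastforce simp: rb_right_def)
next
  case False
  let ?m = "max_elt x"
  have m: "?m \<in> fst x" "?m \<notin> without_max x" "fst x = insert ?m (without_max x)"
    using max_elt(1)[OF x False] by (auto simp: without_max_def)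
  have r: "w \<in> mons (rb_right x) {[]} \<longleftrightarrow>
      (\<exists>B B'. w = [(0, B), (1, insert ?m B')] \<and> B \<noteq> {} \<and> B \<inter> B' = {} \<and> B \<union> B' = without_max x) \<or>
      (\<exists>B B'. w = [(0, insert ?m B), (1, B')] \<and> B' \<noteq> {} \<and> B \<inter> B' = {} \<and> B \<union> B' = without_max x)" for w
  proof -
    have "w \<in> mons (rb_right x) {[]} \<longleftrightarrow>
      (\<exists>B B'. (B, B') \<in> set (decomps (x \<restriction> without_max x)) \<and> B \<noteq> {} \<and> w = [(0, B), (1, insert ?m B')]) \<or>
      (\<exists>B B'. (B, B') \<in> set (decomps (x \<restriction> without_max x)) \<and> B' \<noteq> {} \<and> w = [(0, insert ?m B), (1, B')])"
      unfolding rb_right_def if_not_P[OF False] mons.simps(4) Un_iff mons_sum_pairs mons_Mul_pvar ..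
    then show ?thesis
      unfolding set_decomps[OF restr_without_max[OF x]] by (simp only: mem_Collect_eq prod.case restr_simps) blast
  qed
  show ?thesis
  proof (intro Set.set_eqI iffI)
    fix w assume "w \<in> mons (rb_left x) {[]}"
    then obtain B B' where w: "w = [(0, B), (1, B')]" "B \<noteq> {}" "B' \<noteq> {}" "B \<inter> B' = {}" "B \<union> B' = fst x"
      unfolding mons_rb_left[OF x] by blast
    then consider "?m \<in> B" "?m \<notin> B'" | "?m \<in> B'" "?m \<notin> B" using m(1) by blast
    then show "w \<in> mons (rb_right x) {[]}"
    proof cases
      case 1
      \<comment> \<open>Deleting the maximum from the part that contains it leaves a decomposition
        of the smaller set. That part may become empty, which is why only the other part carries a
        \<open>pvar\<close> in this summand of \<open>rb_right\<close>.\<close>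
      then have "w = [(0, insert ?m (B - {?m})), (1, B')]" "(B - {?m}) \<inter> B' = {}" "(B - {?m}) \<union> B' = without_max x"
        using w by (auto simp: without_max_def)
      then show ?thesis using w(3) unfolding r by blast
    next
      case 2
      then have "w = [(0, B), (1, insert ?m (B' - {?m}))]" "B \<inter> (B' - {?m}) = {}" "B \<union> (B' - {?m}) = without_max x"
        using w by (auto simp: without_max_def)
      then show ?thesis using w(2) unfolding r by blast
    qed
  next
    fix w assume "w \<in> mons (rb_right x) {[]}"
    then consider B B' where "w = [(0, B), (1, insert ?m B')]" "B \<noteq> {}" "B \<inter> B' = {}" "B \<union> B' = without_max x"
      | B B' where "w = [(0, insert ?m B), (1, B')]" "B' \<noteq> {}" "B \<inter> B' = {}" "B \<union> B' = without_max x"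
      unfolding r by blast
    then show "w \<in> mons (rb_left x) {[]}"
    proof cases
      case 1
      then have "B \<inter> insert ?m B' = {}" "B \<union> insert ?m B' = fst x" using m by auto
      then show ?thesis using 1(1,2) unfolding mons_rb_left[OF x] by blast
    next
      case 2
      then have "insert ?m B \<inter> B' = {}" "insert ?m B \<union> B' = fst x" using m by auto
      then show ?thesis using 2(1,2) unfolding mons_rb_left[OF x] by blast
    qed
  qed
qed

lemma regular_sum_pairs:
  assumes "\<And>B B'. (B, B') \<in> set ds \<Longrightarrow> regular (f B B') S" "distinct ds"
    and "\<And>B B' D D' w. (B, B') \<in> set ds \<Longrightarrow> (D, D') \<in> set ds \<Longrightarrow> w \<in> mons (f B B') S \<Longrightarrow> w \<in> mons (f D D') S \<Longrightarrow>
      B = D \<and> B' = D'"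
  shows "regular (sum_term (map (\<lambda>(B, B'). f B B') ds)) S"
proof (rule regular_sum_term[OF _ assms(2)])
  show "regular (case d of (B, B') \<Rightarrow> f B B') S" if "d \<in> set ds" for d
    using assms(1) that by (cases d) simp
  show "mons (case d of (B, B') \<Rightarrow> f B B') S \<inter> mons (case d' of (B, B') \<Rightarrow> f B B') S = {}"
    if "d \<in> set ds" "d' \<in> set ds" "d \<noteq> d'" for d d'
    using assms(3) that by (cases d; cases d') fastforce
qed

lemma regular_rb_left: "x \<in> Obj lin_cat \<Longrightarrow> regular (rb_left x) {[]}"
  unfolding rb_left_def
  by (rule regular_sum_pairs) (simp_all only: mons_Mul_pvar distinct_decomps pvar_simps regular.simps simp_thms list.inject prod.inject)

lemma regular_rb_right:
  assumes x: "x \<in> Obj lin_cat"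
  shows "regular (rb_right x) {[]}"
proof (cases "fst x = {}")
  case False
  let ?m = "max_elt x" and ?ds = "decomps (x \<restriction> without_max x)"
  have y: "x \<restriction> without_max x \<in> Obj lin_cat" by (rule restr_without_max[OF x])
  have m: "?m \<notin> without_max x" by (simp add: without_max_def)
  have D: "?m \<notin> B" "?m \<notin> B'" if "(B, B') \<in> set ?ds" for B B'
    using decompsD(1,2)[OF y that] m by auto
  have ins: "B = D" if "insert ?m B = insert ?m D" "?m \<notin> B" "?m \<notin> D" for B D
    using that insert_ident by metis
  have "regular (sum_term (map (\<lambda>(B, B'). Mul (pvar 0 B) (Var (1, insert ?m B'))) ?ds)) {[]}"
  proof (rule regular_sum_pairs)
    fix B B' D' D'' w assume "(B, B') \<in> set ?ds" "(D', D'') \<in> set ?ds"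
      "w \<in> mons (Mul (pvar 0 B) (Var (1 :: nat, insert ?m B'))) {[]}" "w \<in> mons (Mul (pvar 0 D') (Var (1, insert ?m D''))) {[]}"
    then show "B = D' \<and> B' = D''" unfolding mons_Mul_pvar using D ins by (metis list.inject prod.inject)
  qed (simp_all add: distinct_decomps[OF y])
  moreover have "regular (sum_term (map (\<lambda>(B, B'). Mul (Var (0, insert ?m B)) (pvar 1 B')) ?ds)) {[]}"
  proof (rule regular_sum_pairs)
    fix B B' D' D'' w assume "(B, B') \<in> set ?ds" "(D', D'') \<in> set ?ds"
      "w \<in> mons (Mul (Var (0 :: nat, insert ?m B)) (pvar 1 B')) {[]}" "w \<in> mons (Mul (Var (0, insert ?m D')) (pvar 1 D'')) {[]}"
    then show "B = D' \<and> B' = D''" unfolding mons_Mul_pvar using D ins by (metis list.inject prod.inject)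
  qed (simp_all add: distinct_decomps[OF y])
  \<comment> \<open>The first letter of a word contains the maximum in the second sum but not in the
    first.\<close>
  moreover have "mons (sum_term (map (\<lambda>(B, B'). Mul (pvar 0 B) (Var (1 :: nat, insert ?m B'))) ?ds)) {[]} \<inter>
      mons (sum_term (map (\<lambda>(B, B'). Mul (Var (0, insert ?m B)) (pvar 1 B')) ?ds)) {[]} = {}"
  proof (rule ccontr)
    assume "\<not> ?thesis"
    then obtain w where "w \<in> mons (sum_term (map (\<lambda>(B, B'). Mul (pvar 0 B) (Var (1 :: nat, insert ?m B'))) ?ds)) {[]}"
      "w \<in> mons (sum_term (map (\<lambda>(B, B'). Mul (Var (0, insert ?m B)) (pvar 1 B')) ?ds)) {[]}" by blast
    then obtain B B' D' D'' where "(B, B') \<in> set ?ds" "(D', D'') \<in> set ?ds" "B = insert ?m D'"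
      unfolding mons_sum_pairs mons_Mul_pvar by blast
    then show False using D(1) by blast
  qed
  ultimately show ?thesis
    unfolding rb_right_def if_not_P[OF False] regular.simps(4) by blast
qed (simp add: rb_right_def)

lemma rb_map:
  assumes \<phi>: "\<phi> \<in> Arr lin_cat"
  defines "r \<equiv> \<lambda>(i :: nat, B). (i, cmpt \<phi> ` (fst (fst \<phi>) \<inter> B))"
  shows "rb_left (fst (snd \<phi>)) = map_rig_term r (rb_left (fst \<phi>))"
    "rb_right (fst (snd \<phi>)) = map_rig_term r (rb_right (fst \<phi>))"
proof -
  let ?x = "fst \<phi>" and ?y = "fst (snd \<phi>)" and ?X = "without_max (fst \<phi>)"
  have x: "?x \<in> Obj lin_cat" using \<phi> by (simp add: lin_Arr)
  have p: "map_rig_term r (pvar i B) = pvar i (cmpt \<phi> ` B)" if "B \<subseteq> fst ?x" for i B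
    using that by (auto simp: pvar_def r_def Int_absorb1)
  show "rb_left ?y = map_rig_term r (rb_left ?x)"
    unfolding rb_left_def map_sum_term decomps_Cod[OF \<phi>] map_map
  proof (intro arg_cong[of _ _ sum_term] map_cong refl)
    fix d assume d: "d \<in> set (decomps ?x)"
    obtain B B' where d': "d = (B, B')" by (cases d)
    note B = decompsD(1,2)[OF x d[unfolded d']]
    show "((\<lambda>(B, B'). Mul (pvar 0 B) (pvar 1 B')) \<circ> (\<lambda>(B, B'). (cmpt \<phi> ` B, cmpt \<phi> ` B'))) d =
        (map_rig_term r \<circ> (\<lambda>(B, B'). Mul (pvar 0 B) (pvar 1 B'))) d"
      by (simp only: d' o_apply prod.case rig_term.map p[OF B(1)] p[OF B(2)])
  qed
  have d: "decomps (?y \<restriction> without_max ?y) = map (\<lambda>(B, B'). (cmpt \<phi> ` B, cmpt \<phi> ` B')) (decomps (?x \<restriction> ?X))"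
    using decomps_Cod_restr[OF \<phi> without_max_subset] unfolding without_max_Cod[OF \<phi>] .
  show "rb_right ?y = map_rig_term r (rb_right ?x)"
  proof (cases "fst ?x = {}")
    case True
    then show ?thesis by (simp add: rb_right_def empty_Cod[OF \<phi>])
  next
    case False
    have D: "B \<subseteq> fst ?x" "B' \<subseteq> fst ?x" "insert (max_elt ?x) B \<subseteq> fst ?x" "insert (max_elt ?x) B' \<subseteq> fst ?x"
      if "(B, B') \<in> set (decomps (?x \<restriction> ?X))" for B B'
      using decomps_restrD(4,5)[OF x without_max_subset that] max_elt(1)[OF x False] by auto
    have v: "map_rig_term r (Var (i, insert (max_elt ?x) B)) = Var (i, insert (max_elt ?y) (cmpt \<phi> ` B))"
      if "insert (max_elt ?x) B \<subseteq> fst ?x" for i B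
    proof -
      have "fst ?x \<inter> insert (max_elt ?x) B = insert (max_elt ?x) B" using that by blast
      then show ?thesis by (simp only: r_def rig_term.map prod.case max_elt_Cod[OF \<phi> False] image_insert)
    qed
    have False': "fst ?y \<noteq> {}" using False by (simp add: empty_Cod[OF \<phi>])
    show ?thesis
      unfolding rb_right_def if_not_P[OF False] if_not_P[OF False'] rig_term.map map_sum_term d map_map
    proof (intro arg_cong2[of _ _ _ _ Add] arg_cong[of _ _ sum_term] map_cong refl)
      fix d assume d: "d \<in> set (decomps (?x \<restriction> ?X))"
      obtain B B' where d': "d = (B, B')" by (cases d)
      note B = D[OF d[unfolded d']]
      show "((\<lambda>(B, B'). Mul (pvar 0 B) (Var (1, insert (max_elt ?y) B'))) \<circ> (\<lambda>(B, B'). (cmpt \<phi> ` B, cmpt \<phi> ` B'))) d =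
          (map_rig_term r \<circ> (\<lambda>(B, B'). Mul (pvar 0 B) (Var (1, insert (max_elt ?x) B')))) d"
        by (simp only: d' o_apply prod.case rig_term.map(5) p[OF B(1)] v[OF B(4)])
      show "((\<lambda>(B, B'). Mul (Var (0, insert (max_elt ?y) B)) (pvar 1 B')) \<circ> (\<lambda>(B, B'). (cmpt \<phi> ` B, cmpt \<phi> ` B'))) d =
          (map_rig_term r \<circ> (\<lambda>(B, B'). Mul (Var (0, insert (max_elt ?x) B)) (pvar 1 B'))) d"
        by (simp only: d' o_apply prod.case rig_term.map(5) p[OF B(2)] v[OF B(3)])
    qed
  qed
qed

section \<open>The Rota-Baxter isomorphism\<close>

context coherent_lin begin

text \<open>Naturality, renaming of letters and uniqueness in one statement. It serves for order
  isomorphisms, where letters are renamed, and for natural transformations, where \<open>r\<close>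
  is the identity.\<close>

lemma span_transport:
  assumes h [simp]: "\<And>a. h a \<in> Arr C" and f: "span (\<lambda>a. Dom C (h a)) t u f"
    and g: "span J' (map_rig_term r t) (map_rig_term r u) g"
    and J': "\<And>a. J' a \<in> Obj C" "\<And>a. Cod C (h a) = J' (r a)"
    and reg: "regular (map_rig_term r t) {[]}" "regular (map_rig_term r u) {[]}"
  shows "ar h u \<bullet> f = g \<bullet> ar h t"
proof -
  obtain g' where g': "span (\<lambda>a. Cod C (h a)) t u g'" "ar h u \<bullet> f = g' \<bullet> ar h t"
    using span_natural[OF f] h by blast
  have "span J' (t_sub (\<lambda>a. Var (r a)) t) (t_sub (\<lambda>a. Var (r a)) u) g'"
    using g'(1) J'(2) by (intro span_sub) simp
  then have "g' = g"
    unfolding t_sub_Var_map using span_unique[of J', OF J'(1) reg] g by blast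
  then show ?thesis using g' by simp
qed

text \<open>Differs from \<open>lenv\<close> by removing the maximum of \<open>B\<close>; the
  intersection with \<open>fst x\<close> again gives every letter a value.\<close>

definition renv :: "(nat \<Rightarrow> ('e, 'o, 'a) lin_fun) \<Rightarrow> 'e lin \<Rightarrow> nat \<times> 'e set \<Rightarrow> 'o" where
  "renv F x = (\<lambda>(i, B). FOb (F i) (x \<restriction> without_max (x \<restriction> (fst x \<inter> B))))"

definition renv_ar :: "(nat \<Rightarrow> ('e, 'o, 'a) lin_fun) \<Rightarrow> 'e lin_arr \<Rightarrow> nat \<times> 'e set \<Rightarrow> 'a" where
  "renv_ar F \<phi> = (\<lambda>(i, B). FAr (F i) (\<phi> \<restriction>\<^sub>a without_max (fst \<phi> \<restriction> (fst (fst \<phi>) \<inter> B))))"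

definition renv_nat :: "(nat \<Rightarrow> ('e, 'o, 'a) lin_nat) \<Rightarrow> 'e lin \<Rightarrow> nat \<times> 'e set \<Rightarrow> 'a" where
  "renv_nat \<tau> x = (\<lambda>(i, B). cmpt (\<tau> i) (x \<restriction> without_max (x \<restriction> (fst x \<inter> B))))"

lemma without_max_Int: "without_max (x \<restriction> (fst x \<inter> B)) \<subseteq> fst x"
  by (rule order_trans[OF without_max_restr Int_lower1])

lemma pvar_FOb:
  assumes x: "x \<in> Obj L" and B: "B \<subseteq> fst x"
  shows "FOb (FOb P (F i)) (x \<restriction> B) = ob (renv F x) (pvar i B)"
  using restr_Obj[OF x B] B
  by (simp add: P_FOb pvar_def renv_def Int_absorb1 restr_restr[OF without_max_restr])

text \<open>The maximum of \<open>x\<close> is also the maximum of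
  \<open>insert (max_elt x) B\<close>, so removing it gives back \<open>B\<close>. An unshifted
  factor thus becomes a letter named after the set that it has in \<open>P(F) P(G)\<close>.\<close>

lemma shift_FOb:
  assumes x: "x \<in> Obj L" "fst x \<noteq> {}" and B: "B \<subseteq> without_max x"
  shows "FOb (F i) (x \<restriction> B) = renv F x (i, insert (max_elt x) B)"
proof -
  have "fst x \<inter> insert (max_elt x) B = insert (max_elt x) B"
    using B max_elt(1)[OF x] without_max_subset[of x] by auto
  then show ?thesis by (simp add: renv_def without_max_insert[OF x B])
qed

text \<open>At the empty set both shifted products vanish, which is the case
  \<open>Add Nul Nul\<close>. Otherwise the outer shift passes to the set without its maximum, the
  inner one becomes \<open>pvar_FOb\<close>, and the remaining factor is
  \<open>shift_FOb\<close>.\<close>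

lemma rb_FOb:
  assumes x: "x \<in> Obj L"
  shows "FOb (FOb timesL (FOb P (F 0), FOb P (F 1))) x = ob (renv F x) (rb_left x)"
    "FOb (FOb plusL (FOb P (FOb timesL (FOb P (F 0), F 1)), FOb P (FOb timesL (F 0, FOb P (F 1))))) x = ob (renv F x) (rb_right x)"
proof -
  show "FOb (FOb timesL (FOb P (F 0), FOb P (F 1))) x = ob (renv F x) (rb_left x)"
    using decompsD(1,2)[OF x] x
    by (auto simp: rb_left_def timesL_FOb tob_sum_term pvar_FOb[OF x] t_ob.simps simp del: ob_simps One_nat_def intro!: arg_cong[of _ _ bpo])
  show "FOb (FOb plusL (FOb P (FOb timesL (FOb P (F 0), F 1)), FOb P (FOb timesL (F 0, FOb P (F 1))))) x = ob (renv F x) (rb_right x)"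
  proof (cases "fst x = {}")
    case True
    then show ?thesis using x by (simp add: rb_right_def plusL_FOb P_FOb t_ob.simps del: ob_simps)
  next
    case False
    let ?y = "x \<restriction> without_max x"
    have y: "?y \<in> Obj L" by (rule restr_without_max[OF x])
    have D: "B \<subseteq> without_max x \<and> B' \<subseteq> without_max x \<and> B \<subseteq> fst x \<and> B' \<subseteq> fst x \<and> ?y \<restriction> B = x \<restriction> B \<and> ?y \<restriction> B' = x \<restriction> B'"
      if "(B, B') \<in> set (decomps ?y)" for B B'
      using decompsD(1,2)[OF y that] without_max_subset[of x] by (auto simp: restr_restr)
    have 1: "FOb (FOb timesL (FOb P (F 0), F 1)) ?y =
        ob (renv F x) (sum_term (map (\<lambda>(B, B'). Mul (pvar 0 B) (Var (1, insert (max_elt x) B'))) (decomps ?y)))"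
      using D y by (auto simp: timesL_FOb tob_sum_term pvar_FOb[OF x] shift_FOb[OF x False] t_ob.simps
          simp del: ob_simps One_nat_def intro!: arg_cong[of _ _ bpo])
    have 2: "FOb (FOb timesL (F 0, FOb P (F 1))) ?y =
        ob (renv F x) (sum_term (map (\<lambda>(B, B'). Mul (Var (0, insert (max_elt x) B)) (pvar 1 B')) (decomps ?y)))"
      using D y by (auto simp: timesL_FOb tob_sum_term pvar_FOb[OF x] shift_FOb[OF x False] t_ob.simps
          simp del: ob_simps One_nat_def intro!: arg_cong[of _ _ bpo])
    show ?thesis
      using False x by (simp add: rb_right_def plusL_FOb P_FOb[of "FOb timesL _"] 1 2 t_ob.simps(4) del: ob_simps One_nat_def)
  qed
qed

lemma pvar_FAr:
  assumes \<phi>: "\<phi> \<in> Arr L" and B: "B \<subseteq> fst (fst \<phi>)"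
  shows "FAr (FOb P (F i)) (\<phi> \<restriction>\<^sub>a B) = ar (renv_ar F \<phi>) (pvar i B)"
  using arr_restr_Arr[OF \<phi> B] B
  by (simp add: P_FOb pvar_def renv_ar_def Int_absorb1 arr_restr_restr[OF without_max_restr])

lemma shift_FAr:
  assumes \<phi>: "\<phi> \<in> Arr L" "fst (fst \<phi>) \<noteq> {}" and B: "B \<subseteq> without_max (fst \<phi>)"
  shows "FAr (F i) (\<phi> \<restriction>\<^sub>a B) = renv_ar F \<phi> (i, insert (max_elt (fst \<phi>)) B)"
proof -
  have x: "fst \<phi> \<in> Obj L" using \<phi> by (simp add: lin_Arr)
  have "fst (fst \<phi>) \<inter> insert (max_elt (fst \<phi>)) B = insert (max_elt (fst \<phi>)) B"
    using B max_elt(1)[OF x \<phi>(2)] without_max_subset[of "fst \<phi>"] by auto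
  then show ?thesis by (simp add: renv_ar_def without_max_insert[OF x \<phi>(2) B])
qed

lemma rb_FAr:
  assumes \<phi>: "\<phi> \<in> Arr L"
  shows "FAr (FOb timesL (FOb P (F 0), FOb P (F 1))) \<phi> = ar (renv_ar F \<phi>) (rb_left (fst \<phi>))"
    "FAr (FOb plusL (FOb P (FOb timesL (FOb P (F 0), F 1)), FOb P (FOb timesL (F 0, FOb P (F 1))))) \<phi> =
      ar (renv_ar F \<phi>) (rb_right (fst \<phi>))"
proof -
  let ?x = "fst \<phi>"
  have x: "?x \<in> Obj L" using \<phi> by (simp add: lin_Arr)
  show "FAr (FOb timesL (FOb P (F 0), FOb P (F 1))) \<phi> = ar (renv_ar F \<phi>) (rb_left ?x)"
    using decompsD(1,2)[OF x] \<phi>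
    by (auto simp: rb_left_def timesL_FOb tar_sum_term pvar_FAr[OF \<phi>] t_ar.simps simp del: ar_simps One_nat_def intro!: arg_cong[of _ _ bpa])
  show "FAr (FOb plusL (FOb P (FOb timesL (FOb P (F 0), F 1)), FOb P (FOb timesL (F 0, FOb P (F 1))))) \<phi> =
      ar (renv_ar F \<phi>) (rb_right ?x)"
  proof (cases "fst ?x = {}")
    case True
    then show ?thesis using \<phi> by (simp add: rb_right_def plusL_FOb P_FOb t_ar.simps del: ar_simps)
  next
    case False
    let ?\<psi> = "\<phi> \<restriction>\<^sub>a without_max ?x"
    have \<psi>: "?\<psi> \<in> Arr L" by (rule arr_restr_Arr[OF \<phi> without_max_subset])
    have y: "?x \<restriction> without_max ?x \<in> Obj L" by (rule restr_without_max[OF x])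
    have D: "B \<subseteq> without_max ?x \<and> B' \<subseteq> without_max ?x \<and> B \<subseteq> fst ?x \<and> B' \<subseteq> fst ?x \<and> ?\<psi> \<restriction>\<^sub>a B = \<phi> \<restriction>\<^sub>a B \<and> ?\<psi> \<restriction>\<^sub>a B' = \<phi> \<restriction>\<^sub>a B'"
      if "(B, B') \<in> set (decomps (?x \<restriction> without_max ?x))" for B B'
      using decompsD(1,2)[OF y that] without_max_subset[of ?x] by (auto simp: arr_restr_restr)
    have 1: "FAr (FOb timesL (FOb P (F 0), F 1)) ?\<psi> =
        ar (renv_ar F \<phi>) (sum_term (map (\<lambda>(B, B'). Mul (pvar 0 B) (Var (1, insert (max_elt ?x) B'))) (decomps (?x \<restriction> without_max ?x))))"
      using D \<psi> by (auto simp: timesL_FOb tar_sum_term pvar_FAr[OF \<phi>] shift_FAr[OF \<phi> False] t_ar.simps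
          simp del: ar_simps One_nat_def intro!: arg_cong[of _ _ bpa])
    have 2: "FAr (FOb timesL (F 0, FOb P (F 1))) ?\<psi> =
        ar (renv_ar F \<phi>) (sum_term (map (\<lambda>(B, B'). Mul (Var (0, insert (max_elt ?x) B)) (pvar 1 B')) (decomps (?x \<restriction> without_max ?x))))"
      using D \<psi> by (auto simp: timesL_FOb tar_sum_term pvar_FAr[OF \<phi>] shift_FAr[OF \<phi> False] t_ar.simps
          simp del: ar_simps One_nat_def intro!: arg_cong[of _ _ bpa])
    show ?thesis
      using False \<phi> by (simp add: rb_right_def plusL_FOb P_FOb[of "FOb timesL _"] 1 2 t_ar.simps(4) del: ar_simps One_nat_def)
  qed
qed

lemma pvar_nat:
  assumes x: "x \<in> Obj L" and B: "B \<subseteq> fst x"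
  shows "cmpt (FAr P (\<tau> i)) (x \<restriction> B) = ar (renv_nat \<tau> x) (pvar i B)"
  using restr_Obj[OF x B] B
  by (simp add: P_FAr pvar_def renv_nat_def Int_absorb1 restr_restr[OF without_max_restr])

lemma shift_nat:
  assumes x: "x \<in> Obj L" "fst x \<noteq> {}" and B: "B \<subseteq> without_max x"
  shows "cmpt (\<tau> i) (x \<restriction> B) = renv_nat \<tau> x (i, insert (max_elt x) B)"
proof -
  have "fst x \<inter> insert (max_elt x) B = insert (max_elt x) B"
    using B max_elt(1)[OF x] without_max_subset[of x] by auto
  then show ?thesis by (simp add: renv_nat_def without_max_insert[OF x B])
qed

lemma rb_nat:
  assumes x: "x \<in> Obj L"
  shows "cmpt (FAr timesL (FAr P (\<tau> 0), FAr P (\<tau> 1))) x = ar (renv_nat \<tau> x) (rb_left x)"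
    "cmpt (FAr plusL (FAr P (FAr timesL (FAr P (\<tau> 0), \<tau> 1)), FAr P (FAr timesL (\<tau> 0, FAr P (\<tau> 1))))) x = ar (renv_nat \<tau> x) (rb_right x)"
proof -
  show "cmpt (FAr timesL (FAr P (\<tau> 0), FAr P (\<tau> 1))) x = ar (renv_nat \<tau> x) (rb_left x)"
    using decompsD(1,2)[OF x] x
    by (auto simp: rb_left_def timesL_FAr tar_sum_term pvar_nat[OF x] t_ar.simps simp del: ar_simps One_nat_def intro!: arg_cong[of _ _ bpa])
  show "cmpt (FAr plusL (FAr P (FAr timesL (FAr P (\<tau> 0), \<tau> 1)), FAr P (FAr timesL (\<tau> 0, FAr P (\<tau> 1))))) x = ar (renv_nat \<tau> x) (rb_right x)"
  proof (cases "fst x = {}")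
    case True
    then show ?thesis using x by (simp add: rb_right_def plusL_FAr P_FAr t_ar.simps del: ar_simps)
  next
    case False
    let ?y = "x \<restriction> without_max x"
    have y: "?y \<in> Obj L" by (rule restr_without_max[OF x])
    have D: "B \<subseteq> without_max x \<and> B' \<subseteq> without_max x \<and> B \<subseteq> fst x \<and> B' \<subseteq> fst x \<and> ?y \<restriction> B = x \<restriction> B \<and> ?y \<restriction> B' = x \<restriction> B'"
      if "(B, B') \<in> set (decomps ?y)" for B B'
      using decompsD(1,2)[OF y that] without_max_subset[of x] by (auto simp: restr_restr)
    have 1: "cmpt (FAr timesL (FAr P (\<tau> 0), \<tau> 1)) ?y =
        ar (renv_nat \<tau> x) (sum_term (map (\<lambda>(B, B'). Mul (pvar 0 B) (Var (1, insert (max_elt x) B'))) (decomps ?y)))"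
      using D y by (auto simp: timesL_FAr tar_sum_term pvar_nat[OF x] shift_nat[OF x False] t_ar.simps
          simp del: ar_simps One_nat_def intro!: arg_cong[of _ _ bpa])
    have 2: "cmpt (FAr timesL (\<tau> 0, FAr P (\<tau> 1))) ?y =
        ar (renv_nat \<tau> x) (sum_term (map (\<lambda>(B, B'). Mul (Var (0, insert (max_elt x) B)) (pvar 1 B')) (decomps ?y)))"
      using D y by (auto simp: timesL_FAr tar_sum_term pvar_nat[OF x] shift_nat[OF x False] t_ar.simps
          simp del: ar_simps One_nat_def intro!: arg_cong[of _ _ bpa])
    show ?thesis
      using False x by (simp add: rb_right_def plusL_FAr P_FAr[of "FAr timesL _"] 1 2 t_ar.simps(4) del: ar_simps One_nat_def)
  qed
qed

lemma renv_Obj: "(\<And>i. F i \<in> Obj CL) \<Longrightarrow> x \<in> Obj L \<Longrightarrow> renv F x a \<in> Obj C"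
  by (cases a) (simp add: renv_def FL.ObjD restr_Obj without_max_Int)

text \<open>Chosen separately for each \<open>x\<close>, as for \<open>KL\<close>. The terms here
  are not expansions of terms in functors, because the shift is not an operation of the term
  language.\<close>

definition rb_iso :: "(nat \<Rightarrow> ('e, 'o, 'a) lin_fun) \<Rightarrow> 'e lin \<Rightarrow> 'a" where
  "rb_iso F x = (SOME f. span (renv F x) (rb_left x) (rb_right x) f)"

lemma rb_iso_span: "x \<in> Obj L \<Longrightarrow> span (renv F x) (rb_left x) (rb_right x) (rb_iso F x)"
  unfolding rb_iso_def
  by (rule someI_ex) (rule span_exists[OF regular_rb_left regular_rb_right mons_rb_right[symmetric]])

lemma rb_iso:
  assumes F: "\<And>i. F i \<in> Obj CL" and x: "x \<in> Obj L"
  shows "iso (rb_iso F x)" "Dom C (rb_iso F x) = ob (renv F x) (rb_left x)" "Cod C (rb_iso F x) = ob (renv F x) (rb_right x)"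
proof -
  interpret coherent_env C plusC zeroC aP lP rP plus_o plus_a sP timesC oneC aT lT rT
    times_o times_a dl dr nl nr \<i> "renv F x" by unfold_locales (rule renv_Obj[OF F x])
  show "iso (rb_iso F x)" "Dom C (rb_iso F x) = ob (renv F x) (rb_left x)" "Cod C (rb_iso F x) = ob (renv F x) (rb_right x)"
    using span_simps[OF rb_iso_span[OF x]] .
qed

lemma rb_iso_FAr:
  assumes F: "\<And>i. F i \<in> Obj CL" and \<phi>: "\<phi> \<in> Arr L"
  shows "ar (renv_ar F \<phi>) (rb_right (fst \<phi>)) \<bullet> rb_iso F (fst \<phi>) = rb_iso F (fst (snd \<phi>)) \<bullet> ar (renv_ar F \<phi>) (rb_left (fst \<phi>))"
proof -
  let ?x = "fst \<phi>" and ?y = "fst (snd \<phi>)" and ?r = "\<lambda>(i :: nat, B). (i, cmpt \<phi> ` (fst (fst \<phi>) \<inter> B))"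
  have x: "?x \<in> Obj L" and y: "?y \<in> Obj L" and im: "cmpt \<phi> ` fst ?x = fst ?y"
    using \<phi> by (auto simp: lin_Arr bij_betw_def)
  have h: "renv_ar F \<phi> a \<in> Arr C \<and> Dom C (renv_ar F \<phi> a) = renv F ?x a \<and> Cod C (renv_ar F \<phi> a) = renv F ?y (?r a)" for a
  proof -
    obtain i B where a: "a = (i, B)" by (cases a)
    let ?D = "fst ?x \<inter> B"
    have "cmpt \<phi> ` ?D \<subseteq> fst ?y" using im by auto
    then have e: "fst ?y \<inter> cmpt \<phi> ` ?D = cmpt \<phi> ` ?D" by auto
    \<comment> \<open>Removing the maximum commutes with the restricted order isomorphism, so the
      codomain is the value of the renamed letter.\<close>
    have "without_max (?y \<restriction> (cmpt \<phi> ` ?D)) = restrict (cmpt \<phi>) ?D ` without_max (?x \<restriction> ?D)"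
      using without_max_Cod[OF arr_restr_Arr[OF \<phi>, of ?D]] by (simp only: arr_restr_simps Int_lower1)
    also have "\<dots> = cmpt \<phi> ` without_max (?x \<restriction> ?D)"
      by (rule image_cong[OF HOL.refl]) (use without_max_restr[of ?x ?D] in auto)
    finally show ?thesis
      by (simp add: a renv_ar_def renv_def e FL.ObjD[OF F] arr_restr_Arr[OF \<phi> without_max_Int] lin_simps)
  qed
  show ?thesis
  proof (rule span_transport[where r = ?r and J' = "renv F ?y"])
    show "span (\<lambda>a. Dom C (renv_ar F \<phi> a)) (rb_left ?x) (rb_right ?x) (rb_iso F ?x)"
      using rb_iso_span[OF x] h by simp
    show "span (renv F ?y) (map_rig_term ?r (rb_left ?x)) (map_rig_term ?r (rb_right ?x)) (rb_iso F ?y)"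
      using rb_iso_span[OF y] unfolding rb_map[OF \<phi>] .
    show "regular (map_rig_term ?r (rb_left ?x)) {[]}" "regular (map_rig_term ?r (rb_right ?x)) {[]}"
      using regular_rb_left[OF y] regular_rb_right[OF y] unfolding rb_map[OF \<phi>] .
  qed (use h renv_Obj[OF F y] in auto)
qed

lemma rb_iso_nat:
  assumes \<tau>: "\<And>i. \<tau> i \<in> Arr CL" and x: "x \<in> Obj L"
  shows "ar (renv_nat \<tau> x) (rb_right x) \<bullet> rb_iso (\<lambda>i. fst (\<tau> i)) x =
    rb_iso (\<lambda>i. fst (snd (\<tau> i))) x \<bullet> ar (renv_nat \<tau> x) (rb_left x)"
proof -
  have h: "renv_nat \<tau> x a \<in> Arr C \<and> Dom C (renv_nat \<tau> x a) = renv (\<lambda>i. fst (\<tau> i)) x a \<and>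
      Cod C (renv_nat \<tau> x a) = renv (\<lambda>i. fst (snd (\<tau> i))) x (id a)" for a
    by (cases a) (simp add: renv_nat_def renv_def FL.ArrD(3-5)[OF \<tau>] restr_Obj[OF x without_max_Int])
  show ?thesis
  proof (rule span_transport[where r = id and J' = "renv (\<lambda>i. fst (snd (\<tau> i))) x"])
    show "span (\<lambda>a. Dom C (renv_nat \<tau> x a)) (rb_left x) (rb_right x) (rb_iso (\<lambda>i. fst (\<tau> i)) x)"
      using rb_iso_span[OF x] h by simp
  qed (use h rb_iso_span[OF x] renv_Obj[OF FL.ArrD(2)[OF \<tau>] x] in
      \<open>auto simp: rig_term.map_id regular_rb_left[OF x] regular_rb_right[OF x]\<close>)
qed

theorem rota_baxter_CL:
  "naturally_isomorphic (CL \<times>\<^sub>C CL) CL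
     \<lparr>FOb = \<lambda>(x, y). FOb timesL (FOb P x, FOb P y), FAr = \<lambda>(f, g). FAr timesL (FAr P f, FAr P g)\<rparr>
     \<lparr>FOb = \<lambda>(x, y). FOb plusL (FOb P (FOb timesL (FOb P x, y)), FOb P (FOb timesL (x, FOb P y))),
      FAr = \<lambda>(f, g). FAr plusL (FAr P (FAr timesL (FAr P f, g)), FAr P (FAr timesL (f, FAr P g)))\<rparr>"
    (is "naturally_isomorphic _ _ ?S ?T")
proof (rule pointwise_natural[where c = "\<lambda>(F, G). rb_iso (lst [F, G])"])
  note p = functor_proj[OF FL.category_FC FL.category_FC]
  note Pp = functor_comp[OF p(1) P_functor] functor_comp[OF p(2) P_functor]
  show "is_functor (CL \<times>\<^sub>C CL) CL ?S"
    using functor_bi[OF timesL_functor Pp] by (simp add: case_prod_unfold)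
  show "is_functor (CL \<times>\<^sub>C CL) CL ?T"
    using functor_bi[OF plusL_functor functor_comp[OF functor_bi[OF timesL_functor Pp(1) p(2)] P_functor]
        functor_comp[OF functor_bi[OF timesL_functor p(1) Pp(2)] P_functor]]
    by (simp add: case_prod_unfold)
  have l: "lst [F, G] 0 = F" "lst [F, G] (Suc 0) = G" for F G by (simp_all add: lst_def)
  {
    fix F x assume "F \<in> Obj (CL \<times>\<^sub>C CL)" and x: "x \<in> Obj L"
    then obtain G H where F: "F = (G, H)" and GH: "set [G, H] \<subseteq> Obj CL" by auto
    show "is_isomorphism C ((case F of (F, G) \<Rightarrow> rb_iso (lst [F, G])) x) \<and>
      Dom C ((case F of (F, G) \<Rightarrow> rb_iso (lst [F, G])) x) = FOb (FOb ?S F) x \<and>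
      Cod C ((case F of (F, G) \<Rightarrow> rb_iso (lst [F, G])) x) = FOb (FOb ?T F) x"
      using rb_iso[OF lst_Obj[OF GH] x] rb_FOb[OF x, of "lst [G, H]"] by (simp add: F l)
  }
  {
    fix F \<phi> assume "F \<in> Obj (CL \<times>\<^sub>C CL)" and \<phi>: "\<phi> \<in> Arr L"
    then obtain G H where F: "F = (G, H)" and GH: "set [G, H] \<subseteq> Obj CL" by auto
    show "(case F of (F, G) \<Rightarrow> rb_iso (lst [F, G])) (fst (snd \<phi>)) \<bullet> FAr (FOb ?S F) \<phi> =
        FAr (FOb ?T F) \<phi> \<bullet> (case F of (F, G) \<Rightarrow> rb_iso (lst [F, G])) (fst \<phi>)"
      using rb_iso_FAr[OF lst_Obj[OF GH] \<phi>] rb_FAr[OF \<phi>, of "lst [G, H]"] by (simp add: F l)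
  }
  {
    fix f x assume "f \<in> Arr (CL \<times>\<^sub>C CL)" and x: "x \<in> Obj L"
    then obtain \<sigma> \<tau> where f: "f = (\<sigma>, \<tau>)" and st: "set [\<sigma>, \<tau>] \<subseteq> Arr CL" by auto
    have e: "lst_nat [\<sigma>, \<tau>] 0 = \<sigma>" "lst_nat [\<sigma>, \<tau>] (Suc 0) = \<tau>" by (simp_all add: lst_nat_def)
    have d: "(\<lambda>i. fst (lst_nat [\<sigma>, \<tau>] i)) = lst [fst \<sigma>, fst \<tau>]"
      "(\<lambda>i. fst (snd (lst_nat [\<sigma>, \<tau>] i))) = lst [fst (snd \<sigma>), fst (snd \<tau>)]"
      using lst_nat(2,3)[OF st] by (simp_all add: FL.FC_Dom)
    show "(case Cod (CL \<times>\<^sub>C CL) f of (F, G) \<Rightarrow> rb_iso (lst [F, G])) x \<bullet> cmpt (FAr ?S f) x =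
        cmpt (FAr ?T f) x \<bullet> (case Dom (CL \<times>\<^sub>C CL) f of (F, G) \<Rightarrow> rb_iso (lst [F, G])) x"
      using rb_iso_nat[where \<tau> = "lst_nat [\<sigma>, \<tau>]", OF lst_nat(1)[OF st] x] rb_nat[OF x, of "lst_nat [\<sigma>, \<tau>]"]
      by (simp add: f e d FL.FC_Dom)
  }
qed

text \<open>At nonempty sets both sides are equal, and the components are identities. At the empty
  set the inverse of \<open>lP zeroC\<close> leads from zero to the sum of two zeros.\<close>

lemma additive_P_plus:
  "naturally_isomorphic (CL \<times>\<^sub>C CL) CL
     \<lparr>FOb = \<lambda>(x, y). FOb P (FOb plusL (x, y)), FAr = \<lambda>(f, g). FAr P (FAr plusL (f, g))\<rparr>
     \<lparr>FOb = \<lambda>(x, y). FOb plusL (FOb P x, FOb P y), FAr = \<lambda>(f, g). FAr plusL (FAr P f, FAr P g)\<rparr>"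
    (is "naturally_isomorphic _ _ ?S ?T")
proof (rule pointwise_natural[where c = "\<lambda>(F, G) x. if fst x = {} then inv_arr (lP zeroC)
    else Idn C (FOb plusC (FOb F (x \<restriction> without_max x), FOb G (x \<restriction> without_max x)))"])
  note p = functor_proj[OF FL.category_FC FL.category_FC]
  show "is_functor (CL \<times>\<^sub>C CL) CL ?S"
    using functor_comp[OF plusL_functor P_functor] by (simp add: case_prod_unfold)
  show "is_functor (CL \<times>\<^sub>C CL) CL ?T"
    using functor_bi[OF plusL_functor functor_comp[OF p(1) P_functor] functor_comp[OF p(2) P_functor]]
    by (simp add: case_prod_unfold)
  have z: "FOb plusC (zeroC, zeroC) = zeroC \<oplus>\<^sub>o zeroC" by (simp add: sum.tob_def)
  let ?c = "\<lambda>(F, G) x. if fst x = {} then inv_arr (lP zeroC)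
    else Idn C (FOb plusC (FOb F (x \<restriction> without_max x), FOb G (x \<restriction> without_max x)))"
  {
    fix F x assume "F \<in> Obj (CL \<times>\<^sub>C CL)" and x: "x \<in> Obj L"
    then obtain G H where F: "F = (G, H)" and GH: "G \<in> Obj CL" "H \<in> Obj CL" by auto
    show "is_isomorphism C (?c F x) \<and> Dom C (?c F x) = FOb (FOb ?S F) x \<and> Cod C (?c F x) = FOb (FOb ?T F) x"
      using x by (simp add: F P_FOb plusL_FOb restr_without_max FL.ObjD[OF GH(1)] FL.ObjD[OF GH(2)] z)
  }
  {
    fix F \<phi> assume "F \<in> Obj (CL \<times>\<^sub>C CL)" and \<phi>: "\<phi> \<in> Arr L"
    then obtain G H where F: "F = (G, H)" and GH: "G \<in> Obj CL" "H \<in> Obj CL" by auto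
    show "?c F (fst (snd \<phi>)) \<bullet> FAr (FOb ?S F) \<phi> = FAr (FOb ?T F) \<phi> \<bullet> ?c F (fst \<phi>)"
      using \<phi> arr_restr_Arr[OF \<phi> without_max_subset]
      by (simp add: F P_FOb plusL_FOb empty_Cod[OF \<phi>] without_max_Cod[OF \<phi>] FL.ObjD[OF GH(1)] FL.ObjD[OF GH(2)] lin_simps z)
  }
  {
    fix f x assume "f \<in> Arr (CL \<times>\<^sub>C CL)" and x: "x \<in> Obj L"
    then obtain \<sigma> \<tau> where f: "f = (\<sigma>, \<tau>)" and st: "\<sigma> \<in> Arr CL" "\<tau> \<in> Arr CL" by auto
    show "?c (Cod (CL \<times>\<^sub>C CL) f) x \<bullet> cmpt (FAr ?S f) x = cmpt (FAr ?T f) x \<bullet> ?c (Dom (CL \<times>\<^sub>C CL) f) x"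
      using x by (simp add: f P_FAr plusL_FAr restr_without_max FL.ArrD(3-5)[OF st(1)] FL.ArrD(3-5)[OF st(2)] FL.FC_Dom z)
  }
qed

end

context neg_lin begin

text \<open>Again identities at nonempty sets; at the empty set zero has to be compared with its
  negative.\<close>

lemma additive_P_neg:
  "naturally_isomorphic CL CL
     \<lparr>FOb = \<lambda>x. FOb P (FOb negL x), FAr = \<lambda>f. FAr P (FAr negL f)\<rparr>
     \<lparr>FOb = \<lambda>x. FOb negL (FOb P x), FAr = \<lambda>f. FAr negL (FAr P f)\<rparr>"
    (is "naturally_isomorphic _ _ ?S ?T")
proof -
  obtain z where z: "is_isomorphism C z" "Dom C z = FOb neg zeroC" "Cod C z = zeroC"
    using neg unfolding negative_functor_def by (meson isomorphicE)
  let ?c = "\<lambda>F x. if fst x = {} then inverse_arrow C z else Idn C (FOb neg (FOb F (x \<restriction> without_max x)))"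
  show ?thesis
  proof (rule pointwise_natural[where c = ?c])
    show "is_functor CL CL ?S" by (rule functor_comp[OF negL_functor P_functor])
    show "is_functor CL CL ?T" by (rule functor_comp[OF P_functor negL_functor])
    show "is_isomorphism C (?c F x) \<and> Dom C (?c F x) = FOb (FOb ?S F) x \<and> Cod C (?c F x) = FOb (FOb ?T F) x"
      if "F \<in> Obj CL" "x \<in> Obj L" for F x
      using that(2) by (simp add: P_FOb negL_FOb restr_without_max FL.ObjD[OF that(1)] N.FOb_Obj z)
    show "?c F (fst (snd \<phi>)) \<bullet> FAr (FOb ?S F) \<phi> = FAr (FOb ?T F) \<phi> \<bullet> ?c F (fst \<phi>)"
      if F: "F \<in> Obj CL" and \<phi>: "\<phi> \<in> Arr L" for F \<phi>
      using \<phi> arr_restr_Arr[OF \<phi> without_max_subset]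
      by (simp add: P_FOb negL_FOb empty_Cod[OF \<phi>] without_max_Cod[OF \<phi>] FL.ObjD[OF F] lin_simps N.FAr_Idn z)
    show "?c (Cod CL f) x \<bullet> cmpt (FAr ?S f) x = cmpt (FAr ?T f) x \<bullet> ?c (Dom CL f) x"
      if f: "f \<in> Arr CL" and x: "x \<in> Obj L" for f x
      using x by (simp add: P_FAr negL_FAr restr_without_max FL.ArrD(3-5)[OF f] FL.FC_Dom N.FAr_Idn z)
  qed
qed

end

section \<open>Valuations\<close>

text \<open>Finite linear orders are rigid: every arrow sends the decreasing list of its source to
  that of its target, so source and target determine it.\<close>

lemma lin_Arr_eqI:
  assumes \<phi>: "\<phi> \<in> Arr lin_cat" and \<psi>: "\<psi> \<in> Arr lin_cat" and e: "fst \<phi> = fst \<psi>" "fst (snd \<phi>) = fst (snd \<psi>)"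
  shows "\<phi> = \<psi>"
proof -
  have s: "set (elts_desc (fst \<phi>)) = fst (fst \<phi>)"
    using \<phi> elts_desc(1)[of "fst (fst \<phi>)" "snd (fst \<phi>)"] by (simp add: lin_Arr)
  have "map (cmpt \<phi>) (elts_desc (fst \<phi>)) = map (cmpt \<psi>) (elts_desc (fst \<phi>))"
    using elts_desc_Cod[OF \<phi>] elts_desc_Cod[OF \<psi>] e by simp
  then have "cmpt \<phi> a = cmpt \<psi> a" if "a \<in> fst (fst \<phi>)" for a
    using that s by simp
  moreover have "cmpt \<phi> \<in> extensional (fst (fst \<phi>))" "cmpt \<psi> \<in> extensional (fst (fst \<phi>))"
    using \<phi> \<psi> e by (simp_all add: lin_Arr)
  ultimately have "cmpt \<phi> = cmpt \<psi>" by (intro extensionalityI)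
  then show ?thesis using e by (simp add: prod_eq_iff)
qed

lemma map_ex:
  assumes "distinct as" "length as = length bs"
  shows "\<exists>f. map f as = bs"
  using assms
proof (induction as arbitrary: bs)
  case (Cons a as)
  then obtain b bs' where bs: "bs = b # bs'" "length as = length bs'" by (cases bs) auto
  then obtain f where "map f as = bs'" using Cons by auto
  then have "map (f(a := b)) (a # as) = bs" using Cons.prems(1) bs by auto
  then show ?case by blast
qed simp

text \<open>Lists of equal length are matched position by position. For monotonicity compare
  positions: an earlier position is a larger element, so \<open>(a, b) \<in> snd x\<close> excludes
  that \<open>a\<close> stands strictly before \<open>b\<close>.\<close>

lemma lin_Arr_ex:
  assumes x: "x \<in> Obj lin_cat" and y: "y \<in> Obj lin_cat" and card: "card (fst x) = card (fst y)"
  shows "\<exists>\<phi> \<in> Arr lin_cat. fst \<phi> = x \<and> fst (snd \<phi>) = y"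
proof -
  let ?as = "elts_desc x" and ?bs = "elts_desc y"
  have as: "set ?as = fst x" "sorted_wrt (\<lambda>a b. a \<noteq> b \<and> (b, a) \<in> snd x) ?as" "distinct ?as"
    using elts_desc[of "fst x" "snd x"] x by auto
  have bs: "set ?bs = fst y" "sorted_wrt (\<lambda>a b. a \<noteq> b \<and> (b, a) \<in> snd y) ?bs" "distinct ?bs"
    using elts_desc[of "fst y" "snd y"] y by auto
  have "length ?as = length ?bs"
    using card as(1,3) bs(1,3) distinct_card by metis
  then obtain f where f: "map f ?as = ?bs" using map_ex[OF as(3)] by blast
  have bij: "bij_betw f (fst x) (fst y)"
    unfolding bij_betw_def using f as bs by (metis distinct_map set_map)
  have mono: "(f a, f b) \<in> snd y" if ab: "a \<in> fst x" "b \<in> fst x" "(a, b) \<in> snd x" for a b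
  proof -
    obtain i j where i: "i < length ?as" "a = ?as ! i" and j: "j < length ?as" "b = ?as ! j"
      using ab(1,2) unfolding as(1)[symmetric] by (metis in_set_conv_nth)
    have fi: "f a = ?bs ! i" "f b = ?bs ! j" using i j f by (metis nth_map)+
    have len: "length ?bs = length ?as" using f by (metis length_map)
    consider "i < j" | "i = j" | "j < i" by linarith
    then show ?thesis
    proof cases
      case 1
      then have "a \<noteq> b" "(b, a) \<in> snd x" using sorted_wrt_nth_less[OF as(2) 1] i j by auto
      then show ?thesis using ab(3) x unfolding lin_Obj order_on_defs antisym_def by blast
    next
      case 2
      then have "f a = f b" "f b \<in> fst y" using fi bij_betwE[OF bij] ab(2) by auto
      then show ?thesis using y by (simp add: lin_Obj order_on_defs refl_on_def)
    next
      case 3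
      then show ?thesis using sorted_wrt_nth_less[OF bs(2) 3] i len fi by auto
    qed
  qed
  have "(x, y, restrict f (fst x)) \<in> Arr lin_cat"
    using x y bij mono by (simp add: lin_Arr bij_betw_def)
  then show ?thesis by force
qed

text \<open>Arrows exist in both directions, and by rigidity their composites are the
  identities.\<close>

lemma lin_isomorphic:
  assumes x: "x \<in> Obj lin_cat" and y: "y \<in> Obj lin_cat" and card: "card (fst x) = card (fst y)"
  obtains \<phi> where "\<phi> \<in> Arr lin_cat" "fst \<phi> = x" "fst (snd \<phi>) = y" "is_isomorphism lin_cat \<phi>"
proof -
  interpret category lin_cat by (rule category_lin)
  obtain \<phi> \<psi> where \<phi>: "\<phi> \<in> Arr lin_cat" "fst \<phi> = x" "fst (snd \<phi>) = y"
    and \<psi>: "\<psi> \<in> Arr lin_cat" "fst \<psi> = y" "fst (snd \<psi>) = x"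
    using lin_Arr_ex[OF x y card] lin_Arr_ex[OF y x card[symmetric]] by blast
  have d: "Dom lin_cat \<phi> = x" "Cod lin_cat \<phi> = y" "Dom lin_cat \<psi> = y" "Cod lin_cat \<psi> = x"
    using \<phi> \<psi> by (simp_all add: lin_simps)
  have i: "Idn lin_cat x \<in> Arr lin_cat" "Idn lin_cat y \<in> Arr lin_cat"
    using x y by simp_all
  have "\<psi> \<bullet>\<^bsub>lin_cat\<^esub> \<phi> = Idn lin_cat x"
    by (rule lin_Arr_eqI) (use Cmp_simps(1)[OF \<phi>(1) \<psi>(1)] i d in \<open>simp_all add: lin_simps(3,4) \<phi>(2,3) \<psi>(2,3)\<close>)
  moreover have "\<phi> \<bullet>\<^bsub>lin_cat\<^esub> \<psi> = Idn lin_cat y"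
    by (rule lin_Arr_eqI) (use Cmp_simps(1)[OF \<psi>(1) \<phi>(1)] i d in \<open>simp_all add: lin_simps(3,4) \<phi>(2,3) \<psi>(2,3)\<close>)
  ultimately have "is_isomorphism lin_cat \<phi>"
    by (intro isoI[of _ \<psi>]) (simp_all add: \<phi>(1) \<psi>(1) d)
  then show ?thesis using \<phi> that by blast
qed

lemma std_lin_Obj:
  assumes "inj \<iota>"
  shows "std_lin \<iota> n \<in> Obj lin_cat"
proof -
  note i = injD[OF assms]
  have "linear_order_on (\<iota> ` {1..n}) {(\<iota> i, \<iota> j) | i j. 1 \<le> i \<and> i \<le> j \<and> j \<le> n}"
    unfolding order_on_defs refl_on_def
  proof (intro conjI)
    show "antisym {(\<iota> i, \<iota> j) | i j. 1 \<le> i \<and> i \<le> j \<and> j \<le> n}"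
      by (auto simp: antisym_def dest!: i)
    show "trans {(\<iota> i, \<iota> j) | i j. 1 \<le> i \<and> i \<le> j \<and> j \<le> n}"
      by (force simp: trans_def dest!: i)
    show "total_on (\<iota> ` {1..n}) {(\<iota> i, \<iota> j) | i j. 1 \<le> i \<and> i \<le> j \<and> j \<le> n}"
      by (auto simp: total_on_def) (metis nle_le)
    show "\<forall>a \<in> \<iota> ` {1..n}. (a, a) \<in> {(\<iota> i, \<iota> j) | i j. 1 \<le> i \<and> i \<le> j \<and> j \<le> n}"
      by fastforce
  qed auto
  then show ?thesis by (simp add: lin_Obj std_lin_def)
qed

lemma std_lin_simps:
  assumes "inj \<iota>"
  shows "fst (std_lin \<iota> n) = \<iota> ` {1..n}" "card (fst (std_lin \<iota> n)) = n"
  using card_image[OF inj_on_subset[OF assms subset_UNIV], of "{1..n}"] by (simp_all add: std_lin_def)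

lemma card_without_max: "x \<in> Obj lin_cat \<Longrightarrow> fst x \<noteq> {} \<Longrightarrow> card (without_max x) = card (fst x) - 1"
  using max_elt(1)[of x] by (simp add: without_max_def lin_Obj)

text \<open>The power set is partitioned by cardinality, and the binomial coefficient is the number
  of subsets of each size. It appears as a multiple in the additive monoid.\<close>

lemma (in abelian_monoid) finsum_Pow_card:
  assumes X: "finite X" and h: "\<And>k. k \<le> card X \<Longrightarrow> h k \<in> carrier G"
  shows "(\<Oplus>B \<in> Pow X. h (card B)) = (\<Oplus>k \<in> {..card X}. [(card X choose k)] \<cdot> h k)"
proof -
  let ?A = "\<lambda>k. {B. B \<subseteq> X \<and> card B = k}"
  have U: "Pow X = (\<Union>k \<in> {..card X}. ?A k)" using card_mono[OF X] by auto
  have fin: "finite (?A k)" for k using X by simp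
  have "(\<Oplus>B \<in> Pow X. h (card B)) = (\<Oplus>k \<in> {..card X}. \<Oplus>B \<in> ?A k. h (card B))"
    unfolding U
    by (rule add.finprod_UN_disjoint) (use fin h in \<open>auto simp: pairwise_def disjnt_def\<close>)
  also have "\<dots> = (\<Oplus>k \<in> {..card X}. [(card X choose k)] \<cdot> h k)"
  proof (rule finsum_cong')
    fix k assume k: "k \<in> {..card X}"
    have "(\<Oplus>B \<in> ?A k. h (card B)) = (\<Oplus>B \<in> ?A k. h k)"
      using k by (intro finsum_cong') (auto intro: h)
    then show "(\<Oplus>B \<in> ?A k. h (card B)) = [(card X choose k)] \<cdot> h k"
      using k by (simp add: add.finprod_const h n_subsets[OF X])
  qed (auto intro: h)
  finally show ?thesis .
qed

section \<open>The valuation with values in divided power series\<close>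

locale lin_valuation = neg_lin C plusC zeroC timesC oneC E neg + R: cring R
  for C :: "('o, 'a) cat" and plusC zeroC timesC oneC and E :: "'e itself" and neg
    and R :: "('r, 'm) ring_scheme" +
  fixes v :: "'o \<Rightarrow> 'r" and \<iota> :: "nat \<Rightarrow> 'e"
  assumes val: "valuation_map R C plusC zeroC timesC oneC neg v" and inj: "inj \<iota>"
begin

lemma v_simps:
  "x \<in> Obj C \<Longrightarrow> v x \<in> carrier R" "x \<in> Obj C \<Longrightarrow> y \<in> Obj C \<Longrightarrow> isomorphic C x y \<Longrightarrow> v x = v y"
  "x \<in> Obj C \<Longrightarrow> y \<in> Obj C \<Longrightarrow> v (FOb plusC (x, y)) = v x \<oplus>\<^bsub>R\<^esub> v y"
  "x \<in> Obj C \<Longrightarrow> y \<in> Obj C \<Longrightarrow> v (FOb timesC (x, y)) = v x \<otimes>\<^bsub>R\<^esub> v y"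
  "v oneC = \<one>\<^bsub>R\<^esub>" "v zeroC = \<zero>\<^bsub>R\<^esub>" "x \<in> Obj C \<Longrightarrow> v (FOb neg x) = \<ominus>\<^bsub>R\<^esub> v x"
  using val by (auto simp: valuation_map_def)

abbreviation "sv \<equiv> series_valuation \<iota> v"

lemma sv_carrier: "F \<in> Obj CL \<Longrightarrow> sv F n \<in> carrier R"
  by (simp add: series_valuation_def v_simps FL.ObjD std_lin_Obj[OF inj])

text \<open>Any linear order with \<open>n\<close> elements is isomorphic to the standard one;
  functors preserve isomorphisms and the valuation is constant on isomorphic objects.\<close>

lemma v_FOb:
  assumes F: "F \<in> Obj CL" and x: "x \<in> Obj L"
  shows "v (FOb F x) = sv F (card (fst x))"
proof -
  interpret F: is_functor L C F using F by (simp add: FL.FC_Obj)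
  obtain \<phi> where "\<phi> \<in> Arr L" "fst \<phi> = x" "fst (snd \<phi>) = std_lin \<iota> (card (fst x))" "is_isomorphism L \<phi>"
    by (rule lin_isomorphic[OF x std_lin_Obj[OF inj]]) (simp_all only: std_lin_simps(2)[OF inj])
  then have "isomorphic C (FOb F x) (FOb F (std_lin \<iota> (card (fst x))))"
    using isomorphicI[OF F.functor_iso, of \<phi>] by (simp add: lin_simps FL.ObjD[OF F])
  then show ?thesis
    unfolding series_valuation_def by (intro v_simps FL.ObjD(1)[OF F] x std_lin_Obj[OF inj])
qed

lemma v_bpo:
  assumes "\<And>d. d \<in> set ds \<Longrightarrow> g d \<in> Obj C" "distinct ds"
  shows "v (bpo (map g ds)) = (\<Oplus>\<^bsub>R\<^esub>d \<in> set ds. v (g d))"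
  using assms
proof (induction ds)
  case (Cons d ds)
  then have "(\<Oplus>\<^bsub>R\<^esub>d \<in> insert d (set ds). v (g d)) = v (g d) \<oplus>\<^bsub>R\<^esub> (\<Oplus>\<^bsub>R\<^esub>d \<in> set ds. v (g d))"
    by (intro R.finsum_insert) (auto simp: v_simps)
  then show ?case using Cons by (simp add: v_simps bpo_Obj)
qed (simp add: v_simps)

lemma sv_timesL:
  assumes F: "F \<in> Obj CL" and G: "G \<in> Obj CL"
  shows "sv (FOb timesL (F, G)) n = (\<Oplus>\<^bsub>R\<^esub>k \<in> {..n}. [(n choose k)] \<cdot>\<^bsub>R\<^esub> (sv F k \<otimes>\<^bsub>R\<^esub> sv G (n - k)))"
proof -
  let ?x = "std_lin \<iota> n" and ?g = "\<lambda>(B, B'). FOb timesC (FOb F (std_lin \<iota> n \<restriction> B), FOb G (std_lin \<iota> n \<restriction> B'))"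
    and ?h = "\<lambda>k. sv F k \<otimes>\<^bsub>R\<^esub> sv G (n - k)"
  let ?X = "fst ?x"
  have x: "?x \<in> Obj L" and fin: "finite ?X" and card: "card ?X = n"
    using std_lin_Obj[OF inj, of n] std_lin_simps(2)[OF inj] by (auto simp: lin_Obj)
  have g: "?g d \<in> Obj C" if d: "d \<in> set (decomps ?x)" for d
  proof -
    obtain B B' where d': "d = (B, B')" by (cases d)
    note D = decompsD(1,2)[OF x d[unfolded d']]
    show ?thesis by (simp add: d' FL.ObjD[OF F] FL.ObjD[OF G] restr_Obj[OF x] D)
  qed
  \<comment> \<open>A decomposition is determined by its first part, which turns the sum over the
    list into a sum over the power set.\<close>
  have set: "set (decomps ?x) = (\<lambda>B. (B, ?X - B)) ` Pow ?X"
    unfolding set_decomps[OF x] by fastforce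
  have h: "v (?g (B, ?X - B)) = ?h (card B)" if "B \<in> Pow ?X" for B
  proof -
    have r: "?x \<restriction> B \<in> Obj L" "?x \<restriction> (?X - B) \<in> Obj L" using that by (auto intro: restr_Obj[OF x])
    have "card (?X - B) = n - card B" using that fin card by (simp add: card_Diff_subset finite_subset)
    then show ?thesis
      by (simp add: v_simps FL.ObjD[OF F] FL.ObjD[OF G] r v_FOb[OF F] v_FOb[OF G])
  qed
  have "sv (FOb timesL (F, G)) n = v (bpo (map ?g (decomps ?x)))"
    using x by (simp add: series_valuation_def timesL_FOb)
  also have "\<dots> = (\<Oplus>\<^bsub>R\<^esub>d \<in> (\<lambda>B. (B, ?X - B)) ` Pow ?X. v (?g d))"
    unfolding set[symmetric] by (rule v_bpo[OF g distinct_decomps[OF x]])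
  also have "\<dots> = (\<Oplus>\<^bsub>R\<^esub>B \<in> Pow ?X. v (?g (B, ?X - B)))"
    by (rule R.finsum_reindex) (use v_simps(1)[OF g] set in \<open>auto simp: inj_on_def\<close>)
  also have "\<dots> = (\<Oplus>\<^bsub>R\<^esub>B \<in> Pow ?X. ?h (card B))"
    by (rule R.finsum_cong'[OF HOL.refl]) (use h in \<open>auto simp: sv_carrier F G\<close>)
  also have "\<dots> = (\<Oplus>\<^bsub>R\<^esub>k \<in> {..n}. [(n choose k)] \<cdot>\<^bsub>R\<^esub> ?h k)"
    using R.finsum_Pow_card[OF fin, of ?h] by (simp add: card sv_carrier F G)
  finally show ?thesis .
qed

text \<open>Computed from the definition of the additive inverse as the unique two-sided one:
  addition of series is componentwise, so uniqueness in \<open>R\<close> suffices and no ring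
  structure on the series is required.\<close>

lemma divided_power_series_neg:
  assumes "a \<in> carrier (divided_power_series R)"
  shows "\<ominus>\<^bsub>divided_power_series R\<^esub> a = (\<lambda>n. \<ominus>\<^bsub>R\<^esub> a n)"
proof -
  have a: "a n \<in> carrier R" for n using assms by (auto simp: divided_power_series_def)
  show ?thesis
    unfolding a_inv_def[of "divided_power_series R"] m_inv_def
  proof (rule the_equality)
    fix b assume "b \<in> carrier (add_monoid (divided_power_series R)) \<and>
      a \<otimes>\<^bsub>add_monoid (divided_power_series R)\<^esub> b = \<one>\<^bsub>add_monoid (divided_power_series R)\<^esub> \<and>
      b \<otimes>\<^bsub>add_monoid (divided_power_series R)\<^esub> a = \<one>\<^bsub>add_monoid (divided_power_series R)\<^esub>"
    then have "b n \<in> carrier R" "b n \<oplus>\<^bsub>R\<^esub> a n = \<zero>\<^bsub>R\<^esub>" for n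
      by (auto simp: divided_power_series_def dest: fun_cong[of _ _ n])
    then show "b = (\<lambda>n. \<ominus>\<^bsub>R\<^esub> a n)"
      using a by (intro ext) (metis R.minus_equality)
  qed (use a in \<open>auto simp: divided_power_series_def R.r_neg R.l_neg\<close>)
qed

theorem valuation_map_CL:
  "valuation_map (divided_power_series R) CL plusL zeroL timesL oneL negL sv"
  unfolding valuation_map_def
proof (intro conjI ballI impI funcsetI)
  note s = std_lin_Obj[OF inj]
  show carrier: "sv F \<in> carrier (divided_power_series R)" if "F \<in> Obj CL" for F
    using that by (simp add: divided_power_series_def sv_carrier)
  fix F assume F: "F \<in> Obj CL"
  show "sv (FOb negL F) = \<ominus>\<^bsub>divided_power_series R\<^esub> sv F"
    unfolding divided_power_series_neg[OF carrier[OF F]]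
    by (simp add: fun_eq_iff series_valuation_def negL_FOb s v_simps FL.ObjD[OF F])
  fix G assume G: "G \<in> Obj CL"
  show "sv (FOb plusL (F, G)) = sv F \<oplus>\<^bsub>divided_power_series R\<^esub> sv G"
    by (simp add: fun_eq_iff series_valuation_def divided_power_series_def plusL_FOb s v_simps FL.ObjD[OF F] FL.ObjD[OF G])
  show "sv (FOb timesL (F, G)) = sv F \<otimes>\<^bsub>divided_power_series R\<^esub> sv G"
    by (simp add: fun_eq_iff divided_power_series_def sv_timesL[OF F G])
  assume "isomorphic CL F G"
  then obtain \<tau> where \<tau>: "is_isomorphism CL \<tau>" "fst \<tau> = F" "fst (snd \<tau>) = G"
    unfolding FL.FC_Dom[symmetric] by (rule FL.FC.isomorphicE)
  have iso: "isomorphic C (FOb F x) (FOb G x)" if "x \<in> Obj L" for x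
    using isomorphicI[OF FL.FC_isoD[OF \<tau>(1) that]] \<tau> that FL.FC.iso_Arr[OF \<tau>(1)] by (simp add: FL.ArrD)
  show "sv F = sv G"
    unfolding series_valuation_def by (intro ext v_simps(2) FL.ObjD(1)[OF F] FL.ObjD(1)[OF G] iso s)
next
  note s = std_lin_Obj[OF inj] and f = std_lin_simps(1)[OF inj]
  show "sv oneL = \<one>\<^bsub>divided_power_series R\<^esub>"
    by (auto simp: fun_eq_iff series_valuation_def divided_power_series_def unit_fun_def Let_def s v_simps f)
  show "sv zeroL = \<zero>\<^bsub>divided_power_series R\<^esub>"
    by (simp add: fun_eq_iff series_valuation_def divided_power_series_def const_fun_def s v_simps)
qed

text \<open>The shift moves coefficients by one place: removing the maximum of the standard order on
  \<open>n\<close> elements leaves \<open>n - 1\<close> of them, and the value zero at the empty set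
  is the vanishing constant term of the integral.\<close>

theorem series_valuation_P:
  assumes F: "F \<in> Obj CL"
  shows "sv (FOb P F) = integral_series R (sv F)"
proof
  fix n
  note s = std_lin_Obj[OF inj, of n] and f = std_lin_simps[OF inj, of n]
  show "sv (FOb P F) n = integral_series R (sv F) n"
  proof (cases "n = 0")
    case True
    then have "fst (std_lin \<iota> n) = {}" unfolding f(1) by simp
    then show ?thesis using s True by (simp add: series_valuation_def integral_series_def P_FOb v_simps)
  next
    case False
    then have ne: "fst (std_lin \<iota> n) \<noteq> {}" by (simp add: f)
    then have "sv (FOb P F) n = v (FOb F (std_lin \<iota> n \<restriction> without_max (std_lin \<iota> n)))"
      using s by (simp add: series_valuation_def P_FOb)
    also have "\<dots> = sv F (n - 1)"
      by (simp only: v_FOb[OF F restr_without_max[OF s]] restr_simps card_without_max[OF s ne] f(2))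
    finally show ?thesis using False by (simp add: integral_series_def)
  qed
qed

end

theorem theorem6p1:
  fixes R :: "('r, 'm) ring_scheme"
    and C :: "('o, 'a) cat"
    and plusC timesC :: "('o, 'a) bifunctor"
    and zeroC oneC :: 'o
    and neg :: "('o, 'a) endofunctor"
    and v :: "'o \<Rightarrow> 'r"
    and \<iota> :: "nat \<Rightarrow> 'e"
  defines "CL \<equiv> (lin_fun_cat C :: (('e lin, 'e lin_arr, 'o, 'a) fun_data, _) cat)"
    and "plusL \<equiv> pointwise_plus plusC"
    and "zeroL \<equiv> const_fun C zeroC"
    and "timesL \<equiv> convolution C plusC zeroC timesC"
    and "oneL \<equiv> unit_fun C zeroC oneC"
    and "negL \<equiv> pointwise_neg neg"
    and "P \<equiv> shift_functor C zeroC"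
  assumes "cring R"
    and "categorification R C plusC zeroC timesC oneC neg v"
    and "inj \<iota>"
  shows "rota_baxter_category_0 CL plusL zeroL timesL oneL (Some negL) P \<and>
    valuation_map (divided_power_series R) CL plusL zeroL timesL oneL negL (series_valuation \<iota> v) \<and>
    (\<forall>F \<in> Obj CL. series_valuation \<iota> v (FOb P F) = integral_series R (series_valuation \<iota> v F))"
proof -
  have val: "valuation_map R C plusC zeroC timesC oneC neg v" and neg: "negative_functor C plusC zeroC neg"
    and dist: "distributive_category C plusC zeroC timesC oneC"
    using assms(9) by (simp_all add: categorification_def)
  obtain aP lP rP sP aT lT rT dl dr nl nr where
    coh: "coherent_distributive_category C plusC zeroC aP lP rP sP timesC oneC aT lT rT dl dr nl nr"
    using dist unfolding distributive_category_def by blast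
  \<comment> \<open>The locale parameters introduced by \<open>defines\<close> are instantiated with
    their defining terms.\<close>
  interpret coherent_lin C plusC zeroC aP lP rP "\<lambda>x y. FOb plusC (x, y)" "\<lambda>f g. FAr plusC (f, g)" sP
    timesC oneC aT lT rT "\<lambda>x y. FOb timesC (x, y)" "\<lambda>f g. FAr timesC (f, g)" dl dr nl nr "Idn C" "TYPE('e)"
    unfolding coherent_lin_def by (rule coh)
  interpret V: lin_valuation C plusC zeroC timesC oneC "TYPE('e)" neg R v \<iota>
    by (intro lin_valuation.intro neg_lin.intro neg_lin_axioms.intro lin_valuation_axioms.intro
        rig_lin_axioms neg val assms)
  show ?thesis
    unfolding assms(1-7) lin_fun_cat_def rota_baxter_category_0_def additive_functor_def distributive_category_def
    using coherent_distributive_category_CL V.negative_functor_CL P_functor additive_P_plus V.additive_P_neg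
      rota_baxter_CL V.valuation_map_CL V.series_valuation_P by blast
qed

end
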